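(* Let $p$ be a prime and let $\mathcal O$ be a valuation ring with field of fractions $K$. (i) If $K$ has characteristic $0$, then the base change functor $\mathrm{FLG}(\mathcal O)\to\mathrm{FLG}(K)$ is essentially surjective. (ii) If $K$ has characteristic $p$ and is separably closed, then for every integer $h\ge0$ the base change functor $\mathrm{FLG}^{\ge h}(\mathcal O)\to\mathrm{FLG}^{\ge h}(K)$ is essentially surjective.
   Context: Formal Lie groups. A formal Lie variety over a scheme $S$ is an fppf sheaf on $S$-schemes with a section over $S$ which, Zariski locally on $S$, is isomorphic as a pointed sheaf to $\operatorname{Spf}\mathcal O_S[[T]]$ with its $0$-section. A formal Lie group over $S$ is an fppf sheaf of commutative groups whose underlying sheaf, pointed by the identity section, is a formal Lie variety. $\mathrm{FLG}$ is the stack over schemes of formal Lie groups and isomorphisms; $\mathrm{FLG}(A)$ is the fiber over $\operatorname{Spec}A$. Buds. For a pointed sheaf $(X,\sigma)$ over $S$, $X^{(n)}\subset X$ is the fppf sheafification of the subpresheaf of those $T\to X$ for which some closed subscheme $T'\subset T$ defined by a quasi-coherent ideal with $(n+1)$st power zero maps to $X$ through $\sigma$. $X$ is $n$-infinitesimal if $X^{(n)}=X$. An $n$-germ is a pointed, representable, $n$-infinitesimal sheaf $(X,\sigma)$ such that, for $\mathcal I$ the ideal of $\sigma$, each $\sigma^*(\mathcal I^i/\mathcal I^{i+1})$, $1\le i\le n$, is locally free of rank $1$. An $n$-bud is an $n$-germ with $F\colon(X\times_SX)^{(n)}\to X$ which is unital with respect to $\sigma$, commutative, and associative on $(X\times_SX\times_SX)^{(n)}$.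 If $X$ is a formal Lie group, then $X^{(n)}$ is an $n$-bud by restriction of the multiplication. Height. For an $n$-bud $X$ over $S$ put $[p]_X:=p\cdot\mathrm{id}_X$ in the abelian group $\operatorname{End}(X)$ (addition $f+g=F\circ(f,g)$), and $\mathcal I_X:=\ker[\sigma^{-1}\mathcal O_X\to\mathcal O_S]$. For $n\ge p^h$, $X$ has height $\ge h$ if the endomorphism of $\mathcal I_X$ induced by $[p]_X$ has image in $\mathcal I_X^{p^h}$. A formal Lie group $X$ has height $\ge h$ if the $p^h$-bud $X^{(p^h)}$ has height $\ge h$; $\mathrm{FLG}^{\ge h}\subset\mathrm{FLG}$ is the full substack of such $X$. (When $X$ is given by a formal group law $F$ over $\Gamma(S,\mathcal O_S)$, this means $[p]_F(T)$ is divisible by $T^{p^h}$.) *)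

theory Defs
  imports
    "HOL-Algebra.UnivPoly"
    "HOL-Algebra.Ideal_Product"
    "HOL-Computational_Algebra.Primes"
begin

text \<open>
  Sheaves on schemes over an affine base \<open>Spec A\<close> are presented by their values on affine
  \<open>A\<close>-schemes, i.e. as functors on commutative \<open>A\<close>-algebras; this loses nothing, because every
  scheme has a Zariski cover by affine ones.

  The type \<open>'u\<close> plays the role of the universe: all rings, modules and sets of sections have
  their elements in \<open>'u\<close>. As soon as \<open>'u\<close> is infinite, the \<open>'u\<close>-small algebras are closed
  (up to isomorphism) under all the constructions involved, namely quotients, localisations,
  pushouts and finitely generated algebras. In the theorem \<open>'u\<close> contains a field which is of
  characteristic 0 or separably closed, hence infinite.

  A ring record may do anything outside its carrier, and so may a homomorphism.  Hence all
  conditions are relative to carriers, and presheaves are required not to distinguish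
  homomorphisms that agree on the carrier.
\<close>

section \<open>Algebras over a ring\<close>

text \<open>An algebra is a ring together with its structure map.\<close>

type_synonym 'u alg = "'u ring \<times> ('u \<Rightarrow> 'u)"

abbreviation ring_of :: "'u alg \<Rightarrow> 'u ring" where
  "ring_of B \<equiv> fst B"

abbreviation str_map :: "'u alg \<Rightarrow> 'u \<Rightarrow> 'u" where
  "str_map B \<equiv> snd B"

definition is_alg :: "'u ring \<Rightarrow> 'u alg \<Rightarrow> bool" where
  "is_alg A B \<longleftrightarrow> cring (ring_of B) \<and> str_map B \<in> ring_hom A (ring_of B)"

definition alg_hom :: "'u ring \<Rightarrow> 'u alg \<Rightarrow> 'u alg \<Rightarrow> ('u \<Rightarrow> 'u) \<Rightarrow> bool" where
  "alg_hom A B C f \<longleftrightarrow>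
     is_alg A B \<and> is_alg A C \<and> f \<in> ring_hom (ring_of B) (ring_of C) \<and>
     (\<forall>a\<in>carrier A. f (str_map B a) = str_map C a)"

section \<open>Fppf coverings\<close>

text \<open>\<open>tensor_zero R M N k m n\<close> says that \<open>m 0 \<otimes> n 0 + \<dots> + m (k - 1) \<otimes> n (k - 1)\<close> vanishes
  in the tensor product of \<open>M\<close> and \<open>N\<close> over \<open>R\<close>, the tensor product being given by its universal
  property: an element vanishes iff it is killed by every bilinear map.\<close>

definition bilinear_map ::
  "'u ring \<Rightarrow> ('u, 'u) module \<Rightarrow> ('u, 'u) module \<Rightarrow> ('u, 'u) module \<Rightarrow> ('u \<Rightarrow> 'u \<Rightarrow> 'u) \<Rightarrow> bool"
where
  "bilinear_map R M N L b \<longleftrightarrow>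
     (\<forall>x\<in>carrier M. \<forall>y\<in>carrier N. b x y \<in> carrier L) \<and>
     (\<forall>x\<in>carrier M. \<forall>x'\<in>carrier M. \<forall>y\<in>carrier N.
        b (x \<oplus>\<^bsub>M\<^esub> x') y = b x y \<oplus>\<^bsub>L\<^esub> b x' y) \<and>
     (\<forall>x\<in>carrier M. \<forall>y\<in>carrier N. \<forall>y'\<in>carrier N.
        b x (y \<oplus>\<^bsub>N\<^esub> y') = b x y \<oplus>\<^bsub>L\<^esub> b x y') \<and>
     (\<forall>r\<in>carrier R. \<forall>x\<in>carrier M. \<forall>y\<in>carrier N.
        b (r \<odot>\<^bsub>M\<^esub> x) y = r \<odot>\<^bsub>L\<^esub> b x y \<and> b x (r \<odot>\<^bsub>N\<^esub> y) = r \<odot>\<^bsub>L\<^esub> b x y)"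

definition tensor_zero ::
  "'u ring \<Rightarrow> ('u, 'u) module \<Rightarrow> ('u, 'u) module \<Rightarrow> nat \<Rightarrow> (nat \<Rightarrow> 'u) \<Rightarrow> (nat \<Rightarrow> 'u) \<Rightarrow> bool"
where
  "tensor_zero R M N k m n \<longleftrightarrow>
     (\<forall>(L :: ('u, 'u) module) b. module R L \<and> bilinear_map R M N L b \<longrightarrow>
        (\<Oplus>\<^bsub>L\<^esub>i\<in>{..<k}. b (m i) (n i)) = \<zero>\<^bsub>L\<^esub>)"

definition restrict_scalars :: "'u ring \<Rightarrow> ('u \<Rightarrow> 'u) \<Rightarrow> ('u, 'u) module" where
  "restrict_scalars S f =
     \<lparr>carrier = carrier S, monoid.mult = monoid.mult S, one = one S, zero = zero S, add = add S,
      smult = (\<lambda>r s. f r \<otimes>\<^bsub>S\<^esub> s)\<rparr>"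

definition injective_linear ::
  "'u ring \<Rightarrow> ('u, 'u) module \<Rightarrow> ('u, 'u) module \<Rightarrow> ('u \<Rightarrow> 'u) \<Rightarrow> bool"
where
  "injective_linear R M N t \<longleftrightarrow>
     t \<in> carrier M \<rightarrow> carrier N \<and> inj_on t (carrier M) \<and>
     (\<forall>x\<in>carrier M. \<forall>y\<in>carrier M. t (x \<oplus>\<^bsub>M\<^esub> y) = t x \<oplus>\<^bsub>N\<^esub> t y) \<and>
     (\<forall>r\<in>carrier R. \<forall>x\<in>carrier M. t (r \<odot>\<^bsub>M\<^esub> x) = r \<odot>\<^bsub>N\<^esub> t x)"

text \<open>\<open>f : R \<rightarrow> S\<close> is flat: tensoring with \<open>S\<close> preserves injectivity of linear maps.\<close>

definition flat_hom :: "'u ring \<Rightarrow> 'u ring \<Rightarrow> ('u \<Rightarrow> 'u) \<Rightarrow> bool" where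
  "flat_hom R S f \<longleftrightarrow>
     (\<forall>(M :: ('u, 'u) module) (N :: ('u, 'u) module) t.
        module R M \<and> module R N \<and> injective_linear R M N t \<longrightarrow>
        (\<forall>k. \<forall>m\<in>{..<k} \<rightarrow> carrier M. \<forall>s\<in>{..<k} \<rightarrow> carrier S.
           tensor_zero R N (restrict_scalars S f) k (t \<circ> m) s \<longrightarrow>
           tensor_zero R M (restrict_scalars S f) k m s))"

text \<open>\<open>P\<close> is the polynomial algebra over \<open>R\<close> in the variables \<open>x 0, \<dots>, x (n - 1)\<close>, i.e. the free
  commutative \<open>R\<close>-algebra on them.\<close>

definition polynomial_alg :: "'u ring \<Rightarrow> nat \<Rightarrow> 'u alg \<Rightarrow> (nat \<Rightarrow> 'u) \<Rightarrow> bool" where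
  "polynomial_alg R n P x \<longleftrightarrow>
     is_alg R P \<and> x \<in> {..<n} \<rightarrow> carrier (ring_of P) \<and>
     (\<forall>C. is_alg R C \<longrightarrow> (\<forall>c\<in>{..<n} \<rightarrow> carrier (ring_of C).
        (\<exists>g. alg_hom R P C g \<and> (\<forall>i<n. g (x i) = c i)) \<and>
        (\<forall>g g'. alg_hom R P C g \<and> (\<forall>i<n. g (x i) = c i) \<and>
                alg_hom R P C g' \<and> (\<forall>i<n. g' (x i) = c i) \<longrightarrow>
                (\<forall>y\<in>carrier (ring_of P). g y = g' y))))"

definition finite_presentation :: "'u ring \<Rightarrow> 'u ring \<Rightarrow> ('u \<Rightarrow> 'u) \<Rightarrow> bool" where
  "finite_presentation R S f \<longleftrightarrow>
     (\<exists>n P x g. polynomial_alg R n P x \<and> alg_hom R P (S, f) g \<and>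
        g ` carrier (ring_of P) = carrier S \<and>
        (\<exists>F. finite F \<and> F \<subseteq> carrier (ring_of P) \<and>
           a_kernel (ring_of P) S g = Idl\<^bsub>ring_of P\<^esub> F))"

text \<open>Standard fppf coverings \<open>{Spec C \<rightarrow> Spec B}\<close> of an affine scheme; every fppf covering of an
  affine scheme is refined by one of these. The finite family is a set of pairs of an algebra
  \<open>C\<close> and a map \<open>B \<rightarrow> C\<close>.\<close>

definition fppf_cover :: "'u ring \<Rightarrow> 'u alg \<Rightarrow> ('u alg \<times> ('u \<Rightarrow> 'u)) set \<Rightarrow> bool" where
  "fppf_cover A B \<U> \<longleftrightarrow>
     finite \<U> \<and>
     (\<forall>(C, f)\<in>\<U>. alg_hom A B C f \<and> flat_hom (ring_of B) (ring_of C) f \<and>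
        finite_presentation (ring_of B) (ring_of C) f) \<and>
     (\<forall>P. primeideal P (ring_of B) \<longrightarrow>
        (\<exists>(C, f)\<in>\<U>. \<exists>Q. primeideal Q (ring_of C) \<and> P = {b \<in> carrier (ring_of B). f b \<in> Q}))"

section \<open>Presheaves and fppf sheaves\<close>

record 'u psh =
  sec :: "'u alg \<Rightarrow> 'u set"
  res :: "'u alg \<Rightarrow> 'u alg \<Rightarrow> ('u \<Rightarrow> 'u) \<Rightarrow> 'u \<Rightarrow> 'u"

record 'u pointed_psh = "'u psh" +
  pt :: "'u alg \<Rightarrow> 'u"

record 'u group_psh = "'u pointed_psh" +
  gadd :: "'u alg \<Rightarrow> 'u \<Rightarrow> 'u \<Rightarrow> 'u"

definition presheaf :: "'u ring \<Rightarrow> ('u, 'z) psh_scheme \<Rightarrow> bool" where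
  "presheaf A X \<longleftrightarrow>
     (\<forall>B C f. alg_hom A B C f \<longrightarrow> res X B C f \<in> sec X B \<rightarrow> sec X C) \<and>
     (\<forall>B. is_alg A B \<longrightarrow> (\<forall>x\<in>sec X B. res X B B (\<lambda>b. b) x = x)) \<and>
     (\<forall>B C D f g. alg_hom A B C f \<and> alg_hom A C D g \<longrightarrow>
        (\<forall>x\<in>sec X B. res X C D g (res X B C f x) = res X B D (g \<circ> f) x)) \<and>
     (\<forall>B C f g. alg_hom A B C f \<and> alg_hom A B C g \<and> (\<forall>b\<in>carrier (ring_of B). f b = g b) \<longrightarrow>
        (\<forall>x\<in>sec X B. res X B C f x = res X B C g x))"

text \<open>A family of sections over a covering is matching if its members become equal in every
  algebra \<open>D\<close> over which two members of the covering can be compared; as tensor products of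
  algebras exist, this is agreement on the pairwise fibre products.\<close>

definition matching_family ::
  "'u ring \<Rightarrow> ('u, 'z) psh_scheme \<Rightarrow> 'u alg \<Rightarrow> ('u alg \<times> ('u \<Rightarrow> 'u)) set \<Rightarrow>
     ('u alg \<times> ('u \<Rightarrow> 'u) \<Rightarrow> 'u) \<Rightarrow> bool"
where
  "matching_family A X B \<U> s \<longleftrightarrow>
     (\<forall>(C, f)\<in>\<U>. s (C, f) \<in> sec X C) \<and>
     (\<forall>(C, f)\<in>\<U>. \<forall>(C', f')\<in>\<U>. \<forall>D g g'.
        alg_hom A C D g \<and> alg_hom A C' D g' \<and>
        (\<forall>b\<in>carrier (ring_of B). g (f b) = g' (f' b)) \<longrightarrow>
        res X C D g (s (C, f)) = res X C' D g' (s (C', f')))"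

definition fppf_sheaf :: "'u ring \<Rightarrow> ('u, 'z) psh_scheme \<Rightarrow> bool" where
  "fppf_sheaf A X \<longleftrightarrow>
     presheaf A X \<and>
     (\<forall>B \<U> s. is_alg A B \<and> fppf_cover A B \<U> \<and> matching_family A X B \<U> s \<longrightarrow>
        (\<exists>!x. x \<in> sec X B \<and> (\<forall>(C, f)\<in>\<U>. res X B C f x = s (C, f))))"

definition is_section :: "'u ring \<Rightarrow> ('u, 'z) pointed_psh_scheme \<Rightarrow> bool" where
  "is_section A X \<longleftrightarrow>
     (\<forall>B. is_alg A B \<longrightarrow> pt X B \<in> sec X B) \<and>
     (\<forall>B C f. alg_hom A B C f \<longrightarrow> res X B C f (pt X B) = pt X C)"

section \<open>Formal Lie varieties and formal Lie groups\<close>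

text \<open>\<open>Spf A[[T]]\<close> is the colimit of the schemes \<open>Spec A[T]/(T\<^sup>n)\<close>, so that its \<open>B\<close>-points are
  the elements of \<open>B\<close> with some power zero.\<close>

definition Spf_power_series :: "'u pointed_psh" where
  "Spf_power_series =
     \<lparr>sec = (\<lambda>B. {b \<in> carrier (ring_of B). \<exists>n::nat. b [^]\<^bsub>ring_of B\<^esub> n = \<zero>\<^bsub>ring_of B\<^esub>}),
      res = (\<lambda>B C f. f),
      pt = (\<lambda>B. \<zero>\<^bsub>ring_of B\<^esub>)\<rparr>"

text \<open>Isomorphism of pointed presheaves over the open subscheme \<open>D(a)\<close> of \<open>Spec A\<close>: affine schemes
  over \<open>D(a)\<close> are \<open>A\<close>-algebras in which \<open>a\<close> is invertible.\<close>

definition pointed_iso_over ::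
  "'u ring \<Rightarrow> 'u \<Rightarrow> ('u, 'y) pointed_psh_scheme \<Rightarrow> ('u, 'z) pointed_psh_scheme \<Rightarrow> bool"
where
  "pointed_iso_over A a X Y \<longleftrightarrow>
     (\<exists>\<tau>. (\<forall>B. is_alg A B \<and> str_map B a \<in> Units (ring_of B) \<longrightarrow>
             bij_betw (\<tau> B) (sec X B) (sec Y B) \<and> \<tau> B (pt X B) = pt Y B) \<and>
          (\<forall>B C f. alg_hom A B C f \<and> str_map B a \<in> Units (ring_of B) \<longrightarrow>
             (\<forall>x\<in>sec X B. \<tau> C (res X B C f x) = res Y B C f (\<tau> B x))))"

definition formal_Lie_variety :: "'u ring \<Rightarrow> ('u, 'z) pointed_psh_scheme \<Rightarrow> bool" where
  "formal_Lie_variety A X \<longleftrightarrow>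
     fppf_sheaf A X \<and> is_section A X \<and>
     (\<exists>F. finite F \<and> F \<subseteq> carrier A \<and> Idl\<^bsub>A\<^esub> F = carrier A \<and>
        (\<forall>a\<in>F. pointed_iso_over A a X Spf_power_series))"

definition group_at :: "('u, 'z) group_psh_scheme \<Rightarrow> 'u alg \<Rightarrow> 'u monoid" where
  "group_at X B = \<lparr>carrier = sec X B, monoid.mult = gadd X B, one = pt X B\<rparr>"

definition formal_Lie_group :: "'u ring \<Rightarrow> 'u group_psh \<Rightarrow> bool" where
  "formal_Lie_group A X \<longleftrightarrow>
     (\<forall>B. is_alg A B \<longrightarrow> comm_group (group_at X B)) \<and>
     (\<forall>B C f. alg_hom A B C f \<longrightarrow> res X B C f \<in> hom (group_at X B) (group_at X C)) \<and>
     formal_Lie_variety A X"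

definition formal_Lie_group_iso :: "'u ring \<Rightarrow> 'u group_psh \<Rightarrow> 'u group_psh \<Rightarrow> bool" where
  "formal_Lie_group_iso A X Y \<longleftrightarrow>
     (\<exists>\<tau>. (\<forall>B. is_alg A B \<longrightarrow> \<tau> B \<in> iso (group_at X B) (group_at Y B)) \<and>
          (\<forall>B C f. alg_hom A B C f \<longrightarrow>
             (\<forall>x\<in>sec X B. \<tau> C (res X B C f x) = res Y B C f (\<tau> B x))))"

text \<open>For a ring homomorphism \<open>j : A \<rightarrow> A'\<close>, the base change to \<open>A'\<close> of a sheaf over \<open>A\<close> is its
  restriction to \<open>A'\<close>-algebras, viewed as \<open>A\<close>-algebras via \<open>j\<close>.\<close>

definition alg_via :: "('u \<Rightarrow> 'u) \<Rightarrow> 'u alg \<Rightarrow> 'u alg" where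
  "alg_via j B = (ring_of B, str_map B \<circ> j)"

definition base_change :: "('u \<Rightarrow> 'u) \<Rightarrow> 'u group_psh \<Rightarrow> 'u group_psh" where
  "base_change j X =
     \<lparr>sec = (\<lambda>B. sec X (alg_via j B)),
      res = (\<lambda>B C f. res X (alg_via j B) (alg_via j C) f),
      pt = (\<lambda>B. pt X (alg_via j B)),
      gadd = (\<lambda>B. gadd X (alg_via j B))\<rparr>"

section \<open>Buds and height\<close>

primrec ideal_power :: "('r, 'm) ring_scheme \<Rightarrow> 'r set \<Rightarrow> nat \<Rightarrow> 'r set" where
  "ideal_power R I 0 = carrier R"
| "ideal_power R I (Suc n) = I \<cdot>\<^bsub>R\<^esub> ideal_power R I n"

text \<open>The subpresheaf of the sections over \<open>T\<close> that restrict to the base point on some closed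
  subscheme of \<open>T\<close> whose ideal has vanishing \<open>(n + 1)\<close>st power. A closed subscheme of \<open>Spec B\<close>
  is given by a surjection \<open>q : B \<rightarrow> D\<close>.\<close>

definition nbhd_presections ::
  "'u ring \<Rightarrow> ('u, 'z) pointed_psh_scheme \<Rightarrow> nat \<Rightarrow> 'u alg \<Rightarrow> 'u set"
where
  "nbhd_presections A X n B =
     {x \<in> sec X B. \<exists>D q. alg_hom A B D q \<and>
        q ` carrier (ring_of B) = carrier (ring_of D) \<and>
        ideal_power (ring_of B) (a_kernel (ring_of B) (ring_of D) q) (n + 1)
          = {\<zero>\<^bsub>ring_of B\<^esub>} \<and>
        res X B D q x = pt X D}"

text \<open>The \<open>n\<close>th infinitesimal neighbourhood of the base point. As \<open>X\<close> is a sheaf, the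
  sheafification of a subpresheaf is the subsheaf of the sections that lie in it locally. The
  point, and the multiplication if there is one, are inherited from \<open>X\<close>.\<close>

definition inf_nbhd ::
  "'u ring \<Rightarrow> ('u, 'z) pointed_psh_scheme \<Rightarrow> nat \<Rightarrow> ('u, 'z) pointed_psh_scheme"
where
  "inf_nbhd A X n =
     X\<lparr>sec := (\<lambda>B. {x \<in> sec X B. \<exists>\<U>. fppf_cover A B \<U> \<and>
                      (\<forall>(C, f)\<in>\<U>. res X B C f x \<in> nbhd_presections A X n C)})\<rparr>"

text \<open>The ring of global functions on a presheaf, that is of natural maps to the affine line. They
  are normalised to \<open>undefined\<close> outside their domain, so that equality is equality of maps.\<close>

definition on_domain ::
  "'u ring \<Rightarrow> ('u, 'z) psh_scheme \<Rightarrow> ('u alg \<Rightarrow> 'u \<Rightarrow> 'u) \<Rightarrow> ('u alg \<Rightarrow> 'u \<Rightarrow> 'u)"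
where
  "on_domain A X \<phi> = (\<lambda>B x. if is_alg A B \<and> x \<in> sec X B then \<phi> B x else undefined)"

definition function_ring ::
  "'u ring \<Rightarrow> ('u, 'z) psh_scheme \<Rightarrow> ('u alg \<Rightarrow> 'u \<Rightarrow> 'u) ring"
where
  "function_ring A X =
     \<lparr>carrier = {\<phi>. on_domain A X \<phi> = \<phi> \<and>
        (\<forall>B. is_alg A B \<longrightarrow> \<phi> B \<in> sec X B \<rightarrow> carrier (ring_of B)) \<and>
        (\<forall>B C f. alg_hom A B C f \<longrightarrow> (\<forall>x\<in>sec X B. \<phi> C (res X B C f x) = f (\<phi> B x)))},
      monoid.mult = (\<lambda>\<phi> \<psi>. on_domain A X (\<lambda>B x. \<phi> B x \<otimes>\<^bsub>ring_of B\<^esub> \<psi> B x)),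
      one = on_domain A X (\<lambda>B x. \<one>\<^bsub>ring_of B\<^esub>),
      zero = on_domain A X (\<lambda>B x. \<zero>\<^bsub>ring_of B\<^esub>),
      add = (\<lambda>\<phi> \<psi>. on_domain A X (\<lambda>B x. \<phi> B x \<oplus>\<^bsub>ring_of B\<^esub> \<psi> B x))\<rparr>"

text \<open>An \<open>n\<close>-bud \<open>X\<close> over \<open>Spec A\<close> is affine, its section \<open>\<sigma>\<close> is a homeomorphism and the ideal
  of \<open>\<sigma>\<close> is quasi-coherent. Thus that ideal and its powers correspond to the
  following ideal of the ring of global functions and its powers.\<close>

definition augmentation_ideal ::
  "'u ring \<Rightarrow> ('u, 'z) pointed_psh_scheme \<Rightarrow> ('u alg \<Rightarrow> 'u \<Rightarrow> 'u) set"
where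
  "augmentation_ideal A X =
     {\<phi> \<in> carrier (function_ring A X). \<forall>B. is_alg A B \<longrightarrow> \<phi> B (pt X B) = \<zero>\<^bsub>ring_of B\<^esub>}"

text \<open>On points, \<open>m \<cdot> id\<close> for the addition \<open>f + g = F \<circ> (f, g)\<close> of endomorphisms of a bud whose
  multiplication is \<open>F\<close>.\<close>

primrec multiple :: "('u, 'z) group_psh_scheme \<Rightarrow> nat \<Rightarrow> 'u alg \<Rightarrow> 'u \<Rightarrow> 'u" where
  "multiple X 0 B x = pt X B"
| "multiple X (Suc m) B x = gadd X B (multiple X m B x) x"

definition bud_height_ge :: "nat \<Rightarrow> 'u ring \<Rightarrow> 'u group_psh \<Rightarrow> nat \<Rightarrow> bool" where
  "bud_height_ge p A X h \<longleftrightarrow>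
     (\<forall>\<phi>\<in>augmentation_ideal A X.
        on_domain A X (\<lambda>B x. \<phi> B (multiple X p B x))
          \<in> ideal_power (function_ring A X) (augmentation_ideal A X) (p ^ h))"

definition height_ge :: "nat \<Rightarrow> 'u ring \<Rightarrow> 'u group_psh \<Rightarrow> nat \<Rightarrow> bool" where
  "height_ge p A X h \<longleftrightarrow> bud_height_ge p A (inf_nbhd A X (p ^ h)) h"

section \<open>Valuation rings and fields\<close>

definition field_of_fractions :: "'u ring \<Rightarrow> 'u ring \<Rightarrow> ('u \<Rightarrow> 'u) \<Rightarrow> bool" where
  "field_of_fractions V K j \<longleftrightarrow>
     domain V \<and> field K \<and> j \<in> ring_hom V K \<and> inj_on j (carrier V) \<and>
     (\<forall>x\<in>carrier K. \<exists>a\<in>carrier V. \<exists>b\<in>carrier V - {\<zero>\<^bsub>V\<^esub>}. x = j a \<otimes>\<^bsub>K\<^esub> inv\<^bsub>K\<^esub> (j b))"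

definition valuation_ring :: "'u ring \<Rightarrow> 'u ring \<Rightarrow> ('u \<Rightarrow> 'u) \<Rightarrow> bool" where
  "valuation_ring V K j \<longleftrightarrow>
     field_of_fractions V K j \<and>
     (\<forall>x\<in>carrier K - {\<zero>\<^bsub>K\<^esub>}. x \<in> j ` carrier V \<or> inv\<^bsub>K\<^esub> x \<in> j ` carrier V)"

definition has_characteristic :: "'u ring \<Rightarrow> nat \<Rightarrow> bool" where
  "has_characteristic R c \<longleftrightarrow> (\<forall>n::nat. add_pow R n \<one>\<^bsub>R\<^esub> = \<zero>\<^bsub>R\<^esub> \<longleftrightarrow> c dvd n)"

definition formal_derivative :: "'u ring \<Rightarrow> (nat \<Rightarrow> 'u) \<Rightarrow> (nat \<Rightarrow> 'u)" where
  "formal_derivative K f = (\<lambda>i. add_pow K (Suc i) (coeff (UP K) f (Suc i)))"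

definition separable_poly :: "'u ring \<Rightarrow> (nat \<Rightarrow> 'u) \<Rightarrow> bool" where
  "separable_poly K f \<longleftrightarrow> f \<in> carrier (UP K) \<and>
     (\<exists>u\<in>carrier (UP K). \<exists>v\<in>carrier (UP K).
        u \<otimes>\<^bsub>UP K\<^esub> f \<oplus>\<^bsub>UP K\<^esub> v \<otimes>\<^bsub>UP K\<^esub> formal_derivative K f = \<one>\<^bsub>UP K\<^esub>)"

definition separably_closed :: "'u ring \<Rightarrow> bool" where
  "separably_closed K \<longleftrightarrow>
     (\<forall>f. separable_poly K f \<and> deg K f > 0 \<longrightarrow>
        (\<exists>a\<in>carrier K. eval K K (\<lambda>c. c) a f = \<zero>\<^bsub>K\<^esub>))"

end

theory Submission
  imports "HOL-Algebra.Weak_Morphisms" "HOL-Algebra.Multiplicative_Group" "HOL-Algebra.Ring_Divisibility" Defs "HOL-Algebra.Free_Abelian_Groups"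
begin

text \<open>Over the field of fractions \<open>K\<close> a formal Lie group is a group structure \<open>F\<close> on nilpotent
  elements, that is, a formal group law. It suffices to find a coordinate in which all
  coefficients of \<open>F\<close> lie in the valuation ring and in which \<open>[p]\<close> is visibly of the right height.
  If \<open>[p] = 0\<close>, or if the characteristic is 0, then there is a logarithm and \<open>F\<close> becomes additive.
  Otherwise \<open>[p](T) = g(T\<^sup>q)\<close> with \<open>g'(0) \<noteq> 0\<close> and \<open>q\<close> a power of \<open>p\<close>. As \<open>K\<close> is separably closed, a
  change of coordinates turns \<open>[p](T)\<close> into \<open>T\<^sup>q\<close>. Since \<open>[p]\<close> is an endomorphism, all coefficients
  of \<open>F\<close> are then fixed by \<open>a \<mapsto> a\<^sup>q\<close>, and an element fixed by this map is integral.

  Power series never occur as such: they are replaced by natural operations on nilpotent elements,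
  whose coefficients are read off at the generic point of a truncated polynomial ring.\<close>

text \<open>In characteristic p the obstacle to a logarithm is the cocycle ((x+y)^p - x^p - y^p)/p,
  which is not a coboundary. The condition [p] = 0 is what excludes it, and this explains why the
  proof splits according to [p]. If [p] is not zero, each coefficient of the new coordinate solves
  b^q = a b + e with a nonzero; the derivative of this equation is the constant -a, so separably
  closed is enough. An element with a^q = a is zero or a root of unity, which is why it lies in
  every valuation ring of K. Over a field no gluing occurs: a Zariski cover of Spec K contains all
  of Spec K. Over the valuation ring the lifted sheaf is the formal line itself, so its sheaf
  property has to be established; that is faithfully flat descent. An algebra over the valuation
  ring need not embed into an algebra over K. Identities are therefore transferred through
  coefficients, not values, and inverses, which are not identities, are constructed separately. All
  test rings must live in \<open>'u\<close>; this accounts for the codings.\<close>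

abbreviation alg_add ("_ \<oplus>[_] _" [65,0,66] 65) where "x \<oplus>[B] y \<equiv> x \<oplus>\<^bsub>ring_of B\<^esub> y"
abbreviation alg_mult ("_ \<otimes>[_] _" [70,0,71] 70) where "x \<otimes>[B] y \<equiv> x \<otimes>\<^bsub>ring_of B\<^esub> y"
abbreviation alg_minus ("_ \<ominus>[_] _" [65,0,66] 65) where "x \<ominus>[B] y \<equiv> x \<ominus>\<^bsub>ring_of B\<^esub> y"
abbreviation alg_pow ("_ [^][_] _" [76,0,75] 75) where "x [^][B] (n::nat) \<equiv> x [^]\<^bsub>ring_of B\<^esub> n"
abbreviation alg_zero ("\<zero>[_]") where "\<zero>[B] \<equiv> \<zero>\<^bsub>ring_of B\<^esub>"
abbreviation alg_one ("\<one>[_]") where "\<one>[B] \<equiv> \<one>\<^bsub>ring_of B\<^esub>"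
abbreviation alg_carrier ("carrier[_]") where "carrier[B] \<equiv> carrier (ring_of B)"

section \<open>Coding finite lists by elements of the universe\<close>

lemma infinite_list_encoding:
  assumes "infinite (UNIV :: 'u set)"
  shows "\<exists>e :: 'u list \<Rightarrow> 'u. inj e"
proof -
  have "|lists (UNIV :: 'u set)| =o |UNIV :: 'u set|"
    using assms by (rule card_of_lists_infinite)
  hence "\<exists>f. bij_betw f (lists (UNIV :: 'u set)) (UNIV :: 'u set)"
    by (simp add: card_of_ordIso)
  thus ?thesis by (auto simp: bij_betw_def)
qed

text \<open>This one injection brings truncated polynomials, elements of tensor products and tuples
  over a finite covering back into \<open>'u\<close>.\<close>

definition list_code :: "'u list \<Rightarrow> 'u" where
  "list_code = (SOME e. inj e)"

lemma inj_list_code: "infinite (UNIV :: 'u set) \<Longrightarrow> inj (list_code :: 'u list \<Rightarrow> 'u)"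
  unfolding list_code_def using infinite_list_encoding by (rule someI_ex)

lemma (in cring) image_ring_is_cring:
  assumes "weak_ring_morphism f I R" shows "cring (image_ring f R)"
proof -
  interpret S: ring "image_ring f R" by (rule image_ring_is_ring[OF assms])
  have hom: "f \<in> ring_hom R (image_ring f R)" by (rule weak_ring_morphism_is_hom[OF assms])
  show ?thesis
  proof (unfold_locales)
    fix x y assume "x \<in> carrier (image_ring f R)" "y \<in> carrier (image_ring f R)"
    then obtain a b where "a \<in> carrier R" "b \<in> carrier R" "x = f a" "y = f b"
      by (auto simp: image_ring_carrier)
    thus "x \<otimes>\<^bsub>image_ring f R\<^esub> y = y \<otimes>\<^bsub>image_ring f R\<^esub> x"
      using ring_hom_mult[OF hom, of a b] ring_hom_mult[OF hom, of b a] by (simp add: m_comm)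
  qed
qed

section \<open>Truncated polynomial rings\<close>

text \<open>Two polynomials get the same code iff they differ by a multiple of \<open>T^N\<close>,
  so the image ring is a copy of \<open>R[T]/(T^N)\<close> inside \<open>'u\<close>.\<close>

definition trunc_code :: "'u ring \<Rightarrow> nat \<Rightarrow> (nat \<Rightarrow> 'u) \<Rightarrow> 'u" where
  "trunc_code R N p = list_code (map (coeff (UP R) p) [0..<N])"

definition trunc_ring :: "'u ring \<Rightarrow> nat \<Rightarrow> 'u ring" where
  "trunc_ring R N = image_ring (trunc_code R N) (UP R)"

definition tconst :: "'u ring \<Rightarrow> nat \<Rightarrow> 'u \<Rightarrow> 'u" where
  "tconst R N r = trunc_code R N (monom (UP R) r 0)"

definition tvar :: "'u ring \<Rightarrow> nat \<Rightarrow> 'u" where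
  "tvar R N = trunc_code R N (monom (UP R) \<one>\<^bsub>R\<^esub> 1)"

text \<open>Meaningful for \<open>k < N\<close> only: from degree \<open>N\<close> on the chosen
  representative is arbitrary.\<close>

definition tcoef :: "'u ring \<Rightarrow> nat \<Rightarrow> 'u \<Rightarrow> nat \<Rightarrow> 'u" where
  "tcoef R N u = coeff (UP R) (inv_into (carrier (UP R)) (trunc_code R N) u)"

locale big_cring = cring R for R :: "'u ring" (structure) +
  assumes infinite_univ: "infinite (UNIV :: 'u set)"
begin

sublocale UP: UP_cring R "UP R" by unfold_locales

definition "high_ideal N = {p \<in> carrier (UP R). \<forall>i<N. coeff (UP R) p i = \<zero>}"

lemma high_ideal: "ideal (high_ideal N) (UP R)"
proof (rule idealI[OF UP.UP_ring])
  show "subgroup (high_ideal N) (add_monoid (UP R))"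
  proof (rule UP.P.add.subgroupI)
    show "high_ideal N \<noteq> {}" by (auto simp: high_ideal_def intro!: exI[of _ "\<zero>\<^bsub>UP R\<^esub>"])
  next
    fix a assume "a \<in> high_ideal N"
    thus "\<ominus>\<^bsub>UP R\<^esub> a \<in> high_ideal N"
      by (auto simp: high_ideal_def)
  qed (auto simp: high_ideal_def)
next
  fix a x assume a: "a \<in> high_ideal N" and x: "x \<in> carrier (UP R)"
  have z: "coeff (UP R) (x \<otimes>\<^bsub>UP R\<^esub> a) i = \<zero>" if "i < N" for i
  proof -
    have "coeff (UP R) (x \<otimes>\<^bsub>UP R\<^esub> a) i = (\<Oplus>k\<in>{..i}. coeff (UP R) x k \<otimes> coeff (UP R) a (i - k))"
      using a x by (simp add: high_ideal_def)
    also have "\<dots> = (\<Oplus>k\<in>{..i}. \<zero>)"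
      using a x that by (intro finsum_cong') (auto simp: high_ideal_def)
    finally show ?thesis by simp
  qed
  show "x \<otimes>\<^bsub>UP R\<^esub> a \<in> high_ideal N"
    using a x z by (auto simp: high_ideal_def)
  moreover have "a \<otimes>\<^bsub>UP R\<^esub> x = x \<otimes>\<^bsub>UP R\<^esub> a"
    using a x by (intro UP.P.m_comm) (auto simp: high_ideal_def)
  ultimately show "a \<otimes>\<^bsub>UP R\<^esub> x \<in> high_ideal N" by simp
qed

lemma trunc_code_eq_iff:
  "trunc_code R N p = trunc_code R N q \<longleftrightarrow> (\<forall>i<N. coeff (UP R) p i = coeff (UP R) q i)"
  unfolding trunc_code_def inj_eq[OF inj_list_code[OF infinite_univ]] by auto

lemma trunc_morphism: "weak_ring_morphism (trunc_code R N) (high_ideal N) (UP R)"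
proof (rule weak_ring_morphismI[OF high_ideal])
  fix a b assume "a \<in> carrier (UP R)" "b \<in> carrier (UP R)"
  thus "trunc_code R N a = trunc_code R N b \<longleftrightarrow> a \<ominus>\<^bsub>UP R\<^esub> b \<in> high_ideal N"
    by (auto simp: trunc_code_eq_iff high_ideal_def r_right_minus_eq)
qed

lemma trunc_cring: "cring (trunc_ring R N)"
  unfolding trunc_ring_def by (rule UP.P.image_ring_is_cring[OF trunc_morphism])

lemma trunc_code_hom: "trunc_code R N \<in> ring_hom (UP R) (trunc_ring R N)"
  unfolding trunc_ring_def by (rule UP.P.weak_ring_morphism_is_hom[OF trunc_morphism])

lemma trunc_code_hom_cring: "ring_hom_cring (UP R) (trunc_ring R N) (trunc_code R N)"
  using trunc_code_hom UP.UP_cring trunc_cring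
  by (intro ring_hom_cring.intro) (auto simp: ring_hom_cring_axioms_def)

lemma tconst_hom: "tconst R N \<in> ring_hom R (trunc_ring R N)"
proof -
  have "(trunc_code R N) \<circ> (\<lambda>r. monom (UP R) r 0) \<in> ring_hom R (trunc_ring R N)"
    using UP.const_ring_hom trunc_code_hom by (rule ring_hom_trans)
  thus ?thesis by (simp add: tconst_def[abs_def] comp_def)
qed

lemma tvar_closed: "tvar R N \<in> carrier (trunc_ring R N)"
  unfolding tvar_def by (rule ring_hom_closed[OF trunc_code_hom]) simp

lemma tvar_pow: "tvar R N [^]\<^bsub>trunc_ring R N\<^esub> (k::nat) = trunc_code R N (monom (UP R) \<one> k)"
proof -
  interpret h: ring_hom_cring "UP R" "trunc_ring R N" "trunc_code R N" by (rule trunc_code_hom_cring)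
  show ?thesis
    unfolding tvar_def using h.hom_pow[of "monom (UP R) \<one> 1" k, symmetric] UP.monom_pow[of \<one> 1 k]
    by (simp del: h.hom_pow)
qed

lemma tvar_pow_N: "tvar R N [^]\<^bsub>trunc_ring R N\<^esub> N = \<zero>\<^bsub>trunc_ring R N\<^esub>"
proof -
  interpret h: ring_hom_cring "UP R" "trunc_ring R N" "trunc_code R N" by (rule trunc_code_hom_cring)
  have "trunc_code R N (monom (UP R) \<one> N) = trunc_code R N \<zero>\<^bsub>UP R\<^esub>"
    unfolding trunc_code_eq_iff by simp
  thus ?thesis by (simp add: tvar_pow)
qed

lemma trunc_carrierE:
  assumes "u \<in> carrier (trunc_ring R N)"
  obtains "inv_into (carrier (UP R)) (trunc_code R N) u \<in> carrier (UP R)"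
    "trunc_code R N (inv_into (carrier (UP R)) (trunc_code R N) u) = u"
proof -
  have "u \<in> trunc_code R N ` carrier (UP R)" using assms by (simp add: trunc_ring_def image_ring_carrier)
  thus thesis using that inv_into_into f_inv_into_f by metis
qed

lemma tcoef_closed: "u \<in> carrier (trunc_ring R N) \<Longrightarrow> tcoef R N u k \<in> carrier R"
  unfolding tcoef_def by (auto elim: trunc_carrierE)

lemma tcoef_code:
  assumes "p \<in> carrier (UP R)" "k < N" shows "tcoef R N (trunc_code R N p) k = coeff (UP R) p k"
proof -
  have "trunc_code R N p \<in> carrier (trunc_ring R N)"
    using assms by (intro ring_hom_closed[OF trunc_code_hom])
  from trunc_carrierE[OF this] have
    "trunc_code R N (inv_into (carrier (UP R)) (trunc_code R N) (trunc_code R N p)) = trunc_code R N p"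
    by blast
  thus ?thesis unfolding trunc_code_eq_iff tcoef_def using assms by simp
qed

lemma trunc_monom:
  assumes "r \<in> carrier R"
  shows "trunc_code R N (monom (UP R) r k) =
    tconst R N r \<otimes>\<^bsub>trunc_ring R N\<^esub> tvar R N [^]\<^bsub>trunc_ring R N\<^esub> k"
proof -
  have "monom (UP R) r k = monom (UP R) r 0 \<otimes>\<^bsub>UP R\<^esub> monom (UP R) \<one> k"
    using assms UP.monom_mult[of r \<one> 0 k] by simp
  thus ?thesis
    unfolding tconst_def tvar_pow using assms ring_hom_mult[OF trunc_code_hom] by simp
qed

lemma trunc_sum_code:
  assumes "\<And>i. i < N \<Longrightarrow> a i \<in> carrier R"
  shows "(\<Oplus>\<^bsub>trunc_ring R N\<^esub>i\<in>{..<N}. tconst R N (a i) \<otimes>\<^bsub>trunc_ring R N\<^esub> tvar R N [^]\<^bsub>trunc_ring R N\<^esub> i)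
    = trunc_code R N (\<Oplus>\<^bsub>UP R\<^esub>i\<in>{..<N}. monom (UP R) (a i) i)"
proof -
  interpret h: ring_hom_cring "UP R" "trunc_ring R N" "trunc_code R N" by (rule trunc_code_hom_cring)
  have "trunc_code R N (\<Oplus>\<^bsub>UP R\<^esub>i\<in>{..<N}. monom (UP R) (a i) i) =
     (\<Oplus>\<^bsub>trunc_ring R N\<^esub>i\<in>{..<N}. trunc_code R N (monom (UP R) (a i) i))"
    using assms by (subst h.hom_finsum) (auto simp: comp_def)
  also have "\<dots> = (\<Oplus>\<^bsub>trunc_ring R N\<^esub>i\<in>{..<N}. tconst R N (a i) \<otimes>\<^bsub>trunc_ring R N\<^esub> tvar R N [^]\<^bsub>trunc_ring R N\<^esub> i)"
    using assms ring_hom_closed[OF tconst_hom] tvar_closed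
    by (intro h.S.finsum_cong') (auto simp: trunc_monom)
  finally show ?thesis by simp
qed

lemma coeff_sum_monom:
  assumes "\<And>i. i < N \<Longrightarrow> a i \<in> carrier R" and "k < N"
  shows "coeff (UP R) (\<Oplus>\<^bsub>UP R\<^esub>i\<in>{..<N}. monom (UP R) (a i) i) k = a k"
proof -
  have "coeff (UP R) (\<Oplus>\<^bsub>UP R\<^esub>i\<in>{..<N}. monom (UP R) (a i) i) k = (\<Oplus>i\<in>{..<N}. coeff (UP R) (monom (UP R) (a i) i) k)"
    using assms by (intro UP.coeff_finsum) auto
  also have "\<dots> = (\<Oplus>i\<in>{..<N}. if k = i then a i else \<zero>)"
    using assms by (intro finsum_cong') auto
  also have "\<dots> = a k" using assms by (intro finsum_singleton) auto
  finally show ?thesis .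
qed

lemma tcoef_sum:
  assumes "\<And>i. i < N \<Longrightarrow> a i \<in> carrier R" and "k < N"
  shows "tcoef R N (\<Oplus>\<^bsub>trunc_ring R N\<^esub>i\<in>{..<N}. tconst R N (a i) \<otimes>\<^bsub>trunc_ring R N\<^esub> tvar R N [^]\<^bsub>trunc_ring R N\<^esub> i) k = a k"
proof -
  have "(\<Oplus>\<^bsub>UP R\<^esub>i\<in>{..<N}. monom (UP R) (a i) i) \<in> carrier (UP R)"
    using assms by (intro UP.P.finsum_closed) auto
  with assms show ?thesis by (simp add: trunc_sum_code tcoef_code coeff_sum_monom)
qed

lemma trunc_expand:
  assumes "u \<in> carrier (trunc_ring R N)"
  shows "u = (\<Oplus>\<^bsub>trunc_ring R N\<^esub>i\<in>{..<N}. tconst R N (tcoef R N u i) \<otimes>\<^bsub>trunc_ring R N\<^esub> tvar R N [^]\<^bsub>trunc_ring R N\<^esub> i)"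
proof -
  obtain 1: "inv_into (carrier (UP R)) (trunc_code R N) u \<in> carrier (UP R)"
    and 2: "trunc_code R N (inv_into (carrier (UP R)) (trunc_code R N) u) = u"
    using assms by (rule trunc_carrierE)
  have "trunc_code R N (\<Oplus>\<^bsub>UP R\<^esub>i\<in>{..<N}. monom (UP R) (tcoef R N u i) i)
      = trunc_code R N (inv_into (carrier (UP R)) (trunc_code R N) u)"
    unfolding trunc_code_eq_iff using tcoef_closed[OF assms]
    by (simp add: coeff_sum_monom) (simp add: tcoef_def)
  thus ?thesis using tcoef_closed[OF assms] by (simp add: trunc_sum_code 2)
qed

text \<open>Evaluation at \<open>c\<close> kills all polynomials without terms below degree
  \<open>N\<close> and hence factors through the truncation. This makes \<open>tvar\<close> the
  generic element whose \<open>N\<close>-th power is zero.\<close>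

lemma trunc_universal:
  assumes C: "cring C" and h: "h \<in> ring_hom R C" and c: "c \<in> carrier C" "c [^]\<^bsub>C\<^esub> N = \<zero>\<^bsub>C\<^esub>"
  shows "\<exists>g \<in> ring_hom (trunc_ring R N) C. (\<forall>r\<in>carrier R. g (tconst R N r) = h r) \<and> g (tvar R N) = c"
proof -
  interpret C: cring C by fact
  interpret E: UP_univ_prop R C h "UP R" c "eval R C h c"
    using C h c(1) cring_axioms
    by (auto simp: UP_univ_prop_def UP_pre_univ_prop_def ring_hom_cring_def ring_hom_cring_axioms_def
        UP_cring_def UP_univ_prop_axioms_def)
  define ev where "ev = eval R C h c"
  have ev_hom: "ev \<in> ring_hom (UP R) C" unfolding ev_def by (rule E.eval_ring_hom) (use c in auto)
  have c0: "c [^]\<^bsub>C\<^esub> i = \<zero>\<^bsub>C\<^esub>" if "i \<ge> N" for i :: nat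
  proof -
    have "c [^]\<^bsub>C\<^esub> i = c [^]\<^bsub>C\<^esub> N \<otimes>\<^bsub>C\<^esub> c [^]\<^bsub>C\<^esub> (i - N)" using that c(1) C.nat_pow_mult[of c N "i - N"] by simp
    thus ?thesis using c by simp
  qed
  have ev0: "ev p = \<zero>\<^bsub>C\<^esub>" if "p \<in> high_ideal N" for p
  proof -
    have p: "p \<in> carrier (UP R)" using that by (simp add: high_ideal_def)
    have "ev p = (\<Oplus>\<^bsub>C\<^esub>i\<in>{..deg R p}. h (coeff (UP R) p i) \<otimes>\<^bsub>C\<^esub> c [^]\<^bsub>C\<^esub> i)"
      unfolding ev_def by (rule UP.eval_on_carrier[OF p])
    also have "\<dots> = (\<Oplus>\<^bsub>C\<^esub>i\<in>{..deg R p}. \<zero>\<^bsub>C\<^esub>)"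
    proof (intro C.finsum_cong' refl)
      fix i assume "i \<in> {..deg R p}"
      show "h (coeff (UP R) p i) \<otimes>\<^bsub>C\<^esub> c [^]\<^bsub>C\<^esub> i = \<zero>\<^bsub>C\<^esub>"
        using that p c c0[of i] ring_hom_closed[OF h] E.hom_zero
        by (cases "i < N") (auto simp: high_ideal_def)
    qed auto
    finally show ?thesis by simp
  qed
  have ev_eq: "ev p = ev q" if "p \<in> carrier (UP R)" "q \<in> carrier (UP R)" "trunc_code R N p = trunc_code R N q" for p q
  proof -
    interpret H: ring_hom_cring "UP R" C ev
      using ev_hom C UP.UP_cring by (intro ring_hom_cring.intro) (auto simp: ring_hom_cring_axioms_def)
    have "p \<ominus>\<^bsub>UP R\<^esub> q \<in> high_ideal N" using that by (auto simp: high_ideal_def trunc_code_eq_iff r_right_minus_eq)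
    hence "ev (p \<ominus>\<^bsub>UP R\<^esub> q) = \<zero>\<^bsub>C\<^esub>" by (rule ev0)
    hence "ev p \<ominus>\<^bsub>C\<^esub> ev q = \<zero>\<^bsub>C\<^esub>" using that by (simp add: a_minus_def)
    thus ?thesis using that by simp
  qed
  define g where "g = (\<lambda>u. ev (inv_into (carrier (UP R)) (trunc_code R N) u))"
  have g_code: "g (trunc_code R N p) = ev p" if "p \<in> carrier (UP R)" for p
  proof -
    have "trunc_code R N p \<in> carrier (trunc_ring R N)" by (rule ring_hom_closed[OF trunc_code_hom that])
    from trunc_carrierE[OF this] show ?thesis unfolding g_def using ev_eq that by metis
  qed
  have codeE: "\<exists>p\<in>carrier (UP R). u = trunc_code R N p" if "u \<in> carrier (trunc_ring R N)" for u
    using that trunc_carrierE by metis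
  have "g \<in> ring_hom (trunc_ring R N) C"
  proof (rule ring_hom_memI)
    fix x y assume "x \<in> carrier (trunc_ring R N)" "y \<in> carrier (trunc_ring R N)"
    then obtain p q where pq: "p \<in> carrier (UP R)" "q \<in> carrier (UP R)" "x = trunc_code R N p" "y = trunc_code R N q"
      using codeE by metis
    have "x \<otimes>\<^bsub>trunc_ring R N\<^esub> y = trunc_code R N (p \<otimes>\<^bsub>UP R\<^esub> q)"
      "x \<oplus>\<^bsub>trunc_ring R N\<^esub> y = trunc_code R N (p \<oplus>\<^bsub>UP R\<^esub> q)"
      using pq ring_hom_mult[OF trunc_code_hom] ring_hom_add[OF trunc_code_hom] by auto
    thus "g (x \<otimes>\<^bsub>trunc_ring R N\<^esub> y) = g x \<otimes>\<^bsub>C\<^esub> g y" "g (x \<oplus>\<^bsub>trunc_ring R N\<^esub> y) = g x \<oplus>\<^bsub>C\<^esub> g y"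
      using pq by (simp_all add: g_code ring_hom_mult[OF ev_hom] ring_hom_add[OF ev_hom])
  next
    fix x assume "x \<in> carrier (trunc_ring R N)"
    then obtain p where "p \<in> carrier (UP R)" "x = trunc_code R N p" using codeE by metis
    thus "g x \<in> carrier C" by (simp add: g_code ring_hom_closed[OF ev_hom])
  next
    have "\<one>\<^bsub>trunc_ring R N\<^esub> = trunc_code R N \<one>\<^bsub>UP R\<^esub>" using ring_hom_one[OF trunc_code_hom] by simp
    thus "g \<one>\<^bsub>trunc_ring R N\<^esub> = \<one>\<^bsub>C\<^esub>" by (simp add: g_code ring_hom_one[OF ev_hom])
  qed
  moreover have "g (tconst R N r) = h r" if "r \<in> carrier R" for r
    using that E.eval_const[OF c(1), of r] by (simp add: tconst_def g_code ev_def)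
  moreover have "g (tvar R N) = c"
  proof (cases "\<zero> = \<one>")
    case False
    then show ?thesis using E.eval_monom1[OF c(1)] by (simp add: tvar_def g_code ev_def)
  next
    case True
    hence "\<one>\<^bsub>C\<^esub> = \<zero>\<^bsub>C\<^esub>"
      using ring_hom_zero[OF h ring_axioms C.ring_axioms] ring_hom_one[OF h] by metis
    hence z: "x = \<zero>\<^bsub>C\<^esub>" if "x \<in> carrier C" for x
      using that C.r_one[of x] C.r_null[of x] by simp
    have gc: "g (tvar R N) \<in> carrier C"
      by (rule ring_hom_closed[OF \<open>g \<in> ring_hom _ _\<close> tvar_closed])
    thus ?thesis using z[OF gc] z[OF c(1)] by simp
  qed
  ultimately show ?thesis by blast
qed

end

section \<open>Nilpotent elements and series\<close>

definition nil :: "('u, 'm) ring_scheme \<Rightarrow> 'u set" where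
  "nil R = {b \<in> carrier R. \<exists>n::nat. b [^]\<^bsub>R\<^esub> n = \<zero>\<^bsub>R\<^esub>}"

abbreviation alg_nil ("nil[_]") where "nil[B] \<equiv> nil (ring_of B)"

text \<open>At a nilpotent argument a power series is a finite sum. The least exponent that kills
  \<open>y\<close> is the canonical cut-off; by \<open>series_eq\<close> any other such exponent
  gives the same value.\<close>

definition series :: "('u, 'm) ring_scheme \<Rightarrow> (nat \<Rightarrow> 'u) \<Rightarrow> 'u \<Rightarrow> 'u" where
  "series R a y =
     (\<Oplus>\<^bsub>R\<^esub>k\<in>{..<(LEAST N. y [^]\<^bsub>R\<^esub> (N::nat) = \<zero>\<^bsub>R\<^esub>)}. a k \<otimes>\<^bsub>R\<^esub> y [^]\<^bsub>R\<^esub> k)"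

lemma nilI: "b \<in> carrier R \<Longrightarrow> b [^]\<^bsub>R\<^esub> (n::nat) = \<zero>\<^bsub>R\<^esub> \<Longrightarrow> b \<in> nil R"
  unfolding nil_def by blast

lemma nilE:
  assumes "b \<in> nil R" obtains n :: nat where "b \<in> carrier R" "b [^]\<^bsub>R\<^esub> n = \<zero>\<^bsub>R\<^esub>"
  using assms unfolding nil_def by blast

lemma nil_carrier [simp]: "b \<in> nil R \<Longrightarrow> b \<in> carrier R"
  unfolding nil_def by blast

context cring
begin

lemma pow_zero_mono:
  assumes "y \<in> carrier R" "y [^] (N::nat) = \<zero>" "N \<le> k" shows "y [^] k = \<zero>"
proof -
  have "y [^] k = y [^] N \<otimes> y [^] (k - N)"
    using assms(1,3) nat_pow_mult[of y N "k - N"] by simp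
  thus ?thesis using assms by simp
qed

lemma zero_nil [simp]: "\<zero> \<in> nil R"
  by (rule nilI[of _ _ 1]) simp_all

lemma mult_nil:
  assumes "a \<in> nil R" "r \<in> carrier R" shows "r \<otimes> a \<in> nil R" "a \<otimes> r \<in> nil R"
proof -
  obtain n where n: "a \<in> carrier R" "a [^] (n::nat) = \<zero>" using assms by (elim nilE)
  show "r \<otimes> a \<in> nil R"
    by (rule nilI[of _ _ n]) (use n assms in \<open>simp_all add: nat_pow_distrib\<close>)
  thus "a \<otimes> r \<in> nil R" using n assms by (simp add: m_comm)
qed

lemma uminus_nil: assumes "a \<in> nil R" shows "\<ominus> a \<in> nil R"
  using mult_nil(1)[OF assms, of "\<ominus> \<one>"] assms by (simp add: l_minus)

lemma pow_nil: assumes "a \<in> nil R" "0 < k" shows "a [^] (k::nat) \<in> nil R"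
proof -
  have "a [^] k = a [^] (k - 1) \<otimes> a" using assms(2) by (metis Suc_diff_1 nat_pow_Suc)
  thus ?thesis using assms mult_nil(1) by simp
qed

text \<open>The power lies in the ideal generated by \<open>a^m\<close> and \<open>b^n\<close>. The
  induction multiplies by \<open>a + b\<close> and uses two representations of the previous power,
  one for each summand.\<close>

lemma binomial_split:
  assumes a: "a \<in> carrier R" and b: "b \<in> carrier R"
  shows "\<exists>r\<in>carrier R. \<exists>s\<in>carrier R. (a \<oplus> b) [^] (m + n) = r \<otimes> a [^] (m::nat) \<oplus> s \<otimes> b [^] (n::nat)"
proof (induction "m + n" arbitrary: m n rule: less_induct)
  case less
  show ?case
  proof (cases m)
    case 0
    show ?thesis using a b 0
      by (intro bexI[of _ "(a \<oplus> b) [^] (m + n)"] bexI[of _ \<zero>]) auto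
  next
    case (Suc m')
    note m = this
    show ?thesis
    proof (cases n)
      case 0
      show ?thesis using a b 0
        by (intro bexI[of _ "(a \<oplus> b) [^] (m + n)"] bexI[of _ \<zero>]) auto
    next
      case (Suc n')
      have "\<exists>r\<in>carrier R. \<exists>s\<in>carrier R. (a \<oplus> b) [^] (m' + n) = r \<otimes> a [^] m' \<oplus> s \<otimes> b [^] n"
        using less m by simp
      then obtain r s where rs: "r \<in> carrier R" "s \<in> carrier R"
        "(a \<oplus> b) [^] (m' + n) = r \<otimes> a [^] m' \<oplus> s \<otimes> b [^] n" by blast
      have "\<exists>r\<in>carrier R. \<exists>s\<in>carrier R. (a \<oplus> b) [^] (m + n') = r \<otimes> a [^] m \<oplus> s \<otimes> b [^] n'"
        using less Suc by simp
      then obtain r' s' where rs': "r' \<in> carrier R" "s' \<in> carrier R"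
        "(a \<oplus> b) [^] (m + n') = r' \<otimes> a [^] m \<oplus> s' \<otimes> b [^] n'" by blast
      have eq: "m' + n = m + n'" "m + n = Suc (m' + n)" using m Suc by auto
      define X where "X = a [^] m'"
      define Y where "Y = b [^] n'"
      have XY: "X \<in> carrier R" "Y \<in> carrier R" "a [^] m = X \<otimes> a" "b [^] n = Y \<otimes> b"
        using a b m Suc by (auto simp: X_def Y_def)
      define Z where "Z = (a \<oplus> b) [^] (m' + n)"
      have Z: "Z \<in> carrier R" "Z = r \<otimes> X \<oplus> s \<otimes> (Y \<otimes> b)" "Z = r' \<otimes> (X \<otimes> a) \<oplus> s' \<otimes> Y"
        subgoal using a b by (simp add: Z_def)
        subgoal unfolding Z_def rs(3) XY(4) X_def ..
        subgoal unfolding Z_def eq(1) rs'(3) XY(3) Y_def ..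
        done
      \<comment> \<open>In \<open>Z a\<close> the representation by \<open>a^(m-1)\<close> and
        \<open>b^n\<close> is inserted, in \<open>Z b\<close> the one by \<open>a^m\<close> and
        \<open>b^(n-1)\<close>.\<close>
      have "(a \<oplus> b) [^] (m + n) = Z \<otimes> a \<oplus> Z \<otimes> b"
        unfolding eq(2) nat_pow_Suc Z_def[symmetric] using Z(1) a b by (simp add: r_distr)
      also have "\<dots> = (r \<otimes> X \<oplus> s \<otimes> (Y \<otimes> b)) \<otimes> a \<oplus> (r' \<otimes> (X \<otimes> a) \<oplus> s' \<otimes> Y) \<otimes> b"
        using Z by metis
      also have "\<dots> = (r \<oplus> r' \<otimes> b) \<otimes> (X \<otimes> a) \<oplus> (s' \<oplus> s \<otimes> a) \<otimes> (Y \<otimes> b)"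
        using XY(1,2) rs(1,2) rs'(1,2) a b by algebra
      finally show ?thesis using XY rs rs' a b
        by (intro bexI[of _ "r \<oplus> r' \<otimes> b"] bexI[of _ "s' \<oplus> s \<otimes> a"]) auto
    qed
  qed
qed

lemma add_nil: assumes "a \<in> nil R" "b \<in> nil R" shows "a \<oplus> b \<in> nil R"
proof -
  obtain m where m: "a \<in> carrier R" "a [^] (m::nat) = \<zero>" using assms by (elim nilE)
  obtain n where n: "b \<in> carrier R" "b [^] (n::nat) = \<zero>" using assms by (elim nilE)
  from binomial_split[OF m(1) n(1), of m n] have "(a \<oplus> b) [^] (m + n) = \<zero>" using m n by auto
  thus ?thesis using m n by (intro nilI) auto
qed

lemma minus_nil: "a \<in> nil R \<Longrightarrow> b \<in> nil R \<Longrightarrow> a \<ominus> b \<in> nil R"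
  by (simp add: a_minus_def add_nil uminus_nil)

lemma one_plus_nil_unit: assumes "b \<in> nil R" shows "\<one> \<oplus> b \<in> Units R"
proof -
  obtain n where n: "b \<in> carrier R" "b [^] (n::nat) = \<zero>" using assms by (elim nilE)
  \<comment> \<open>Partial geometric series: \<open>c\<close> is the sum of the powers of
    \<open>-b\<close> below \<open>n\<close>.\<close>
  have "\<exists>c\<in>carrier R. (\<one> \<oplus> b) \<otimes> c = \<one> \<ominus> (\<ominus> b) [^] n" for n :: nat
  proof (induction n)
    case 0
    show ?case by (rule bexI[of _ \<zero>]) (use n in \<open>auto simp: a_minus_def r_neg\<close>)
  next
    case (Suc k)
    then obtain c where c: "c \<in> carrier R" "(\<one> \<oplus> b) \<otimes> c = \<one> \<ominus> (\<ominus> b) [^] k" by blast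
    define X where "X = (\<ominus> b) [^] k"
    have X: "X \<in> carrier R" using n by (simp add: X_def)
    have "(\<one> \<oplus> b) \<otimes> (c \<oplus> X) = (\<one> \<oplus> b) \<otimes> c \<oplus> (\<one> \<oplus> b) \<otimes> X"
      using X n c by (simp add: r_distr)
    also have "\<dots> = (\<one> \<ominus> X) \<oplus> (\<one> \<oplus> b) \<otimes> X" using c by (simp add: X_def)
    also have "\<dots> = \<one> \<ominus> X \<otimes> (\<ominus> b)" using X n by algebra
    also have "\<dots> = \<one> \<ominus> (\<ominus> b) [^] Suc k" by (simp add: X_def)
    finally show ?case using c X by (intro bexI[of _ "c \<oplus> X"]) auto
  qed
  from this[of n] obtain c where c: "c \<in> carrier R" "(\<one> \<oplus> b) \<otimes> c = \<one> \<ominus> (\<ominus> b) [^] n" by blast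
  have "\<ominus> b = \<ominus> \<one> \<otimes> b" using n by (simp add: l_minus)
  hence "(\<ominus> b) [^] n = \<zero>" using n by (simp add: nat_pow_distrib)
  hence "(\<one> \<oplus> b) \<otimes> c = \<one>" using c by (simp add: a_minus_def)
  thus ?thesis using c n by (auto simp: Units_def m_comm intro!: bexI[of _ c])
qed

lemma unit_plus_nil: assumes "u \<in> Units R" "b \<in> nil R" shows "u \<oplus> b \<in> Units R"
proof -
  have u: "u \<in> carrier R" "inv u \<in> carrier R" "u \<otimes> inv u = \<one>" using assms by auto
  have "u \<otimes> (\<one> \<oplus> inv u \<otimes> b) = u \<oplus> (u \<otimes> inv u) \<otimes> b"
    using u(1,2) nil_carrier[OF assms(2)] by algebra
  hence "u \<oplus> b = u \<otimes> (\<one> \<oplus> inv u \<otimes> b)" using u assms by simp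
  thus ?thesis using assms one_plus_nil_unit[of "inv u \<otimes> b"] mult_nil(1) by simp
qed

lemma unit_mult_zero: assumes "u \<in> Units R" "x \<in> carrier R" "u \<otimes> x = \<zero>" shows "x = \<zero>"
proof -
  have u: "u \<in> carrier R" "inv u \<in> carrier R" "inv u \<otimes> u = \<one>" using assms by auto
  have "inv u \<otimes> (u \<otimes> x) = (inv u \<otimes> u) \<otimes> x" using u(1,2) assms(2) by (simp only: m_assoc)
  thus ?thesis using u assms by simp
qed

lemma series_eq:
  assumes y: "y \<in> carrier R" "y [^] (N::nat) = \<zero>" and a: "\<And>k. a k \<in> carrier R"
  shows "series R a y = (\<Oplus>k\<in>{..<N}. a k \<otimes> y [^] k)"
proof -
  define L where "L = (LEAST N. y [^] (N::nat) = \<zero>)"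
  have L: "y [^] L = \<zero>" unfolding L_def using y(2) by (rule LeastI)
  have LN: "L \<le> N" unfolding L_def using y(2) by (rule Least_le)
  have "(\<Oplus>k\<in>{..<L}. a k \<otimes> y [^] k) = (\<Oplus>k\<in>{..<N}. a k \<otimes> y [^] k)"
  proof (rule add.finprod_mono_neutral_cong_left)
    show "a i \<otimes> y [^] i = \<zero>" if "i \<in> {..<N} - {..<L}" for i
      using that pow_zero_mono[OF y(1) L, of i] a by simp
  qed (use LN y a in auto)
  thus ?thesis by (simp add: series_def L_def)
qed

lemma series_closed:
  assumes "y \<in> nil R" "\<And>k. a k \<in> carrier R" shows "series R a y \<in> carrier R"
proof -
  obtain N where N: "y \<in> carrier R" "y [^] (N::nat) = \<zero>" using assms by (elim nilE)
  show ?thesis unfolding series_eq[OF N assms(2)] using N assms by (intro finsum_closed) auto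
qed

lemma series_cong: "(\<And>k. a k = b k) \<Longrightarrow> series R a y = series R b y"
  by presburger

lemma series_add:
  assumes "y \<in> nil R" "\<And>k. a k \<in> carrier R" "\<And>k. b k \<in> carrier R"
  shows "series R (\<lambda>k. a k \<oplus> b k) y = series R a y \<oplus> series R b y"
proof -
  obtain N where N: "y \<in> carrier R" "y [^] (N::nat) = \<zero>" using assms by (elim nilE)
  have "(\<Oplus>k\<in>{..<N}. (a k \<oplus> b k) \<otimes> y [^] k) = (\<Oplus>k\<in>{..<N}. a k \<otimes> y [^] k \<oplus> b k \<otimes> y [^] k)"
    using N assms by (intro finsum_cong') (auto simp: l_distr)
  also have "\<dots> = (\<Oplus>k\<in>{..<N}. a k \<otimes> y [^] k) \<oplus> (\<Oplus>k\<in>{..<N}. b k \<otimes> y [^] k)"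
    using N assms by (intro finsum_addf) auto
  finally show ?thesis using series_eq[OF N] assms by simp
qed

lemma series_smult:
  assumes "y \<in> nil R" "\<And>k. a k \<in> carrier R" "r \<in> carrier R"
  shows "series R (\<lambda>k. r \<otimes> a k) y = r \<otimes> series R a y"
proof -
  obtain N where N: "y \<in> carrier R" "y [^] (N::nat) = \<zero>" using assms by (elim nilE)
  have "(\<Oplus>k\<in>{..<N}. (r \<otimes> a k) \<otimes> y [^] k) = (\<Oplus>k\<in>{..<N}. r \<otimes> (a k \<otimes> y [^] k))"
    using N assms by (intro finsum_cong') (auto simp: m_assoc)
  also have "\<dots> = r \<otimes> (\<Oplus>k\<in>{..<N}. a k \<otimes> y [^] k)"
    using N assms by (subst finsum_rdistr) auto
  finally show ?thesis using series_eq[OF N] assms by simp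
qed

lemma series_minus:
  assumes "y \<in> nil R" "\<And>k. a k \<in> carrier R" "\<And>k. b k \<in> carrier R"
  shows "series R (\<lambda>k. a k \<ominus> b k) y = series R a y \<ominus> series R b y"
proof -
  have "series R (\<lambda>k. a k \<ominus> b k) y = series R (\<lambda>k. a k \<oplus> \<ominus> \<one> \<otimes> b k) y"
    using assms by (intro series_cong) (auto simp: a_minus_def l_minus)
  also have "\<dots> = series R a y \<oplus> \<ominus> \<one> \<otimes> series R b y"
    using assms by (subst series_add) (auto simp: series_smult)
  finally show ?thesis using assms series_closed[of y b] by (simp add: a_minus_def l_minus)
qed

lemma series_shift:
  assumes "y \<in> nil R" "\<And>k. a k \<in> carrier R"
  shows "series R a y = a 0 \<oplus> y \<otimes> series R (\<lambda>k. a (Suc k)) y"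
proof -
  obtain N where N: "y \<in> carrier R" "y [^] (N::nat) = \<zero>" using assms by (elim nilE)
  have N': "y [^] Suc N = \<zero>" using N by simp
  have "series R a y = (\<Oplus>k\<in>{..N}. a k \<otimes> y [^] k)"
    by (simp add: series_eq[OF N(1) N' assms(2)] lessThan_Suc_atMost)
  also have "\<dots> = (\<Oplus>k\<in>{..<N}. a (Suc k) \<otimes> y [^] Suc k) \<oplus> a 0"
  proof (cases N)
    \<comment> \<open>If already \<open>y^0\<close> is zero, then the ring is the zero ring.\<close>
    case 0
    hence "carrier R = {\<zero>}" using N by (simp add: carrier_one_zero)
    hence "a 0 = \<zero>" using assms(2)[of 0] by simp
    thus ?thesis using 0 by simp
  next
    case (Suc M)
    thus ?thesis using assms N finsum_Suc2[of "\<lambda>k. a k \<otimes> y [^] k" M]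
      by (simp add: lessThan_Suc_atMost)
  qed
  also have "(\<Oplus>k\<in>{..<N}. a (Suc k) \<otimes> y [^] Suc k) = (\<Oplus>k\<in>{..<N}. y \<otimes> (a (Suc k) \<otimes> y [^] k))"
    using assms N by (intro finsum_cong') (auto simp: m_ac)
  also have "\<dots> = y \<otimes> series R (\<lambda>k. a (Suc k)) y"
    using assms N by (subst finsum_rdistr[symmetric]) (auto simp: series_eq[OF N])
  finally show ?thesis using assms series_closed[of y "\<lambda>k. a (Suc k)"] N by (simp add: a_comm)
qed

lemma series_nil:
  assumes "y \<in> nil R" "\<And>k. a k \<in> carrier R" "a 0 \<in> nil R" shows "series R a y \<in> nil R"
  using assms series_closed[of y "\<lambda>k. a (Suc k)"]
  by (simp add: series_shift[of y a] add_nil mult_nil)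

lemma series_at_zero: assumes "\<And>k. a k \<in> carrier R" shows "series R a \<zero> = a 0"
  using assms series_shift[of \<zero> a] series_closed[of \<zero> "\<lambda>k. a (Suc k)"] by simp

lemma series_pow_arg:
  assumes y: "y \<in> nil R" and a: "\<And>k. a k \<in> carrier R" and q: "0 < (q::nat)"
  shows "series R a (y [^] q) = series R (\<lambda>k. if q dvd k then a (k div q) else \<zero>) y"
proof -
  obtain N where N: "y \<in> carrier R" "y [^] (N::nat) = \<zero>" using y by (elim nilE)
  have N1: "(y [^] q) [^] N = \<zero>" using N q by (simp add: nat_pow_pow pow_zero_mono[OF N])
  have N2: "y [^] (q * N) = \<zero>" using N1 N by (simp add: nat_pow_pow)
  let ?f = "\<lambda>k. (if q dvd k then a (k div q) else \<zero>) \<otimes> y [^] k"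
  have "series R (\<lambda>k. if q dvd k then a (k div q) else \<zero>) y = (\<Oplus>k\<in>{..<q * N}. ?f k)"
    using a by (intro series_eq[OF N(1) N2]) auto
  also have "\<dots> = (\<Oplus>k\<in>(\<lambda>k. q * k) ` {..<N}. ?f k)"
  proof (rule add.finprod_mono_neutral_cong_right)
    show "?f i = \<zero>" if "i \<in> {..<q * N} - (\<lambda>k. q * k) ` {..<N}" for i
      using that N by (auto elim!: dvdE)
  qed (use q N a in auto)
  also have "\<dots> = (\<Oplus>k\<in>{..<N}. ?f (q * k))"
    using a N q by (subst add.finprod_reindex) (auto simp: inj_on_def)
  also have "\<dots> = (\<Oplus>k\<in>{..<N}. a k \<otimes> (y [^] q) [^] k)"
    using a N q by (intro finsum_cong') (auto simp: nat_pow_pow)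
  also have "\<dots> = series R a (y [^] q)"
    using a N N1 by (intro series_eq[symmetric]) auto
  finally show ?thesis by simp
qed

end

lemma hom_nil:
  assumes "cring R" "cring S" "f \<in> ring_hom R S" "y \<in> nil R" shows "f y \<in> nil S"
proof -
  interpret f: ring_hom_cring R S f using assms by (simp add: ring_hom_cring_def ring_hom_cring_axioms_def)
  obtain N where N: "y \<in> carrier R" "y [^]\<^bsub>R\<^esub> (N::nat) = \<zero>\<^bsub>R\<^esub>" using assms by (elim nilE)
  have "f y [^]\<^bsub>S\<^esub> N = \<zero>\<^bsub>S\<^esub>" using N f.hom_pow[of y N, symmetric] by (simp del: f.hom_pow)
  thus ?thesis using N by (intro nilI) auto
qed

lemma hom_pow_eq:
  assumes "cring R" "cring S" "f \<in> ring_hom R S" "y \<in> carrier R"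
  shows "f (y [^]\<^bsub>R\<^esub> (n::nat)) = f y [^]\<^bsub>S\<^esub> n"
proof -
  interpret f: ring_hom_cring R S f using assms by (simp add: ring_hom_cring_def ring_hom_cring_axioms_def)
  show ?thesis using assms by simp
qed

lemma hom_series:
  assumes "cring R" "cring S" "f \<in> ring_hom R S" "y \<in> nil R" "\<And>k. a k \<in> carrier R"
  shows "f (series R a y) = series S (\<lambda>k. f (a k)) (f y)"
proof -
  interpret f: ring_hom_cring R S f using assms by (simp add: ring_hom_cring_def ring_hom_cring_axioms_def)
  obtain N where N: "y \<in> carrier R" "y [^]\<^bsub>R\<^esub> (N::nat) = \<zero>\<^bsub>R\<^esub>" using assms by (elim nilE)
  have N': "f y [^]\<^bsub>S\<^esub> N = \<zero>\<^bsub>S\<^esub>" using N f.hom_pow[of y N, symmetric] by (simp del: f.hom_pow)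
  have "f (series R a y) = (\<Oplus>\<^bsub>S\<^esub>k\<in>{..<N}. f (a k \<otimes>\<^bsub>R\<^esub> y [^]\<^bsub>R\<^esub> k))"
    using assms N by (subst f.R.series_eq[OF N]) (auto simp: comp_def)
  also have "\<dots> = (\<Oplus>\<^bsub>S\<^esub>k\<in>{..<N}. f (a k) \<otimes>\<^bsub>S\<^esub> f y [^]\<^bsub>S\<^esub> k)"
    using assms N by (intro f.S.finsum_cong') auto
  also have "\<dots> = series S (\<lambda>k. f (a k)) (f y)"
    using assms N N' by (intro f.S.series_eq[symmetric]) auto
  finally show ?thesis .
qed

section \<open>Natural operations on nilpotent elements\<close>

definition nilpts :: "'u alg \<Rightarrow> nat \<Rightarrow> 'u list set" where
  "nilpts B n = {xs. length xs = n \<and> set xs \<subseteq> nil[B]}"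

text \<open>Functions on the \<open>n\<close>-dimensional formal affine space, that is, power series
  in \<open>n\<close> variables over \<open>A\<close>, in a form that needs no coefficients.\<close>

definition natop :: "'u ring \<Rightarrow> nat \<Rightarrow> ('u alg \<Rightarrow> 'u list \<Rightarrow> 'u) \<Rightarrow> bool" where
  "natop A n P \<longleftrightarrow>
     (\<forall>B. is_alg A B \<longrightarrow> (\<forall>xs\<in>nilpts B n. P B xs \<in> carrier[B])) \<and>
     (\<forall>B C f. alg_hom A B C f \<longrightarrow> (\<forall>xs\<in>nilpts B n. P C (map f xs) = f (P B xs)))"

definition trunc_alg :: "'u alg \<Rightarrow> nat \<Rightarrow> 'u alg" where
  "trunc_alg B N = (trunc_ring (ring_of B) N, tconst (ring_of B) N \<circ> str_map B)"

text \<open>The coefficient of the \<open>k\<close>-th power of the first variable, a function of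
  the remaining ones. It is read off by inserting \<open>T\<close> from
  \<open>B[T]/(T^(k+1))\<close>, the shortest truncation in which \<open>T^k\<close>
  survives.\<close>

definition op_coef :: "('u alg \<Rightarrow> 'u list \<Rightarrow> 'u) \<Rightarrow> nat \<Rightarrow> 'u alg \<Rightarrow> 'u list \<Rightarrow> 'u" where
  "op_coef P k B xs = tcoef (ring_of B) (Suc k)
     (P (trunc_alg B (Suc k)) (tvar (ring_of B) (Suc k) # map (tconst (ring_of B) (Suc k)) xs)) k"

lemma trunc_alg_simps [simp]: "ring_of (trunc_alg B N) = trunc_ring (ring_of B) N"
  "str_map (trunc_alg B N) = tconst (ring_of B) N \<circ> str_map B"
  by (simp_all add: trunc_alg_def)

lemma is_alg_cring: "is_alg A B \<Longrightarrow> cring (ring_of B)"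
  by (simp add: is_alg_def)

lemma is_alg_str: "is_alg A B \<Longrightarrow> str_map B \<in> ring_hom A (ring_of B)"
  by (simp add: is_alg_def)

lemma alg_homD:
  assumes "alg_hom A B C f"
  shows "is_alg A B" "is_alg A C" "f \<in> ring_hom (ring_of B) (ring_of C)"
    "cring (ring_of B)" "cring (ring_of C)"
    "\<And>a. a \<in> carrier A \<Longrightarrow> f (str_map B a) = str_map C a"
    "\<And>b. b \<in> carrier[B] \<Longrightarrow> f b \<in> carrier[C]"
    "\<And>b. b \<in> nil[B] \<Longrightarrow> f b \<in> nil[C]"
    "f \<zero>[B] = \<zero>[C]"
  using assms ring_hom_closed[of f "ring_of B" "ring_of C"] hom_nil[of "ring_of B" "ring_of C" f]
    ring_hom_zero[of f "ring_of B" "ring_of C"]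
  by (auto simp: alg_hom_def is_alg_def cring.axioms)

lemma alg_hom_id: "is_alg A B \<Longrightarrow> alg_hom A B B (\<lambda>b. b)"
  by (auto simp: alg_hom_def intro!: ring_hom_memI)

lemma alg_hom_comp: "alg_hom A B C f \<Longrightarrow> alg_hom A C D g \<Longrightarrow> alg_hom A B D (g \<circ> f)"
  by (auto simp: alg_hom_def intro!: ring_hom_trans)

lemma base_alg: "cring A \<Longrightarrow> is_alg A (A, \<lambda>a. a)"
  by (auto simp: is_alg_def intro!: ring_hom_memI)

lemma str_alg_hom: "cring A \<Longrightarrow> is_alg A B \<Longrightarrow> alg_hom A (A, \<lambda>a. a) B (str_map B)"
  by (simp add: alg_hom_def base_alg is_alg_str)

lemma nilpts_Cons [simp]: "y # xs \<in> nilpts B (Suc n) \<longleftrightarrow> y \<in> nil[B] \<and> xs \<in> nilpts B n"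
  by (auto simp: nilpts_def)

lemma nilpts_0 [simp]: "nilpts B 0 = {[]}"
  by (auto simp: nilpts_def)

lemma nilpts_SucE:
  assumes "l \<in> nilpts B (Suc n)" obtains y xs where "l = y # xs" "y \<in> nil[B]" "xs \<in> nilpts B n"
  using assms by (cases l) (auto simp: nilpts_def)

lemma nilpts_map: "alg_hom A B C f \<Longrightarrow> xs \<in> nilpts B n \<Longrightarrow> map f xs \<in> nilpts C n"
  by (auto simp: nilpts_def dest!: alg_homD(8))

lemma natop_closed: "natop A n P \<Longrightarrow> is_alg A B \<Longrightarrow> xs \<in> nilpts B n \<Longrightarrow> P B xs \<in> carrier[B]"
  unfolding natop_def by blast

lemma natop_natural: "natop A n P \<Longrightarrow> alg_hom A B C f \<Longrightarrow> xs \<in> nilpts B n \<Longrightarrow> P C (map f xs) = f (P B xs)"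
  unfolding natop_def by blast

lemma natopI:
  assumes "\<And>B xs. is_alg A B \<Longrightarrow> xs \<in> nilpts B n \<Longrightarrow> P B xs \<in> carrier[B]"
    and "\<And>B C f xs. alg_hom A B C f \<Longrightarrow> xs \<in> nilpts B n \<Longrightarrow> P C (map f xs) = f (P B xs)"
  shows "natop A n P"
  unfolding natop_def using assms by blast

lemma natop_add:
  assumes "natop A n P" "natop A n Q"
  shows "natop A n (\<lambda>B xs. P B xs \<oplus>[B] Q B xs)"
proof (rule natopI)
  fix B xs assume "is_alg A B" "xs \<in> nilpts B n"
  thus "P B xs \<oplus>[B] Q B xs \<in> carrier[B]"
    using assms by (simp add: natop_closed cring.cring_simprules(1) is_alg_cring)
next
  fix B C f xs assume h: "alg_hom A B C f" "xs \<in> nilpts B n"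
  thus "P C (map f xs) \<oplus>[C] Q C (map f xs) = f (P B xs \<oplus>[B] Q B xs)"
    using assms alg_homD[OF h(1)] by (simp add: natop_closed natop_natural[OF _ h] ring_hom_add)
qed

lemma natop_mult:
  assumes "natop A n P" "natop A n Q"
  shows "natop A n (\<lambda>B xs. P B xs \<otimes>[B] Q B xs)"
proof (rule natopI)
  fix B xs assume "is_alg A B" "xs \<in> nilpts B n"
  thus "P B xs \<otimes>[B] Q B xs \<in> carrier[B]"
    using assms by (simp add: natop_closed cring.cring_simprules(5) is_alg_cring)
next
  fix B C f xs assume h: "alg_hom A B C f" "xs \<in> nilpts B n"
  thus "P C (map f xs) \<otimes>[C] Q C (map f xs) = f (P B xs \<otimes>[B] Q B xs)"
    using assms alg_homD[OF h(1)] by (simp add: natop_closed natop_natural[OF _ h] ring_hom_mult)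
qed

lemma natop_pow:
  assumes "natop A n P"
  shows "natop A n (\<lambda>B xs. P B xs [^][B] (k::nat))"
proof (rule natopI)
  fix B xs assume "is_alg A B" "xs \<in> nilpts B n"
  thus "P B xs [^][B] k \<in> carrier[B]"
    using assms by (intro monoid.nat_pow_closed ring.is_monoid cring.axioms)
      (auto simp: natop_closed is_alg_cring)
next
  fix B C f xs assume h: "alg_hom A B C f" "xs \<in> nilpts B n"
  thus "P C (map f xs) [^][C] k = f (P B xs [^][B] k)"
    using assms alg_homD[OF h(1)] by (simp add: natop_closed natop_natural[OF _ h] hom_pow_eq)
qed

lemma natop_const: "c \<in> carrier A \<Longrightarrow> natop A n (\<lambda>B xs. str_map B c)"
  by (rule natopI) (auto dest: alg_homD(6) is_alg_str ring_hom_closed)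

lemma natop_minus:
  assumes "natop A n P" "natop A n Q"
  shows "natop A n (\<lambda>B xs. P B xs \<ominus>[B] Q B xs)"
proof (rule natopI)
  fix B xs assume B: "is_alg A B" "xs \<in> nilpts B n"
  then interpret B: cring "ring_of B" by (simp add: is_alg_cring)
  show "P B xs \<ominus>[B] Q B xs \<in> carrier[B]"
    using assms B by (simp add: natop_closed)
next
  fix B C f xs assume h: "alg_hom A B C f" "xs \<in> nilpts B n"
  note hD = alg_homD[OF h(1)]
  interpret f: ring_hom_cring "ring_of B" "ring_of C" f
    using hD by (simp add: ring_hom_cring_def ring_hom_cring_axioms_def)
  show "P C (map f xs) \<ominus>[C] Q C (map f xs) = f (P B xs \<ominus>[B] Q B xs)"
    using assms hD h by (simp add: natop_closed natop_natural[OF _ h] a_minus_def)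
qed

lemma natop_nth: "i < n \<Longrightarrow> natop A n (\<lambda>B xs. xs ! i)"
  by (rule natopI) (simp_all add: nilpts_def subset_iff)

lemma natop_series:
  assumes "\<And>k. natop A n (a k)"
  shows "natop A (Suc n) (\<lambda>B l. series (ring_of B) (\<lambda>k. a k B (tl l)) (hd l))"
proof (rule natopI)
  fix B xs assume B: "is_alg A B" and "xs \<in> nilpts B (Suc n)"
  then obtain z zs where z: "xs = z # zs" "z \<in> nil[B]" "zs \<in> nilpts B n" by (elim nilpts_SucE)
  show "series (ring_of B) (\<lambda>k. a k B (tl xs)) (hd xs) \<in> carrier[B]"
    using cring.series_closed[OF is_alg_cring[OF B] z(2) natop_closed[OF assms B z(3)]] z(1) by simp
next
  fix B C f xs assume h: "alg_hom A B C f" and "xs \<in> nilpts B (Suc n)"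
  then obtain z zs where z: "xs = z # zs" "z \<in> nil[B]" "zs \<in> nilpts B n" by (elim nilpts_SucE)
  show "series (ring_of C) (\<lambda>k. a k C (tl (map f xs))) (hd (map f xs)) =
          f (series (ring_of B) (\<lambda>k. a k B (tl xs)) (hd xs))"
    using hom_series[OF alg_homD(4,5,3)[OF h] z(2) natop_closed[OF assms alg_homD(1)[OF h] z(3)]]
      natop_natural[OF assms h z(3)] z(1) by simp
qed

lemma natop_comp:
  assumes P: "natop A m P" and Q: "\<And>i. i < m \<Longrightarrow> natop A n (Q i)"
    and nil: "\<And>i B xs. i < m \<Longrightarrow> is_alg A B \<Longrightarrow> xs \<in> nilpts B n \<Longrightarrow> Q i B xs \<in> nil[B]"
  shows "natop A n (\<lambda>B xs. P B (map (\<lambda>i. Q i B xs) [0..<m]))"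
proof (rule natopI)
  fix B xs assume h: "is_alg A B" "xs \<in> nilpts B n"
  show "P B (map (\<lambda>i. Q i B xs) [0..<m]) \<in> carrier[B]"
    using nil[OF _ h] by (intro natop_closed[OF P h(1)]) (auto simp: nilpts_def)
next
  fix B C f xs assume h: "alg_hom A B C f" "xs \<in> nilpts B n"
  have e1: "map (\<lambda>i. Q i C (map f xs)) [0..<m] = map f (map (\<lambda>i. Q i B xs) [0..<m])"
    using natop_natural[OF Q h] by simp
  have e2: "map (\<lambda>i. Q i B xs) [0..<m] \<in> nilpts B m"
    using nil[OF _ alg_homD(1)[OF h(1)] h(2)] by (auto simp: nilpts_def)
  show "P C (map (\<lambda>i. Q i C (map f xs)) [0..<m]) = f (P B (map (\<lambda>i. Q i B xs) [0..<m]))"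
    unfolding e1 by (rule natop_natural[OF P h(1) e2])
qed

context big_cring
begin

lemma alg_big: "is_alg R B \<Longrightarrow> big_cring (ring_of B)"
  using infinite_univ by (simp add: big_cring_def big_cring_axioms_def is_alg_def)

lemma trunc_is_alg: assumes "is_alg R B" shows "is_alg R (trunc_alg B N)"
proof -
  interpret B: big_cring "ring_of B" by (rule alg_big[OF assms])
  show ?thesis using ring_hom_trans[OF is_alg_str[OF assms] B.tconst_hom[of N]] B.trunc_cring
    by (simp add: is_alg_def)
qed

lemma tconst_alg_hom: assumes "is_alg R B" shows "alg_hom R B (trunc_alg B N) (tconst (ring_of B) N)"
proof -
  interpret B: big_cring "ring_of B" by (rule alg_big[OF assms])
  show ?thesis using B.tconst_hom trunc_is_alg[OF assms] assms by (simp add: alg_hom_def)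
qed

lemma trunc_alg_universal:
  assumes f: "alg_hom R B C f" and c: "c \<in> carrier[C]" "c [^][C] N = \<zero>[C]"
  obtains g where "alg_hom R (trunc_alg B N) C g"
    "\<And>r. r \<in> carrier[B] \<Longrightarrow> g (tconst (ring_of B) N r) = f r" "g (tvar (ring_of B) N) = c"
proof -
  note fD = alg_homD[OF f]
  interpret B: big_cring "ring_of B" by (rule alg_big[OF fD(1)])
  obtain g where g: "g \<in> ring_hom (trunc_ring (ring_of B) N) (ring_of C)"
     "\<And>r. r \<in> carrier[B] \<Longrightarrow> g (tconst (ring_of B) N r) = f r" "g (tvar (ring_of B) N) = c"
    using B.trunc_universal[OF fD(5,3) c] by blast
  moreover have "alg_hom R (trunc_alg B N) C g"
    using g fD ring_hom_closed[OF is_alg_str[OF fD(1)]] trunc_is_alg[OF fD(1)]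
    by (simp add: alg_hom_def)
  ultimately show thesis using that by blast
qed

lemma tvar_nil: assumes "is_alg R B" shows "tvar (ring_of B) N \<in> nil (trunc_ring (ring_of B) N)"
proof -
  interpret B: big_cring "ring_of B" by (rule alg_big[OF assms])
  show ?thesis using B.tvar_pow_N B.tvar_closed by (rule nilI[rotated])
qed

lemma series_trunc:
  assumes B: "is_alg R B" and c: "\<And>k. c k \<in> carrier[B]" and k: "k < N"
    and u: "u = series (trunc_ring (ring_of B) N) (\<lambda>k. tconst (ring_of B) N (c k)) (tvar (ring_of B) N)"
  shows "tcoef (ring_of B) N u k = c k"
proof -
  interpret B: big_cring "ring_of B" by (rule alg_big[OF B])
  interpret T: cring "trunc_ring (ring_of B) N" by (rule B.trunc_cring)
  show ?thesis unfolding u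
    using B.tcoef_sum[of N c k] c k B.tvar_closed B.tvar_pow_N ring_hom_closed[OF B.tconst_hom]
    by (subst T.series_eq[of _ N]) auto
qed

text \<open>The element \<open>T\<close> of \<open>B[T]/(T^N)\<close> is one of the admissible
  arguments, and the value there displays all coefficients below \<open>N\<close>.\<close>

lemma series_unique:
  assumes B: "is_alg R B" and c: "\<And>k. c k \<in> carrier[B]"
    and z: "\<And>C f y. alg_hom R B C f \<Longrightarrow> y \<in> carrier[C] \<Longrightarrow> y [^][C] N = \<zero>[C] \<Longrightarrow>
       series (ring_of C) (\<lambda>k. f (c k)) y = \<zero>[C]"
    and k: "k < (N::nat)"
  shows "c k = \<zero>[B]"
proof -
  interpret B: big_cring "ring_of B" by (rule alg_big[OF B])
  interpret T: cring "trunc_ring (ring_of B) N" by (rule B.trunc_cring)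
  let ?S = "\<lambda>c. series (trunc_ring (ring_of B) N) (\<lambda>k. tconst (ring_of B) N (c k)) (tvar (ring_of B) N)"
  have hz: "tconst (ring_of B) N \<zero>[B] = \<zero>\<^bsub>trunc_ring (ring_of B) N\<^esub>"
    using alg_homD(9)[OF tconst_alg_hom[OF B]] by simp
  have "?S c = \<zero>\<^bsub>trunc_ring (ring_of B) N\<^esub>"
    using z[OF tconst_alg_hom[OF B], of "tvar (ring_of B) N"] B.tvar_closed B.tvar_pow_N by simp
  also have "\<dots> = ?S (\<lambda>k. \<zero>[B])"
    using T.series_eq[OF B.tvar_closed B.tvar_pow_N, of "\<lambda>_. \<zero>\<^bsub>trunc_ring (ring_of B) N\<^esub>"] B.tvar_closed
    by (simp add: hz)
  finally have eq: "?S c = ?S (\<lambda>k. \<zero>[B])" .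
  show ?thesis
    using series_trunc[of B c, OF B c k refl] series_trunc[OF B _ k refl, of "\<lambda>_. \<zero>[B]"] eq by simp
qed

lemma series_unique_all:
  assumes B: "is_alg R B" and c: "\<And>k. c k \<in> carrier[B]"
    and z: "\<And>C f y. alg_hom R B C f \<Longrightarrow> y \<in> nil[C] \<Longrightarrow>
       series (ring_of C) (\<lambda>k. f (c k)) y = \<zero>[C]"
  shows "c k = \<zero>[B]"
proof (rule series_unique[OF B c _ lessI])
  fix C f y assume "alg_hom R B C f" "y \<in> carrier[C]" "y [^][C] Suc k = \<zero>[C]"
  thus "series (ring_of C) (\<lambda>k. f (c k)) y = \<zero>[C]" by (intro z nilI)
qed

section \<open>Expansion of an operation in its first argument\<close>

context
  fixes n P assumes P: "natop R (Suc n) P"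
begin

abbreviation (input) "gpt B N xs \<equiv> tvar (ring_of B) N # map (tconst (ring_of B) N) xs"

lemma gpt: "is_alg R B \<Longrightarrow> xs \<in> nilpts B n \<Longrightarrow> gpt B N xs \<in> nilpts (trunc_alg B N) (Suc n)"
  using nilpts_map[OF tconst_alg_hom] tvar_nil by simp

text \<open>The homomorphism sending \<open>T\<close> to \<open>y\<close> carries the generic point
  to \<open>y # map f xs\<close>; by naturality it carries the value of \<open>P\<close>
  along.\<close>

lemma generic_value:
  assumes f: "alg_hom R B C f" and xs: "xs \<in> nilpts B n"
    and y: "y \<in> carrier[C]" "y [^][C] N = \<zero>[C]"
  shows "P C (y # map f xs) =
    series (ring_of C) (\<lambda>k. f (tcoef (ring_of B) N (P (trunc_alg B N) (gpt B N xs)) k)) y"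
proof -
  note fD = alg_homD[OF f]
  let ?T = "trunc_ring (ring_of B) N" and ?u = "P (trunc_alg B N) (gpt B N xs)"
  interpret B: big_cring "ring_of B" by (rule alg_big[OF fD(1)])
  interpret T: cring ?T by (rule B.trunc_cring)
  obtain g where g: "alg_hom R (trunc_alg B N) C g"
     "\<And>r. r \<in> carrier[B] \<Longrightarrow> g (tconst (ring_of B) N r) = f r" "g (tvar (ring_of B) N) = y"
    using trunc_alg_universal[OF f y] by blast
  have u: "?u \<in> carrier ?T" using natop_closed[OF P trunc_is_alg gpt] fD(1) xs by simp
  have mapeq: "map g (gpt B N xs) = y # map f xs"
    using g xs nil_carrier by (auto simp: nilpts_def)
  hence "P C (y # map f xs) = P C (map g (gpt B N xs))" by (simp only:)
  also have "\<dots> = g ?u" by (rule natop_natural[OF P g(1) gpt[OF fD(1) xs]])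
  also have ue: "?u = series ?T (\<lambda>k. tconst (ring_of B) N (tcoef (ring_of B) N ?u k)) (tvar (ring_of B) N)"
    using B.trunc_expand[OF u] B.tcoef_closed[OF u] ring_hom_closed[OF B.tconst_hom]
    by (subst T.series_eq[OF B.tvar_closed B.tvar_pow_N]) auto
  also have "g \<dots> = series (ring_of C) (\<lambda>k. g (tconst (ring_of B) N (tcoef (ring_of B) N ?u k))) (g (tvar (ring_of B) N))"
    using alg_homD(3,4,5)[OF g(1)] tvar_nil[OF fD(1)] B.tcoef_closed[OF u] ring_hom_closed[OF B.tconst_hom]
    by (intro hom_series) auto
  also have "\<dots> = series (ring_of C) (\<lambda>k. f (tcoef (ring_of B) N ?u k)) y"
    using g B.tcoef_closed[OF u] by simp
  finally show ?thesis .
qed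

text \<open>Since \<open>k < N\<close>, the generic point over \<open>C\<close> truncated at
  \<open>k + 1\<close> is a specialisation of the one over \<open>B\<close> truncated at
  \<open>N\<close>. So the coefficient depends neither on the truncation nor on the ring where it is
  read off.\<close>

lemma tcoef_op_coef:
  assumes B: "is_alg R B" and xs: "xs \<in> nilpts B n" and f: "alg_hom R B C f" and k: "k < N"
  shows "op_coef P k C (map f xs) = f (tcoef (ring_of B) N (P (trunc_alg B N) (gpt B N xs)) k)"
proof -
  note fD = alg_homD[OF f]
  interpret B: big_cring "ring_of B" by (rule alg_big[OF B])
  interpret C: big_cring "ring_of C" by (rule alg_big[OF fD(2)])
  let ?u = "P (trunc_alg B N) (gpt B N xs)"
  let ?T = "trunc_ring (ring_of C) (Suc k)"
  interpret T: cring ?T by (rule C.trunc_cring)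
  have u: "?u \<in> carrier (trunc_ring (ring_of B) N)"
    using natop_closed[OF P trunc_is_alg gpt] B xs by simp
  have h: "alg_hom R B (trunc_alg C (Suc k)) (tconst (ring_of C) (Suc k) \<circ> f)"
    using f tconst_alg_hom[OF fD(2)] by (rule alg_hom_comp)
  have 0: "tvar (ring_of C) (Suc k) [^]\<^bsub>?T\<^esub> N = \<zero>\<^bsub>?T\<^esub>"
    using T.pow_zero_mono[OF C.tvar_closed C.tvar_pow_N] k by simp
  have "P (trunc_alg C (Suc k)) (gpt C (Suc k) (map f xs)) =
     series ?T (\<lambda>i. tconst (ring_of C) (Suc k) (f (tcoef (ring_of B) N ?u i))) (tvar (ring_of C) (Suc k))"
    using generic_value[OF h xs _ , of "tvar (ring_of C) (Suc k)" N] 0 C.tvar_closed by simp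
  hence "tcoef (ring_of C) (Suc k) (P (trunc_alg C (Suc k)) (gpt C (Suc k) (map f xs))) k = f (tcoef (ring_of B) N ?u k)"
    using B.tcoef_closed[OF u] fD(7) by (intro series_trunc[OF fD(2)]) auto
  thus ?thesis by (simp add: op_coef_def)
qed

lemma tcoef_op_coef_id:
  assumes B: "is_alg R B" and xs: "xs \<in> nilpts B n" and k: "k < N"
  shows "op_coef P k B xs = tcoef (ring_of B) N (P (trunc_alg B N) (gpt B N xs)) k"
  using tcoef_op_coef[OF B xs alg_hom_id[OF B] k] by simp

lemma op_coef_natop: "natop R n (op_coef P k)"
proof (rule natopI)
  fix B xs assume B: "is_alg R B" and xs: "xs \<in> nilpts B n"
  interpret B: big_cring "ring_of B" by (rule alg_big[OF B])
  have "P (trunc_alg B (Suc k)) (gpt B (Suc k) xs) \<in> carrier (trunc_ring (ring_of B) (Suc k))"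
    using natop_closed[OF P trunc_is_alg gpt] B xs by simp
  thus "op_coef P k B xs \<in> carrier[B]"
    unfolding op_coef_def by (rule B.tcoef_closed)
next
  fix B C f xs assume f: "alg_hom R B C f" and xs: "xs \<in> nilpts B n"
  show "op_coef P k C (map f xs) = f (op_coef P k B xs)"
    using tcoef_op_coef[OF alg_homD(1)[OF f] xs f lessI] tcoef_op_coef_id[OF alg_homD(1)[OF f] xs lessI] by simp
qed

lemma natop_expand:
  assumes B: "is_alg R B" and xs: "xs \<in> nilpts B n" and y: "y \<in> nil[B]"
  shows "P B (y # xs) = series (ring_of B) (\<lambda>k. op_coef P k B xs) y"
proof -
  interpret B: big_cring "ring_of B" by (rule alg_big[OF B])
  obtain N where N: "y \<in> carrier[B]" "y [^][B] (N::nat) = \<zero>[B]" using y by (elim nilE)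
  let ?c = "\<lambda>k. tcoef (ring_of B) N (P (trunc_alg B N) (gpt B N xs)) k"
  have u: "P (trunc_alg B N) (gpt B N xs) \<in> carrier (trunc_ring (ring_of B) N)"
    using natop_closed[OF P trunc_is_alg gpt] B xs by simp
  have "P B (y # xs) = series (ring_of B) ?c y"
    using generic_value[OF alg_hom_id[OF B] xs N] by simp
  also have "\<dots> = (\<Oplus>\<^bsub>ring_of B\<^esub>k\<in>{..<N}. ?c k \<otimes>[B] y [^][B] k)"
    using N B.tcoef_closed[OF u] by (intro B.series_eq)
  also have "\<dots> = (\<Oplus>\<^bsub>ring_of B\<^esub>k\<in>{..<N}. op_coef P k B xs \<otimes>[B] y [^][B] k)"
    using N natop_closed[OF op_coef_natop B xs]
    by (intro B.finsum_cong') (auto simp: tcoef_op_coef_id[OF B xs])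
  also have "\<dots> = series (ring_of B) (\<lambda>k. op_coef P k B xs) y"
    using N natop_closed[OF op_coef_natop B xs] by (intro B.series_eq[symmetric])
  finally show ?thesis .
qed

end

text \<open>Substituting \<open>q\<close>-th powers for the variables is injective on power series:
  it only moves the coefficients to multiples of \<open>q\<close>. The induction treats one variable
  at a time. This lemma later cancels the Frobenius.\<close>

lemma natop_zero_power_test:
  assumes "natop R n P" and q: "0 < (q::nat)"
    and z: "\<And>B xs. is_alg R B \<Longrightarrow> xs \<in> nilpts B n \<Longrightarrow>
          P B (map (\<lambda>x. x [^][B] q) xs) = \<zero>[B]"
    and B: "is_alg R B" and xs: "xs \<in> nilpts B n"
  shows "P B xs = \<zero>[B]"
  using assms(1) z B xs
proof (induction n arbitrary: P B xs)
  case 0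
  thus ?case using "0.prems"(2)[of B "[]"] by simp
next
  case (Suc n)
  note P = Suc.prems(1)
  have c0: "op_coef P k B xs = \<zero>[B]" if B: "is_alg R B" and xs: "xs \<in> nilpts B n" for k B xs
  proof (rule Suc.IH[OF op_coef_natop[OF P]])
    fix B xs assume B: "is_alg R B" and xs: "xs \<in> nilpts B n"
    interpret B: big_cring "ring_of B" by (rule alg_big[OF B])
    let ?xs = "map (\<lambda>x. x [^][B] q) xs"
    have xs': "?xs \<in> nilpts B n" using xs q by (auto simp: nilpts_def intro!: B.pow_nil)
    define c where "c = (\<lambda>k. if q dvd k then op_coef P (k div q) B ?xs else \<zero>[B])"
    \<comment> \<open>\<open>c\<close> is the coefficient sequence of \<open>P\<close> at
      \<open>y^q\<close>, and the wanted coefficient stands at the place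
      \<open>q * k\<close>.\<close>
    have "c (q * k) = \<zero>[B]"
    proof (rule series_unique_all[OF B])
      fix k show "c k \<in> carrier[B]"
        using natop_closed[OF op_coef_natop[OF P] B xs'] by (simp add: c_def)
    next
      fix C f y assume f: "alg_hom R B C f" and y: "y \<in> nil[C]"
      note fD = alg_homD[OF f]
      interpret C: big_cring "ring_of C" by (rule alg_big[OF fD(2)])
      have m: "map f ?xs = map (\<lambda>x. x [^][C] q) (map f xs)"
        using xs nil_carrier by (auto simp: nilpts_def hom_pow_eq[OF fD(4,5,3)])
      have "series (ring_of C) (\<lambda>k. f (c k)) y =
        series (ring_of C) (\<lambda>k. if q dvd k then op_coef P (k div q) C (map f ?xs) else \<zero>[C]) y"
        using natop_natural[OF op_coef_natop[OF P] f xs'] fD(9) by (intro C.series_cong) (auto simp: c_def)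
      also have "\<dots> = series (ring_of C) (\<lambda>k. op_coef P k C (map f ?xs)) (y [^][C] q)"
        using y q natop_closed[OF op_coef_natop[OF P] fD(2) nilpts_map[OF f xs']]
        by (intro C.series_pow_arg[symmetric])
      also have "\<dots> = P C (y [^][C] q # map f ?xs)"
        using natop_expand[OF P fD(2) nilpts_map[OF f xs'] C.pow_nil[OF y q]] by simp
      also have "\<dots> = P C (map (\<lambda>x. x [^][C] q) (y # map f xs))" by (simp only: m list.map)
      also have "\<dots> = \<zero>[C]"
        using Suc.prems(2)[OF fD(2), of "y # map f xs"] y nilpts_map[OF f xs] by simp
      finally show "series (ring_of C) (\<lambda>k. f (c k)) y = \<zero>[C]" .
    qed
    thus "op_coef P k B ?xs = \<zero>[B]" using q by (simp add: c_def)
  qed (use B xs in auto)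
  interpret B: big_cring "ring_of B" by (rule alg_big[OF Suc.prems(3)])
  obtain y ys where y: "xs = y # ys" "y \<in> nil[B]" "ys \<in> nilpts B n"
    using Suc.prems(4) by (elim nilpts_SucE)
  obtain N where N: "y \<in> carrier[B]" "y [^][B] (N::nat) = \<zero>[B]" using y by (elim nilE)
  show ?case
    using N natop_expand[OF P Suc.prems(3) y(3,2)] c0[OF Suc.prems(3) y(3)] y(1)
    by (simp add: B.series_eq[OF N])
qed

end

section \<open>Transfer along an injective base change\<close>

lemma alg_via_simps [simp]: "ring_of (alg_via j B) = ring_of B" "str_map (alg_via j B) = str_map B \<circ> j"
  by (simp_all add: alg_via_def)

lemma alg_via_is_alg: "j \<in> ring_hom V K \<Longrightarrow> is_alg K B \<Longrightarrow> is_alg V (alg_via j B)"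
  by (auto simp: is_alg_def intro: ring_hom_trans)

lemma alg_via_hom: "j \<in> ring_hom V K \<Longrightarrow> alg_hom K B C f \<Longrightarrow> alg_hom V (alg_via j B) (alg_via j C) f"
  using alg_via_is_alg[of j V K] ring_hom_closed[of j V K] by (auto simp: alg_hom_def)

lemma nilpts_alg_via [simp]: "nilpts (alg_via j B) n = nilpts B n"
  by (simp add: nilpts_def)

text \<open>A power series over \<open>V\<close> is zero if its image over \<open>K\<close> is zero,
  because \<open>j\<close> is injective on coefficients. A single \<open>V\<close>-algebra
  \<open>B\<close> may well die over \<open>K\<close>, so the values in \<open>B\<close> cannot be
  compared directly.\<close>

lemma natop_zero_transfer:
  assumes V: "big_cring V" and K: "big_cring K" and j: "j \<in> ring_hom V K" "inj_on j (carrier V)"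
    and "natop V n P"
    and "\<And>B xs. is_alg K B \<Longrightarrow> xs \<in> nilpts B n \<Longrightarrow> P (alg_via j B) xs = \<zero>[B]"
    and B: "is_alg V B" and xs: "xs \<in> nilpts B n"
  shows "P B xs = \<zero>[B]"
proof -
  interpret V: big_cring V by fact
  interpret K: big_cring K by fact
  show ?thesis
    using assms(5-8)
  proof (induction n arbitrary: P B xs)
    \<comment> \<open>An operation without variables is one element of \<open>V\<close>, mapped to
      each algebra.\<close>
    case 0
    define v where "v = P (V, \<lambda>a. a) []"
    have v: "v \<in> carrier V"
      using natop_closed[OF "0.prems"(1) base_alg[OF V.is_cring], of "[]"] by (simp add: v_def)
    have val: "P B [] = str_map B v" if "is_alg V B" for B
      using natop_natural[OF "0.prems"(1) str_alg_hom[OF V.is_cring that], of "[]"] by (simp add: v_def)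
    have "j v = \<zero>\<^bsub>K\<^esub>"
      using "0.prems"(2)[OF base_alg[OF K.is_cring], of "[]"] val[OF alg_via_is_alg[OF j(1) base_alg[OF K.is_cring]]]
      by simp
    hence "v = \<zero>\<^bsub>V\<^esub>"
      using j v ring_hom_zero[OF j(1) V.ring_axioms K.ring_axioms] by (metis V.zero_closed inj_onD)
    thus ?case using 0 val alg_homD(9)[OF str_alg_hom[OF V.is_cring "0.prems"(3)]] by simp
  next
    case (Suc n)
    note P = Suc.prems(1)
    have c0: "op_coef P k B xs = \<zero>[B]" if B: "is_alg V B" and xs: "xs \<in> nilpts B n" for k B xs
    proof (rule Suc.IH[OF V.op_coef_natop[OF P]])
      fix B xs assume B: "is_alg K B" and xs: "xs \<in> nilpts B n"
      show "op_coef P k (alg_via j B) xs = \<zero>[B]"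
      proof (rule K.series_unique_all[OF B, where c = "\<lambda>k. op_coef P k (alg_via j B) xs"])
        fix k show "op_coef P k (alg_via j B) xs \<in> carrier[B]"
          using natop_closed[OF V.op_coef_natop[OF P] alg_via_is_alg[OF j(1) B]] xs by simp
      next
        fix C f y assume f: "alg_hom K B C f" and y: "y \<in> nil[C]"
        note fD = alg_homD[OF f]
        have "series (ring_of C) (\<lambda>k. f (op_coef P k (alg_via j B) xs)) y =
           series (ring_of C) (\<lambda>k. op_coef P k (alg_via j C) (map f xs)) y"
          using natop_natural[OF V.op_coef_natop[OF P] alg_via_hom[OF j(1) f]] xs by simp
        also have "\<dots> = P (alg_via j C) (y # map f xs)"
          using V.natop_expand[OF P alg_via_is_alg[OF j(1) fD(2)], of "map f xs" y] y nilpts_map[OF f xs] by simp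
        also have "\<dots> = \<zero>[C]" using Suc.prems(2)[OF fD(2)] y nilpts_map[OF f xs] by simp
        finally show "series (ring_of C) (\<lambda>k. f (op_coef P k (alg_via j B) xs)) y = \<zero>[C]" .
      qed
    qed (use B xs in auto)
    interpret B: big_cring "ring_of B" by (rule V.alg_big[OF Suc.prems(3)])
    obtain y ys where y: "xs = y # ys" "y \<in> nil[B]" "ys \<in> nilpts B n"
      using Suc.prems(4) by (elim nilpts_SucE)
    obtain N where N: "y \<in> carrier[B]" "y [^][B] (N::nat) = \<zero>[B]" using y by (elim nilE)
    show ?case
      using N V.natop_expand[OF P Suc.prems(3) y(3,2)] c0[OF Suc.prems(3) y(3)] y(1)
      by (simp add: B.series_eq[OF N])
  qed
qed

section \<open>Faithfully flat descent\<close>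

lemma (in cring) prime_over_proper_ideal:
  assumes I: "ideal I R" and one: "\<one> \<notin> I"
  obtains P where "primeideal P R" "I \<subseteq> P"
proof -
  define S where "S = {J. ideal J R \<and> I \<subseteq> J \<and> \<one> \<notin> J}"
  have "\<exists>M\<in>S. \<forall>X\<in>S. M \<subseteq> X \<longrightarrow> X = M"
  proof (rule subset_Zorn)
    fix C assume C: "subset.chain S C"
    show "\<exists>U\<in>S. \<forall>X\<in>C. X \<subseteq> U"
    proof (cases "C = {}")
      case True
      thus ?thesis using I one by (auto simp: S_def)
    next
      case False
      have "subset.chain {I. ideal I R} C" using C by (auto simp: pred_on.chain_def S_def)
      hence "ideal (\<Union>C) R" using chain_Union_is_ideal[of C] False by simp
      hence "\<Union>C \<in> S" using C False by (auto simp: pred_on.chain_def S_def)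
      thus ?thesis by blast
    qed
  qed
  then obtain M where M: "M \<in> S" "\<And>X. X \<in> S \<Longrightarrow> M \<subseteq> X \<Longrightarrow> X = M" by blast
  have "maximalideal M R"
  proof (rule maximalidealI)
    fix J assume J: "ideal J R" "M \<subseteq> J" "J \<subseteq> carrier R"
    show "J = M \<or> J = carrier R"
    proof (cases "\<one> \<in> J")
      case True thus ?thesis using ideal.one_imp_carrier[OF J(1)] by simp
    next
      case False thus ?thesis using M J by (auto simp: S_def)
    qed
  qed (use M in \<open>auto simp: S_def\<close>)
  thus thesis using that M(1) maximalideal_prime by (auto simp: S_def)
qed

lemma restrict_scalars_simps [simp]:
  "carrier (restrict_scalars S f) = carrier S" "\<zero>\<^bsub>restrict_scalars S f\<^esub> = \<zero>\<^bsub>S\<^esub>"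
  "ring.add (restrict_scalars S f) = ring.add S" "r \<odot>\<^bsub>restrict_scalars S f\<^esub> s = f r \<otimes>\<^bsub>S\<^esub> s"
  by (simp_all add: restrict_scalars_def)

lemma restrict_scalars_module:
  assumes "cring R" "cring S" "f \<in> ring_hom R S" shows "module R (restrict_scalars S f)"
proof -
  interpret S: cring S by fact
  interpret f: ring_hom_cring R S f using assms by (simp add: ring_hom_cring_def ring_hom_cring_axioms_def)
  show ?thesis
  proof (rule moduleI[OF assms(1)])
    show "abelian_group (restrict_scalars S f)"
      by (rule abelian_groupI) (auto simp: S.a_ac intro: bexI[of _ "\<ominus>\<^bsub>S\<^esub> _"] S.l_neg)
  qed (auto simp: S.l_distr S.r_distr S.m_assoc)
qed

lemma restrict_scalars_uminus:
  assumes "cring R" "cring S" "f \<in> ring_hom R S" "x \<in> carrier S"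
  shows "\<ominus>\<^bsub>restrict_scalars S f\<^esub> x = \<ominus>\<^bsub>S\<^esub> x"
proof -
  interpret S: cring S by fact
  interpret M: module R "restrict_scalars S f" by (rule restrict_scalars_module[OF assms(1-3)])
  show ?thesis using M.minus_equality[of "\<ominus>\<^bsub>S\<^esub> x" x] assms(4) by (simp add: S.l_neg)
qed

text \<open>A quotient module, realised on the values of a map whose fibres are the cosets.\<close>

definition image_module :: "('x \<Rightarrow> 'u) \<Rightarrow> ('r, 'x, 'm) module_scheme \<Rightarrow> ('r, 'u) module" where
  "image_module \<rho> N = \<lparr>carrier = \<rho> ` carrier N, monoid.mult = undefined, one = undefined,
     ring.zero = \<rho> \<zero>\<^bsub>N\<^esub>,
     ring.add = (\<lambda>x y. \<rho> (inv_into (carrier N) \<rho> x \<oplus>\<^bsub>N\<^esub> inv_into (carrier N) \<rho> y)),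
     smult = (\<lambda>r x. \<rho> (r \<odot>\<^bsub>N\<^esub> inv_into (carrier N) \<rho> x))\<rparr>"

lemma quotient_module:
  assumes N: "module R N" and S: "submodule S R N"
    and \<rho>: "\<forall>x\<in>carrier N. \<forall>y\<in>carrier N. \<rho> x = \<rho> y \<longleftrightarrow> x \<ominus>\<^bsub>N\<^esub> y \<in> S"
  shows "module R (image_module \<rho> N)"
    and "\<And>x. x \<in> carrier N \<Longrightarrow> \<rho> x \<in> carrier (image_module \<rho> N)"
    and "\<And>x y. x \<in> carrier N \<Longrightarrow> y \<in> carrier N \<Longrightarrow> \<rho> (x \<oplus>\<^bsub>N\<^esub> y) = \<rho> x \<oplus>\<^bsub>image_module \<rho> N\<^esub> \<rho> y"
    and "\<And>r x. r \<in> carrier R \<Longrightarrow> x \<in> carrier N \<Longrightarrow> \<rho> (r \<odot>\<^bsub>N\<^esub> x) = r \<odot>\<^bsub>image_module \<rho> N\<^esub> \<rho> x"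
    and "\<rho> \<zero>\<^bsub>N\<^esub> = \<zero>\<^bsub>image_module \<rho> N\<^esub>"
proof -
  interpret N: module R N by fact
  note SE = N.submoduleE[OF S]
  let ?M = "image_module \<rho> N" and ?p = "inv_into (carrier N) \<rho>"
  have p: "?p (\<rho> x) \<in> carrier N" "?p (\<rho> x) \<ominus>\<^bsub>N\<^esub> x \<in> S" if "x \<in> carrier N" for x
  proof -
    show 1: "?p (\<rho> x) \<in> carrier N" using that by (auto intro: inv_into_into)
    have "\<rho> (?p (\<rho> x)) = \<rho> x" using that by (auto intro: f_inv_into_f)
    thus "?p (\<rho> x) \<ominus>\<^bsub>N\<^esub> x \<in> S" using \<rho> 1 that by blast
  qed
  show add: "\<rho> (x \<oplus>\<^bsub>N\<^esub> y) = \<rho> x \<oplus>\<^bsub>?M\<^esub> \<rho> y" if xy: "x \<in> carrier N" "y \<in> carrier N" for x y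
  proof -
    have "(?p (\<rho> x) \<oplus>\<^bsub>N\<^esub> ?p (\<rho> y)) \<ominus>\<^bsub>N\<^esub> (x \<oplus>\<^bsub>N\<^esub> y) = (?p (\<rho> x) \<ominus>\<^bsub>N\<^esub> x) \<oplus>\<^bsub>N\<^esub> (?p (\<rho> y) \<ominus>\<^bsub>N\<^esub> y)"
      using p(1)[OF xy(1)] p(1)[OF xy(2)] xy by (simp add: a_minus_def N.minus_add N.a_ac)
    also have "\<dots> \<in> S" by (intro SE(5) p(2) xy)
    finally have "\<rho> (?p (\<rho> x) \<oplus>\<^bsub>N\<^esub> ?p (\<rho> y)) = \<rho> (x \<oplus>\<^bsub>N\<^esub> y)"
      using p xy \<rho> by simp
    thus ?thesis by (simp add: image_module_def)
  qed
  show smult: "\<rho> (r \<odot>\<^bsub>N\<^esub> x) = r \<odot>\<^bsub>?M\<^esub> \<rho> x" if rx: "r \<in> carrier R" "x \<in> carrier N" for r x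
  proof -
    have "(r \<odot>\<^bsub>N\<^esub> ?p (\<rho> x)) \<ominus>\<^bsub>N\<^esub> (r \<odot>\<^bsub>N\<^esub> x) = r \<odot>\<^bsub>N\<^esub> (?p (\<rho> x) \<ominus>\<^bsub>N\<^esub> x)"
      using p[OF rx(2)] rx by (simp add: a_minus_def N.smult_r_distr N.smult_r_minus)
    also have "\<dots> \<in> S" by (intro SE(4) p(2) rx)
    finally have "\<rho> (r \<odot>\<^bsub>N\<^esub> ?p (\<rho> x)) = \<rho> (r \<odot>\<^bsub>N\<^esub> x)" using p rx \<rho> by simp
    thus ?thesis by (simp add: image_module_def)
  qed
  show zero: "\<rho> \<zero>\<^bsub>N\<^esub> = \<zero>\<^bsub>?M\<^esub>" by (simp add: image_module_def)
  show cl: "\<rho> x \<in> carrier ?M" if "x \<in> carrier N" for x using that by (simp add: image_module_def)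
  have ex: "\<exists>x\<in>carrier N. u = \<rho> x" if "u \<in> carrier ?M" for u using that by (auto simp: image_module_def)
  show "module R ?M"
  proof (rule moduleI[OF N.is_cring])
    show "abelian_group ?M"
    proof (rule abelian_groupI)
      fix u v w assume "u \<in> carrier ?M" "v \<in> carrier ?M" "w \<in> carrier ?M"
      then obtain x y z where "x \<in> carrier N" "y \<in> carrier N" "z \<in> carrier N" "u = \<rho> x" "v = \<rho> y" "w = \<rho> z"
        using ex by metis
      thus "u \<oplus>\<^bsub>?M\<^esub> v \<oplus>\<^bsub>?M\<^esub> w = u \<oplus>\<^bsub>?M\<^esub> (v \<oplus>\<^bsub>?M\<^esub> w)"
        by (simp add: add[symmetric] N.a_assoc)
    next
      fix u v assume "u \<in> carrier ?M" "v \<in> carrier ?M"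
      then obtain x y where "x \<in> carrier N" "y \<in> carrier N" "u = \<rho> x" "v = \<rho> y" using ex by metis
      thus "u \<oplus>\<^bsub>?M\<^esub> v = v \<oplus>\<^bsub>?M\<^esub> u" "u \<oplus>\<^bsub>?M\<^esub> v \<in> carrier ?M"
        by (simp_all add: add[symmetric] N.a_comm cl)
    next
      fix u assume "u \<in> carrier ?M"
      then obtain x where x: "x \<in> carrier N" "u = \<rho> x" using ex by metis
      thus "\<zero>\<^bsub>?M\<^esub> \<oplus>\<^bsub>?M\<^esub> u = u" by (simp add: zero[symmetric] add[symmetric])
      show "\<exists>y\<in>carrier ?M. y \<oplus>\<^bsub>?M\<^esub> u = \<zero>\<^bsub>?M\<^esub>"
        using x by (intro bexI[of _ "\<rho> (\<ominus>\<^bsub>N\<^esub> x)"])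
          (simp_all add: zero[symmetric] add[symmetric] cl N.l_neg)
    qed (simp add: zero[symmetric] cl)
  next
    fix a u assume "a \<in> carrier R" "u \<in> carrier ?M"
    then obtain x where x: "a \<in> carrier R" "x \<in> carrier N" "u = \<rho> x" using ex by metis
    thus "a \<odot>\<^bsub>?M\<^esub> u \<in> carrier ?M" by (simp add: smult[symmetric] cl)
  next
    fix a b u assume "a \<in> carrier R" "b \<in> carrier R" "u \<in> carrier ?M"
    then obtain x where "a \<in> carrier R" "b \<in> carrier R" "x \<in> carrier N" "u = \<rho> x" using ex by metis
    thus "(a \<oplus>\<^bsub>R\<^esub> b) \<odot>\<^bsub>?M\<^esub> u = a \<odot>\<^bsub>?M\<^esub> u \<oplus>\<^bsub>?M\<^esub> b \<odot>\<^bsub>?M\<^esub> u"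
      "(a \<otimes>\<^bsub>R\<^esub> b) \<odot>\<^bsub>?M\<^esub> u = a \<odot>\<^bsub>?M\<^esub> (b \<odot>\<^bsub>?M\<^esub> u)"
      by (simp_all add: smult[symmetric] add[symmetric] N.smult_l_distr N.smult_assoc1)
  next
    fix a u v assume "a \<in> carrier R" "u \<in> carrier ?M" "v \<in> carrier ?M"
    then obtain x y where "a \<in> carrier R" "x \<in> carrier N" "y \<in> carrier N" "u = \<rho> x" "v = \<rho> y" using ex by metis
    thus "a \<odot>\<^bsub>?M\<^esub> (u \<oplus>\<^bsub>?M\<^esub> v) = a \<odot>\<^bsub>?M\<^esub> u \<oplus>\<^bsub>?M\<^esub> a \<odot>\<^bsub>?M\<^esub> v"
      by (simp add: smult[symmetric] add[symmetric] N.smult_r_distr)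
  next
    fix u assume "u \<in> carrier ?M"
    then obtain x where "x \<in> carrier N" "u = \<rho> x" using ex by metis
    thus "\<one>\<^bsub>R\<^esub> \<odot>\<^bsub>?M\<^esub> u = u" by (simp add: smult[symmetric])
  qed
qed

text \<open>A representative of each coset is chosen and then coded by \<open>h\<close>. So the
  quotient of a module with elements of any type can be placed in \<open>'u\<close> once the module
  injects into \<open>'u\<close>.\<close>

lemma quotient_code_exists:
  fixes N :: "('r, 'x, 'm) module_scheme" and h :: "'x \<Rightarrow> 'u"
  assumes N: "module R N" and S: "submodule S R N" and h: "inj_on h (carrier N)"
  shows "\<exists>\<rho> :: 'x \<Rightarrow> 'u. \<forall>x\<in>carrier N. \<forall>y\<in>carrier N. \<rho> x = \<rho> y \<longleftrightarrow> x \<ominus>\<^bsub>N\<^esub> y \<in> S"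
proof -
  interpret N: module R N by fact
  note SE = N.submoduleE[OF S]
  define c where "c x = (SOME z. z \<in> carrier N \<and> x \<ominus>\<^bsub>N\<^esub> z \<in> S)" for x
  have z0: "\<zero>\<^bsub>N\<^esub> \<in> S" using subgroup.one_closed[OF submodule.axioms(1)[OF S]] by simp
  have sym: "y \<ominus>\<^bsub>N\<^esub> x \<in> S" if "x \<ominus>\<^bsub>N\<^esub> y \<in> S" "x \<in> carrier N" "y \<in> carrier N" for x y
    using SE(3)[OF that(1)] that by (simp add: a_minus_def N.minus_add N.a_comm)
  have tr: "x \<ominus>\<^bsub>N\<^esub> z \<in> S" if "x \<ominus>\<^bsub>N\<^esub> y \<in> S" "y \<ominus>\<^bsub>N\<^esub> z \<in> S" "x \<in> carrier N" "y \<in> carrier N" "z \<in> carrier N" for x y z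
  proof -
    have "(x \<ominus>\<^bsub>N\<^esub> y) \<oplus>\<^bsub>N\<^esub> (y \<ominus>\<^bsub>N\<^esub> z) = x \<ominus>\<^bsub>N\<^esub> z"
      using that by (simp add: a_minus_def N.a_assoc N.r_neg1)
    thus ?thesis using SE(5)[OF that(1,2)] by simp
  qed
  have c: "c x \<in> carrier N \<and> x \<ominus>\<^bsub>N\<^esub> c x \<in> S" if "x \<in> carrier N" for x
    unfolding c_def by (rule someI[of _ x]) (use that z0 in \<open>simp add: a_minus_def N.r_neg\<close>)
  have "h (c x) = h (c y) \<longleftrightarrow> x \<ominus>\<^bsub>N\<^esub> y \<in> S" if xy: "x \<in> carrier N" "y \<in> carrier N" for x y
  proof
    assume "h (c x) = h (c y)"
    hence "c x = c y" using h c xy by (meson inj_onD)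
    thus "x \<ominus>\<^bsub>N\<^esub> y \<in> S" using tr[of x "c x" y] sym[of y "c y"] c[OF xy(1)] c[OF xy(2)] xy by metis
  next
    assume s: "x \<ominus>\<^bsub>N\<^esub> y \<in> S"
    have "(z \<in> carrier N \<and> x \<ominus>\<^bsub>N\<^esub> z \<in> S) = (z \<in> carrier N \<and> y \<ominus>\<^bsub>N\<^esub> z \<in> S)" for z
      using tr[of x y z] tr[of y x z] sym[OF s xy] s xy by blast
    hence "c x = c y" by (simp add: c_def)
    thus "h (c x) = h (c y)" by simp
  qed
  thus ?thesis by (intro exI[of _ "h \<circ> c"]) simp
qed

lemma bilinear_mapD:
  assumes "bilinear_map R M N L b"
  shows "\<And>x y. x \<in> carrier M \<Longrightarrow> y \<in> carrier N \<Longrightarrow> b x y \<in> carrier L"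
    "\<And>x x' y. x \<in> carrier M \<Longrightarrow> x' \<in> carrier M \<Longrightarrow> y \<in> carrier N \<Longrightarrow> b (x \<oplus>\<^bsub>M\<^esub> x') y = b x y \<oplus>\<^bsub>L\<^esub> b x' y"
    "\<And>x y y'. x \<in> carrier M \<Longrightarrow> y \<in> carrier N \<Longrightarrow> y' \<in> carrier N \<Longrightarrow> b x (y \<oplus>\<^bsub>N\<^esub> y') = b x y \<oplus>\<^bsub>L\<^esub> b x y'"
    "\<And>r x y. r \<in> carrier R \<Longrightarrow> x \<in> carrier M \<Longrightarrow> y \<in> carrier N \<Longrightarrow> b (r \<odot>\<^bsub>M\<^esub> x) y = r \<odot>\<^bsub>L\<^esub> b x y"
    "\<And>r x y. r \<in> carrier R \<Longrightarrow> x \<in> carrier M \<Longrightarrow> y \<in> carrier N \<Longrightarrow> b x (r \<odot>\<^bsub>N\<^esub> y) = r \<odot>\<^bsub>L\<^esub> b x y"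
  using assms unfolding bilinear_map_def by blast+

lemma bilinear_mapI:
  assumes "\<And>x y. x \<in> carrier M \<Longrightarrow> y \<in> carrier N \<Longrightarrow> b x y \<in> carrier L"
    "\<And>x x' y. x \<in> carrier M \<Longrightarrow> x' \<in> carrier M \<Longrightarrow> y \<in> carrier N \<Longrightarrow> b (x \<oplus>\<^bsub>M\<^esub> x') y = b x y \<oplus>\<^bsub>L\<^esub> b x' y"
    "\<And>x y y'. x \<in> carrier M \<Longrightarrow> y \<in> carrier N \<Longrightarrow> y' \<in> carrier N \<Longrightarrow> b x (y \<oplus>\<^bsub>N\<^esub> y') = b x y \<oplus>\<^bsub>L\<^esub> b x y'"
    "\<And>r x y. r \<in> carrier R \<Longrightarrow> x \<in> carrier M \<Longrightarrow> y \<in> carrier N \<Longrightarrow> b (r \<odot>\<^bsub>M\<^esub> x) y = r \<odot>\<^bsub>L\<^esub> b x y"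
    "\<And>r x y. r \<in> carrier R \<Longrightarrow> x \<in> carrier M \<Longrightarrow> y \<in> carrier N \<Longrightarrow> b x (r \<odot>\<^bsub>N\<^esub> y) = r \<odot>\<^bsub>L\<^esub> b x y"
  shows "bilinear_map R M N L b"
  using assms unfolding bilinear_map_def by blast

lemma tensor_zero_one:
  "tensor_zero R M N 1 m n \<longleftrightarrow>
    (\<forall>(L :: ('u, 'u) module) b. module R L \<and> bilinear_map R M N L b \<longrightarrow> b (m 0) (n 0) = \<zero>\<^bsub>L\<^esub>)"
  if "m 0 \<in> carrier M" "n 0 \<in> carrier N" for M N :: "('u, 'u) module"
proof -
  have key: "(\<Oplus>\<^bsub>L\<^esub>i\<in>{..<1::nat}. b (m i) (n i)) = b (m 0) (n 0)"
    if L: "module R L" "bilinear_map R M N L b" for L :: "('u, 'u) module" and b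
  proof -
    interpret L: module R L by fact
    have "b (m 0) (n 0) \<in> carrier L" using bilinear_mapD(1)[OF L(2)] \<open>m 0 \<in> _\<close> \<open>n 0 \<in> _\<close> by blast
    moreover have "{..<1::nat} = {0}" by auto
    ultimately show ?thesis by simp
  qed
  show ?thesis unfolding tensor_zero_def
    by (intro iff_allI imp_cong refl, elim conjE, simp only: key)
qed

text \<open>The hypothesis says that \<open>m\<close> tensor 1 vanishes over every member of the
  covering. If \<open>m\<close> were not zero, its annihilator would lie in a prime, which comes
  from a prime \<open>Q\<close> of some member \<open>C\<close>; by flatness \<open>m\<close> tensor
  1 is zero already for the submodule generated by \<open>m\<close>, but that submodule tensored
  with \<open>C\<close> maps to the nonzero ring \<open>C/Q\<close>, sending \<open>m\<close> tensor
  1 to 1.\<close>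

lemma faithfully_flat_zero:
  fixes M :: "('u, 'u) module"
  assumes U: "fppf_cover A B \<U>" and B: "is_alg A B"
    and M: "module (ring_of B) M" and m: "m \<in> carrier M"
    and z: "\<And>C f L b. (C, f) \<in> \<U> \<Longrightarrow> module (ring_of B) L \<Longrightarrow>
       bilinear_map (ring_of B) M (restrict_scalars (ring_of C) f) L b \<Longrightarrow> b m \<one>[C] = \<zero>\<^bsub>L\<^esub>"
  shows "m = \<zero>\<^bsub>M\<^esub>"
proof (rule ccontr)
  assume m0: "m \<noteq> \<zero>\<^bsub>M\<^esub>"
  let ?R = "ring_of B"
  interpret M: module ?R M by fact
  define I where "I = {r \<in> carrier ?R. r \<odot>\<^bsub>M\<^esub> m = \<zero>\<^bsub>M\<^esub>}"
  have I: "ideal I ?R"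
  proof (rule idealI[OF M.R.ring_axioms])
    show "subgroup I (add_monoid ?R)"
      by (rule M.R.add.subgroupI)
        (use m in \<open>auto simp: I_def M.smult_l_distr M.smult_l_minus intro: exI[of _ "\<zero>\<^bsub>?R\<^esub>"]\<close>)
    fix a x assume ax: "a \<in> I" "x \<in> carrier ?R"
    thus "x \<otimes>\<^bsub>?R\<^esub> a \<in> I" using m by (simp add: I_def M.smult_assoc1)
    thus "a \<otimes>\<^bsub>?R\<^esub> x \<in> I" using ax by (simp add: I_def M.m_comm)
  qed
  have "\<one>\<^bsub>?R\<^esub> \<notin> I" using m m0 by (simp add: I_def)
  then obtain P where P: "primeideal P ?R" "I \<subseteq> P"
    using M.prime_over_proper_ideal[OF I] by blast
  obtain C f Q where C: "(C, f) \<in> \<U>" and Q: "primeideal Q (ring_of C)" "P = {b \<in> carrier ?R. f b \<in> Q}"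
    using U P(1) unfolding fppf_cover_def by blast
  have f: "alg_hom A B C f" "flat_hom ?R (ring_of C) f"
    using U C unfolding fppf_cover_def by blast+
  note fD = alg_homD[OF f(1)]
  let ?S = "ring_of C"
  let ?N = "restrict_scalars ?S f"
  interpret S: cring ?S by (rule fD)
  interpret Q: primeideal Q ?S by fact
  have Nm: "module ?R ?N" by (rule restrict_scalars_module) (use fD in auto)
  interpret N: module ?R ?N by (rule Nm)
  have um: "\<ominus>\<^bsub>?N\<^esub> x = \<ominus>\<^bsub>?S\<^esub> x" if "x \<in> carrier ?S" for x
    by (rule restrict_scalars_uminus[OF fD(4,5,3) that])
  \<comment> \<open>The cyclic submodule generated by \<open>m\<close>; flatness is applied to its
    inclusion into \<open>M\<close>.\<close>
  define H where "H = (\<lambda>r. r \<odot>\<^bsub>M\<^esub> m) ` carrier ?R"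
  have Hsub: "submodule H ?R M"
  proof (rule M.submoduleI)
    show "H \<subseteq> carrier M" using m by (auto simp: H_def)
    show "\<zero>\<^bsub>M\<^esub> \<in> H" using m by (auto simp: H_def intro: image_eqI[of _ _ "\<zero>\<^bsub>?R\<^esub>"])
    show "\<ominus>\<^bsub>M\<^esub> a \<in> H" if "a \<in> H" for a
      using that m by (auto simp: H_def M.smult_l_minus[symmetric])
    show "a \<oplus>\<^bsub>M\<^esub> b \<in> H" if "a \<in> H" "b \<in> H" for a b
      using that m by (auto simp: H_def M.smult_l_distr[symmetric])
    show "a \<odot>\<^bsub>M\<^esub> x \<in> H" if "a \<in> carrier ?R" "x \<in> H" for a x
      using that m by (auto simp: H_def M.smult_assoc1[symmetric])
  qed
  let ?M' = "M\<lparr>carrier := H\<rparr>"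
  have M': "module ?R ?M'" by (rule submodule.submodule_is_module[OF Hsub M])
  have mH: "m \<in> H" using m by (auto simp: H_def intro: image_eqI[of _ _ "\<one>\<^bsub>?R\<^esub>"])
  have HM: "H \<subseteq> carrier M" using m by (auto simp: H_def)
  have inj: "injective_linear ?R ?M' M (\<lambda>x. x)"
    using HM by (auto simp: injective_linear_def inj_on_def)
  have "tensor_zero ?R M ?N 1 ((\<lambda>x. x) \<circ> (\<lambda>_. m)) (\<lambda>_. \<one>\<^bsub>?S\<^esub>)"
    using z[OF C] m by (subst tensor_zero_one) auto
  hence tz: "tensor_zero ?R ?M' ?N 1 (\<lambda>_. m) (\<lambda>_. \<one>\<^bsub>?S\<^esub>)"
    using f(2) M' M inj mH unfolding flat_hom_def by (auto simp: Pi_def)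
  have Qsub: "submodule Q ?R ?N"
  proof (rule N.submoduleI)
    show "a \<odot>\<^bsub>?N\<^esub> x \<in> Q" if "a \<in> carrier ?R" "x \<in> Q" for a x
      using that fD(7) Q.I_l_closed by simp
  qed (use Q.a_subset Q.zero_closed um in auto)
  obtain \<rho> :: "'u \<Rightarrow> 'u" where \<rho>: "\<forall>x\<in>carrier ?N. \<forall>y\<in>carrier ?N. \<rho> x = \<rho> y \<longleftrightarrow> x \<ominus>\<^bsub>?N\<^esub> y \<in> Q"
    using quotient_code_exists[OF Nm Qsub inj_on_id2] by blast
  note L = quotient_module[OF Nm Qsub \<rho>]
  let ?L = "image_module \<rho> ?N"
  interpret L: module ?R ?L by (rule L(1))
  define s where "s x = (SOME r. r \<in> carrier ?R \<and> r \<odot>\<^bsub>M\<^esub> m = x)" for x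
  have s: "s x \<in> carrier ?R" "s x \<odot>\<^bsub>M\<^esub> m = x" if "x \<in> H" for x
  proof -
    have "s x \<in> carrier ?R \<and> s x \<odot>\<^bsub>M\<^esub> m = x"
      unfolding s_def by (rule someI_ex) (use that in \<open>auto simp: H_def\<close>)
    thus "s x \<in> carrier ?R" "s x \<odot>\<^bsub>M\<^esub> m = x" by auto
  qed
  \<comment> \<open>The scalar \<open>s x\<close> is determined modulo the annihilator
    \<open>I\<close>, whose image lies in \<open>Q\<close>. Hence \<open>b\<close> does not depend
    on the choice and sends the pair of \<open>r m\<close> and \<open>c\<close> to the class of
    \<open>f r c\<close>.\<close>
  define b where "b x c = \<rho> (f (s x) \<otimes>\<^bsub>?S\<^esub> c)" for x c
  have b: "b (r \<odot>\<^bsub>M\<^esub> m) c = \<rho> (f r \<otimes>\<^bsub>?S\<^esub> c)" if r: "r \<in> carrier ?R" and c: "c \<in> carrier ?S" for r c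
  proof -
    have H: "r \<odot>\<^bsub>M\<^esub> m \<in> H" using r by (auto simp: H_def)
    have "(s (r \<odot>\<^bsub>M\<^esub> m) \<ominus>\<^bsub>?R\<^esub> r) \<odot>\<^bsub>M\<^esub> m = \<zero>\<^bsub>M\<^esub>"
      using s[OF H] r m by (simp add: a_minus_def M.smult_l_distr M.smult_l_minus M.r_neg)
    hence "s (r \<odot>\<^bsub>M\<^esub> m) \<ominus>\<^bsub>?R\<^esub> r \<in> I" using s[OF H] r by (simp add: I_def)
    hence "f (s (r \<odot>\<^bsub>M\<^esub> m) \<ominus>\<^bsub>?R\<^esub> r) \<in> Q" using P(2) Q(2) by blast
    hence "c \<otimes>\<^bsub>?S\<^esub> f (s (r \<odot>\<^bsub>M\<^esub> m) \<ominus>\<^bsub>?R\<^esub> r) \<in> Q" using Q.I_l_closed c by blast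
    moreover interpret f: ring_hom_cring ?R ?S f
      using fD by (simp add: ring_hom_cring_def ring_hom_cring_axioms_def)
    have "c \<otimes>\<^bsub>?S\<^esub> f (s (r \<odot>\<^bsub>M\<^esub> m) \<ominus>\<^bsub>?R\<^esub> r) = f (s (r \<odot>\<^bsub>M\<^esub> m)) \<otimes>\<^bsub>?S\<^esub> c \<ominus>\<^bsub>?S\<^esub> f r \<otimes>\<^bsub>?S\<^esub> c"
      using s[OF H] r c by (simp add: a_minus_def S.r_distr S.r_minus S.m_comm)
    ultimately have "f (s (r \<odot>\<^bsub>M\<^esub> m)) \<otimes>\<^bsub>?S\<^esub> c \<ominus>\<^bsub>?S\<^esub> f r \<otimes>\<^bsub>?S\<^esub> c \<in> Q" by simp
    thus ?thesis unfolding b_def using s[OF H] r c \<rho> by (simp add: a_minus_def um)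
  qed
  have bil: "bilinear_map ?R ?M' ?N ?L b"
  proof (rule bilinear_mapI)
    fix x y assume "x \<in> carrier ?M'" "y \<in> carrier ?N"
    thus "b x y \<in> carrier ?L" using L(2) s fD(7) by (simp add: b_def)
  next
    fix x x' y assume "x \<in> carrier ?M'" "x' \<in> carrier ?M'" "y \<in> carrier ?N"
    then obtain r r' where "x = r \<odot>\<^bsub>M\<^esub> m" "x' = r' \<odot>\<^bsub>M\<^esub> m" "r \<in> carrier ?R" "r' \<in> carrier ?R" "y \<in> carrier ?S"
      by (auto simp: H_def)
    thus "b (x \<oplus>\<^bsub>?M'\<^esub> x') y = b x y \<oplus>\<^bsub>?L\<^esub> b x' y"
      using m fD(7) L(3)[symmetric]
      by (simp add: M.smult_l_distr[symmetric] b ring_hom_add[OF fD(3)] S.l_distr)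
  next
    fix x y y' assume "x \<in> carrier ?M'" "y \<in> carrier ?N" "y' \<in> carrier ?N"
    then obtain r where "x = r \<odot>\<^bsub>M\<^esub> m" "r \<in> carrier ?R" "y \<in> carrier ?S" "y' \<in> carrier ?S"
      by (auto simp: H_def)
    thus "b x (y \<oplus>\<^bsub>?N\<^esub> y') = b x y \<oplus>\<^bsub>?L\<^esub> b x y'"
      using m fD(7) L(3)[symmetric] by (simp add: b S.r_distr)
  next
    fix r x y assume "r \<in> carrier ?R" "x \<in> carrier ?M'" "y \<in> carrier ?N"
    then obtain t where "x = t \<odot>\<^bsub>M\<^esub> m" "t \<in> carrier ?R" "r \<in> carrier ?R" "y \<in> carrier ?S"
      by (auto simp: H_def)
    thus "b (r \<odot>\<^bsub>?M'\<^esub> x) y = r \<odot>\<^bsub>?L\<^esub> b x y" "b x (r \<odot>\<^bsub>?N\<^esub> y) = r \<odot>\<^bsub>?L\<^esub> b x y"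
      using m fD(7) L(4)[symmetric]
      by (simp_all add: M.smult_assoc1[symmetric] b ring_hom_mult[OF fD(3)] S.m_ac)
  qed
  have "b m \<one>\<^bsub>?S\<^esub> = \<zero>\<^bsub>?L\<^esub>"
    using tz L(1) bil mH by (subst (asm) tensor_zero_one) auto
  hence "\<rho> \<one>\<^bsub>?S\<^esub> = \<rho> \<zero>\<^bsub>?S\<^esub>"
    using b[of "\<one>\<^bsub>?R\<^esub>" "\<one>\<^bsub>?S\<^esub>"] m L(5) ring_hom_one[OF fD(3)] by simp
  hence "\<one>\<^bsub>?S\<^esub> \<in> Q" using \<rho> um by (simp add: a_minus_def)
  thus False using Q.I_notcarr Q.one_imp_carrier by simp
qed

text \<open>Apply \<open>faithfully_flat_zero\<close> to the base ring as a module over itself: a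
  bilinear map lets the scalar \<open>x - y\<close> pass to the side of \<open>C\<close>, where it
  becomes zero.\<close>

lemma cover_injective:
  assumes U: "fppf_cover A B \<U>" and B: "is_alg A B"
    and xy: "x \<in> carrier[B]" "y \<in> carrier[B]"
    and eq: "\<And>C f. (C, f) \<in> \<U> \<Longrightarrow> f x = f y"
  shows "x = y"
proof -
  let ?R = "ring_of B"
  let ?M = "restrict_scalars ?R (\<lambda>b. b)"
  interpret R: cring ?R using B by (rule is_alg_cring)
  have M: "module ?R ?M" by (rule restrict_scalars_module) (auto intro: ring_hom_memI R.is_cring)
  have "x \<ominus>\<^bsub>?R\<^esub> y = \<zero>\<^bsub>?M\<^esub>"
  proof (rule faithfully_flat_zero[OF U B M])
    fix C f L b assume C: "(C, f) \<in> \<U>" and L: "module ?R L"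
      and b: "bilinear_map ?R ?M (restrict_scalars (ring_of C) f) L b"
    have "alg_hom A B C f" using U C unfolding fppf_cover_def by blast
    note fD = alg_homD[OF this]
    interpret L: module ?R L by fact
    interpret f: ring_hom_cring ?R "ring_of C" f
      using fD by (simp add: ring_hom_cring_def ring_hom_cring_axioms_def)
    have fz: "f (x \<ominus>\<^bsub>?R\<^esub> y) = \<zero>[C]" using eq[OF C] xy by (simp add: a_minus_def f.S.r_neg)
    have "b (x \<ominus>\<^bsub>?R\<^esub> y) \<one>[C] = (x \<ominus>\<^bsub>?R\<^esub> y) \<odot>\<^bsub>L\<^esub> b \<one>\<^bsub>?R\<^esub> \<one>[C]"
      using bilinear_mapD(4)[OF b, of "x \<ominus>\<^bsub>?R\<^esub> y" "\<one>\<^bsub>?R\<^esub>" "\<one>[C]"] xy by simp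
    also have "\<dots> = b \<one>\<^bsub>?R\<^esub> (f (x \<ominus>\<^bsub>?R\<^esub> y) \<otimes>[C] \<one>[C])"
      using bilinear_mapD(5)[OF b, of "x \<ominus>\<^bsub>?R\<^esub> y" "\<one>\<^bsub>?R\<^esub>" "\<one>[C]"] xy by simp
    also have "\<dots> = b \<one>\<^bsub>?R\<^esub> (f \<zero>\<^bsub>?R\<^esub> \<otimes>[C] \<one>[C])" by (simp add: fz)
    also have "\<dots> = \<zero>\<^bsub>?R\<^esub> \<odot>\<^bsub>L\<^esub> b \<one>\<^bsub>?R\<^esub> \<one>[C]"
      using bilinear_mapD(5)[OF b, of "\<zero>\<^bsub>?R\<^esub>" "\<one>\<^bsub>?R\<^esub>" "\<one>[C]"] by simp
    also have "\<dots> = \<zero>\<^bsub>L\<^esub>" using bilinear_mapD(1)[OF b, of "\<one>\<^bsub>?R\<^esub>" "\<one>[C]"] by simp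
    finally show "b (x \<ominus>\<^bsub>?R\<^esub> y) \<one>[C] = \<zero>\<^bsub>L\<^esub>" .
  qed (use xy in simp)
  thus ?thesis using xy by simp
qed

text \<open>For a fixed module \<open>L\<close>, an element of the tensor product of \<open>C1\<close> and \<open>C2\<close> is represented by
  its values on all bilinear maps to \<open>L\<close>. These functions form a ring, which is a quotient of the
  tensor product and large enough to detect what happens in \<open>L\<close>.\<close>

locale tensor_values =
  R: cring R + C1: cring C1 + C2: cring C2 + L: module R L
  for R :: "'u ring" and C1 :: "'u ring" and C2 :: "'u ring" and L :: "('u, 'u) module" +
  fixes f1 f2 :: "'u \<Rightarrow> 'u"
  assumes f1: "f1 \<in> ring_hom R C1" and f2: "f2 \<in> ring_hom R C2"
begin

definition "Bil = {\<beta>. bilinear_map R (restrict_scalars C1 f1) (restrict_scalars C2 f2) L \<beta>}"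

primrec ev :: "('u \<Rightarrow> 'u \<Rightarrow> 'u) \<Rightarrow> ('u \<times> 'u) list \<Rightarrow> 'u" where
  "ev \<beta> [] = \<zero>\<^bsub>L\<^esub>"
| "ev \<beta> (p # l) = \<beta> (fst p) (snd p) \<oplus>\<^bsub>L\<^esub> ev \<beta> l"

definition Ev :: "('u \<times> 'u) list \<Rightarrow> ('u \<Rightarrow> 'u \<Rightarrow> 'u) \<Rightarrow> 'u" where
  "Ev l = (\<lambda>\<beta>. if \<beta> \<in> Bil then ev \<beta> l else undefined)"

definition "Ls = {l. set l \<subseteq> carrier C1 \<times> carrier C2}"

definition pmult :: "'u \<times> 'u \<Rightarrow> 'u \<times> 'u \<Rightarrow> 'u \<times> 'u" where
  "pmult p q = (fst p \<otimes>\<^bsub>C1\<^esub> fst q, snd p \<otimes>\<^bsub>C2\<^esub> snd q)"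

primrec lmult :: "('u \<times> 'u) list \<Rightarrow> ('u \<times> 'u) list \<Rightarrow> ('u \<times> 'u) list" where
  "lmult [] l' = []"
| "lmult (p # l) l' = map (pmult p) l' @ lmult l l'"

definition shift :: "('u \<Rightarrow> 'u \<Rightarrow> 'u) \<Rightarrow> 'u \<Rightarrow> 'u \<Rightarrow> 'u \<Rightarrow> 'u \<Rightarrow> 'u" where
  "shift \<beta> x y = (\<lambda>x' y'. \<beta> (x \<otimes>\<^bsub>C1\<^esub> x') (y \<otimes>\<^bsub>C2\<^esub> y'))"

text \<open>If \<open>u\<close> is evaluation at a sum of tensors \<open>x_i\<close>,
  \<open>y_i\<close>, then applying \<open>u\<close> to the bilinear map that sends
  \<open>x\<close>, \<open>y\<close> to \<open>v (shift \<beta> x y)\<close> gives the value of the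
  product tensor at \<open>\<beta>\<close>. This describes multiplication without choosing
  representatives.\<close>

definition D0 :: "(('u \<Rightarrow> 'u \<Rightarrow> 'u) \<Rightarrow> 'u) ring" where
  "D0 = \<lparr>carrier = Ev ` Ls,
     monoid.mult = (\<lambda>u v \<beta>. if \<beta> \<in> Bil then u (\<lambda>x y. v (shift \<beta> x y)) else undefined),
     one = Ev [(\<one>\<^bsub>C1\<^esub>, \<one>\<^bsub>C2\<^esub>)], ring.zero = Ev [],
     ring.add = (\<lambda>u v \<beta>. if \<beta> \<in> Bil then u \<beta> \<oplus>\<^bsub>L\<^esub> v \<beta> else undefined)\<rparr>"

lemma f1_closed: "r \<in> carrier R \<Longrightarrow> f1 r \<in> carrier C1" by (rule ring_hom_closed[OF f1])
lemma f2_closed: "r \<in> carrier R \<Longrightarrow> f2 r \<in> carrier C2" by (rule ring_hom_closed[OF f2])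

lemma BilD:
  assumes "\<beta> \<in> Bil"
  shows "\<And>x y. x \<in> carrier C1 \<Longrightarrow> y \<in> carrier C2 \<Longrightarrow> \<beta> x y \<in> carrier L"
    "\<And>x x' y. x \<in> carrier C1 \<Longrightarrow> x' \<in> carrier C1 \<Longrightarrow> y \<in> carrier C2 \<Longrightarrow> \<beta> (x \<oplus>\<^bsub>C1\<^esub> x') y = \<beta> x y \<oplus>\<^bsub>L\<^esub> \<beta> x' y"
    "\<And>x y y'. x \<in> carrier C1 \<Longrightarrow> y \<in> carrier C2 \<Longrightarrow> y' \<in> carrier C2 \<Longrightarrow> \<beta> x (y \<oplus>\<^bsub>C2\<^esub> y') = \<beta> x y \<oplus>\<^bsub>L\<^esub> \<beta> x y'"
    "\<And>r x y. r \<in> carrier R \<Longrightarrow> x \<in> carrier C1 \<Longrightarrow> y \<in> carrier C2 \<Longrightarrow> \<beta> (f1 r \<otimes>\<^bsub>C1\<^esub> x) y = r \<odot>\<^bsub>L\<^esub> \<beta> x y"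
    "\<And>r x y. r \<in> carrier R \<Longrightarrow> x \<in> carrier C1 \<Longrightarrow> y \<in> carrier C2 \<Longrightarrow> \<beta> x (f2 r \<otimes>\<^bsub>C2\<^esub> y) = r \<odot>\<^bsub>L\<^esub> \<beta> x y"
  using assms bilinear_mapD[of R "restrict_scalars C1 f1" "restrict_scalars C2 f2" L \<beta>]
  by (simp_all add: Bil_def)

lemma BilI:
  assumes "\<And>x y. x \<in> carrier C1 \<Longrightarrow> y \<in> carrier C2 \<Longrightarrow> \<beta> x y \<in> carrier L"
    "\<And>x x' y. x \<in> carrier C1 \<Longrightarrow> x' \<in> carrier C1 \<Longrightarrow> y \<in> carrier C2 \<Longrightarrow> \<beta> (x \<oplus>\<^bsub>C1\<^esub> x') y = \<beta> x y \<oplus>\<^bsub>L\<^esub> \<beta> x' y"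
    "\<And>x y y'. x \<in> carrier C1 \<Longrightarrow> y \<in> carrier C2 \<Longrightarrow> y' \<in> carrier C2 \<Longrightarrow> \<beta> x (y \<oplus>\<^bsub>C2\<^esub> y') = \<beta> x y \<oplus>\<^bsub>L\<^esub> \<beta> x y'"
    "\<And>r x y. r \<in> carrier R \<Longrightarrow> x \<in> carrier C1 \<Longrightarrow> y \<in> carrier C2 \<Longrightarrow> \<beta> (f1 r \<otimes>\<^bsub>C1\<^esub> x) y = r \<odot>\<^bsub>L\<^esub> \<beta> x y"
    "\<And>r x y. r \<in> carrier R \<Longrightarrow> x \<in> carrier C1 \<Longrightarrow> y \<in> carrier C2 \<Longrightarrow> \<beta> x (f2 r \<otimes>\<^bsub>C2\<^esub> y) = r \<odot>\<^bsub>L\<^esub> \<beta> x y"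
  shows "\<beta> \<in> Bil"
  unfolding Bil_def using assms by (auto intro!: bilinear_mapI)

lemma shift_Bil: "\<beta> \<in> Bil \<Longrightarrow> x \<in> carrier C1 \<Longrightarrow> y \<in> carrier C2 \<Longrightarrow> shift \<beta> x y \<in> Bil"
  using C1.m_lcomm[of x "f1 _"] C2.m_lcomm[of y "f2 _"]
  by (intro BilI) (simp_all add: shift_def BilD C1.r_distr C2.r_distr f1_closed f2_closed)

lemma LsE: assumes "p # l \<in> Ls" obtains "fst p \<in> carrier C1" "snd p \<in> carrier C2" "l \<in> Ls"
  using assms by (auto simp: Ls_def)

lemma Ls_simps [simp]: "[] \<in> Ls" "(x, y) # l \<in> Ls \<longleftrightarrow> x \<in> carrier C1 \<and> y \<in> carrier C2 \<and> l \<in> Ls"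
  "l @ l' \<in> Ls \<longleftrightarrow> l \<in> Ls \<and> l' \<in> Ls"
  by (auto simp: Ls_def)

lemma ev_closed: "\<beta> \<in> Bil \<Longrightarrow> l \<in> Ls \<Longrightarrow> ev \<beta> l \<in> carrier L"
  by (induction l) (auto elim!: LsE simp: BilD)

lemma ev_append: "\<beta> \<in> Bil \<Longrightarrow> l \<in> Ls \<Longrightarrow> l' \<in> Ls \<Longrightarrow> ev \<beta> (l @ l') = ev \<beta> l \<oplus>\<^bsub>L\<^esub> ev \<beta> l'"
  by (induction l) (auto elim!: LsE simp: ev_closed BilD L.a_assoc)

lemma pmult_Ls: "fst p \<in> carrier C1 \<Longrightarrow> snd p \<in> carrier C2 \<Longrightarrow> l \<in> Ls \<Longrightarrow> map (pmult p) l \<in> Ls"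
  by (auto simp: Ls_def pmult_def)

lemma lmult_Ls: "l \<in> Ls \<Longrightarrow> l' \<in> Ls \<Longrightarrow> lmult l l' \<in> Ls"
  by (induction l) (auto elim!: LsE simp: pmult_Ls)

lemma ev_pmult: "ev \<beta> (map (pmult (x, y)) l) = ev (shift \<beta> x y) l"
  by (induction l) (auto simp: shift_def pmult_def)

lemma ev_shift_Bil: assumes b: "\<beta> \<in> Bil" and l: "l \<in> Ls" shows "(\<lambda>x y. ev (shift \<beta> x y) l) \<in> Bil"
  using l
proof (induction l)
  case Nil
  show ?case by (rule BilI) auto
next
  case (Cons p l)
  then obtain p: "fst p \<in> carrier C1" "snd p \<in> carrier C2" "l \<in> Ls" by (elim LsE)
  with Cons have IH: "(\<lambda>x y. ev (shift \<beta> x y) l) \<in> Bil" by simp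
  note D = BilD[OF IH]
  show ?case
    by (rule BilI)
      (use p b D in \<open>simp_all add: shift_def BilD C1.l_distr C2.l_distr C1.m_assoc C2.m_assoc f1_closed f2_closed L.a_ac L.smult_r_distr\<close>)
qed

lemma ev_lmult: "\<beta> \<in> Bil \<Longrightarrow> l \<in> Ls \<Longrightarrow> l' \<in> Ls \<Longrightarrow> ev \<beta> (lmult l l') = ev (\<lambda>x y. ev (shift \<beta> x y) l') l"
proof (induction l)
  case (Cons p l)
  then obtain p: "fst p \<in> carrier C1" "snd p \<in> carrier C2" "l \<in> Ls" by (elim LsE)
  thus ?case using Cons by (cases p) (simp add: ev_append pmult_Ls lmult_Ls ev_pmult)
qed simp

lemma Ev_mult: "l \<in> Ls \<Longrightarrow> l' \<in> Ls \<Longrightarrow> Ev l \<otimes>\<^bsub>D0\<^esub> Ev l' = Ev (lmult l l')"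
proof (rule ext)
  fix \<beta> assume l: "l \<in> Ls" "l' \<in> Ls"
  show "(Ev l \<otimes>\<^bsub>D0\<^esub> Ev l') \<beta> = Ev (lmult l l') \<beta>"
  proof (cases "\<beta> \<in> Bil")
    case True
    have *: "ev (\<lambda>x y. Ev l' (shift \<beta> x y)) k = ev (\<lambda>x y. ev (shift \<beta> x y) l') k" if "k \<in> Ls" for k
      using that by (induction k) (auto elim!: LsE simp: Ev_def shift_Bil[OF True])
    have "(\<lambda>x y. Ev l' (shift \<beta> x y)) \<in> Bil"
      using BilD[OF ev_shift_Bil[OF True l(2)]]
      by (intro BilI) (simp_all add: Ev_def shift_Bil[OF True] f1_closed f2_closed)
    thus ?thesis using True l * by (simp add: D0_def Ev_def[of l] Ev_def[of "lmult l l'"] ev_lmult)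
  qed (simp add: D0_def Ev_def)
qed

lemma Ev_add: "l \<in> Ls \<Longrightarrow> l' \<in> Ls \<Longrightarrow> Ev l \<oplus>\<^bsub>D0\<^esub> Ev l' = Ev (l @ l')"
  by (rule ext) (simp add: D0_def Ev_def ev_append)

lemma Ev_eqI: "(\<And>\<beta>. \<beta> \<in> Bil \<Longrightarrow> ev \<beta> l = ev \<beta> l') \<Longrightarrow> Ev l = Ev l'"
  by (rule ext) (simp add: Ev_def)

lemma lmult_append: "lmult (a @ b) c = lmult a c @ lmult b c"
  by (induction a) auto

lemma lmult_map: "fst p \<in> carrier C1 \<Longrightarrow> snd p \<in> carrier C2 \<Longrightarrow> l \<in> Ls \<Longrightarrow> l' \<in> Ls \<Longrightarrow>
    lmult (map (pmult p) l) l' = map (pmult p) (lmult l l')"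
  by (induction l) (auto elim!: LsE simp: pmult_def Ls_def C1.m_assoc C2.m_assoc)

lemma lmult_assoc: "a \<in> Ls \<Longrightarrow> b \<in> Ls \<Longrightarrow> c \<in> Ls \<Longrightarrow> lmult (lmult a b) c = lmult a (lmult b c)"
  by (induction a) (auto elim!: LsE simp: lmult_append lmult_map)

lemma ev_lmult_Cons: "\<beta> \<in> Bil \<Longrightarrow> l \<in> Ls \<Longrightarrow> q # l' \<in> Ls \<Longrightarrow>
    ev \<beta> (lmult l (q # l')) = ev \<beta> (map (pmult q) l) \<oplus>\<^bsub>L\<^esub> ev \<beta> (lmult l l')"
proof (induction l)
  case (Cons p l)
  obtain p: "fst p \<in> carrier C1" "snd p \<in> carrier C2" "l \<in> Ls" using Cons.prems(2) by (elim LsE)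
  obtain q: "fst q \<in> carrier C1" "snd q \<in> carrier C2" "l' \<in> Ls" using Cons.prems(3) by (elim LsE)
  have pq: "pmult p q = pmult q p" using p q by (simp add: pmult_def C1.m_comm C2.m_comm)
  have c: "\<beta> (fst (pmult q p)) (snd (pmult q p)) \<in> carrier L" using p q Cons.prems by (simp add: pmult_def BilD)
  show ?case
    using Cons p q c by (simp add: ev_append pmult_Ls lmult_Ls ev_closed pq L.a_ac)
qed (simp_all add: ev_closed)

lemma ev_lmult_comm: "\<beta> \<in> Bil \<Longrightarrow> l \<in> Ls \<Longrightarrow> l' \<in> Ls \<Longrightarrow> ev \<beta> (lmult l l') = ev \<beta> (lmult l' l)"
proof (induction l)
  case Nil
  show ?case by (induction l') auto
next
  case (Cons p l)
  obtain p: "fst p \<in> carrier C1" "snd p \<in> carrier C2" "l \<in> Ls" using Cons.prems(2) by (elim LsE)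
  show ?case
    using Cons p by (simp add: ev_append pmult_Ls lmult_Ls ev_lmult_Cons)
qed

lemma D0_carrier: "u \<in> carrier D0 \<longleftrightarrow> (\<exists>l\<in>Ls. u = Ev l)"
  by (auto simp: D0_def)

lemma lmult_one: "l \<in> Ls \<Longrightarrow> lmult [(\<one>\<^bsub>C1\<^esub>, \<one>\<^bsub>C2\<^esub>)] l = l"
  by (auto simp: Ls_def pmult_def intro!: map_idI)

lemma D0_one: "\<one>\<^bsub>D0\<^esub> = Ev [(\<one>\<^bsub>C1\<^esub>, \<one>\<^bsub>C2\<^esub>)]" and D0_zero: "\<zero>\<^bsub>D0\<^esub> = Ev []"
  by (simp_all add: D0_def)

lemma ev_neg: "\<beta> \<in> Bil \<Longrightarrow> l \<in> Ls \<Longrightarrow>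
   map (\<lambda>p. (\<ominus>\<^bsub>C1\<^esub> fst p, snd p)) l \<in> Ls \<and>
   ev \<beta> (map (\<lambda>p. (\<ominus>\<^bsub>C1\<^esub> fst p, snd p)) l) \<oplus>\<^bsub>L\<^esub> ev \<beta> l = \<zero>\<^bsub>L\<^esub>"
proof (induction l)
  case (Cons p l)
  obtain p: "fst p \<in> carrier C1" "snd p \<in> carrier C2" "l \<in> Ls" using Cons.prems(2) by (elim LsE)
  let ?n = "map (\<lambda>p. (\<ominus>\<^bsub>C1\<^esub> fst p, snd p)) l"
  have n: "?n \<in> Ls" "ev \<beta> ?n \<oplus>\<^bsub>L\<^esub> ev \<beta> l = \<zero>\<^bsub>L\<^esub>" using Cons p by auto
  have 0: "\<beta> \<zero>\<^bsub>C1\<^esub> (snd p) = \<zero>\<^bsub>L\<^esub>"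
    using BilD(2)[OF Cons.prems(1), of "\<zero>\<^bsub>C1\<^esub>" "\<zero>\<^bsub>C1\<^esub>" "snd p"] BilD(1)[OF Cons.prems(1), of "\<zero>\<^bsub>C1\<^esub>" "snd p"] p
    by (simp add: L.add.l_cancel_one')
  have 1: "\<beta> (\<ominus>\<^bsub>C1\<^esub> fst p) (snd p) \<oplus>\<^bsub>L\<^esub> \<beta> (fst p) (snd p) = \<zero>\<^bsub>L\<^esub>"
    using BilD(2)[OF Cons.prems(1), of "\<ominus>\<^bsub>C1\<^esub> fst p" "fst p" "snd p"] p 0 by (simp add: C1.l_neg)
  have c: "\<beta> (\<ominus>\<^bsub>C1\<^esub> fst p) (snd p) \<in> carrier L" "\<beta> (fst p) (snd p) \<in> carrier L"
    "ev \<beta> ?n \<in> carrier L" "ev \<beta> l \<in> carrier L"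
    using p n Cons.prems BilD(1) ev_closed by auto
  have "(\<beta> (\<ominus>\<^bsub>C1\<^esub> fst p) (snd p) \<oplus>\<^bsub>L\<^esub> ev \<beta> ?n) \<oplus>\<^bsub>L\<^esub> (\<beta> (fst p) (snd p) \<oplus>\<^bsub>L\<^esub> ev \<beta> l)
     = (\<beta> (\<ominus>\<^bsub>C1\<^esub> fst p) (snd p) \<oplus>\<^bsub>L\<^esub> \<beta> (fst p) (snd p)) \<oplus>\<^bsub>L\<^esub> (ev \<beta> ?n \<oplus>\<^bsub>L\<^esub> ev \<beta> l)"
    using c by (simp add: L.a_ac)
  thus ?case using n p c 1 by simp
qed simp

lemma D0_cring: "cring D0"
proof (rule cringI)
  show "abelian_group D0"
  proof (rule abelian_groupI)
    fix u v w assume "u \<in> carrier D0" "v \<in> carrier D0" "w \<in> carrier D0"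
    thus "u \<oplus>\<^bsub>D0\<^esub> v \<oplus>\<^bsub>D0\<^esub> w = u \<oplus>\<^bsub>D0\<^esub> (v \<oplus>\<^bsub>D0\<^esub> w)"
      by (auto simp: D0_carrier Ev_add)
  next
    fix u v assume "u \<in> carrier D0" "v \<in> carrier D0"
    then obtain l l' where l: "l \<in> Ls" "l' \<in> Ls" "u = Ev l" "v = Ev l'" by (auto simp: D0_carrier)
    thus "u \<oplus>\<^bsub>D0\<^esub> v \<in> carrier D0" by (auto simp: D0_carrier Ev_add)
    show "u \<oplus>\<^bsub>D0\<^esub> v = v \<oplus>\<^bsub>D0\<^esub> u" using l by (auto simp: Ev_add ev_append ev_closed L.a_comm intro!: Ev_eqI)
  next
    fix u assume "u \<in> carrier D0"
    then obtain l where l: "l \<in> Ls" "u = Ev l" by (auto simp: D0_carrier)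
    thus "\<zero>\<^bsub>D0\<^esub> \<oplus>\<^bsub>D0\<^esub> u = u" by (simp add: D0_zero Ev_add)
    show "\<exists>y\<in>carrier D0. y \<oplus>\<^bsub>D0\<^esub> u = \<zero>\<^bsub>D0\<^esub>"
    proof (cases "Bil = {}")
      \<comment> \<open>Without bilinear maps all functions \<open>Ev l\<close> coincide.\<close>
      case True
      hence "u \<oplus>\<^bsub>D0\<^esub> u = \<zero>\<^bsub>D0\<^esub>" using l by (auto simp: D0_zero Ev_add intro!: Ev_eqI)
      thus ?thesis using l D0_carrier by blast
    next
      case False
      let ?n = "map (\<lambda>p. (\<ominus>\<^bsub>C1\<^esub> fst p, snd p)) l"
      have n: "?n \<in> Ls" using ev_neg l False by blast
      have "Ev ?n \<oplus>\<^bsub>D0\<^esub> u = \<zero>\<^bsub>D0\<^esub>"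
        using n l ev_neg by (auto simp: Ev_add D0_zero ev_append intro!: Ev_eqI)
      thus ?thesis using n D0_carrier by blast
    qed
  qed (auto simp: D0_carrier D0_zero)
  show "comm_monoid D0"
  proof (rule comm_monoidI)
    fix u v assume "u \<in> carrier D0" "v \<in> carrier D0"
    then obtain l l' where l: "l \<in> Ls" "l' \<in> Ls" "u = Ev l" "v = Ev l'" by (auto simp: D0_carrier)
    thus "u \<otimes>\<^bsub>D0\<^esub> v \<in> carrier D0" by (auto simp: D0_carrier Ev_mult lmult_Ls)
    show "u \<otimes>\<^bsub>D0\<^esub> v = v \<otimes>\<^bsub>D0\<^esub> u" using l ev_lmult_comm by (auto simp: Ev_mult intro!: Ev_eqI)
  next
    fix u v w assume "u \<in> carrier D0" "v \<in> carrier D0" "w \<in> carrier D0"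
    thus "u \<otimes>\<^bsub>D0\<^esub> v \<otimes>\<^bsub>D0\<^esub> w = u \<otimes>\<^bsub>D0\<^esub> (v \<otimes>\<^bsub>D0\<^esub> w)"
      by (auto simp: D0_carrier Ev_mult lmult_Ls lmult_assoc)
  next
    fix u assume "u \<in> carrier D0"
    then obtain l where l: "l \<in> Ls" "u = Ev l" by (auto simp: D0_carrier)
    thus "\<one>\<^bsub>D0\<^esub> \<otimes>\<^bsub>D0\<^esub> u = u" by (simp add: D0_one Ev_mult lmult_one del: lmult.simps)
  qed (auto simp: D0_carrier D0_one)
  fix u v w assume "u \<in> carrier D0" "v \<in> carrier D0" "w \<in> carrier D0"
  thus "(u \<oplus>\<^bsub>D0\<^esub> v) \<otimes>\<^bsub>D0\<^esub> w = u \<otimes>\<^bsub>D0\<^esub> w \<oplus>\<^bsub>D0\<^esub> v \<otimes>\<^bsub>D0\<^esub> w"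
    by (auto simp: D0_carrier Ev_mult Ev_add lmult_Ls lmult_append)
qed

text \<open>\<open>g\<close> and \<open>g'\<close> are the two inclusions into the ring of values,
  moved into \<open>'u\<close>. The last clause says that an equality in this ring is seen by every
  bilinear map to \<open>L\<close>; so a matching condition over test algebras turns into a
  statement about \<open>L\<close>.\<close>

lemma tensor_ring_exists:
  assumes inf: "infinite (UNIV :: 'u set)"
  shows "\<exists>(D :: 'u ring) g g'. cring D \<and> g \<in> ring_hom C1 D \<and> g' \<in> ring_hom C2 D \<and>
     (\<forall>r\<in>carrier R. g (f1 r) = g' (f2 r)) \<and>
     (\<forall>\<beta>\<in>Bil. \<forall>s\<in>carrier C1. \<forall>s'\<in>carrier C2. g s = g' s' \<longrightarrow> \<beta> s \<one>\<^bsub>C2\<^esub> = \<beta> \<one>\<^bsub>C1\<^esub> s')"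
proof -
  \<comment> \<open>An element of \<open>D0\<close> is a function on bilinear maps, not an element
    of \<open>'u\<close>; it is coded by a chosen list of pure tensors that represents it.\<close>
  define h where "h u = list_code (map (\<lambda>p. list_code [fst p, snd p]) (SOME l. l \<in> Ls \<and> Ev l = u))"
    for u :: "('u \<Rightarrow> 'u \<Rightarrow> 'u) \<Rightarrow> 'u"
  have inj: "inj_on h (carrier D0)"
  proof (rule inj_onI)
    fix u v assume uv: "u \<in> carrier D0" "v \<in> carrier D0" "h u = h v"
    let ?l = "\<lambda>u. SOME l. l \<in> Ls \<and> Ev l = u"
    have s: "Ev (?l u) = u" if "u \<in> carrier D0" for u
      using someI_ex[of "\<lambda>l. l \<in> Ls \<and> Ev l = u"] that by (auto simp: D0_carrier)
    have me: "map (\<lambda>p. list_code [fst p, snd p]) (?l u) = map (\<lambda>p. list_code [fst p, snd p]) (?l v)"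
      using uv(3) inj_list_code[OF inf] unfolding h_def by (auto dest: injD)
    have "inj (\<lambda>p :: 'u \<times> 'u. list_code [fst p, snd p])"
      using inj_list_code[OF inf] by (auto simp: inj_def)
    from injD[OF inj_mapI[OF this] me] have "?l u = ?l v" .
    hence "Ev (?l u) = Ev (?l v)" by (rule arg_cong)
    thus "u = v" unfolding s[OF uv(1)] s[OF uv(2)] .
  qed
  interpret D0: cring D0 by (rule D0_cring)
  let ?D = "image_ring h D0"
  have "h \<in> ring_iso D0 ?D" by (rule inj_imp_image_ring_iso[OF inj])
  hence hh: "h \<in> ring_hom D0 ?D" by (simp add: ring_iso_def)
  have "cring (?D\<lparr>ring.zero := h \<zero>\<^bsub>D0\<^esub>\<rparr>)"
    using D0.ring_iso_imp_img_cring[OF inj_imp_image_ring_iso[OF inj]] .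
  hence D: "cring ?D" by (simp add: image_ring_def image_group_def monoid.defs)
  let ?g = "\<lambda>s. Ev [(s, \<one>\<^bsub>C2\<^esub>)]" and ?g' = "\<lambda>s. Ev [(\<one>\<^bsub>C1\<^esub>, s)]"
  have g: "?g \<in> ring_hom C1 D0"
    by (rule ring_hom_memI) (auto simp: D0_carrier D0_one Ev_mult Ev_add pmult_def BilD L.r_zero intro!: Ev_eqI)
  have g': "?g' \<in> ring_hom C2 D0"
    by (rule ring_hom_memI) (auto simp: D0_carrier D0_one Ev_mult Ev_add pmult_def BilD L.r_zero intro!: Ev_eqI)
  have comm: "?g (f1 r) = ?g' (f2 r)" if "r \<in> carrier R" for r
  proof (rule Ev_eqI)
    fix \<beta> assume b: "\<beta> \<in> Bil"
    show "ev \<beta> [(f1 r, \<one>\<^bsub>C2\<^esub>)] = ev \<beta> [(\<one>\<^bsub>C1\<^esub>, f2 r)]"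
      using BilD(4)[OF b that, of "\<one>\<^bsub>C1\<^esub>" "\<one>\<^bsub>C2\<^esub>"] BilD(5)[OF b that, of "\<one>\<^bsub>C1\<^esub>" "\<one>\<^bsub>C2\<^esub>"] that
      by (simp add: f1_closed f2_closed)
  qed
  have det: "\<beta> s \<one>\<^bsub>C2\<^esub> = \<beta> \<one>\<^bsub>C1\<^esub> s'"
    if "\<beta> \<in> Bil" "s \<in> carrier C1" "s' \<in> carrier C2" "h (?g s) = h (?g' s')" for \<beta> s s'
  proof -
    have "?g s = ?g' s'"
      using inj that ring_hom_closed[OF g] ring_hom_closed[OF g'] by (auto dest: inj_onD)
    hence "Ev [(s, \<one>\<^bsub>C2\<^esub>)] \<beta> = Ev [(\<one>\<^bsub>C1\<^esub>, s')] \<beta>" by simp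
    thus ?thesis using that by (simp add: Ev_def BilD)
  qed
  show ?thesis
    by (rule exI[of _ ?D], rule exI[of _ "h \<circ> ?g"], rule exI[of _ "h \<circ> ?g'"])
      (use D ring_hom_trans[OF g hh] ring_hom_trans[OF g' hh] comm det in simp)
qed

end

section \<open>The formal line is an fppf sheaf\<close>

text \<open>A finite covering is treated through the product of its members, regarded as a module
  over the base.\<close>

definition product_module ::
  "'i set \<Rightarrow> ('i \<Rightarrow> 'u ring) \<Rightarrow> ('i \<Rightarrow> 'r \<Rightarrow> 'u) \<Rightarrow> ('r, 'i \<Rightarrow> 'u) module" where
  "product_module I S f = \<lparr>carrier = (\<Pi>\<^sub>E i\<in>I. carrier (S i)),
     monoid.mult = undefined, one = undefined, ring.zero = (\<lambda>i\<in>I. \<zero>\<^bsub>S i\<^esub>),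
     ring.add = (\<lambda>\<phi> \<psi>. \<lambda>i\<in>I. \<phi> i \<oplus>\<^bsub>S i\<^esub> \<psi> i), smult = (\<lambda>r \<phi>. \<lambda>i\<in>I. f i r \<otimes>\<^bsub>S i\<^esub> \<phi> i)\<rparr>"

lemma product_module_simps [simp]:
  "carrier (product_module I S f) = (\<Pi>\<^sub>E i\<in>I. carrier (S i))"
  "\<zero>\<^bsub>product_module I S f\<^esub> = (\<lambda>i\<in>I. \<zero>\<^bsub>S i\<^esub>)"
  "\<phi> \<oplus>\<^bsub>product_module I S f\<^esub> \<psi> = (\<lambda>i\<in>I. \<phi> i \<oplus>\<^bsub>S i\<^esub> \<psi> i)"
  "r \<odot>\<^bsub>product_module I S f\<^esub> \<phi> = (\<lambda>i\<in>I. f i r \<otimes>\<^bsub>S i\<^esub> \<phi> i)"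
  by (simp_all add: product_module_def)

lemma product_module:
  assumes R: "cring R" and S: "\<And>i. i \<in> I \<Longrightarrow> cring (S i)" and f: "\<And>i. i \<in> I \<Longrightarrow> f i \<in> ring_hom R (S i)"
  shows "module R (product_module I S f)"
proof -
  note [simp] = cring.cring_simprules[OF S]
  have [simp]: "f i r \<in> carrier (S i)" if "i \<in> I" "r \<in> carrier R" for i r
    using ring_hom_closed[OF f] that by blast
  show ?thesis
  proof (rule moduleI[OF R])
    show "abelian_group (product_module I S f)"
    proof (rule abelian_groupI)
      fix x assume "x \<in> carrier (product_module I S f)"
      thus "\<exists>y\<in>carrier (product_module I S f). y \<oplus>\<^bsub>product_module I S f\<^esub> x = \<zero>\<^bsub>product_module I S f\<^esub>"
        by (intro bexI[of _ "\<lambda>i\<in>I. \<ominus>\<^bsub>S i\<^esub> x i"]) (auto simp: PiE_iff fun_eq_iff)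
    qed (auto simp: PiE_iff fun_eq_iff extensional_def cring.cring_simprules[OF S])
  qed (auto simp: PiE_iff fun_eq_iff extensional_def ring_hom_add[OF f] ring_hom_mult[OF f] ring_hom_one[OF f]
      cring.cring_simprules[OF S] monoid.r_one[OF ring.is_monoid[OF cring.axioms(1)[OF S]]])
qed

text \<open>An additive map on a finite product is the sum of its restrictions to the factors. Hence
  \<open>F c\<close> and \<open>G d\<close> may be compared factor by factor although
  \<open>c\<close> and \<open>d\<close> differ.\<close>

lemma additive_eq_on_product:
  assumes I: "finite I" and S: "\<And>i. i \<in> I \<Longrightarrow> cring (S i)" and L: "abelian_group L"
    and F: "\<And>x y. x \<in> (\<Pi>\<^sub>E i\<in>I. carrier (S i)) \<Longrightarrow> y \<in> (\<Pi>\<^sub>E i\<in>I. carrier (S i)) \<Longrightarrow>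
       F (\<lambda>i\<in>I. x i \<oplus>\<^bsub>S i\<^esub> y i) = F x \<oplus>\<^bsub>L\<^esub> F y"
    and G: "\<And>x y. x \<in> (\<Pi>\<^sub>E i\<in>I. carrier (S i)) \<Longrightarrow> y \<in> (\<Pi>\<^sub>E i\<in>I. carrier (S i)) \<Longrightarrow>
       G (\<lambda>i\<in>I. x i \<oplus>\<^bsub>S i\<^esub> y i) = G x \<oplus>\<^bsub>L\<^esub> G y"
    and FL: "F \<in> (\<Pi>\<^sub>E i\<in>I. carrier (S i)) \<rightarrow> carrier L" and GL: "G \<in> (\<Pi>\<^sub>E i\<in>I. carrier (S i)) \<rightarrow> carrier L"
    and c: "c \<in> (\<Pi>\<^sub>E i\<in>I. carrier (S i))" and d: "d \<in> (\<Pi>\<^sub>E i\<in>I. carrier (S i))"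
    and eq: "\<And>i. i \<in> I \<Longrightarrow> F (\<lambda>k\<in>I. if k = i then c i else \<zero>\<^bsub>S k\<^esub>) = G (\<lambda>k\<in>I. if k = i then d i else \<zero>\<^bsub>S k\<^esub>)"
  shows "F c = G d"
proof -
  interpret L: abelian_group L by fact
  define cut where "cut J x = (\<lambda>i\<in>I. if i \<in> J then x i else \<zero>\<^bsub>S i\<^esub>)" for J and x :: "'a \<Rightarrow> 'b"
  note [simp] = cring.cring_simprules[OF S]
  have cl: "cut J x \<in> (\<Pi>\<^sub>E i\<in>I. carrier (S i))" if "x \<in> (\<Pi>\<^sub>E i\<in>I. carrier (S i))" for J x
    using that by (auto simp: cut_def PiE_iff)
  have zero: "H (cut {} x) = \<zero>\<^bsub>L\<^esub>"
    if H: "\<And>x y. x \<in> (\<Pi>\<^sub>E i\<in>I. carrier (S i)) \<Longrightarrow> y \<in> (\<Pi>\<^sub>E i\<in>I. carrier (S i)) \<Longrightarrow>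
       H (\<lambda>i\<in>I. x i \<oplus>\<^bsub>S i\<^esub> y i) = H x \<oplus>\<^bsub>L\<^esub> H y"
      and HL: "H \<in> (\<Pi>\<^sub>E i\<in>I. carrier (S i)) \<rightarrow> carrier L" and x: "x \<in> (\<Pi>\<^sub>E i\<in>I. carrier (S i))" for H x
  proof -
    have "(\<lambda>i\<in>I. cut {} x i \<oplus>\<^bsub>S i\<^esub> cut {} x i) = cut {} x" by (auto simp: cut_def fun_eq_iff)
    hence "H (cut {} x) \<oplus>\<^bsub>L\<^esub> H (cut {} x) = H (cut {} x)" using H[OF cl[OF x] cl[OF x], of "{}" "{}"] by simp
    moreover have "H (cut {} x) \<in> carrier L" using HL cl[OF x] by blast
    ultimately show ?thesis by (simp add: L.add.l_cancel_one)
  qed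
  have "F (cut J c) = G (cut J d)" if "J \<subseteq> I" for J
    using finite_subset[OF that I] that
  proof (induction J rule: finite_induct)
    case empty
    show ?case by (rule trans[OF zero[of F c, OF F FL c] zero[of G d, OF G GL d, symmetric]])
  next
    case (insert i J)
    have ins: "cut (insert i J) x = (\<lambda>k\<in>I. cut J x k \<oplus>\<^bsub>S k\<^esub> (\<lambda>k\<in>I. if k = i then x i else \<zero>\<^bsub>S k\<^esub>) k)"
      if "x \<in> (\<Pi>\<^sub>E i\<in>I. carrier (S i))" for x
      using insert that by (auto simp: cut_def fun_eq_iff PiE_iff)
    have e: "(\<lambda>k\<in>I. if k = i then x i else \<zero>\<^bsub>S k\<^esub>) \<in> (\<Pi>\<^sub>E i\<in>I. carrier (S i))"
      if "x \<in> (\<Pi>\<^sub>E i\<in>I. carrier (S i))" for x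
      using insert that by (auto simp: PiE_iff)
    show ?case
      unfolding ins[OF c] ins[OF d] F[OF cl[OF c] e[OF c]] G[OF cl[OF d] e[OF d]]
      using insert eq by simp
  qed
  moreover have "cut I x = x" if "x \<in> (\<Pi>\<^sub>E i\<in>I. carrier (S i))" for x
    using that by (auto simp: cut_def fun_eq_iff PiE_iff extensional_def)
  ultimately show ?thesis using c d by fastforce
qed

text \<open>Exactness of the descent sequence. The family \<open>s\<close> is a point of the product
  of all members; it comes from the base iff its class modulo the diagonal vanishes, and by
  \<open>faithfully_flat_zero\<close> this may be tested after tensoring with one member
  \<open>C\<close>. There the family is split by its own component at \<open>C\<close>.\<close>

lemma cover_glue:
  fixes A :: "'u ring"
  assumes inf: "infinite (UNIV :: 'u set)" and U: "fppf_cover A B \<U>" and B: "is_alg A B"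
    and s: "\<And>i. i \<in> \<U> \<Longrightarrow> s i \<in> carrier (ring_of (fst i))"
    and match: "\<And>C f C' f' D g g'. (C, f) \<in> \<U> \<Longrightarrow> (C', f') \<in> \<U> \<Longrightarrow> alg_hom A C D g \<Longrightarrow> alg_hom A C' D g' \<Longrightarrow>
       (\<And>b. b \<in> carrier[B] \<Longrightarrow> g (f b) = g' (f' b)) \<Longrightarrow> g (s (C, f)) = g' (s (C', f'))"
  shows "\<exists>x\<in>carrier[B]. \<forall>i\<in>\<U>. snd i x = s i"
proof -
  let ?R = "ring_of B" and ?S = "\<lambda>i :: 'u alg \<times> ('u \<Rightarrow> 'u). ring_of (fst i)"
  have finU: "finite \<U>" using U by (simp add: fppf_cover_def)
  have hom: "alg_hom A B C f" if "(C, f) \<in> \<U>" for C f using U that unfolding fppf_cover_def by blast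
  have hom': "alg_hom A B (fst i) (snd i)" if "i \<in> \<U>" for i using hom[of "fst i" "snd i"] that by simp
  have Sc: "cring (?S i)" if "i \<in> \<U>" for i using alg_homD(5)[OF hom'[OF that]] .
  have Sh: "snd i \<in> ring_hom ?R (?S i)" if "i \<in> \<U>" for i using alg_homD(3)[OF hom'[OF that]] .
  have Sz: "snd i r \<otimes>\<^bsub>?S i\<^esub> \<zero>\<^bsub>?S i\<^esub> = \<zero>\<^bsub>?S i\<^esub>" if "i \<in> \<U>" "r \<in> carrier ?R" for i r
  proof -
    interpret I: cring "?S i" by (rule Sc[OF that(1)])
    show ?thesis using ring_hom_closed[OF Sh[OF that(1)] that(2)] by simp
  qed
  interpret R: cring ?R using B by (rule is_alg_cring)
  define N where "N = product_module \<U> ?S snd"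
  have N: "module ?R N" unfolding N_def by (rule product_module[OF R.is_cring Sc Sh])
  interpret N: module ?R N by fact
  have Ncar: "carrier N = (\<Pi>\<^sub>E i\<in>\<U>. carrier (?S i))" by (simp add: N_def)
  define diag where "diag r = (\<lambda>i\<in>\<U>. snd i r)" for r
  have diag: "diag r \<in> carrier N" if "r \<in> carrier ?R" for r
    using that ring_hom_closed[OF Sh] by (auto simp: diag_def Ncar PiE_iff)
  have diag_add: "diag r \<oplus>\<^bsub>N\<^esub> diag r' = diag (r \<oplus>\<^bsub>?R\<^esub> r')" if "r \<in> carrier ?R" "r' \<in> carrier ?R" for r r'
    using that ring_hom_add[OF Sh] by (auto simp: diag_def N_def fun_eq_iff)
  have diag_smult: "r \<odot>\<^bsub>N\<^esub> diag r' = diag (r \<otimes>\<^bsub>?R\<^esub> r')" if "r \<in> carrier ?R" "r' \<in> carrier ?R" for r r'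
    using that ring_hom_mult[OF Sh] by (auto simp: diag_def N_def fun_eq_iff)
  have diag_zero: "diag \<zero>\<^bsub>?R\<^esub> = \<zero>\<^bsub>N\<^esub>"
    using alg_homD(9)[OF hom'] by (auto simp: diag_def N_def fun_eq_iff)
  define S where "S = diag ` carrier ?R"
  have S: "submodule S ?R N"
  proof (rule N.submoduleI)
    show "S \<subseteq> carrier N" using diag by (auto simp: S_def)
    show "\<zero>\<^bsub>N\<^esub> \<in> S" using diag_zero by (auto simp: S_def intro: rev_image_eqI)
    fix a assume "a \<in> S"
    then obtain r where r: "r \<in> carrier ?R" "a = diag r" by (auto simp: S_def)
    have "diag (\<ominus>\<^bsub>?R\<^esub> r) \<oplus>\<^bsub>N\<^esub> a = \<zero>\<^bsub>N\<^esub>" using r by (simp add: diag_add R.l_neg diag_zero)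
    hence "\<ominus>\<^bsub>N\<^esub> a = diag (\<ominus>\<^bsub>?R\<^esub> r)" using r diag by (intro N.minus_equality) auto
    thus "\<ominus>\<^bsub>N\<^esub> a \<in> S" using r by (auto simp: S_def)
  qed (auto simp: S_def diag_add diag_smult)
  obtain us where us: "set us = \<U>" using finU finite_list by blast
  have inj: "inj_on (\<lambda>\<phi>. list_code (map \<phi> us)) (carrier N)"
  proof (rule inj_onI)
    fix x y assume xy: "x \<in> carrier N" "y \<in> carrier N" "list_code (map x us) = list_code (map y us)"
    hence "map x us = map y us" using inj_list_code[OF inf] by (auto dest: injD)
    hence "x i = y i" if "i \<in> \<U>" for i using that us by auto
    thus "x = y" using xy(1,2) unfolding Ncar by (intro PiE_ext)
  qed
  obtain \<rho> :: "_ \<Rightarrow> 'u" where \<rho>: "\<forall>x\<in>carrier N. \<forall>y\<in>carrier N. \<rho> x = \<rho> y \<longleftrightarrow> x \<ominus>\<^bsub>N\<^esub> y \<in> S"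
    using quotient_code_exists[OF N S inj] by blast
  note M = quotient_module[OF N S \<rho>]
  let ?M = "image_module \<rho> N"
  define c where "c = (\<lambda>i\<in>\<U>. s i)"
  have c: "c \<in> carrier N" using s by (auto simp: c_def Ncar)
  have nz: "\<ominus>\<^bsub>N\<^esub> \<zero>\<^bsub>N\<^esub> = \<zero>\<^bsub>N\<^esub>" by (rule N.minus_equality) simp_all
  have "\<rho> c = \<zero>\<^bsub>?M\<^esub>"
  proof (rule faithfully_flat_zero[OF U B M(1) M(2)[OF c]])
    fix C f L b assume C: "(C, f) \<in> \<U>" and L: "module ?R L"
      and b: "bilinear_map ?R ?M (restrict_scalars (ring_of C) f) L b"
    interpret L: module ?R L by fact
    note fD = alg_homD[OF hom[OF C]]
    interpret C: cring "ring_of C" by (rule fD)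
    have sC: "s (C, f) \<in> carrier[C]" using s[OF C] by simp
    have bc: "b (\<rho> x) y \<in> carrier L" if "x \<in> carrier N" "y \<in> carrier[C]" for x y
      using bilinear_mapD(1)[OF b] M(2) that by simp
    have badd: "b (\<rho> (x \<oplus>\<^bsub>N\<^esub> x')) y = b (\<rho> x) y \<oplus>\<^bsub>L\<^esub> b (\<rho> x') y"
      if "x \<in> carrier N" "x' \<in> carrier N" "y \<in> carrier[C]" for x x' y
      using bilinear_mapD(2)[OF b] M(2,3) that by simp
    have badd': "b (\<rho> (\<lambda>i\<in>\<U>. x i \<oplus>\<^bsub>?S i\<^esub> x' i)) y = b (\<rho> x) y \<oplus>\<^bsub>L\<^esub> b (\<rho> x') y"
      if "x \<in> carrier N" "x' \<in> carrier N" "y \<in> carrier[C]" for x x' y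
      using badd[OF that] by (simp add: N_def)
    define e where "e i x = (\<lambda>k\<in>\<U>. if k = i then x else \<zero>\<^bsub>?S k\<^esub>)" for i x
    have e: "e i x \<in> carrier N" if "i \<in> \<U>" "x \<in> carrier (?S i)" for i x
      using that by (auto simp: e_def Ncar PiE_iff cring.cring_simprules[OF Sc])
    \<comment> \<open>The component \<open>s (C, f)\<close> is moved to the other side of the tensor
      product. What remains on the left is the diagonal element 1, whose class is zero.\<close>
    have "b (\<rho> c) \<one>[C] = b (\<rho> (diag \<one>\<^bsub>?R\<^esub>)) (s (C, f))"
    proof (rule additive_eq_on_product[OF finU Sc L.abelian_group_axioms,
          where F = "\<lambda>x. b (\<rho> x) \<one>[C]" and G = "\<lambda>x. b (\<rho> x) (s (C, f))"])
      fix i assume i: "i \<in> \<U>"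
      note iD = alg_homD[OF hom'[OF i]]
      interpret I: cring "?S i" by (rule iD)
      interpret T: tensor_values ?R "?S i" "ring_of C" L "snd i" f
        using iD fD L by (simp add: tensor_values_def tensor_values_axioms_def)
      have eadd: "e i (x \<oplus>\<^bsub>?S i\<^esub> x') = e i x \<oplus>\<^bsub>N\<^esub> e i x'" if "x \<in> carrier (?S i)" "x' \<in> carrier (?S i)" for x x'
        unfolding e_def N_def product_module_simps
        by (rule restrict_ext) (simp add: abelian_monoid.l_zero[OF abelian_group.axioms(1)[OF ring.is_abelian_group[OF cring.axioms(1)[OF Sc]]]]
            abelian_monoid.zero_closed[OF abelian_group.axioms(1)[OF ring.is_abelian_group[OF cring.axioms(1)[OF Sc]]]])
      have esm: "e i (snd i r \<otimes>\<^bsub>?S i\<^esub> x) = r \<odot>\<^bsub>N\<^esub> e i x" if "x \<in> carrier (?S i)" "r \<in> carrier ?R" for x r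
        unfolding e_def N_def product_module_simps
        by (rule restrict_ext) (simp add: Sz[OF _ that(2)])
      \<comment> \<open>On the \<open>i\<close>-th factor, \<open>b\<close> is a bilinear map on the
        product of the \<open>i\<close>-th member and \<open>C\<close>. The matching condition in a
        ring of tensor values gives \<open>s i\<close> tensor 1 equal to 1 tensor
        \<open>s (C, f)\<close> as far as \<open>\<beta>\<close> can see.\<close>
      define \<beta> where "\<beta> x y = b (\<rho> (e i x)) y" for x y
      have \<beta>: "\<beta> \<in> T.Bil"
      proof (rule T.BilI)
        fix x x' y assume "x \<in> carrier (?S i)" "x' \<in> carrier (?S i)" "y \<in> carrier[C]"
        thus "\<beta> (x \<oplus>\<^bsub>?S i\<^esub> x') y = \<beta> x y \<oplus>\<^bsub>L\<^esub> \<beta> x' y" using i by (simp add: \<beta>_def eadd badd e)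
      next
        fix x y y' assume "x \<in> carrier (?S i)" "y \<in> carrier[C]" "y' \<in> carrier[C]"
        thus "\<beta> x (y \<oplus>[C] y') = \<beta> x y \<oplus>\<^bsub>L\<^esub> \<beta> x y'"
          using bilinear_mapD(3)[OF b] M(2) e[OF i] by (simp add: \<beta>_def)
      next
        fix r x y assume rxy: "r \<in> carrier ?R" "x \<in> carrier (?S i)" "y \<in> carrier[C]"
        thus "\<beta> (snd i r \<otimes>\<^bsub>?S i\<^esub> x) y = r \<odot>\<^bsub>L\<^esub> \<beta> x y"
          using bilinear_mapD(4)[OF b] M(2,4) e[OF i] by (simp add: \<beta>_def esm)
        show "\<beta> x (f r \<otimes>[C] y) = r \<odot>\<^bsub>L\<^esub> \<beta> x y"
          using rxy bilinear_mapD(5)[OF b] M(2) e[OF i] by (simp add: \<beta>_def)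
      qed (use i in \<open>simp add: \<beta>_def bc e\<close>)
      obtain D :: "'u ring" and g g' where D: "cring D" "g \<in> ring_hom (?S i) D" "g' \<in> ring_hom (ring_of C) D"
        "\<And>r. r \<in> carrier ?R \<Longrightarrow> g (snd i r) = g' (f r)"
        "\<And>\<beta> s s'. \<beta> \<in> T.Bil \<Longrightarrow> s \<in> carrier (?S i) \<Longrightarrow> s' \<in> carrier[C] \<Longrightarrow> g s = g' s' \<Longrightarrow>
            \<beta> s \<one>[C] = \<beta> \<one>\<^bsub>?S i\<^esub> s'"
        using T.tensor_ring_exists[OF inf] by metis
      let ?D = "(D, g \<circ> str_map (fst i))"
      have h1: "alg_hom A (fst i) ?D g"
        using D(1,2) iD(2) ring_hom_trans[OF is_alg_str[OF iD(2)] D(2)] by (simp add: alg_hom_def is_alg_def)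
      have h2: "alg_hom A C ?D g'"
        using h1 fD D(3,4) iD(6) ring_hom_closed[OF is_alg_str[OF B]] by (simp add: alg_hom_def) metis
      have "g (s (fst i, snd i)) = g' (s (C, f))"
        by (rule match[OF _ C h1 h2]) (use i D(4) in auto)
      hence "\<beta> (s i) \<one>[C] = \<beta> \<one>\<^bsub>?S i\<^esub> (s (C, f))"
        using D(5)[OF \<beta> s[OF i] sC] by simp
      moreover have "c i = s i" "diag \<one>\<^bsub>?R\<^esub> i = \<one>\<^bsub>?S i\<^esub>"
        using i ring_hom_one[OF iD(3)] by (simp_all add: c_def diag_def)
      ultimately show "b (\<rho> (\<lambda>k\<in>\<U>. if k = i then c i else \<zero>\<^bsub>?S k\<^esub>)) \<one>[C] =
        b (\<rho> (\<lambda>k\<in>\<U>. if k = i then diag \<one>\<^bsub>?R\<^esub> i else \<zero>\<^bsub>?S k\<^esub>)) (s (C, f))"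
        by (simp only: \<beta>_def e_def)
    qed (use c diag[OF R.one_closed] badd' bc sC in \<open>auto simp: Ncar[symmetric]\<close>)
    also have "\<rho> (diag \<one>\<^bsub>?R\<^esub>) = \<rho> \<zero>\<^bsub>N\<^esub>"
      using bspec[OF bspec[OF \<rho> diag[OF R.one_closed]] N.zero_closed] diag[OF R.one_closed] nz by (simp add: S_def a_minus_def)
    also have "b (\<rho> \<zero>\<^bsub>N\<^esub>) (s (C, f)) = \<zero>\<^bsub>L\<^esub>"
      using badd[OF N.zero_closed N.zero_closed sC] bc[OF N.zero_closed sC] by (simp add: L.add.l_cancel_one')
    finally show "b (\<rho> c) \<one>[C] = \<zero>\<^bsub>L\<^esub>" .
  qed
  hence "\<rho> c = \<rho> \<zero>\<^bsub>N\<^esub>" using M(5) by simp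
  hence "c \<in> S" using nz bspec[OF bspec[OF \<rho> c] N.zero_closed] c by (simp add: a_minus_def)
  then obtain r where r: "r \<in> carrier ?R" "c = diag r" by (auto simp: S_def)
  have "snd i r = s i" if "i \<in> \<U>" for i
    using fun_cong[OF r(2), of i] that by (simp add: c_def diag_def)
  thus ?thesis using r by blast
qed

definition nil_sections :: "('u, 'z) psh_scheme \<Rightarrow> bool" where
  "nil_sections X \<longleftrightarrow> (\<forall>B. sec X B = nil[B]) \<and> (\<forall>B C f x. res X B C f x = f x)"

lemma nil_fppf_sheaf:
  fixes A :: "'u ring" and X :: "('u, 'z) psh_scheme"
  assumes inf: "infinite (UNIV :: 'u set)" and X: "nil_sections X"
  shows "fppf_sheaf A X"
proof -
  have sec [simp]: "sec X B = nil[B]" and res [simp]: "res X B C f x = f x" for B C f x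
    using X unfolding nil_sections_def by blast+
  have "presheaf A X"
    unfolding presheaf_def by (auto dest: alg_homD(8))
  moreover have "\<exists>!x. x \<in> sec X B \<and> (\<forall>(C, f)\<in>\<U>. res X B C f x = s (C, f))"
    if B: "is_alg A B" and U: "fppf_cover A B \<U>" and m: "matching_family A X B \<U> s" for B \<U> s
  proof -
    interpret R: cring "ring_of B" using B by (rule is_alg_cring)
    have sn: "s i \<in> nil (ring_of (fst i))" if "i \<in> \<U>" for i
      using m that unfolding matching_family_def by (cases i) force
    have "\<exists>x\<in>carrier[B]. \<forall>i\<in>\<U>. snd i x = s i"
    proof (rule cover_glue[OF inf U B])
      fix C f C' f' D g g' assume h: "(C, f) \<in> \<U>" "(C', f') \<in> \<U>" "alg_hom A C D g" "alg_hom A C' D g'"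
        "\<And>b. b \<in> carrier[B] \<Longrightarrow> g (f b) = g' (f' b)"
      note mm = conjunct2[OF m[unfolded matching_family_def]]
      show "g (s (C, f)) = g' (s (C', f'))"
        using bspec[OF bspec[OF mm h(1), unfolded prod.case] h(2), unfolded prod.case res] h(3-5) by metis
    qed (use sn in auto)
    then obtain x where x: "x \<in> carrier[B]" "\<And>i. i \<in> \<U> \<Longrightarrow> snd i x = s i" by blast
    have hom: "alg_hom A B C f" if "(C, f) \<in> \<U>" for C f using U that unfolding fppf_cover_def by blast
    \<comment> \<open>Finiteness of the covering gives a common exponent, so that the glued element
      is again nilpotent.\<close>
    have "\<exists>n::nat. \<forall>i\<in>\<U>. s i [^]\<^bsub>ring_of (fst i)\<^esub> n = \<zero>\<^bsub>ring_of (fst i)\<^esub>"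
    proof -
      define n where "n i = (SOME n::nat. s i [^]\<^bsub>ring_of (fst i)\<^esub> n = \<zero>\<^bsub>ring_of (fst i)\<^esub>)" for i
      have n: "s i [^]\<^bsub>ring_of (fst i)\<^esub> n i = \<zero>\<^bsub>ring_of (fst i)\<^esub>" if "i \<in> \<U>" for i
        unfolding n_def using sn[OF that] unfolding nil_def mem_Collect_eq by (rule someI_ex[OF conjunct2])
      have fin: "finite \<U>" using U by (simp add: fppf_cover_def)
      have le: "n i \<le> sum n \<U>" if "i \<in> \<U>" for i by (rule member_le_sum[OF that _ fin]) simp
      have "s i [^]\<^bsub>ring_of (fst i)\<^esub> (sum n \<U>) = \<zero>\<^bsub>ring_of (fst i)\<^esub>" if i: "i \<in> \<U>" for i
        using cring.pow_zero_mono[OF alg_homD(5)[OF hom[of "fst i" "snd i"]] _ n[OF i] le[OF i]] i sn[OF i] by simp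
      thus ?thesis by blast
    qed
    then obtain n :: nat where n: "\<And>i. i \<in> \<U> \<Longrightarrow> s i [^]\<^bsub>ring_of (fst i)\<^esub> n = \<zero>\<^bsub>ring_of (fst i)\<^esub>" by blast
    have "x [^][B] n = \<zero>[B]"
    proof (rule cover_injective[OF U B])
      fix C f assume C: "(C, f) \<in> \<U>"
      note fD = alg_homD[OF hom[OF C]]
      show "f (x [^][B] n) = f \<zero>[B]"
        using n[OF C] x(2)[OF C] by (simp add: hom_pow_eq[OF fD(4,5,3) x(1)] fD(9))
    qed (use x in auto)
    hence xn: "x \<in> nil[B]" using x(1) by (rule nilI[rotated])
    show ?thesis
    proof (rule ex1I[of _ x])
      show "x \<in> sec X B \<and> (\<forall>(C, f)\<in>\<U>. res X B C f x = s (C, f))" using xn x(2) by auto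
      fix y assume y: "y \<in> sec X B \<and> (\<forall>(C, f)\<in>\<U>. res X B C f y = s (C, f))"
      show "y = x"
      proof (rule cover_injective[OF U B])
        fix C f assume C: "(C, f) \<in> \<U>"
        thus "f y = f x" using y x(2)[OF C] by auto
      qed (use x y in auto)
    qed
  qed
  ultimately show ?thesis unfolding fppf_sheaf_def by blast
qed

section \<open>Power series with constant coefficients\<close>

lemma (in abelian_monoid) finsum_lessThan_Suc:
  assumes "\<And>i. i < Suc n \<Longrightarrow> f i \<in> carrier G"
  shows "(\<Oplus>i\<in>{..<Suc n}. f i) = f n \<oplus> (\<Oplus>i\<in>{..<n}. f i)"
  unfolding lessThan_Suc using assms by (intro finsum_insert) auto

context cring
begin

lemma series_monom:
  assumes y: "y \<in> nil R" and c: "c \<in> carrier R"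
  shows "series R (\<lambda>k. if k = n then c else \<zero>) y = c \<otimes> y [^] n"
proof -
  obtain N where N: "y \<in> carrier R" "y [^] (N::nat) = \<zero>" using y by (elim nilE)
  have N': "y [^] (N + Suc n) = \<zero>" by (rule pow_zero_mono[OF N]) simp
  have "series R (\<lambda>k. if k = n then c else \<zero>) y = (\<Oplus>k\<in>{..<N + Suc n}. (if k = n then c else \<zero>) \<otimes> y [^] k)"
    using c by (intro series_eq[OF N(1) N']) auto
  also have "\<dots> = (\<Oplus>k\<in>{..<N + Suc n}. if n = k then c \<otimes> y [^] k else \<zero>)"
    using c N by (intro finsum_cong') auto
  also have "\<dots> = c \<otimes> y [^] n" using c N by (intro finsum_singleton) auto
  finally show ?thesis .
qed

lemma series_zero: "y \<in> nil R \<Longrightarrow> series R (\<lambda>k. \<zero>) y = \<zero>"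
  using series_monom[of y \<zero> 0] by simp

lemma pow_diff:
  assumes x: "x \<in> carrier R" and y: "y \<in> carrier R"
  shows "\<exists>u\<in>carrier R. \<exists>v\<in>carrier R. x [^] (k + 2 :: nat) \<ominus> y [^] (k + 2) = (x \<ominus> y) \<otimes> (x \<otimes> u \<oplus> y \<otimes> v)"
proof (induction k)
  case 0
  have "x [^] (0 + 2 :: nat) \<ominus> y [^] (0 + 2 :: nat) = x \<otimes> x \<ominus> y \<otimes> y"
    using x y by (simp add: numeral_2_eq_2)
  also have "\<dots> = (x \<ominus> y) \<otimes> (x \<otimes> \<one> \<oplus> y \<otimes> \<one>)" using x y by algebra
  finally show ?case by blast
next
  case (Suc k)
  then obtain u v where uv: "u \<in> carrier R" "v \<in> carrier R"
    "x [^] (k + 2) \<ominus> y [^] (k + 2) = (x \<ominus> y) \<otimes> (x \<otimes> u \<oplus> y \<otimes> v)" by blast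
  define X where "X = x [^] (k + 1)"
  define Y where "Y = y [^] (k + 2)"
  have c: "X \<in> carrier R" "Y \<in> carrier R" using x y by (simp_all add: X_def Y_def)
  have e: "x [^] (k + 2) = x \<otimes> X" "x [^] (Suc k + 2) = (x \<otimes> X) \<otimes> x" "y [^] (Suc k + 2) = Y \<otimes> y"
    using x y by (simp_all add: X_def Y_def m_comm)
  have uv': "x \<otimes> X \<ominus> Y = (x \<ominus> y) \<otimes> (x \<otimes> u \<oplus> y \<otimes> v)" using uv(3) unfolding e Y_def .
  have "(x \<otimes> X) \<otimes> x \<ominus> Y \<otimes> y = (x \<otimes> X) \<otimes> (x \<ominus> y) \<oplus> (x \<otimes> X \<ominus> Y) \<otimes> y" using c x y by algebra
  also have "\<dots> = (x \<ominus> y) \<otimes> (x \<otimes> (X \<oplus> u \<otimes> y) \<oplus> y \<otimes> (v \<otimes> y))"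
    unfolding uv' using c x y uv(1,2) by algebra
  finally show ?case unfolding e using c x y uv
    by (intro bexI[of _ "X \<oplus> u \<otimes> y"] bexI[of _ "v \<otimes> y"]) auto
qed

text \<open>Constant terms cancel, the linear term contributes \<open>a 1\<close>, and by
  \<open>pow_diff\<close> each higher term contributes a cofactor in the ideal of \<open>x\<close>
  and \<open>y\<close>. If \<open>a 1\<close> is a unit, so is the whole cofactor of
  \<open>x - y\<close>.\<close>

lemma series_diff:
  assumes x: "x \<in> nil R" and y: "y \<in> nil R" and a: "\<And>k. a k \<in> carrier R"
  shows "\<exists>u\<in>carrier R. \<exists>v\<in>carrier R. series R a x \<ominus> series R a y = (x \<ominus> y) \<otimes> (a 1 \<oplus> (x \<otimes> u \<oplus> y \<otimes> v))"
proof -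
  have xc: "x \<in> carrier R" and yc: "y \<in> carrier R" using x y by auto
  have aux: "b \<otimes> (d \<otimes> (x \<otimes> s \<oplus> y \<otimes> t)) \<oplus> d \<otimes> (c \<oplus> (x \<otimes> u \<oplus> y \<otimes> v))
      = d \<otimes> (c \<oplus> (x \<otimes> (u \<oplus> b \<otimes> s) \<oplus> y \<otimes> (v \<oplus> b \<otimes> t)))"
    if "b \<in> carrier R" "c \<in> carrier R" "d \<in> carrier R" "s \<in> carrier R" "t \<in> carrier R" "u \<in> carrier R" "v \<in> carrier R"
    for b c d s t u v
    using that xc yc by (simp add: r_distr m_ac a_ac)
  have step: "\<exists>u\<in>carrier R. \<exists>v\<in>carrier R. (\<Oplus>k\<in>{..<N + 2}. a k \<otimes> x [^] k) \<ominus> (\<Oplus>k\<in>{..<N + 2}. a k \<otimes> y [^] k)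
      = (x \<ominus> y) \<otimes> (a 1 \<oplus> (x \<otimes> u \<oplus> y \<otimes> v))" for N
  proof (induction N)
    case 0
    have e: "(\<Oplus>k\<in>{..<0 + 2}. a k \<otimes> z [^] k) = a 1 \<otimes> z \<oplus> a 0" if "z \<in> carrier R" for z
      using that a by (simp add: numeral_2_eq_2 finsum_lessThan_Suc)
    have "(a 1 \<otimes> x \<oplus> a 0) \<ominus> (a 1 \<otimes> y \<oplus> a 0) = (x \<ominus> y) \<otimes> (a 1 \<oplus> (x \<otimes> \<zero> \<oplus> y \<otimes> \<zero>))"
      using xc yc a[of 0] a[of 1] by algebra
    thus ?case unfolding e[OF xc] e[OF yc] by blast
  next
    case (Suc N)
    define X where "X = (\<Oplus>k\<in>{..<N + 2}. a k \<otimes> x [^] k)"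
    define Y where "Y = (\<Oplus>k\<in>{..<N + 2}. a k \<otimes> y [^] k)"
    obtain u v where uv: "u \<in> carrier R" "v \<in> carrier R"
      "X \<ominus> Y = (x \<ominus> y) \<otimes> (a 1 \<oplus> (x \<otimes> u \<oplus> y \<otimes> v))" using Suc unfolding X_def Y_def by blast
    define xp where "xp = x [^] (N + 2)"
    define yp where "yp = y [^] (N + 2)"
    define b where "b = a (N + 2)"
    have b: "b \<in> carrier R" using a by (simp add: b_def)
    obtain s t where st: "s \<in> carrier R" "t \<in> carrier R"
      "xp \<ominus> yp = (x \<ominus> y) \<otimes> (x \<otimes> s \<oplus> y \<otimes> t)" using pow_diff[OF xc yc] unfolding xp_def yp_def by blast
    have XY: "X \<in> carrier R" "Y \<in> carrier R" using a xc yc by (auto simp: X_def Y_def intro!: finsum_closed)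
    have e: "(\<Oplus>k\<in>{..<Suc N + 2}. a k \<otimes> z [^] k) = a (N + 2) \<otimes> z [^] (N + 2) \<oplus> (\<Oplus>k\<in>{..<N + 2}. a k \<otimes> z [^] k)"
      if "z \<in> carrier R" for z using that a finsum_lessThan_Suc[of "N + 2" "\<lambda>k. a k \<otimes> z [^] k"] by simp
    have p: "xp \<in> carrier R" "yp \<in> carrier R" using xc yc by (auto simp: xp_def yp_def)
    have "(b \<otimes> xp \<oplus> X) \<ominus> (b \<otimes> yp \<oplus> Y) = b \<otimes> (xp \<ominus> yp) \<oplus> (X \<ominus> Y)"
      using p XY b by algebra
    also have "\<dots> = (x \<ominus> y) \<otimes> (a 1 \<oplus> (x \<otimes> (u \<oplus> b \<otimes> s) \<oplus> y \<otimes> (v \<oplus> b \<otimes> t)))"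
      unfolding uv st by (rule aux) (use uv(1,2) st(1,2) xc yc a[of 1] b in auto)
    finally show ?case unfolding e[OF xc] e[OF yc] X_def[symmetric] Y_def[symmetric] b_def[symmetric]
        xp_def[symmetric] yp_def[symmetric]
      using uv st b by (intro bexI[of _ "u \<oplus> b \<otimes> s"] bexI[of _ "v \<oplus> b \<otimes> t"]) auto
  qed
  obtain M where M: "x [^] (M::nat) = \<zero>" using x by (elim nilE)
  obtain N where N: "y [^] (N::nat) = \<zero>" using y by (elim nilE)
  have h: "x [^] (M + N + 2) = \<zero>" "y [^] (M + N + 2) = \<zero>"
    by (rule pow_zero_mono[OF xc M] pow_zero_mono[OF yc N], simp)+
  show ?thesis unfolding series_eq[of x _ a, OF xc h(1) a] series_eq[of y _ a, OF yc h(2) a] by (rule step)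
qed

text \<open>A power series without constant term and with invertible linear term is invertible under
  composition. Injectivity is immediate from \<open>series_diff\<close>; surjectivity is an
  approximation whose error gains a factor \<open>c\<close> in each step and so dies.\<close>

lemma series_bij:
  assumes a: "\<And>k. a k \<in> carrier R" and a0: "a 0 = \<zero>" and a1: "a 1 \<in> Units R"
  shows "bij_betw (series R a) (nil R) (nil R)"
proof -
  have cl: "series R a x \<in> nil R" if "x \<in> nil R" for x
    using that a a0 by (intro series_nil) auto
  have "inj_on (series R a) (nil R)"
  proof (rule inj_onI)
    fix x y assume xy: "x \<in> nil R" "y \<in> nil R" "series R a x = series R a y"
    obtain u v where uv: "u \<in> carrier R" "v \<in> carrier R"
      "series R a x \<ominus> series R a y = (x \<ominus> y) \<otimes> (a 1 \<oplus> (x \<otimes> u \<oplus> y \<otimes> v))"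
      using series_diff[of x y a, OF xy(1,2) a] by blast
    have "x \<otimes> u \<oplus> y \<otimes> v \<in> nil R" using xy uv by (intro add_nil mult_nil)
    hence U: "a 1 \<oplus> (x \<otimes> u \<oplus> y \<otimes> v) \<in> Units R" using a1 by (rule unit_plus_nil[rotated])
    have "(x \<ominus> y) \<otimes> (a 1 \<oplus> (x \<otimes> u \<oplus> y \<otimes> v)) = \<zero>"
      using uv(3) xy(3) nil_carrier[OF cl[OF xy(2)]] by (simp add: a_minus_def[of R "series R a y"] r_neg)
    hence "(a 1 \<oplus> (x \<otimes> u \<oplus> y \<otimes> v)) \<otimes> (x \<ominus> y) = \<zero>"
      using m_comm[OF minus_closed[OF nil_carrier[OF xy(1)] nil_carrier[OF xy(2)]] Units_closed[OF U]] by simp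
    hence "x \<ominus> y = \<zero>" 
      by (rule unit_mult_zero[OF U minus_closed[OF nil_carrier[OF xy(1)] nil_carrier[OF xy(2)]]])
    thus "x = y" using xy by simp
  qed
  moreover have "\<exists>b\<in>nil R. series R a b = c" if c: "c \<in> nil R" for c
  proof -
    have cc: "c \<in> carrier R" using c by simp
    have i: "inv (a 1) \<in> carrier R" "inv (a 1) \<otimes> a 1 = \<one>" using a1 by auto
    \<comment> \<open>The approximate solutions are kept in the form \<open>c s\<close>; this is
      what makes each correction smaller by a factor \<open>c\<close>.\<close>
    have "\<exists>s\<in>carrier R. \<exists>r\<in>carrier R. series R a (c \<otimes> s) \<ominus> c = c [^] (k::nat) \<otimes> r" for k
    proof (induction k)
      case 0
      show ?case using series_at_zero[of a, OF a] a0 c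
        by (intro bexI[of _ \<zero>] bexI[of _ "\<ominus> c"]) (auto simp: a_minus_def)
    next
      case (Suc k)
      then obtain s r where sr: "s \<in> carrier R" "r \<in> carrier R" "series R a (c \<otimes> s) \<ominus> c = c [^] k \<otimes> r" by blast
      define e where "e = series R a (c \<otimes> s) \<ominus> c"
      have cs: "c \<otimes> s \<in> nil R" using c sr by (intro mult_nil)
      have e: "e \<in> nil R" using cl[OF cs] c by (simp add: e_def minus_nil)
      obtain t where t: "t \<in> carrier R" "e = c \<otimes> t"
      proof -
        have "series R a (c \<otimes> s) = (c \<otimes> s) \<otimes> series R (\<lambda>k. a (Suc k)) (c \<otimes> s)"
          using series_shift[of "c \<otimes> s" a] cs a a0 series_closed[of "c \<otimes> s" "\<lambda>k. a (Suc k)"] by simp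
        moreover define S where "S = series R (\<lambda>k. a (Suc k)) (c \<otimes> s)"
        moreover have S: "S \<in> carrier R" unfolding S_def using cs a by (rule series_closed)
        ultimately have "e = c \<otimes> s \<otimes> S \<ominus> c" by (simp add: e_def)
        also have "\<dots> = c \<otimes> (s \<otimes> S \<ominus> \<one>)" using S sr cc by algebra
        finally show thesis using that[of "s \<otimes> S \<ominus> \<one>"] S sr by simp
      qed
      \<comment> \<open>Newton step: since \<open>e = c t\<close>, this subtracts
        \<open>e / a 1\<close> from \<open>c s\<close>.\<close>
      define s' where "s' = s \<ominus> inv (a 1) \<otimes> t"
      have s': "s' \<in> carrier R" using sr t i by (simp add: s'_def)
      have cs': "c \<otimes> s' \<in> nil R" using c s' by (intro mult_nil)
      obtain u v where uv: "u \<in> carrier R" "v \<in> carrier R"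
        "series R a (c \<otimes> s') \<ominus> series R a (c \<otimes> s) = (c \<otimes> s' \<ominus> c \<otimes> s) \<otimes> (a 1 \<oplus> (c \<otimes> s' \<otimes> u \<oplus> c \<otimes> s \<otimes> v))"
        using series_diff[of "c \<otimes> s'" "c \<otimes> s" a, OF cs' cs a] by blast
      define P where "P = series R a (c \<otimes> s)"
      define Q where "Q = series R a (c \<otimes> s')"
      have PQ: "P \<in> carrier R" "Q \<in> carrier R" using cl[OF cs] cl[OF cs'] by (auto simp: P_def Q_def)
      have d: "c \<otimes> s' \<ominus> c \<otimes> s = \<ominus> (inv (a 1) \<otimes> e)" unfolding s'_def t(2) using i(1) t(1) sr(1) cc by algebra
      have "Q \<ominus> c = (Q \<ominus> P) \<oplus> (P \<ominus> c)" using PQ cc by (simp add: a_minus_def a_assoc r_neg1)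
      also have "\<dots> = \<ominus> (inv (a 1) \<otimes> e) \<otimes> (a 1 \<oplus> (c \<otimes> s' \<otimes> u \<oplus> c \<otimes> s \<otimes> v)) \<oplus> e"
        using uv(3) d by (simp add: P_def Q_def e_def)
      also have "\<dots> = e \<ominus> (inv (a 1) \<otimes> a 1) \<otimes> e \<ominus> inv (a 1) \<otimes> e \<otimes> c \<otimes> (s' \<otimes> u \<oplus> s \<otimes> v)"
        using i(1) a[of 1] nil_carrier[OF e] cc s' uv(1,2) sr(1) by algebra
      also have "\<dots> = e \<otimes> c \<otimes> (\<ominus> (inv (a 1) \<otimes> (s' \<otimes> u \<oplus> s \<otimes> v)))"
        unfolding i(2) using i(1) nil_carrier[OF e] cc s' uv(1,2) sr(1) by algebra
      also have "e = c [^] k \<otimes> r" using sr by (simp add: e_def)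
      also have "(c [^] k \<otimes> r) \<otimes> c \<otimes> (\<ominus> (inv (a 1) \<otimes> (s' \<otimes> u \<oplus> s \<otimes> v))) =
         c [^] k \<otimes> c \<otimes> (r \<otimes> (\<ominus> (inv (a 1) \<otimes> (s' \<otimes> u \<oplus> s \<otimes> v))))"
        using nat_pow_closed[OF cc, of k] i(1) cc s' uv(1,2) sr(1,2) by algebra
      finally have "Q \<ominus> c = c [^] Suc k \<otimes> (r \<otimes> (\<ominus> (inv (a 1) \<otimes> (s' \<otimes> u \<oplus> s \<otimes> v))))" by simp
      moreover have "r \<otimes> (\<ominus> (inv (a 1) \<otimes> (s' \<otimes> u \<oplus> s \<otimes> v))) \<in> carrier R" using i s' uv sr by simp
      ultimately show ?case using s' unfolding Q_def by blast
    qed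
    moreover obtain N where N: "c [^] (N::nat) = \<zero>" using c by (elim nilE)
    ultimately obtain s r where sr: "s \<in> carrier R" "r \<in> carrier R" "series R a (c \<otimes> s) \<ominus> c = c [^] N \<otimes> r" by blast
    have cs: "c \<otimes> s \<in> nil R" using c sr by (intro mult_nil)
    have "series R a (c \<otimes> s) = c" using sr N cl[OF cs] cc by simp
    thus ?thesis using cs by blast
  qed
  ultimately show ?thesis using cl unfolding bij_betw_def by (auto intro: rev_image_eqI)
qed

end

definition kser :: "(nat \<Rightarrow> 'u) \<Rightarrow> 'u alg \<Rightarrow> 'u \<Rightarrow> 'u" where
  "kser c B x = series (ring_of B) (\<lambda>k. str_map B (c k)) x"

text \<open>The outer index belongs to the second argument: \<open>c j k\<close> is the coefficient
  of \<open>y^j x^k\<close>. For the same reason the corresponding operations take the list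
  \<open>[y, x]\<close>.\<close>

definition kser2 :: "(nat \<Rightarrow> nat \<Rightarrow> 'u) \<Rightarrow> 'u alg \<Rightarrow> 'u \<Rightarrow> 'u \<Rightarrow> 'u" where
  "kser2 c B x y = series (ring_of B) (\<lambda>j. kser (c j) B x) y"

context big_cring
begin

lemma str_closed: "is_alg R B \<Longrightarrow> c \<in> carrier R \<Longrightarrow> str_map B c \<in> carrier[B]"
  using ring_hom_closed[OF is_alg_str] .

lemma kser_natop: "(\<And>k. c k \<in> carrier R) \<Longrightarrow> natop R 1 (\<lambda>B xs. kser c B (hd xs))"
  using natop_series[of R 0 "\<lambda>k B xs. str_map B (c k)"] natop_const[of _ R 0] by (simp add: kser_def)

lemma kser_closed:
  assumes "is_alg R B" "\<And>k. c k \<in> carrier R" "x \<in> nil[B]" shows "kser c B x \<in> carrier[B]"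
  unfolding kser_def
  by (rule cring.series_closed[OF is_alg_cring[OF assms(1)] assms(3) str_closed[OF assms(1,2)]])

lemma kser_nat:
  assumes f: "alg_hom R B C f" and c: "\<And>k. c k \<in> carrier R" and x: "x \<in> nil[B]"
  shows "f (kser c B x) = kser c C (f x)"
  unfolding kser_def
  using hom_series[OF alg_homD(4,5,3)[OF f] x, of "\<lambda>k. str_map B (c k)"] str_closed[OF alg_homD(1)[OF f] c]
    alg_homD(6)[OF f c] by simp

lemma kser_nil:
  assumes B: "is_alg R B" and c: "\<And>k. c k \<in> carrier R" and x: "x \<in> nil[B]" and c0: "c 0 = \<zero>"
  shows "kser c B x \<in> nil[B]"
proof -
  interpret B: big_cring "ring_of B" by (rule alg_big[OF B])
  have "str_map B \<zero> = \<zero>[B]" using alg_homD(9)[OF str_alg_hom[OF is_cring B]] by simp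
  thus ?thesis unfolding kser_def using str_closed[OF B c] x c0 by (intro B.series_nil) auto
qed

lemma kser2_natop: "(\<And>j k. c j k \<in> carrier R) \<Longrightarrow> natop R 2 (\<lambda>B xs. kser2 c B (xs ! 1) (xs ! 0))"
proof -
  assume c: "\<And>j k. c j k \<in> carrier R"
  have "natop R (Suc 1) (\<lambda>B l. series (ring_of B) (\<lambda>k. kser (c k) B (hd (tl l))) (hd l))"
    by (rule natop_series[where a = "\<lambda>k B xs. kser (c k) B (hd xs)"]) (rule kser_natop[OF c])
  hence "natop R 2 (\<lambda>B l. kser2 c B (hd (tl l)) (hd l))" by (simp add: kser2_def numeral_2_eq_2)
  moreover have "kser2 c B (hd (tl l)) (hd l) = kser2 c B (l ! 1) (l ! 0)" if "l \<in> nilpts B 2" for B l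
    using that by (auto simp: nilpts_def length_Suc_conv numeral_2_eq_2)
  ultimately show ?thesis unfolding natop_def by (metis nilpts_map)
qed

lemma natop0_const:
  assumes "natop R 0 P" "is_alg R B" shows "P B [] = str_map B (P (R, \<lambda>a. a) [])"
    "P (R, \<lambda>a. a) [] \<in> carrier R"
  using natop_natural[OF assms(1) str_alg_hom[OF is_cring assms(2)], of "[]"]
    natop_closed[OF assms(1) base_alg[OF is_cring], of "[]"] by simp_all

lemma natop1_kser:
  assumes P: "natop R 1 P"
  obtains c where "\<And>k. c k \<in> carrier R" "\<And>B x. is_alg R B \<Longrightarrow> x \<in> nil[B] \<Longrightarrow> P B [x] = kser c B x"
proof -
  have P': "natop R (Suc 0) P" using P by simp
  show thesis
  proof (rule that[of "\<lambda>k. op_coef P k (R, \<lambda>a. a) []"])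
    fix k show "op_coef P k (R, \<lambda>a. a) [] \<in> carrier R"
      using natop0_const(2)[OF op_coef_natop[OF P'] base_alg[OF is_cring]] .
    fix B x assume B: "is_alg R B" and x: "x \<in> nil[B]"
    show "P B [x] = kser (\<lambda>k. op_coef P k (R, \<lambda>a. a) []) B x"
      using natop_expand[OF P' B _ x, of "[]"] natop0_const(1)[OF op_coef_natop[OF P'] B] by (simp add: kser_def)
  qed
qed

lemma natop2_kser2:
  assumes P: "natop R 2 P"
  obtains c where "\<And>j k. c j k \<in> carrier R"
    "\<And>B x y. is_alg R B \<Longrightarrow> x \<in> nil[B] \<Longrightarrow> y \<in> nil[B] \<Longrightarrow> P B [y, x] = kser2 c B x y"
proof -
  have P': "natop R (Suc 1) P" using P by (simp add: numeral_2_eq_2)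
  have "\<forall>j. \<exists>c. (\<forall>k. c k \<in> carrier R) \<and> (\<forall>B x. is_alg R B \<longrightarrow> x \<in> nil[B] \<longrightarrow> op_coef P j B [x] = kser c B x)"
    using natop1_kser[OF op_coef_natop[OF P']] by metis
  then obtain c where c: "\<And>j k. c j k \<in> carrier R"
    "\<And>j B x. is_alg R B \<Longrightarrow> x \<in> nil[B] \<Longrightarrow> op_coef P j B [x] = kser (c j) B x" by metis
  show thesis
  proof (rule that[of c])
    fix B x y assume B: "is_alg R B" and x: "x \<in> nil[B]" and y: "y \<in> nil[B]"
    show "P B [y, x] = kser2 c B x y"
      using natop_expand[OF P' B _ y, of "[x]"] x c(2)[OF B x] by (simp add: kser2_def)
  qed (rule c(1))
qed

lemma kser_unique_le:
  assumes c: "\<And>k. c k \<in> carrier R"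
    and z: "\<And>B x. is_alg R B \<Longrightarrow> x \<in> carrier[B] \<Longrightarrow> x [^][B] (N::nat) = \<zero>[B] \<Longrightarrow> kser c B x = \<zero>[B]"
    and k: "k < N"
  shows "c k = \<zero>"
proof -
  have "c k = \<zero>\<^bsub>ring_of (R, \<lambda>a. a)\<^esub>"
  proof (rule series_unique[OF base_alg[OF is_cring] _ _ k, where c = c])
    fix C f y assume f: "alg_hom R (R, \<lambda>a. a) C f"
      and y: "y \<in> carrier[C]" "y [^][C] N = \<zero>[C]"
    show "series (ring_of C) (\<lambda>k. f (c k)) y = \<zero>[C]"
      using z[OF alg_homD(2)[OF f] y] alg_homD(6)[OF f c] by (simp add: kser_def)
  qed (use c in simp)
  thus ?thesis by simp
qed

lemma kser_unique:
  assumes c: "\<And>k. c k \<in> carrier R"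
    and z: "\<And>B x. is_alg R B \<Longrightarrow> x \<in> nil[B] \<Longrightarrow> kser c B x = \<zero>[B]"
  shows "c k = \<zero>"
proof (rule kser_unique_le[OF c _ lessI])
  fix B x assume "is_alg R B" "x \<in> carrier[B]" "x [^][B] Suc k = \<zero>[B]"
  thus "kser c B x = \<zero>[B]" by (intro z nilI)
qed

lemma kser2_unique:
  assumes c: "\<And>j k. c j k \<in> carrier R"
    and z: "\<And>B x y. is_alg R B \<Longrightarrow> x \<in> nil[B] \<Longrightarrow> y \<in> nil[B] \<Longrightarrow> kser2 c B x y = \<zero>[B]"
  shows "c j k = \<zero>"
proof (rule kser_unique[OF c])
  fix B x assume B: "is_alg R B" and x: "x \<in> nil[B]"
  show "kser (c j) B x = \<zero>[B]"
  proof (rule series_unique_all[OF B, where c = "\<lambda>j. kser (c j) B x"])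
    fix C f y assume f: "alg_hom R B C f" and y: "y \<in> nil[C]"
    show "series (ring_of C) (\<lambda>k. f (kser (c k) B x)) y = \<zero>[C]"
      using z[OF alg_homD(2)[OF f] alg_homD(8)[OF f x] y] kser_nat[OF f c x] by (simp add: kser2_def)
  qed (use kser_closed[OF B c x] in simp)
qed

end

section \<open>Group structures on the formal line\<close>

definition nil_monoid :: "('u alg \<Rightarrow> 'u \<Rightarrow> 'u \<Rightarrow> 'u) \<Rightarrow> 'u alg \<Rightarrow> 'u monoid" where
  "nil_monoid F B = \<lparr>carrier = nil[B], monoid.mult = F B, one = \<zero>[B]\<rparr>"

lemma nil_monoid_simps [simp]: "carrier (nil_monoid F B) = nil[B]"
  "x \<otimes>\<^bsub>nil_monoid F B\<^esub> y = F B x y" "\<one>\<^bsub>nil_monoid F B\<^esub> = \<zero>[B]"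
  by (simp_all add: nil_monoid_def)

text \<open>A one-dimensional commutative formal group law over \<open>R\<close>, given by the group
  structures it induces on nilpotent elements.\<close>

locale nil_group = big_cring R for R :: "'u ring" (structure) +
  fixes F :: "'u alg \<Rightarrow> 'u \<Rightarrow> 'u \<Rightarrow> 'u"
  assumes grp: "is_alg R B \<Longrightarrow> comm_group (nil_monoid F B)"
    and nat: "alg_hom R B C f \<Longrightarrow> x \<in> nil[B] \<Longrightarrow> y \<in> nil[B] \<Longrightarrow> f (F B x y) = F C (f x) (f y)"
begin

context
  fixes B assumes B: "is_alg R B"
begin

interpretation G: comm_group "nil_monoid F B" by (rule grp[OF B])

lemma F_closed: "x \<in> nil[B] \<Longrightarrow> y \<in> nil[B] \<Longrightarrow> F B x y \<in> nil[B]"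
  using G.m_closed by simp

lemma F_assoc: "x \<in> nil[B] \<Longrightarrow> y \<in> nil[B] \<Longrightarrow> z \<in> nil[B] \<Longrightarrow>
    F B (F B x y) z = F B x (F B y z)"
  using G.m_assoc by simp

lemma F_comm: "x \<in> nil[B] \<Longrightarrow> y \<in> nil[B] \<Longrightarrow> F B x y = F B y x"
  using G.m_comm by simp

lemma F_zero: "x \<in> nil[B] \<Longrightarrow> F B x \<zero>[B] = x" "x \<in> nil[B] \<Longrightarrow> F B \<zero>[B] x = x"
  using G.r_one[of x] G.l_one[of x] by simp_all

end

lemma F_natop: "natop R 2 (\<lambda>B xs. F B (xs ! 1) (xs ! 0))"
proof (rule natopI)
  fix B xs assume B: "is_alg R B" and "xs \<in> nilpts B 2"
  then obtain x y where "xs = [y, x]" "x \<in> nil[B]" "y \<in> nil[B]"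
    by (auto simp: nilpts_def length_Suc_conv numeral_2_eq_2)
  thus "F B (xs ! 1) (xs ! 0) \<in> carrier[B]" using F_closed[OF B] by simp
next
  fix B C f xs assume f: "alg_hom R B C f" and "xs \<in> nilpts B 2"
  then obtain x y where "xs = [y, x]" "x \<in> nil[B]" "y \<in> nil[B]"
    by (auto simp: nilpts_def length_Suc_conv numeral_2_eq_2)
  thus "F C (map f xs ! 1) (map f xs ! 0) = f (F B (xs ! 1) (xs ! 0))" using nat[OF f] by simp
qed

text \<open>Both unit laws fix the terms that involve only one variable; everything else is
  divisible by \<open>x y\<close>.\<close>

lemma F_form:
  assumes B: "is_alg R B" and x: "x \<in> nil[B]" and y: "y \<in> nil[B]"
  shows "\<exists>w\<in>carrier[B]. F B x y = x \<oplus>[B] y \<oplus>[B] x \<otimes>[B] y \<otimes>[B] w"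
proof -
  interpret B: big_cring "ring_of B" by (rule alg_big[OF B])
  obtain c where c: "\<And>j k. c j k \<in> carrier R"
    and F: "\<And>B x y. is_alg R B \<Longrightarrow> x \<in> nil[B] \<Longrightarrow> y \<in> nil[B] \<Longrightarrow> F B x y = kser2 c B x y"
    using natop2_kser2[OF F_natop] by (metis nth_Cons_0 nth_Cons_Suc One_nat_def)
  let ?a = "\<lambda>j x. kser (c j) B x"
  have ac: "?a j x \<in> carrier[B]" if "x \<in> nil[B]" for j x by (rule kser_closed[OF B c that])
  have a0: "?a 0 x = x"
    using F[OF B x B.zero_nil] F_zero(1)[OF B x] B.series_at_zero[of "\<lambda>j. ?a j x", OF ac[OF x]] by (simp add: kser2_def)
  \<comment> \<open>Compare coefficients in the unit law that puts zero for the first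
    argument.\<close>
  have az: "?a j \<zero>[B] = (if j = 1 then \<one>[B] else \<zero>[B])" for j
  proof -
    let ?d = "\<lambda>j. if j = 1 then \<one>[B] else \<zero>[B]"
    have "?a j \<zero>[B] \<ominus>\<^bsub>ring_of B\<^esub> ?d j = \<zero>[B]"
    proof (rule series_unique_all[OF B, where c = "\<lambda>j. ?a j \<zero>[B] \<ominus>\<^bsub>ring_of B\<^esub> ?d j"])
      fix C f y assume f: "alg_hom R B C f" and y: "y \<in> nil[C]"
      note fD = alg_homD[OF f]
      interpret C: big_cring "ring_of C" by (rule alg_big[OF fD(2)])
      interpret f: ring_hom_cring "ring_of B" "ring_of C" f
        using fD by (simp add: ring_hom_cring_def ring_hom_cring_axioms_def)
      have cc: "kser (c j) C \<zero>[C] \<in> carrier[C]" for j by (rule kser_closed[OF fD(2) c C.zero_nil])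
      have "series (ring_of C) (\<lambda>j. f (?a j \<zero>[B] \<ominus>\<^bsub>ring_of B\<^esub> ?d j)) y =
         series (ring_of C) (\<lambda>j. kser (c j) C \<zero>[C] \<ominus>\<^bsub>ring_of C\<^esub> (if j = 1 then \<one>[C] else \<zero>[C])) y"
        using kser_nat[OF f c B.zero_nil] ac[OF B.zero_nil] by (intro C.series_cong) (simp add: a_minus_def)
      also have "\<dots> = F C \<zero>[C] y \<ominus>[C] y"
        using y cc F[OF fD(2) C.zero_nil y] by (subst C.series_minus) (auto simp: C.series_monom kser2_def)
      also have "\<dots> = \<zero>[C]" using F_zero(2)[OF fD(2) y] y by simp
      finally show "series (ring_of C) (\<lambda>j. f (?a j \<zero>[B] \<ominus>\<^bsub>ring_of B\<^esub> ?d j)) y = \<zero>[C]" .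
    qed (use ac[OF B.zero_nil] in simp)
    thus ?thesis using ac[OF B.zero_nil] by simp
  qed
  let ?b = "\<lambda>j. series (ring_of B) (\<lambda>k. str_map B (c (Suc j) (Suc k))) x"
  have bc: "?b j \<in> carrier[B]" for j using str_closed[OF B c] x by (intro B.series_closed) auto
  \<comment> \<open>Each coefficient is its value at \<open>x = 0\<close>, known from
    \<open>az\<close>, plus a multiple of \<open>x\<close>.\<close>
  have as: "?a (Suc j) x = (if j = 0 then \<one>[B] else \<zero>[B]) \<oplus>[B] x \<otimes>[B] ?b j" for j
  proof -
    have "?a (Suc j) x = str_map B (c (Suc j) 0) \<oplus>[B] x \<otimes>[B] ?b j"
      unfolding kser_def using str_closed[OF B c] x by (intro B.series_shift) auto
    moreover have "str_map B (c (Suc j) 0) = ?a (Suc j) \<zero>[B]"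
      unfolding kser_def using str_closed[OF B c] by (intro B.series_at_zero[symmetric])
    ultimately show ?thesis using az[of "Suc j"] by simp
  qed
  define w where "w = series (ring_of B) ?b y"
  have w: "w \<in> carrier[B]" unfolding w_def using y bc by (rule B.series_closed)
  have "F B x y = ?a 0 x \<oplus>[B] y \<otimes>[B] series (ring_of B) (\<lambda>j. ?a (Suc j) x) y"
    unfolding F[OF B x y] kser2_def using y ac[OF x] by (intro B.series_shift)
  also have "series (ring_of B) (\<lambda>j. ?a (Suc j) x) y = \<one>[B] \<oplus>[B] x \<otimes>[B] w"
    unfolding as using y bc x by (subst B.series_add) (auto simp: B.series_monom B.series_smult w_def)
  finally have "F B x y = x \<oplus>[B] y \<otimes>[B] (\<one>[B] \<oplus>[B] x \<otimes>[B] w)" unfolding a0 .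
  also have "\<dots> = x \<oplus>[B] y \<oplus>[B] x \<otimes>[B] y \<otimes>[B] w"
    using nil_carrier[OF x] nil_carrier[OF y] w by algebra
  finally show ?thesis using w by blast
qed

end

lemma comm_group_transport:
  assumes G: "comm_group G" and h: "bij_betw h (carrier G) S"
    and m: "\<And>x y. x \<in> carrier G \<Longrightarrow> y \<in> carrier G \<Longrightarrow> h (x \<otimes>\<^bsub>G\<^esub> y) = m (h x) (h y)"
  shows "comm_group \<lparr>carrier = S, monoid.mult = m, one = h \<one>\<^bsub>G\<^esub>\<rparr>"
proof -
  interpret G: comm_group G by fact
  let ?H = "\<lparr>carrier = S, monoid.mult = m, one = h \<one>\<^bsub>G\<^esub>\<rparr>"
  have "h \<in> iso G ?H" using h m by (auto simp: iso_def hom_def bij_betw_def)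
  hence "comm_group (?H\<lparr>one := h \<one>\<^bsub>G\<^esub>\<rparr>)" by (rule G.iso_imp_img_comm_group)
  thus ?thesis by simp
qed

lemma nil_group_transport:
  fixes A :: "'u ring"
  assumes A: "big_cring A"
    and grp: "\<And>B. is_alg A B \<Longrightarrow> comm_group \<lparr>carrier = S B, monoid.mult = m B, one = e B\<rparr>"
    and bij: "\<And>B. is_alg A B \<Longrightarrow> bij_betw (\<phi> B) (S B) (nil[B])"
    and zero: "\<And>B. is_alg A B \<Longrightarrow> \<phi> B (e B) = \<zero>[B]"
    and r: "\<And>B C f x. alg_hom A B C f \<Longrightarrow> x \<in> S B \<Longrightarrow> r B C f x \<in> S C \<and> f (\<phi> B x) = \<phi> C (r B C f x)"
    and hom: "\<And>B C f x y. alg_hom A B C f \<Longrightarrow> x \<in> S B \<Longrightarrow> y \<in> S B \<Longrightarrow>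
        r B C f (m B x y) = m C (r B C f x) (r B C f y)"
    and F: "\<And>B x y. F B x y = \<phi> B (m B (inv_into (S B) (\<phi> B) x) (inv_into (S B) (\<phi> B) y))"
  shows "nil_group A F"
    and "\<And>B x y. is_alg A B \<Longrightarrow> x \<in> S B \<Longrightarrow> y \<in> S B \<Longrightarrow> \<phi> B (m B x y) = F B (\<phi> B x) (\<phi> B y)"
proof -
  show e: "\<phi> B (m B x y) = F B (\<phi> B x) (\<phi> B y)" if "is_alg A B" "x \<in> S B" "y \<in> S B" for B x y
    using bij[OF that(1)] that by (simp add: F bij_betw_def)
  show "nil_group A F"
  proof (intro nil_group.intro[OF A] nil_group_axioms.intro)
    fix B assume B: "is_alg A B"
    show "comm_group (nil_monoid F B)"
      using comm_group_transport[OF grp[OF B], of "\<phi> B" "nil[B]" "F B"] bij[OF B] e[OF B] zero[OF B]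
      by (simp add: nil_monoid_def)
  next
    fix B C f x y assume f: "alg_hom A B C f" and xy: "x \<in> nil[B]" "y \<in> nil[B]"
    note B = alg_homD(1)[OF f] and C = alg_homD(2)[OF f]
    have "x \<in> \<phi> B ` S B" "y \<in> \<phi> B ` S B" using bij[OF B] xy unfolding bij_betw_def by simp_all
    then obtain u v where uv: "u \<in> S B" "v \<in> S B" "x = \<phi> B u" "y = \<phi> B v" by blast
    have muv: "m B u v \<in> S B" using comm_group.axioms(1)[OF grp[OF B]] comm_monoid.axioms(1) monoid.m_closed uv by fastforce
    show "f (F B x y) = F C (f x) (f y)"
      using r[OF f] uv muv hom[OF f uv(1,2)] e[OF B uv(1,2)] e[OF C] by metis
  qed
qed

definition line_group :: "('u alg \<Rightarrow> 'u \<Rightarrow> 'u \<Rightarrow> 'u) \<Rightarrow> 'u group_psh" where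
  "line_group F = \<lparr>sec = (\<lambda>B. nil[B]), res = (\<lambda>B C f. f), pt = (\<lambda>B. \<zero>[B]), gadd = F\<rparr>"

lemma line_group_simps [simp]: "sec (line_group F) B = nil[B]" "res (line_group F) B C f = f"
  "pt (line_group F) B = \<zero>[B]" "gadd (line_group F) = F" "group_at (line_group F) B = nil_monoid F B"
  by (simp_all add: line_group_def group_at_def nil_monoid_def)

lemma (in nil_group) line_group_formal_Lie_group: "formal_Lie_group R (line_group F)"
proof -
  have "formal_Lie_variety R (line_group F)"
    unfolding formal_Lie_variety_def
  proof (intro conjI exI[of _ "{\<one>}"] ballI)
    show "fppf_sheaf R (line_group F)"
      by (rule nil_fppf_sheaf[OF infinite_univ]) (simp add: nil_sections_def)
    show "is_section R (line_group F)" unfolding is_section_def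
    proof (intro conjI allI impI)
      fix B assume "is_alg R B"
      then interpret B: cring "ring_of B" by (rule is_alg_cring)
      show "pt (line_group F) B \<in> sec (line_group F) B" by simp
    qed (simp add: alg_homD(9))
    have "ideal (Idl\<^bsub>R\<^esub> {\<one>}) R" by (rule genideal_ideal) simp
    moreover have "\<one> \<in> Idl\<^bsub>R\<^esub> {\<one>}" using genideal_self[of "{\<one>}"] by simp
    ultimately show "Idl\<^bsub>R\<^esub> {\<one>} = carrier R" by (rule ideal.one_imp_carrier)
    fix a
    show "pointed_iso_over R a (line_group F) Spf_power_series"
      unfolding pointed_iso_over_def
      by (rule exI[of _ "\<lambda>B x. x"]) (auto simp: Spf_power_series_def nil_def bij_betw_def simp del: nil_carrier)
  qed auto
  thus ?thesis unfolding formal_Lie_group_def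
    using grp nat alg_homD(8) by (auto simp: hom_def)
qed

text \<open>The elements defining the Zariski cover generate the unit ideal, so one of them is not
  zero. In a field it is a unit, hence a unit in every algebra, and the local coordinate there is a
  global one.\<close>

lemma formal_Lie_group_over_field:
  fixes K :: "'u ring"
  assumes K: "field K" "big_cring K" and Y: "formal_Lie_group K Y"
  obtains \<tau> F where "nil_group K F"
    "\<And>B. is_alg K B \<Longrightarrow> bij_betw (\<tau> B) (sec Y B) (nil[B])"
    "\<And>B. is_alg K B \<Longrightarrow> \<tau> B (pt Y B) = \<zero>[B]"
    "\<And>B x y. is_alg K B \<Longrightarrow> x \<in> sec Y B \<Longrightarrow> y \<in> sec Y B \<Longrightarrow> \<tau> B (gadd Y B x y) = F B (\<tau> B x) (\<tau> B y)"
    "\<And>B C f x. alg_hom K B C f \<Longrightarrow> x \<in> sec Y B \<Longrightarrow> res Y B C f x \<in> sec Y C \<and> f (\<tau> B x) = \<tau> C (res Y B C f x)"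
proof -
  interpret K: field K by fact
  note grp = Y[unfolded formal_Lie_group_def, THEN conjunct1, rule_format]
  note hom = Y[unfolded formal_Lie_group_def, THEN conjunct2, THEN conjunct1, rule_format]
  have var: "formal_Lie_variety K Y" using Y by (simp add: formal_Lie_group_def)
  obtain G where G: "G \<subseteq> carrier K" "Idl\<^bsub>K\<^esub> G = carrier K" "\<And>a. a \<in> G \<Longrightarrow> pointed_iso_over K a Y Spf_power_series"
    using var unfolding formal_Lie_variety_def by blast
  have "\<exists>a\<in>G. a \<noteq> \<zero>\<^bsub>K\<^esub>"
  proof (rule ccontr)
    assume "\<not> ?thesis"
    hence "Idl\<^bsub>K\<^esub> G \<subseteq> {\<zero>\<^bsub>K\<^esub>}" by (intro K.genideal_minimal[OF K.zeroideal]) auto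
    thus False using G(2) K.one_closed K.one_not_zero by auto
  qed
  then obtain a where a: "a \<in> G" "a \<noteq> \<zero>\<^bsub>K\<^esub>" by blast
  hence aU: "a \<in> Units K" using G(1) K.field_Units by auto
  have u: "str_map B a \<in> Units (ring_of B)" if B: "is_alg K B" for B
  proof -
    interpret B: cring "ring_of B" by (rule is_alg_cring[OF B])
    have h: "str_map B \<in> ring_hom K (ring_of B)" by (rule is_alg_str[OF B])
    have c: "a \<in> carrier K" "inv\<^bsub>K\<^esub> a \<in> carrier K" using aU by auto
    have "str_map B a \<otimes>[B] str_map B (inv\<^bsub>K\<^esub> a) = \<one>[B]"
      using ring_hom_mult[OF h c] ring_hom_one[OF h] aU by simp
    moreover from this have "str_map B (inv\<^bsub>K\<^esub> a) \<otimes>[B] str_map B a = \<one>[B]"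
      using ring_hom_closed[OF h] c by (simp add: B.m_comm)
    ultimately show ?thesis using ring_hom_closed[OF h] c unfolding Units_def by blast
  qed
  have Spf: "sec Spf_power_series B = nil[B]" "pt Spf_power_series B = \<zero>[B]"
    "res Spf_power_series B C f x = f x" for B C :: "'u alg" and f x
    by (simp_all add: Spf_power_series_def nil_def del: nil_carrier)
  obtain \<tau> where \<tau>1: "\<And>B. is_alg K B \<Longrightarrow> bij_betw (\<tau> B) (sec Y B) (nil[B]) \<and> \<tau> B (pt Y B) = \<zero>[B]"
    and \<tau>2: "\<And>B C f x. alg_hom K B C f \<Longrightarrow> x \<in> sec Y B \<Longrightarrow> \<tau> C (res Y B C f x) = f (\<tau> B x)"
    using G(3)[OF a(1)] u alg_homD(1) unfolding pointed_iso_over_def Spf by metis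
  have r: "res Y B C f x \<in> sec Y C \<and> f (\<tau> B x) = \<tau> C (res Y B C f x)" if f: "alg_hom K B C f" "x \<in> sec Y B" for B C f x
    using hom[OF f(1)] \<tau>2[OF f] f(2) by (auto simp: hom_def group_at_def)
  define F where "F B x y = \<tau> B (gadd Y B (inv_into (sec Y B) (\<tau> B) x) (inv_into (sec Y B) (\<tau> B) y))" for B x y
  have T: "nil_group K F" "\<And>B x y. is_alg K B \<Longrightarrow> x \<in> sec Y B \<Longrightarrow> y \<in> sec Y B \<Longrightarrow> \<tau> B (gadd Y B x y) = F B (\<tau> B x) (\<tau> B y)"
  proof -
    have g: "\<And>B. is_alg K B \<Longrightarrow> comm_group \<lparr>carrier = sec Y B, monoid.mult = gadd Y B, one = pt Y B\<rparr>"
      using grp by (simp add: group_at_def)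
    have h: "\<And>B C f x y. alg_hom K B C f \<Longrightarrow> x \<in> sec Y B \<Longrightarrow> y \<in> sec Y B \<Longrightarrow>
        res Y B C f (gadd Y B x y) = gadd Y C (res Y B C f x) (res Y B C f y)"
      using hom by (auto simp: hom_def group_at_def)
    note T = nil_group_transport[OF K(2), where S = "sec Y" and m = "gadd Y" and e = "pt Y" and \<phi> = \<tau> and r = "res Y" and F = F]
    show "nil_group K F" by (rule T) (use g h \<tau>1 r F_def in blast)+
    show "\<And>B x y. is_alg K B \<Longrightarrow> x \<in> sec Y B \<Longrightarrow> y \<in> sec Y B \<Longrightarrow> \<tau> B (gadd Y B x y) = F B (\<tau> B x) (\<tau> B y)"
      by (rule T) (use g h \<tau>1 r F_def in blast)+
  qed
  show thesis by (rule that[of F \<tau>]) (use T \<tau>1 r in blast)+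
qed

section \<open>Binary forms and the binomial theorem\<close>

primrec nat_in :: "('a, 'm) ring_scheme \<Rightarrow> nat \<Rightarrow> 'a" where
  "nat_in R 0 = \<zero>\<^bsub>R\<^esub>"
| "nat_in R (Suc i) = nat_in R i \<oplus>\<^bsub>R\<^esub> \<one>\<^bsub>R\<^esub>"

definition form :: "('a, 'm) ring_scheme \<Rightarrow> nat \<Rightarrow> (nat \<Rightarrow> 'a) \<Rightarrow> 'a \<Rightarrow> 'a \<Rightarrow> 'a" where
  "form R n a x y = (\<Oplus>\<^bsub>R\<^esub>s\<in>{..n}. (a s \<otimes>\<^bsub>R\<^esub> y [^]\<^bsub>R\<^esub> (n - s)) \<otimes>\<^bsub>R\<^esub> x [^]\<^bsub>R\<^esub> s)"

context cring
begin

lemma nat_in_closed [simp]: "nat_in R i \<in> carrier R"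
  by (induction i) auto

lemma nat_in_add_pow: "nat_in R i = [i] \<cdot> \<one>"
  by (induction i) (simp_all add: add.nat_pow_Suc)

lemma nat_in_add: "nat_in R (i + j) = nat_in R i \<oplus> nat_in R j"
  by (induction j) (simp_all add: a_assoc)

lemma nat_in_mult: "nat_in R (i * j) = nat_in R i \<otimes> nat_in R j"
  by (induction i) (simp_all add: nat_in_add l_distr a_comm)

lemma nat_in_one: "nat_in R 1 = \<one>"
  by simp

lemma nat_in_pow: "nat_in R (i ^ j) = nat_in R i [^] (j :: nat)"
  by (induction j) (simp_all add: nat_in_mult m_comm)

lemma nat_in_sum: "finite I \<Longrightarrow> nat_in R (\<Sum>i\<in>I. f i) = (\<Oplus>i\<in>I. nat_in R (f i))"
  by (induction I rule: finite_induct) (simp_all add: nat_in_add)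

lemma form_closed:
  assumes "\<And>s. a s \<in> carrier R" "x \<in> carrier R" "y \<in> carrier R" shows "form R n a x y \<in> carrier R"
  unfolding form_def using assms by (intro finsum_closed) auto

lemma form_cong: "(\<And>s. s \<le> n \<Longrightarrow> a s = b s) \<Longrightarrow> (\<And>s. b s \<in> carrier R) \<Longrightarrow> x \<in> carrier R \<Longrightarrow> y \<in> carrier R \<Longrightarrow>
    form R n a x y = form R n b x y"
  unfolding form_def by (intro finsum_cong') auto

lemma form_add:
  assumes "\<And>s. a s \<in> carrier R" "\<And>s. b s \<in> carrier R" "x \<in> carrier R" "y \<in> carrier R"
  shows "form R n (\<lambda>s. a s \<oplus> b s) x y = form R n a x y \<oplus> form R n b x y"
proof -
  have "form R n (\<lambda>s. a s \<oplus> b s) x y =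
     (\<Oplus>s\<in>{..n}. (a s \<otimes> y [^] (n - s)) \<otimes> x [^] s \<oplus> (b s \<otimes> y [^] (n - s)) \<otimes> x [^] s)"
    unfolding form_def using assms by (intro finsum_cong') (auto simp: l_distr)
  also have "\<dots> = form R n a x y \<oplus> form R n b x y"
    unfolding form_def using assms by (intro finsum_addf) auto
  finally show ?thesis .
qed

lemma form_smult:
  assumes "\<And>s. a s \<in> carrier R" "r \<in> carrier R" "x \<in> carrier R" "y \<in> carrier R"
  shows "form R n (\<lambda>s. r \<otimes> a s) x y = r \<otimes> form R n a x y"
proof -
  have "form R n (\<lambda>s. r \<otimes> a s) x y = (\<Oplus>s\<in>{..n}. r \<otimes> ((a s \<otimes> y [^] (n - s)) \<otimes> x [^] s))"
    unfolding form_def using assms by (intro finsum_cong') (auto simp: m_assoc)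
  also have "\<dots> = r \<otimes> form R n a x y"
    unfolding form_def using assms by (subst finsum_rdistr) auto
  finally show ?thesis .
qed

lemma form_minus:
  assumes "\<And>s. a s \<in> carrier R" "\<And>s. b s \<in> carrier R" "x \<in> carrier R" "y \<in> carrier R"
  shows "form R n (\<lambda>s. a s \<ominus> b s) x y = form R n a x y \<ominus> form R n b x y"
proof -
  have "form R n (\<lambda>s. a s \<ominus> b s) x y = form R n (\<lambda>s. a s \<oplus> \<ominus> \<one> \<otimes> b s) x y"
    using assms by (simp add: a_minus_def l_minus)
  also have "\<dots> = form R n a x y \<oplus> \<ominus> \<one> \<otimes> form R n b x y"
    using assms by (subst form_add) (auto simp: form_smult)
  finally show ?thesis using assms form_closed[of b x y n] by (simp add: a_minus_def l_minus)
qed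

lemma form_single:
  assumes "c \<in> carrier R" "x \<in> carrier R" "y \<in> carrier R" "k \<le> n"
  shows "form R n (\<lambda>s. if s = k then c else \<zero>) x y = c \<otimes> y [^] (n - k) \<otimes> x [^] k"
proof -
  have "form R n (\<lambda>s. if s = k then c else \<zero>) x y =
      (\<Oplus>s\<in>{..n}. if k = s then c \<otimes> y [^] (n - s) \<otimes> x [^] s else \<zero>)"
    unfolding form_def using assms by (intro finsum_cong') auto
  also have "\<dots> = c \<otimes> y [^] (n - k) \<otimes> x [^] k" using assms by (intro finsum_singleton) auto
  finally show ?thesis .
qed

lemma binomial_form:
  assumes x: "x \<in> carrier R" and y: "y \<in> carrier R"
  shows "(x \<oplus> y) [^] n = form R n (\<lambda>s. nat_in R (n choose s)) x y"
proof (induction n)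
  case 0
  show ?case using x y by (simp add: form_def)
next
  case (Suc m)
  let ?S = "form R m (\<lambda>s. nat_in R (m choose s)) x y"
  let ?c = "\<lambda>k. nat_in R (m choose k)"
  have S: "?S \<in> carrier R" using x y by (intro form_closed) auto
  have A: "x \<otimes> ?S = (\<Oplus>k\<in>{..m}. ?c k \<otimes> y [^] (m - k) \<otimes> x [^] Suc k)"
    unfolding form_def using x y
    by (subst finsum_rdistr) (auto intro!: finsum_cong' simp: m_ac)
  let ?g = "\<lambda>k. ?c k \<otimes> y [^] (Suc m - k) \<otimes> x [^] k"
  have "y \<otimes> ?S = (\<Oplus>k\<in>{..m}. ?g k)"
    unfolding form_def using x y
    by (subst finsum_rdistr) (auto intro!: finsum_cong' simp: m_ac Suc_diff_le)
  also have "\<dots> = (\<Oplus>k\<in>{..Suc m}. ?g k)" using x y by (simp add: Pi_def binomial_eq_0)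
  also have "\<dots> = (\<Oplus>k\<in>{..m}. ?g (Suc k)) \<oplus> ?g 0" using x y by (intro finsum_Suc2) auto
  finally have B: "y \<otimes> ?S = (\<Oplus>k\<in>{..m}. ?g (Suc k)) \<oplus> ?g 0" .
  have "form R (Suc m) (\<lambda>s. nat_in R (Suc m choose s)) x y =
    (\<Oplus>k\<in>{..m}. nat_in R (Suc m choose Suc k) \<otimes> y [^] (m - k) \<otimes> x [^] Suc k) \<oplus> ?g 0"
    unfolding form_def using x y by (subst finsum_Suc2) auto
  also have "(\<Oplus>k\<in>{..m}. nat_in R (Suc m choose Suc k) \<otimes> y [^] (m - k) \<otimes> x [^] Suc k) =
     (\<Oplus>k\<in>{..m}. ?c k \<otimes> y [^] (m - k) \<otimes> x [^] Suc k \<oplus> ?g (Suc k))"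
    using x y by (intro finsum_cong') (auto simp: nat_in_add l_distr)
  also have "\<dots> = x \<otimes> ?S \<oplus> (\<Oplus>k\<in>{..m}. ?g (Suc k))"
    unfolding A using x y by (intro finsum_addf) auto
  also have "(x \<otimes> ?S \<oplus> (\<Oplus>k\<in>{..m}. ?g (Suc k))) \<oplus> ?g 0 = x \<otimes> ?S \<oplus> y \<otimes> ?S"
    unfolding B using x y S by (subst a_assoc) (auto intro!: finsum_closed)
  also have "\<dots> = (x \<oplus> y) [^] Suc m" using S x y Suc by (simp add: l_distr m_comm)
  finally show ?case by simp
qed

lemma pow_add_square_zero:
  assumes t: "t \<in> carrier R" "t \<otimes> t = \<zero>" and y: "y \<in> carrier R"
  shows "(t \<oplus> y) [^] Suc s = y [^] Suc s \<oplus> t \<otimes> (nat_in R (Suc s) \<otimes> y [^] s)"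
proof (induction s)
  case 0
  show ?case using t y by (simp add: a_comm)
next
  case (Suc s)
  define Y where "Y = y [^] s"
  define N where "N = nat_in R (Suc s)"
  have c: "Y \<in> carrier R" "N \<in> carrier R" using y by (simp_all add: Y_def N_def del: nat_in.simps)
  have "(t \<oplus> y) [^] Suc (Suc s) = (Y \<otimes> y \<oplus> t \<otimes> (N \<otimes> Y)) \<otimes> (t \<oplus> y)"
    unfolding nat_pow_Suc[of _ "Suc s"] Suc by (simp add: Y_def N_def)
  also have "\<dots> = (Y \<otimes> y) \<otimes> y \<oplus> t \<otimes> ((N \<oplus> \<one>) \<otimes> (Y \<otimes> y)) \<oplus> (t \<otimes> t) \<otimes> (N \<otimes> Y)"
    using c t(1) y by algebra
  also have "\<dots> = (Y \<otimes> y) \<otimes> y \<oplus> t \<otimes> ((N \<oplus> \<one>) \<otimes> (Y \<otimes> y))" using c t y by simp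
  finally show ?case by (simp add: Y_def N_def)
qed

lemma form_square_zero:
  assumes t: "t \<in> carrier R" "t \<otimes> t = \<zero>" and y: "y \<in> carrier R" and a: "\<And>s. a s \<in> carrier R" and a0: "a 0 = \<zero>"
  shows "form R (Suc m) a t y = a 1 \<otimes> t \<otimes> y [^] m"
proof -
  have "form R (Suc m) a t y = form R (Suc m) (\<lambda>s. if s = 1 then a 1 else \<zero>) t y"
    unfolding form_def
  proof (intro finsum_cong')
    fix s
    have "t [^] s = \<zero>" if "(2::nat) \<le> s"
      by (rule pow_zero_mono[of t 2]) (use that t in \<open>auto simp: numeral_2_eq_2\<close>)
    hence "s = 0 \<or> s = 1 \<or> t [^] s = \<zero>" by (cases "2 \<le> s") auto
    thus "a s \<otimes> y [^] (Suc m - s) \<otimes> t [^] s = (if s = 1 then a 1 else \<zero>) \<otimes> y [^] (Suc m - s) \<otimes> t [^] s"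
      using a a0 y by (auto simp: t)
  qed (use a t y in auto)
  also have "\<dots> = a 1 \<otimes> y [^] m \<otimes> t" using t y a by (subst form_single) auto
  finally show ?thesis using a t y by (simp add: m_ac)
qed

text \<open>First order Taylor expansion; the form multiplied by \<open>t\<close> is the partial
  derivative in the first variable.\<close>

lemma form_add_square_zero:
  assumes t: "t \<in> carrier R" "t \<otimes> t = \<zero>" and y: "y \<in> carrier R" and z: "z \<in> carrier R" and a: "\<And>s. a s \<in> carrier R"
  shows "form R (Suc m) a (t \<oplus> y) z = form R (Suc m) a y z \<oplus> t \<otimes> form R m (\<lambda>k. nat_in R (Suc k) \<otimes> a (Suc k)) y z"
proof -
  let ?g = "\<lambda>x s. a s \<otimes> z [^] (Suc m - s) \<otimes> x [^] s"
  have ex: "form R (Suc m) a x z = (\<Oplus>k\<in>{..m}. ?g x (Suc k)) \<oplus> ?g x 0" if "x \<in> carrier R" for x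
    unfolding form_def using a z that by (intro finsum_Suc2) auto
  have e: "?g (t \<oplus> y) (Suc k) = ?g y (Suc k) \<oplus> t \<otimes> ((nat_in R (Suc k) \<otimes> a (Suc k)) \<otimes> z [^] (m - k) \<otimes> y [^] k)" for k
  proof -
    define Y where "Y = y [^] k"
    define N where "N = nat_in R (Suc k)"
    define Z where "Z = a (Suc k) \<otimes> z [^] (m - k)"
    have c: "Y \<in> carrier R" "N \<in> carrier R" "a (Suc k) \<in> carrier R" "z [^] (m - k) \<in> carrier R"
      using y a z by (simp_all add: Y_def N_def del: nat_in.simps)
    have "(t \<oplus> y) [^] Suc k = Y \<otimes> y \<oplus> t \<otimes> (N \<otimes> Y)"
      using pow_add_square_zero[OF t y, of k] by (simp add: Y_def N_def)
    moreover have "a (Suc k) \<otimes> z [^] (m - k) \<otimes> (Y \<otimes> y \<oplus> t \<otimes> (N \<otimes> Y)) =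
       a (Suc k) \<otimes> z [^] (m - k) \<otimes> (Y \<otimes> y) \<oplus> t \<otimes> ((N \<otimes> a (Suc k)) \<otimes> z [^] (m - k) \<otimes> Y)"
      using c t(1) y by (simp add: r_distr m_ac)
    ultimately show ?thesis by (simp add: Y_def N_def)
  qed
  have "(\<Oplus>k\<in>{..m}. ?g (t \<oplus> y) (Suc k)) =
     (\<Oplus>k\<in>{..m}. ?g y (Suc k) \<oplus> t \<otimes> ((nat_in R (Suc k) \<otimes> a (Suc k)) \<otimes> z [^] (m - k) \<otimes> y [^] k))"
    using a z t(1) y e by (intro finsum_cong') auto
  also have "\<dots> = (\<Oplus>k\<in>{..m}. ?g y (Suc k)) \<oplus> (\<Oplus>k\<in>{..m}. t \<otimes> ((nat_in R (Suc k) \<otimes> a (Suc k)) \<otimes> z [^] (m - k) \<otimes> y [^] k))"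
    using a z t(1) y by (intro finsum_addf) auto
  also have "(\<Oplus>k\<in>{..m}. t \<otimes> ((nat_in R (Suc k) \<otimes> a (Suc k)) \<otimes> z [^] (m - k) \<otimes> y [^] k)) =
     t \<otimes> form R m (\<lambda>k. nat_in R (Suc k) \<otimes> a (Suc k)) y z"
    unfolding form_def using a z t(1) y by (subst finsum_rdistr) (auto simp del: nat_in.simps)
  finally have e2: "(\<Oplus>k\<in>{..m}. ?g (t \<oplus> y) (Suc k)) = (\<Oplus>k\<in>{..m}. ?g y (Suc k)) \<oplus> t \<otimes> form R m (\<lambda>k. nat_in R (Suc k) \<otimes> a (Suc k)) y z" .
  define P where "P = (\<Oplus>k\<in>{..m}. ?g y (Suc k))"
  define Q where "Q = t \<otimes> form R m (\<lambda>k. nat_in R (Suc k) \<otimes> a (Suc k)) y z"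
  define G where "G = a 0 \<otimes> z [^] (Suc m)"
  have c: "P \<in> carrier R" "Q \<in> carrier R" "G \<in> carrier R"
    using a z t(1) y by (auto simp: P_def Q_def G_def simp del: nat_in.simps intro!: finsum_closed form_closed)
  have "form R (Suc m) a (t \<oplus> y) z = (P \<oplus> Q) \<oplus> G"
    using ex[of "t \<oplus> y"] e2 a z t(1) y by (simp add: P_def Q_def G_def)
  also have "\<dots> = (P \<oplus> G) \<oplus> Q" using c by (simp add: a_ac)
  also have "P \<oplus> G = form R (Suc m) a y z" using ex[OF y] a z y by (simp add: P_def G_def)
  finally show ?thesis by (simp add: Q_def)
qed

lemma form_series:
  assumes x: "x \<in> nil R" and y: "y \<in> nil R" and a: "\<And>s. a s \<in> carrier R"
  shows "series R (\<lambda>s. series R (\<lambda>k. if s + k = n then a s else \<zero>) y) x = form R n a x y"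
proof -
  have i: "series R (\<lambda>k. if s + k = n then a s else \<zero>) y = (if s \<le> n then a s \<otimes> y [^] (n - s) else \<zero>)" for s
  proof (cases "s \<le> n")
    case True
    hence "(\<lambda>k. if s + k = n then a s else \<zero>) = (\<lambda>k. if k = n - s then a s else \<zero>)"
      by (auto simp: fun_eq_iff)
    thus ?thesis using series_monom[OF y a[of s], of "n - s"] True by simp
  next
    case False
    hence "(\<lambda>k. if s + k = n then a s else \<zero>) = (\<lambda>k. \<zero>)" by (auto simp: fun_eq_iff)
    thus ?thesis using series_zero[OF y] False by simp
  qed
  obtain N where N: "x [^] (N::nat) = \<zero>" using x by (elim nilE)
  have xc: "x \<in> carrier R" and yc: "y \<in> carrier R" using x y by auto
  have N': "x [^] (N + Suc n) = \<zero>" by (rule pow_zero_mono[OF xc N]) simp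
  have "series R (\<lambda>s. series R (\<lambda>k. if s + k = n then a s else \<zero>) y) x
     = (\<Oplus>s\<in>{..<N + Suc n}. (if s \<le> n then a s \<otimes> y [^] (n - s) else \<zero>) \<otimes> x [^] s)"
    unfolding i using a yc by (intro series_eq[OF xc N']) auto
  also have "\<dots> = (\<Oplus>s\<in>{..n}. (if s \<le> n then a s \<otimes> y [^] (n - s) else \<zero>) \<otimes> x [^] s)"
    using a xc yc by (intro add.finprod_mono_neutral_cong_right) auto
  also have "\<dots> = form R n a x y"
    unfolding form_def using a xc yc by (intro finsum_cong') auto
  finally show ?thesis .
qed

lemma form_pow_args:
  assumes x: "x \<in> carrier R" and y: "y \<in> carrier R" and a: "\<And>s. a s \<in> carrier R" and p: "0 < (p::nat)"
    and z: "\<And>s. \<not> p dvd s \<Longrightarrow> s \<le> p * m \<Longrightarrow> a s = \<zero>"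
  shows "form R (p * m) a x y = form R m (\<lambda>s. a (p * s)) (x [^] p) (y [^] p)"
proof -
  let ?f = "\<lambda>s. a s \<otimes> y [^] (p * m - s) \<otimes> x [^] s"
  have "form R (p * m) a x y = (\<Oplus>s\<in>(\<lambda>s. p * s) ` {..m}. ?f s)"
    unfolding form_def
  proof (rule add.finprod_mono_neutral_cong_right)
    fix s assume s: "s \<in> {..p * m} - (\<lambda>s. p * s) ` {..m}"
    have "\<not> p dvd s"
    proof
      assume "p dvd s"
      then obtain k where k: "s = p * k" by (elim dvdE)
      hence "k \<le> m" using s p by auto
      thus False using s k by auto
    qed
    thus "?f s = \<zero>" using s z x y by simp
  qed (use x y a p in auto)
  also have "\<dots> = (\<Oplus>s\<in>{..m}. ?f (p * s))"
    using a x y p by (subst add.finprod_reindex) (auto simp: inj_on_def)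
  also have "\<dots> = form R m (\<lambda>s. a (p * s)) (x [^] p) (y [^] p)"
    unfolding form_def using a x y by (intro finsum_cong') (auto simp: nat_pow_pow right_diff_distrib')
  finally show ?thesis .
qed

end

lemma hom_nat_in: "cring R \<Longrightarrow> cring S \<Longrightarrow> f \<in> ring_hom R S \<Longrightarrow> f (nat_in R i) = nat_in S i"
proof -
  assume "cring R" "cring S" "f \<in> ring_hom R S"
  then interpret f: ring_hom_cring R S f by (simp add: ring_hom_cring_def ring_hom_cring_axioms_def)
  show ?thesis by (induction i) auto
qed

lemma hom_form:
  assumes "cring R" "cring S" "f \<in> ring_hom R S" "\<And>s. a s \<in> carrier R" "x \<in> carrier R" "y \<in> carrier R"
  shows "f (form R n a x y) = form S n (\<lambda>s. f (a s)) (f x) (f y)"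
proof -
  interpret f: ring_hom_cring R S f using assms by (simp add: ring_hom_cring_def ring_hom_cring_axioms_def)
  show ?thesis unfolding form_def using assms
    by (subst f.hom_finsum) (auto intro!: f.S.finsum_cong' simp: comp_def)
qed

section \<open>Characteristic\<close>

text \<open>\<open>p\<close> is the characteristic, and \<open>p = 0\<close> is allowed: then
  \<open>p dvd i\<close> means \<open>i = 0\<close>. This lets one argument serve both halves of the
  theorem.\<close>

locale line_field = big_cring R + field R for R :: "'u ring" (structure) +
  fixes p :: nat
  assumes char_iff: "nat_in R i = \<zero> \<longleftrightarrow> p dvd i"
    and p_prime: "p \<noteq> 0 \<Longrightarrow> Factorial_Ring.prime p"
begin

lemma alg_nat_in: "is_alg R B \<Longrightarrow> str_map B (nat_in R i) = nat_in (ring_of B) i"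
  by (rule hom_nat_in[OF is_cring is_alg_cring is_alg_str])

lemma alg_str_zero: "is_alg R B \<Longrightarrow> str_map B \<zero> = \<zero>[B]"
  using alg_homD(9)[OF str_alg_hom[OF is_cring]] by simp

lemma alg_str_one: "is_alg R B \<Longrightarrow> str_map B \<one> = \<one>[B]"
  using ring_hom_one[OF is_alg_str] .

lemma alg_nat_in_zero: "is_alg R B \<Longrightarrow> p dvd i \<Longrightarrow> nat_in (ring_of B) i = \<zero>[B]"
  using alg_nat_in[of B i] alg_str_zero[of B] char_iff[of i] by metis

lemma prime_dvd_binomial: "p \<noteq> 0 \<Longrightarrow> 0 < k \<Longrightarrow> k < p \<Longrightarrow> p dvd (p choose k)"
proof -
  assume h: "p \<noteq> 0" "0 < k" "k < p"
  have "p dvd k * (p choose k)" using times_binomial_minus1_eq[of k p] h by simp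
  moreover have "\<not> p dvd k" using h by (auto dest: dvd_imp_le)
  ultimately show ?thesis using p_prime h prime_dvd_mult_iff by blast
qed

lemma frobenius_add:
  assumes p: "p \<noteq> 0" and B: "is_alg R B" and x: "x \<in> carrier[B]" and y: "y \<in> carrier[B]"
  shows "(x \<oplus>[B] y) [^][B] p = x [^][B] p \<oplus>[B] y [^][B] p"
proof -
  interpret B: big_cring "ring_of B" by (rule alg_big[OF B])
  let ?d = "\<lambda>j s. if s = j then \<one>[B] else \<zero>[B]"
  have "(x \<oplus>[B] y) [^][B] p = form (ring_of B) p (\<lambda>s. nat_in (ring_of B) (p choose s)) x y"
    by (rule B.binomial_form[OF x y])
  also have "\<dots> = form (ring_of B) p (\<lambda>s. ?d p s \<oplus>[B] ?d 0 s) x y"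
  proof (rule B.form_cong)
    fix s assume s: "s \<le> p"
    show "nat_in (ring_of B) (p choose s) = ?d p s \<oplus>[B] ?d 0 s"
    proof (cases "s = 0 \<or> s = p")
      case True
      thus ?thesis using p by auto
    next
      case False
      hence "nat_in (ring_of B) (p choose s) = \<zero>[B]"
        using s p by (intro alg_nat_in_zero[OF B] prime_dvd_binomial) auto
      thus ?thesis using False by simp
    qed
  qed (use x y in auto)
  also have "\<dots> = x [^][B] p \<oplus>[B] y [^][B] p"
    using x y by (subst B.form_add) (auto simp: B.form_single)
  finally show ?thesis .
qed

lemma frobenius_pow_add:
  assumes p: "p \<noteq> 0" and B: "is_alg R B" and x: "x \<in> carrier[B]" and y: "y \<in> carrier[B]"
  shows "(x \<oplus>[B] y) [^][B] (p ^ k) = x [^][B] (p ^ k) \<oplus>[B] y [^][B] (p ^ k)"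
proof (induction k)
  case 0
  interpret B: big_cring "ring_of B" by (rule alg_big[OF B])
  show ?case using x y by simp
next
  case (Suc k)
  interpret B: big_cring "ring_of B" by (rule alg_big[OF B])
  have "z [^][B] (p ^ Suc k) = (z [^][B] (p ^ k)) [^][B] p"
    if "z \<in> carrier[B]" for z using that by (simp add: B.nat_pow_pow mult.commute)
  thus ?case using Suc x y frobenius_add[OF p B] by simp
qed

lemma frobenius_nat_in:
  assumes p: "p \<noteq> 0" and B: "is_alg R B"
  shows "nat_in (ring_of B) i [^][B] p = nat_in (ring_of B) i"
proof -
  interpret B: big_cring "ring_of B" by (rule alg_big[OF B])
  show ?thesis
  proof (induction i)
    case 0
    show ?case using B.nat_pow_zero[OF p] by simp
  next
    case (Suc i)
    show ?case
      using frobenius_add[OF p B B.nat_in_closed[of i] B.one_closed] unfolding nat_in.simps Suc B.nat_pow_one .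
  qed
qed

end

section \<open>Symmetric cocycles\<close>

text \<open>Tested at \<open>T\<close> in \<open>B[T]/(T^(n+1))\<close>, where \<open>T^n\<close> is
  not a zero divisor for constants. It lets a statement about the degree \<open>n\<close> part be
  proved after multiplication by a generic \<open>t^n\<close>.\<close>

lemma (in big_cring) generic_coefficient:
  assumes B: "is_alg R B" and a: "a \<in> carrier[B]"
    and z: "\<And>C f t. alg_hom R B C f \<Longrightarrow> t \<in> carrier[C] \<Longrightarrow> t [^][C] Suc n = \<zero>[C] \<Longrightarrow>
      f a \<otimes>[C] t [^][C] n = \<zero>[C]"
  shows "a = \<zero>[B]"
proof -
  interpret B: big_cring "ring_of B" by (rule alg_big[OF B])
  have "(if n = n then a else \<zero>[B]) = \<zero>[B]"
  proof (rule series_unique[OF B, where c = "\<lambda>k. if k = n then a else \<zero>[B]" and N = "Suc n"])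
    fix C f y assume f: "alg_hom R B C f" and y: "y \<in> carrier[C]" "y [^][C] Suc n = \<zero>[C]"
    note fD = alg_homD[OF f]
    interpret C: big_cring "ring_of C" by (rule alg_big[OF fD(2)])
    have "series (ring_of C) (\<lambda>k. f (if k = n then a else \<zero>[B])) y =
        series (ring_of C) (\<lambda>k. if k = n then f a else \<zero>[C]) y"
      by (intro C.series_cong) (simp add: fD(9))
    thus "series (ring_of C) (\<lambda>k. f (if k = n then a else \<zero>[B])) y = \<zero>[C]"
      using z[OF f y] C.series_monom[OF nilI[OF y] fD(7)[OF a]] by simp
  qed (use a in auto)
  thus ?thesis by simp
qed

definition aform :: "nat \<Rightarrow> (nat \<Rightarrow> 'u) \<Rightarrow> 'u alg \<Rightarrow> 'u \<Rightarrow> 'u \<Rightarrow> 'u" where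
  "aform n h B x y = form (ring_of B) n (\<lambda>s. str_map B (h s)) x y"

context big_cring
begin

lemma aform_closed:
  assumes "is_alg R B" "\<And>s. h s \<in> carrier R" "x \<in> carrier[B]" "y \<in> carrier[B]"
  shows "aform n h B x y \<in> carrier[B]"
  unfolding aform_def
  by (rule cring.form_closed[OF is_alg_cring[OF assms(1)] str_closed[OF assms(1,2)] assms(3,4)])

lemma aform_nat:
  assumes f: "alg_hom R B C f" and h: "\<And>s. h s \<in> carrier R" and "x \<in> carrier[B]" "y \<in> carrier[B]"
  shows "f (aform n h B x y) = aform n h C (f x) (f y)"
  unfolding aform_def using alg_homD(6)[OF f h]
  by (subst hom_form[OF alg_homD(4,5,3)[OF f] str_closed[OF alg_homD(1)[OF f] h] assms(3,4)]) simp

lemma aform_zero: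
  assumes h: "\<And>s. h s \<in> carrier R"
    and z: "\<And>B x y. is_alg R B \<Longrightarrow> x \<in> nil[B] \<Longrightarrow> y \<in> nil[B] \<Longrightarrow> aform n h B x y = \<zero>[B]"
    and s: "s \<le> n"
  shows "h s = \<zero>"
proof -
  let ?c = "\<lambda>s k. if s + k = n then h s else \<zero>"
  have "?c s (n - s) = \<zero>"
  proof (rule kser2_unique[where c = ?c])
    fix B x y assume B: "is_alg R B" and x: "x \<in> nil[B]" and y: "y \<in> nil[B]"
    interpret B: big_cring "ring_of B" by (rule alg_big[OF B])
    have s0: "str_map B \<zero> = \<zero>[B]" using alg_homD(9)[OF str_alg_hom[OF is_cring B]] by simp
    have "kser2 ?c B x y = series (ring_of B) (\<lambda>s. series (ring_of B) (\<lambda>k. if s + k = n then str_map B (h s) else \<zero>[B]) x) y"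
      unfolding kser2_def kser_def by (intro B.series_cong arg_cong2[where f = "series (ring_of B)"] refl ext) (simp add: s0)
    also have "\<dots> = aform n h B y x"
      unfolding aform_def by (rule B.form_series[OF y x str_closed[OF B h]])
    finally show "kser2 ?c B x y = \<zero>[B]" using z[OF B y x] by simp
  qed (use h in auto)
  thus ?thesis using s by simp
qed

end

context line_field
begin

text \<open>Homogeneous 2-cocycles of the additive group, as in Lazard's comparison of formal group
  laws that agree up to degree \<open>n\<close>.\<close>

definition cocycle :: "nat \<Rightarrow> (nat \<Rightarrow> 'u) \<Rightarrow> bool" where
  "cocycle n h \<longleftrightarrow> (\<forall>B x y z. is_alg R B \<longrightarrow> x \<in> nil[B] \<longrightarrow> y \<in> nil[B] \<longrightarrow> z \<in> nil[B] \<longrightarrow>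
     aform n h B x y \<oplus>[B] aform n h B (x \<oplus>[B] y) z =
     aform n h B x (y \<oplus>[B] z) \<oplus>[B] aform n h B y z)"

text \<open>What the equation [p] = 0 says about the leading degree: the cocycle summed along the
  pairs \<open>i x\<close>, \<open>x\<close>, in the way in which a multiple is built up one
  addition at a time.\<close>

definition torsion :: "nat \<Rightarrow> (nat \<Rightarrow> 'u) \<Rightarrow> bool" where
  "torsion n h \<longleftrightarrow> (\<forall>B x. is_alg R B \<longrightarrow> x \<in> nil[B] \<longrightarrow>
     (\<Oplus>\<^bsub>ring_of B\<^esub>i\<in>{..<p}. aform n h B (nat_in (ring_of B) i \<otimes>[B] x) x) = \<zero>[B])"

text \<open>Differentiate the cocycle identity in its first variable at zero, by inserting a
  \<open>t\<close> with \<open>t^2 = 0\<close>, and compare coefficients of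
  \<open>Y^k Z^(m-k)\<close>.\<close>

lemma cocycle_derivative:
  assumes h: "\<And>s. h s \<in> carrier R" and h0: "h 0 = \<zero>" and coc: "cocycle (Suc m) h" and k: "k < m"
  shows "nat_in R (Suc k) \<otimes> h (Suc k) = h 1 \<otimes> nat_in R (m choose k)"
proof -
  define d where "d k = nat_in R (Suc k) \<otimes> h (Suc k)" for k
  define b where "b k = h 1 \<otimes> nat_in R (m choose k)" for k
  \<comment> \<open>The difference of both sides of the differentiated identity. The extra term at
    \<open>k = m\<close> comes from the value of the form at \<open>t\<close>, \<open>Y\<close>,
    which is \<open>h 1\<close> times \<open>t Y^m\<close>; this is why only \<open>k < m\<close> is
    claimed.\<close>
  define e where "e k = (d k \<ominus> b k) \<oplus> (if k = m then h 1 else \<zero>)" for k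
  have c: "d k \<in> carrier R" "b k \<in> carrier R" "e k \<in> carrier R" for k
    using h by (simp_all add: d_def b_def e_def del: nat_in.simps)
  have z: "aform m e C Y Z \<otimes>[C] t = \<zero>[C]"
    if C: "is_alg R C" and Y: "Y \<in> nil[C]" and Z: "Z \<in> nil[C]"
      and t: "t \<in> carrier[C]" "t [^][C] Suc 1 = \<zero>[C]" for C Y Z t
  proof -
    interpret C: big_cring "ring_of C" by (rule alg_big[OF C])
    interpret s: ring_hom_cring R "ring_of C" "str_map C"
      using is_alg_str[OF C] is_cring C.is_cring by (simp add: ring_hom_cring_def ring_hom_cring_axioms_def)
    define H where "H = (\<lambda>s. str_map C (h s))"
    have H: "H s \<in> carrier[C]" "H 0 = \<zero>[C]" for s
      using h h0 by (simp_all add: H_def)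
    have t2: "t \<otimes>[C] t = \<zero>[C]" using t by simp
    have tn: "t \<in> nil[C]" by (rule nilI[OF t])
    have Yc: "Y \<in> carrier[C]" and Zc: "Z \<in> carrier[C]" using Y Z by auto
    define D where "D = form (ring_of C) m (\<lambda>k. nat_in (ring_of C) (Suc k) \<otimes>[C] H (Suc k)) Y Z"
    define W where "W = form (ring_of C) (Suc m) H Y Z"
    define P where "P = Y [^][C] m"
    define Q where "Q = (Y \<oplus>[C] Z) [^][C] m"
    have cl: "D \<in> carrier[C]" "W \<in> carrier[C]" "P \<in> carrier[C]" "Q \<in> carrier[C]"
      using Yc Zc H by (auto simp: D_def W_def P_def Q_def simp del: nat_in.simps intro!: C.form_closed)
    have "H 1 \<otimes>[C] t \<otimes>[C] P \<oplus>[C] (W \<oplus>[C] t \<otimes>[C] D) =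
       H 1 \<otimes>[C] t \<otimes>[C] Q \<oplus>[C] W"
    proof -
      have "aform (Suc m) h C t Y \<oplus>[C] aform (Suc m) h C (t \<oplus>[C] Y) Z =
         aform (Suc m) h C t (Y \<oplus>[C] Z) \<oplus>[C] aform (Suc m) h C Y Z"
        using coc C tn Y Z unfolding cocycle_def by blast
      thus ?thesis
        unfolding aform_def H_def[symmetric]
          C.form_square_zero[where a = H, OF t(1) t2 Yc H(1) H(2)] C.form_add_square_zero[where a = H, OF t(1) t2 Yc Zc H(1)]
          C.form_square_zero[where a = H, OF t(1) t2 C.a_closed[OF Yc Zc] H(1) H(2)] D_def W_def P_def Q_def .
    qed
    hence eq: "(H 1 \<otimes>[C] t \<otimes>[C] P \<oplus>[C] t \<otimes>[C] D) \<oplus>[C] W =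
       H 1 \<otimes>[C] t \<otimes>[C] Q \<oplus>[C] W"
      using cl H(1)[of 1] t(1) by (simp add: C.a_ac)
    have eq: "H 1 \<otimes>[C] t \<otimes>[C] P \<oplus>[C] t \<otimes>[C] D =
       H 1 \<otimes>[C] t \<otimes>[C] Q"
      by (rule C.add.r_cancel[OF eq])
        (use cl H(1)[of 1] t(1) in auto)
    have "aform m e C Y Z = (D \<ominus>[C] H 1 \<otimes>[C] Q) \<oplus>[C] H 1 \<otimes>[C] P"
    proof -
      let ?d = "\<lambda>k. nat_in (ring_of C) (Suc k) \<otimes>[C] H (Suc k)"
      let ?b = "\<lambda>k. H 1 \<otimes>[C] nat_in (ring_of C) (m choose k)"
      let ?i = "\<lambda>k. if k = m then H 1 else \<zero>[C]"
      have "str_map C (e k) = (?d k \<ominus>[C] ?b k) \<oplus>[C] ?i k" for k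
        using h alg_nat_in[OF C] by (simp add: e_def d_def b_def H_def a_minus_def del: nat_in.simps)
      hence "aform m e C Y Z = form (ring_of C) m (\<lambda>k. (?d k \<ominus>[C] ?b k) \<oplus>[C] ?i k) Y Z"
        by (simp only: aform_def)
      also have "\<dots> = (form (ring_of C) m ?d Y Z \<ominus>[C] form (ring_of C) m ?b Y Z) \<oplus>[C] form (ring_of C) m ?i Y Z"
        using H(1) Yc Zc by (simp add: C.form_add C.form_minus del: nat_in.simps)
      also have "form (ring_of C) m ?b Y Z = H 1 \<otimes>[C] Q"
        using H(1)[of 1] Yc Zc by (subst C.form_smult) (auto simp: Q_def C.binomial_form)
      also have "form (ring_of C) m ?i Y Z = H 1 \<otimes>[C] P"
        using H(1)[of 1] Yc Zc by (subst C.form_single) (auto simp: P_def)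
      finally show ?thesis by (simp only: D_def)
    qed
    also have "\<dots> \<otimes>[C] t = (H 1 \<otimes>[C] t \<otimes>[C] P \<oplus>[C] t \<otimes>[C] D) \<ominus>[C] H 1 \<otimes>[C] t \<otimes>[C] Q"
      using cl H(1)[of 1] t(1) by algebra
    also have "\<dots> = \<zero>[C]" unfolding eq using cl H(1)[of 1] t(1) by simp
    finally show ?thesis .
  qed
  have "e k = \<zero>"
  proof (rule aform_zero[OF c(3)])
    fix B x y assume B: "is_alg R B" and x: "x \<in> nil[B]" and y: "y \<in> nil[B]"
    have cl: "aform m e B x y \<in> carrier[B]" using aform_closed[OF B c(3)] x y by simp
    show "aform m e B x y = \<zero>[B]"
    proof (rule generic_coefficient[OF B cl, of 1])
      fix C f t assume f: "alg_hom R B C f" and t: "t \<in> carrier[C]" "t [^][C] Suc 1 = \<zero>[C]"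
      interpret C: big_cring "ring_of C" by (rule alg_big[OF alg_homD(2)[OF f]])
      show "f (aform m e B x y) \<otimes>[C] t [^][C] (1::nat) = \<zero>[C]"
        using z[OF alg_homD(2)[OF f] alg_homD(8)[OF f x] alg_homD(8)[OF f y] t] aform_nat[OF f c(3), of x y m] x y t
        by simp
    qed
  qed (use k in simp)
  hence "d k \<ominus> b k = \<zero>" using k c by (simp add: e_def)
  thus ?thesis using c by (simp add: d_def b_def del: nat_in.simps)
qed

text \<open>Passing from \<open>k\<close> to \<open>k + 1\<close> multiplies by
  \<open>(n - 1 - k) / (k + 1)\<close>, and \<open>p\<close> divides neither factor: together with
  \<open>n\<close> it would otherwise divide \<open>k + 1 < p\<close>, or at the end
  \<open>k + 1\<close> itself.\<close>

lemma not_dvd_binomial_pred: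
  assumes p: "p \<noteq> 0" and n: "p dvd n" "0 < n" and k: "k < p"
  shows "\<not> p dvd (n - 1 choose k)"
  using k
proof (induction k)
  case 0
  show ?case using prime_gt_1_nat[OF p_prime[OF p]] by simp
next
  case (Suc k)
  have pn: "p \<le> n" using n by (auto dest: dvd_imp_le)
  have "Suc k * (n - 1 choose Suc k) = (n - 1) * ((n - 1 - 1) choose k)" by (rule binomial_absorption)
  also have "\<dots> = (n - 1 - k) * (n - 1 choose k)" by (rule binomial_absorb_comp[symmetric])
  finally have e: "Suc k * (n - 1 choose Suc k) = (n - 1 - k) * (n - 1 choose k)" .
  have "\<not> p dvd (n - 1 - k)"
  proof
    assume "p dvd (n - 1 - k)"
    moreover have "n - (n - 1 - k) = Suc k" using Suc.prems pn by simp
    ultimately have "p dvd Suc k" using n(1) by (metis dvd_diff_nat)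
    thus False using Suc.prems by (auto dest: dvd_imp_le)
  qed
  hence "\<not> p dvd (n - 1 - k) * (n - 1 choose k)"
    using Suc prime_dvd_mult_iff[OF p_prime[OF p]] by simp
  thus ?case unfolding e[symmetric] using dvd_mult by blast
qed

text \<open>By the derivative relations the form is \<open>h 1\<close> times ((x+y)^p - x^p -
  y^p)/p, the one cocycle of degree \<open>p\<close> that is no coboundary. The torsion sum of this
  cocycle telescopes to \<open>p^(p-1) - 1\<close>, which is -1 in the field, so \<open>h 1\<close>
  vanishes.\<close>

lemma torsion_prime_degree:
  assumes p: "p \<noteq> 0" and h: "\<And>s. h s \<in> carrier R" and h0: "h 0 = \<zero>" "h p = \<zero>" and coc: "cocycle p h" and tor: "torsion p h"
  shows "h 1 = \<zero>"
proof -
  note pp = p_prime[OF p]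
  have p2: "2 \<le> p" by (rule prime_ge_2_nat[OF pp])
  define e where "e s = (p choose s) div p" for s
  \<comment> \<open>Dividing by \<open>p\<close> takes place in the natural numbers, before passing
    to the field, where \<open>p\<close> is zero.\<close>
  have pe: "p * e s = (p choose s)" if "0 < s" "s < p" for s
    using prime_dvd_binomial[OF p that] by (simp add: e_def)
  have hs: "h s = h 1 \<otimes> nat_in R (e s)" if s: "0 < s" "s < p" for s
  proof -
    obtain k where k: "s = Suc k" using s by (cases s) auto
    have "Suc (p - 1) = p" "k < p - 1" using p2 k s by auto
    hence rel: "nat_in R s \<otimes> h s = h 1 \<otimes> nat_in R (p - 1 choose k)"
      using cocycle_derivative[where h = h, OF h h0(1), of "p - 1" k] coc k by simp
    have "p * (s * e s) = s * (p choose s)" using pe[OF s] by simp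
    also have "\<dots> = p * (p - 1 choose k)" using times_binomial_minus1_eq[of s p] s k by simp
    finally have "s * e s = (p - 1 choose k)" using p by simp
    hence "nat_in R s \<otimes> h s = h 1 \<otimes> (nat_in R s \<otimes> nat_in R (e s))" by (metis rel nat_in_mult)
    also have "\<dots> = nat_in R s \<otimes> (h 1 \<otimes> nat_in R (e s))" using h[of 1] by (simp add: m_ac)
    finally have "nat_in R s \<otimes> h s = nat_in R s \<otimes> (h 1 \<otimes> nat_in R (e s))" .
    moreover have "nat_in R s \<noteq> \<zero>" using s by (auto simp: char_iff dest: dvd_imp_le)
    ultimately show ?thesis using m_lcancel[of "nat_in R s" "h s" "h 1 \<otimes> nat_in R (e s)"] h by simp
  qed
  \<comment> \<open>The torsion sum of the integral cocycle at \<open>x = 1\<close>. Multiplied by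
    \<open>p\<close> its terms are \<open>(i+1)^p - i^p - 1\<close>, so
    \<open>p E + p = p^p\<close>.\<close>
  define E where "E = (\<Sum>i<p. \<Sum>s\<in>{0<..<p}. e s * i ^ s)"
  have "nat_in R E = \<ominus> \<one>"
  proof -
    have bin: "(\<Sum>s\<in>{0<..<p}. (p choose s) * i ^ s) + (i ^ p + 1) = (i + 1) ^ p" for i :: nat
    proof -
      have "(i + 1) ^ p = (\<Sum>s\<in>{..p}. (p choose s) * i ^ s)" using binomial[of i 1 p] by simp
      also have "{..p} = insert 0 (insert p {0<..<p})" using p2 by auto
      also have "(\<Sum>s\<in>\<dots>. (p choose s) * i ^ s) = (\<Sum>s\<in>{0<..<p}. (p choose s) * i ^ s) + (i ^ p + 1)"
        using p2 by (simp)
      finally show ?thesis by simp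
    qed
    have "(\<Sum>i<n. \<Sum>s\<in>{0<..<p}. (p choose s) * i ^ s) + n = n ^ p" for n
    proof (induction n)
      case (Suc n)
      thus ?case using bin[of n] by simp
    qed (use p in \<open>simp add: zero_power\<close>)
    hence "(\<Sum>i<p. \<Sum>s\<in>{0<..<p}. (p choose s) * i ^ s) + p = p ^ p" .
    moreover have "(\<Sum>i<p. \<Sum>s\<in>{0<..<p}. (p choose s) * i ^ s) = p * E"
      unfolding E_def sum_distrib_left by (intro sum.cong refl) (simp add: pe flip: mult.assoc)
    ultimately have "p * (E + 1) = p ^ p" by simp
    also have "\<dots> = p * p ^ (p - 1)" using p by (metis power_eq_if)
    finally have "E + 1 = p ^ (p - 1)" using p unfolding mult_cancel1 by blast
    hence "p dvd E + 1" using p2 by simp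
    hence "nat_in R (E + 1) = \<zero>" by (simp only: char_iff)
    thus ?thesis using sum_zero_eq_neg[of "nat_in R E" \<one>] by simp
  qed
  moreover have "h 1 \<otimes> nat_in R E = \<zero>"
  proof -
    define S where "S = (\<Oplus>i\<in>{..<p}. \<Oplus>s\<in>{..p}. h s \<otimes> nat_in R (i ^ s))"
    have S: "S \<in> carrier R" unfolding S_def using h by (intro finsum_closed) auto
    have inner: "(\<Oplus>s\<in>{..p}. h s \<otimes> nat_in R (i ^ s)) = h 1 \<otimes> nat_in R (\<Sum>s\<in>{0<..<p}. e s * i ^ s)" for i
    proof -
      have "(\<Oplus>s\<in>{..p}. h s \<otimes> nat_in R (i ^ s)) = (\<Oplus>s\<in>{0<..<p}. h s \<otimes> nat_in R (i ^ s))"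
      proof (rule add.finprod_mono_neutral_cong_right)
        fix s assume "s \<in> {..p} - {0<..<p}"
        hence "s = 0 \<or> s = p" by auto
        thus "h s \<otimes> nat_in R (i ^ s) = \<zero>\<^bsub>R\<^esub>" using h0 by auto
      qed (use h in auto)
      also have "\<dots> = (\<Oplus>s\<in>{0<..<p}. h 1 \<otimes> nat_in R (e s * i ^ s))"
      proof (intro finsum_cong')
        fix s assume "s \<in> {0<..<p}"
        hence "h s = h 1 \<otimes> nat_in R (e s)" by (intro hs) auto
        thus "h s \<otimes> nat_in R (i ^ s) = h 1 \<otimes> nat_in R (e s * i ^ s)"
          unfolding nat_in_mult using m_assoc[OF h[of 1] nat_in_closed nat_in_closed] by simp
      qed (use h in auto)
      also have "\<dots> = h 1 \<otimes> nat_in R (\<Sum>s\<in>{0<..<p}. e s * i ^ s)"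
        unfolding nat_in_sum[OF finite_greaterThanLessThan] using h
        by (intro finsum_rdistr[symmetric]) auto
      finally show ?thesis .
    qed
    have "S = (\<Oplus>i\<in>{..<p}. h 1 \<otimes> nat_in R (\<Sum>s\<in>{0<..<p}. e s * i ^ s))"
      unfolding S_def inner ..
    also have "\<dots> = h 1 \<otimes> nat_in R E"
      unfolding E_def nat_in_sum[OF finite_lessThan] using h by (intro finsum_rdistr[symmetric]) auto
    finally have SE: "S = h 1 \<otimes> nat_in R E" .
    have "S = \<zero>\<^bsub>ring_of (R, \<lambda>a. a)\<^esub>"
    proof (rule generic_coefficient[OF base_alg[OF is_cring], of S p])
      fix C f t assume f: "alg_hom R (R, \<lambda>a. a) C f" and t: "t \<in> carrier[C]" "t [^][C] Suc p = \<zero>[C]"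
      note fD = alg_homD[OF f]
      interpret C: big_cring "ring_of C" by (rule alg_big[OF fD(2)])
      interpret f: ring_hom_cring R "ring_of C" f
        using fD is_cring by (simp add: ring_hom_cring_def ring_hom_cring_axioms_def)
      have str: "str_map C a = f a" if "a \<in> carrier R" for a using fD(6)[OF that] by simp
      have tn: "t \<in> nil[C]" by (rule nilI[OF t])
      let ?T = "t [^][C] p"
      have tm: "aform p h C (nat_in (ring_of C) i \<otimes>[C] t) t = (\<Oplus>\<^bsub>ring_of C\<^esub>s\<in>{..p}. f (h s \<otimes> nat_in R (i ^ s))) \<otimes>[C] ?T" for i
      proof -
        have "aform p h C (nat_in (ring_of C) i \<otimes>[C] t) t = (\<Oplus>\<^bsub>ring_of C\<^esub>s\<in>{..p}. f (h s \<otimes> nat_in R (i ^ s)) \<otimes>[C] ?T)"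
          unfolding aform_def form_def
        proof (intro C.finsum_cong')
          fix s assume s: "s \<in> {..p}"
          have T: "?T = t [^][C] (p - s) \<otimes>[C] t [^][C] s"
            using s t(1) by (simp add: C.nat_pow_mult)
          have n: "f (nat_in R (i ^ s)) = nat_in (ring_of C) i [^][C] s"
            using hom_nat_in[OF is_cring C.is_cring f.homh, of "i ^ s"] by (simp add: C.nat_in_pow)
          show "str_map C (h s) \<otimes>[C] t [^][C] (p - s) \<otimes>[C] (nat_in (ring_of C) i \<otimes>[C] t) [^][C] s
             = f (h s \<otimes> nat_in R (i ^ s)) \<otimes>[C] ?T"
            using h t(1) by (simp add: T n str C.nat_pow_distrib C.m_ac)
        qed (use h t(1) in auto)
        also have "\<dots> = (\<Oplus>\<^bsub>ring_of C\<^esub>s\<in>{..p}. f (h s \<otimes> nat_in R (i ^ s))) \<otimes>[C] ?T"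
          using h t(1) by (intro C.finsum_ldistr[symmetric]) auto
        finally show ?thesis .
      qed
      have "\<zero>[C] = (\<Oplus>\<^bsub>ring_of C\<^esub>i\<in>{..<p}. aform p h C (nat_in (ring_of C) i \<otimes>[C] t) t)"
        by (rule sym) (use tor fD(2) tn in \<open>unfold torsion_def, blast\<close>)
      also have "\<dots> = (\<Oplus>\<^bsub>ring_of C\<^esub>i\<in>{..<p}. (\<Oplus>\<^bsub>ring_of C\<^esub>s\<in>{..p}. f (h s \<otimes> nat_in R (i ^ s)))) \<otimes>[C] ?T"
        unfolding tm using h t(1) by (intro C.finsum_ldistr[symmetric]) (auto intro!: C.finsum_closed)
      also have "(\<Oplus>\<^bsub>ring_of C\<^esub>i\<in>{..<p}. (\<Oplus>\<^bsub>ring_of C\<^esub>s\<in>{..p}. f (h s \<otimes> nat_in R (i ^ s)))) = f S"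
        unfolding S_def using h
        by (subst f.hom_finsum) (auto intro!: C.finsum_cong' finsum_closed simp: comp_def f.hom_finsum simp del: f.hom_mult)
      finally show "f S \<otimes>[C] ?T = \<zero>[C]" by simp
    qed (use S in simp)
    thus ?thesis using SE by simp
  qed
  ultimately have "\<ominus> h 1 = \<zero>" using h[of 1] by (simp add: r_minus)
  thus ?thesis using h[of 1] by (metis minus_minus minus_zero)
qed

lemma aform_natop: "(\<And>s. h s \<in> carrier R) \<Longrightarrow> natop R n P \<Longrightarrow> natop R n Q \<Longrightarrow>
   natop R n (\<lambda>B xs. aform m h B (P B xs) (Q B xs))"
  by (rule natopI) (auto intro: aform_closed natop_closed simp: aform_nat natop_closed natop_natural alg_homD(1))

text \<open>Symmetric cocycle lemma over a field. If \<open>p\<close> does not divide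
  \<open>n\<close>, the derivative relations and symmetry determine \<open>h\<close> up to the
  scalar \<open>c\<close>. If \<open>p\<close> divides \<open>n\<close>, then \<open>h\<close> is a
  form in \<open>x^p\<close> and \<open>y^p\<close>, and the induction passes to degree
  \<open>n / p\<close>. The torsion hypothesis intervenes in degree \<open>p\<close> alone.\<close>

lemma cocycle_coboundary:
  assumes "2 \<le> n" "\<And>s. h s \<in> carrier R" "h 0 = \<zero>" "h n = \<zero>" "\<And>s. s \<le> n \<Longrightarrow> h s = h (n - s)"
    "cocycle n h" "p \<noteq> 0 \<Longrightarrow> torsion n h"
  shows "\<exists>c\<in>carrier R. \<forall>B x y. is_alg R B \<longrightarrow> x \<in> nil[B] \<longrightarrow> y \<in> nil[B] \<longrightarrow>
    aform n h B x y = str_map B c \<otimes>[B] ((x \<oplus>[B] y) [^][B] n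
       \<ominus>\<^bsub>ring_of B\<^esub> x [^][B] n \<ominus>[B] y [^][B] n)"
  using assms
proof (induction n arbitrary: h rule: less_induct)
  case (less n)
  note n2 = less.prems(1) and h = less.prems(2) and h0 = less.prems(3) and hn = less.prems(4)
    and sym = less.prems(5) and coc = less.prems(6) and tor = less.prems(7)
  have der: "nat_in R s \<otimes> h s = h 1 \<otimes> nat_in R (n - 1 choose (s - 1))" if "0 < s" "s < n" for s
  proof -
    have "Suc (n - 1) = n" "Suc (s - 1) = s" "s - 1 < n - 1" using that by auto
    thus ?thesis using cocycle_derivative[where h = h, OF h h0, of "n - 1" "s - 1"] coc by simp
  qed
  show ?case
  proof (cases "p dvd n")
    case False
    have nn: "nat_in R n \<noteq> \<zero>" using False by (simp add: char_iff)
    have U: "nat_in R n \<in> Units R" using nn by (simp add: field_Units)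
    \<comment> \<open>Forced by the coefficient of \<open>x y^(n-1)\<close>, which is
      \<open>n c\<close> in the coboundary.\<close>
    define c where "c = inv (nat_in R n) \<otimes> h 1"
    have c: "c \<in> carrier R" using U h by (simp add: c_def)
    have nc: "nat_in R n \<otimes> c = h 1" using U h by (simp add: c_def m_assoc[symmetric])
    have main: "h s = c \<otimes> nat_in R (n choose s)" if s: "0 < s" "s < n" "\<not> p dvd s" for s
    proof -
      have "nat_in R s \<otimes> (c \<otimes> nat_in R (n choose s)) = c \<otimes> nat_in R (s * (n choose s))"
        using c by (simp add: nat_in_mult m_lcomm)
      also have "s * (n choose s) = n * (n - 1 choose (s - 1))" using times_binomial_minus1_eq[of s n] s by simp
      also have "c \<otimes> nat_in R \<dots> = (nat_in R n \<otimes> c) \<otimes> nat_in R (n - 1 choose (s - 1))"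
        using c by (simp add: nat_in_mult m_ac)
      also have "\<dots> = nat_in R s \<otimes> h s" using der[OF s(1,2)] nc by simp
      finally show ?thesis
        using s(3) h c m_lcancel[of "nat_in R s" "c \<otimes> nat_in R (n choose s)" "h s"] by (simp add: char_iff)
    qed
    have hs: "h s = c \<otimes> nat_in R (n choose s)" if s: "0 < s" "s < n" for s
    proof (cases "p dvd s")
      case True
      \<comment> \<open>The derivative relation gives nothing for \<open>s\<close> divisible by
        \<open>p\<close>; symmetry replaces \<open>s\<close> by \<open>n - s\<close>.\<close>
      have "\<not> p dvd (n - s)" using True False s by (metis dvd_diffD less_imp_le)
      hence "h (n - s) = c \<otimes> nat_in R (n choose (n - s))" using s by (intro main) auto
      thus ?thesis using sym[of s] s binomial_symmetric[of s n] by simp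
    qed (use main s in auto)
    show ?thesis
    proof (intro bexI[OF _ c] allI impI)
      fix B x y assume B: "is_alg R B" and x: "x \<in> nil[B]" and y: "y \<in> nil[B]"
      interpret B: big_cring "ring_of B" by (rule alg_big[OF B])
      have xc: "x \<in> carrier[B]" and yc: "y \<in> carrier[B]" using x y by auto
      let ?g = "\<lambda>s. nat_in (ring_of B) (n choose s)" and ?d = "\<lambda>j s. if s = j then \<one>[B] else \<zero>[B]"
      have sc: "str_map B c \<in> carrier[B]" by (rule str_closed[OF B c])
      have "aform n h B x y = form (ring_of B) n (\<lambda>s. str_map B c \<otimes>[B] (?g s \<ominus>[B] ?d n s \<ominus>[B] ?d 0 s)) x y"
        unfolding aform_def
      proof (rule B.form_cong)
        fix s assume "s \<le> n"
        then consider "s = 0" | "s = n" | "0 < s" "s < n" by linarith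
        thus "str_map B (h s) = str_map B c \<otimes>[B] (?g s \<ominus>[B] ?d n s \<ominus>[B] ?d 0 s)"
        proof cases
          case 3
          thus ?thesis using hs[OF 3] sc c ring_hom_mult[OF is_alg_str[OF B] c, of "nat_in R (n choose s)"]
            by (simp add: alg_nat_in[OF B] a_minus_def)
        qed (use h0 hn n2 sc in \<open>auto simp: alg_str_zero[OF B] a_minus_def B.r_neg\<close>)
      qed (use sc xc yc in auto)
      also have "\<dots> = str_map B c \<otimes>[B] ((x \<oplus>[B] y) [^][B] n
         \<ominus>\<^bsub>ring_of B\<^esub> x [^][B] n \<ominus>[B] y [^][B] n)"
        using sc xc yc by (subst B.form_smult) (auto simp: B.form_minus B.form_single B.binomial_form)
      finally show "aform n h B x y = \<dots>" .
    qed
  next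
    case True
    hence p: "p \<noteq> 0" using n2 by (cases "p = 0") auto
    note pp = p_prime[OF p]
    have p2: "2 \<le> p" by (rule prime_ge_2_nat[OF pp])
    \<comment> \<open>In degree \<open>p\<close> this is the torsion condition. In larger degrees
      the derivative relation at \<open>s = p\<close> has left side zero, and the binomial
      coefficient on its right side is not divisible by \<open>p\<close>.\<close>
    have h1: "h 1 = \<zero>"
    proof (cases "n = p")
      case True
      thus ?thesis using torsion_prime_degree[where h = h, OF p h h0] hn coc tor[OF p] by simp
    next
      case False
      have "p \<le> n" using True n2 by (auto dest: dvd_imp_le)
      hence pn: "p < n" using False by simp
      have "nat_in R p = \<zero>" by (simp add: char_iff)
      hence "h 1 \<otimes> nat_in R (n - 1 choose (p - 1)) = \<zero>" using der[of p] pn p h by simp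
      moreover have "nat_in R (n - 1 choose (p - 1)) \<noteq> \<zero>"
        using not_dvd_binomial_pred[OF p True, of "p - 1"] n2 p2 by (simp add: char_iff)
      ultimately show ?thesis using h[of 1] by (simp add: integral_iff)
    qed
    have hz: "h s = \<zero>" if "\<not> p dvd s" "s \<le> n" for s
    proof -
      have "0 < s" using that by (intro gr0I) auto
      moreover have "s < n" using that True by (cases "s = n") auto
      ultimately have "nat_in R s \<otimes> h s = \<zero>" using der h1 by simp
      thus ?thesis using that h by (simp add: integral_iff char_iff)
    qed
    obtain m where m: "n = p * m" using True by (elim dvdE)
    \<comment> \<open>By \<open>hz\<close> only exponents divisible by \<open>p\<close> survive, so
      \<open>h\<close> at \<open>x\<close>, \<open>y\<close> is \<open>g\<close> at
      \<open>x^p\<close>, \<open>y^p\<close>.\<close>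
    define g where "g s = h (p * s)" for s
    have g: "g s \<in> carrier R" for s using h by (simp add: g_def)
    have hg: "aform n h B x y = aform m g B (x [^][B] p) (y [^][B] p)"
      if B: "is_alg R B" and "x \<in> carrier[B]" "y \<in> carrier[B]" for B x y
    proof -
      interpret B: big_cring "ring_of B" by (rule alg_big[OF B])
      show ?thesis unfolding aform_def m g_def
        by (rule B.form_pow_args[OF that(2,3) str_closed[OF B h]])
          (use p hz m in \<open>auto simp: alg_str_zero[OF B]\<close>)
    qed
    have "\<exists>c\<in>carrier R. \<forall>B x y. is_alg R B \<longrightarrow> x \<in> nil[B] \<longrightarrow> y \<in> nil[B] \<longrightarrow>
      aform m g B x y = str_map B c \<otimes>[B] ((x \<oplus>[B] y) [^][B] m
       \<ominus>\<^bsub>ring_of B\<^esub> x [^][B] m \<ominus>[B] y [^][B] m)"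
    proof (cases "m = 1")
      \<comment> \<open>Here \<open>n = p\<close>, and the two end coefficients, the only ones left,
        are zero by hypothesis.\<close>
      case True
      have "g 0 = \<zero>" "g 1 = \<zero>" using h0 hn m True by (simp_all add: g_def)
      hence "g s = \<zero>" if "s \<le> m" for s using that True by (cases s) auto
      hence "aform m g B x y = \<zero>[B]" if B: "is_alg R B" and "x \<in> nil[B]" "y \<in> nil[B]" for B x y
      proof -
        interpret B: big_cring "ring_of B" by (rule alg_big[OF B])
        show ?thesis unfolding aform_def form_def
          using that \<open>\<And>s. s \<le> m \<Longrightarrow> g s = \<zero>\<close>
          by (intro B.add.finprod_one_eqI) (simp add: alg_str_zero[OF B])
      qed
      moreover have "str_map B \<zero> \<otimes>[B] ((x \<oplus>[B] y) [^][B] m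
       \<ominus>\<^bsub>ring_of B\<^esub> x [^][B] m \<ominus>[B] y [^][B] m) = \<zero>[B]"
        if B: "is_alg R B" and "x \<in> nil[B]" "y \<in> nil[B]" for B x y
      proof -
        interpret B: big_cring "ring_of B" by (rule alg_big[OF B])
        show ?thesis using that by (simp add: alg_str_zero[OF B])
      qed
      ultimately show ?thesis by (intro bexI[of _ \<zero>]) auto
    next
      case False
      have m0: "m \<noteq> 0" using m n2 by (cases "m = 0") auto
      have "m < n" unfolding m using mult_le_mono1[OF p2, of m] m0 by linarith
      moreover have "2 \<le> m" using m0 False by linarith
      moreover have "g 0 = \<zero>" "g m = \<zero>" using h0 hn m by (simp_all add: g_def)
      moreover have "g s = g (m - s)" if "s \<le> m" for s
        using sym[of "p * s"] that m by (simp add: g_def right_diff_distrib')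
      \<comment> \<open>Since Frobenius is additive, the identity for \<open>h\<close> is the one
        for \<open>g\<close> at \<open>p\<close>-th powers; \<open>natop_zero_power_test\<close>
        removes the powers. The torsion condition descends in the same way, as integers are fixed by
        Frobenius.\<close>
      moreover have "cocycle m g"
        unfolding cocycle_def
      proof (intro allI impI)
        fix B x y z assume B: "is_alg R B" and x: "x \<in> nil[B]" and y: "y \<in> nil[B]" and z: "z \<in> nil[B]"
        interpret O: big_cring "ring_of B" by (rule alg_big[OF B])
        define X where "X i B xs = xs ! i" for i :: nat and B :: "'u alg" and xs :: "'u list"
        have X: "natop R 3 (X i)" if "i < 3" for i unfolding X_def using that by (rule natop_nth)
        define L where "L B xs = (aform m g B (X 0 B xs) (X 1 B xs) \<oplus>[B] aform m g B (X 0 B xs \<oplus>[B] X 1 B xs) (X 2 B xs))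
           \<ominus>\<^bsub>ring_of B\<^esub> (aform m g B (X 0 B xs) (X 1 B xs \<oplus>[B] X 2 B xs) \<oplus>[B] aform m g B (X 1 B xs) (X 2 B xs))" for B xs
        have L: "natop R 3 L" unfolding L_def
          by (intro natop_minus natop_add aform_natop g X) simp_all
        have "L B [x, y, z] = \<zero>[B]"
        proof (rule natop_zero_power_test[OF L, of p])
          fix B xs assume B: "is_alg R B" and "xs \<in> nilpts B 3"
          then obtain x y z where xs: "xs = [x, y, z]" and n: "x \<in> nil[B]" "y \<in> nil[B]" "z \<in> nil[B]"
            by (auto simp: nilpts_def length_Suc_conv numeral_3_eq_3)
          interpret B: big_cring "ring_of B" by (rule alg_big[OF B])
          have c: "x \<in> carrier[B]" "y \<in> carrier[B]" "z \<in> carrier[B]" using n by auto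
          have "aform n h B x y \<oplus>[B] aform n h B (x \<oplus>[B] y) z =
            aform n h B x (y \<oplus>[B] z) \<oplus>[B] aform n h B y z"
            using coc B n unfolding cocycle_def by blast
          thus "L B (map (\<lambda>x. x [^][B] p) xs) = \<zero>[B]"
            using c by (simp add: L_def X_def xs hg[OF B] frobenius_add[OF p B] aform_closed[OF B g])
        qed (use p B x y z in \<open>auto simp: nilpts_def\<close>)
        thus "aform m g B x y \<oplus>[B] aform m g B (x \<oplus>[B] y) z =
          aform m g B x (y \<oplus>[B] z) \<oplus>[B] aform m g B y z"
          using x y z by (simp add: L_def X_def aform_closed[OF B g])
      qed
      moreover have "torsion m g"
        unfolding torsion_def
      proof (intro allI impI)
        fix B x assume B: "is_alg R B" and x: "x \<in> nil[B]"
        interpret O: big_cring "ring_of B" by (rule alg_big[OF B])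
        define L where "L B xs = (\<Oplus>\<^bsub>ring_of B\<^esub>i\<in>{..<p}. aform m g B (nat_in (ring_of B) i \<otimes>[B] (xs ! 0)) (xs ! 0))" for B xs
        have L: "natop R 1 L"
        proof (rule natopI)
          fix B xs assume B: "is_alg R B" and "xs \<in> nilpts B 1"
          then obtain x where xs: "xs = [x]" and n: "x \<in> nil[B]" by (auto simp: nilpts_def length_Suc_conv)
          interpret B: big_cring "ring_of B" by (rule alg_big[OF B])
          show "L B xs \<in> carrier[B]" using n by (auto simp: L_def xs intro!: B.finsum_closed aform_closed[OF B g])
        next
          fix B C f xs assume f: "alg_hom R B C f" and "xs \<in> nilpts B 1"
          then obtain x where xs: "xs = [x]" and n: "x \<in> nil[B]" by (auto simp: nilpts_def length_Suc_conv)
          note fD = alg_homD[OF f]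
          interpret B: big_cring "ring_of B" by (rule alg_big[OF fD(1)])
          interpret C: big_cring "ring_of C" by (rule alg_big[OF fD(2)])
          interpret f: ring_hom_cring "ring_of B" "ring_of C" f
            using fD by (simp add: ring_hom_cring_def ring_hom_cring_axioms_def)
          have "f (L B xs) = (\<Oplus>\<^bsub>ring_of C\<^esub>i\<in>{..<p}. f (aform m g B (nat_in (ring_of B) i \<otimes>[B] x) x))"
            unfolding L_def xs using n by (subst f.hom_finsum) (auto simp: comp_def intro!: aform_closed[OF fD(1) g])
          also have "\<dots> = L C (map f xs)"
            unfolding L_def xs using n fD(7,8)
            by (intro C.finsum_cong') (auto simp: aform_nat[OF f g] hom_nat_in[OF fD(4,5,3)] intro!: aform_closed[OF fD(2) g])
          finally show "L C (map f xs) = f (L B xs)" by simp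
        qed
        have "L B [x] = \<zero>[B]"
        proof (rule natop_zero_power_test[OF L, of p])
          fix B xs assume B: "is_alg R B" and "xs \<in> nilpts B 1"
          then obtain x where xs: "xs = [x]" and n: "x \<in> nil[B]" by (auto simp: nilpts_def length_Suc_conv)
          interpret B: big_cring "ring_of B" by (rule alg_big[OF B])
          have "L B (map (\<lambda>x. x [^][B] p) xs) = (\<Oplus>\<^bsub>ring_of B\<^esub>i\<in>{..<p}. aform n h B (nat_in (ring_of B) i \<otimes>[B] x) x)"
            unfolding L_def xs using n
            by (intro B.finsum_cong') (auto simp: hg[OF B] B.nat_pow_distrib frobenius_nat_in[OF p B] intro!: aform_closed[OF B g])
          also have "\<dots> = \<zero>[B]" using tor[OF p] B n unfolding torsion_def by blast
          finally show "L B (map (\<lambda>x. x [^][B] p) xs) = \<zero>[B]" .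
        qed (use p B x in \<open>auto simp: nilpts_def\<close>)
        thus "(\<Oplus>\<^bsub>ring_of B\<^esub>i\<in>{..<p}. aform m g B (nat_in (ring_of B) i \<otimes>[B] x) x) = \<zero>[B]"
          by (simp add: L_def)
      qed
      ultimately show ?thesis using less.IH[of m g] g by blast
    qed
    then obtain c where c: "c \<in> carrier R" "\<And>B x y. is_alg R B \<Longrightarrow> x \<in> nil[B] \<Longrightarrow> y \<in> nil[B] \<Longrightarrow>
      aform m g B x y = str_map B c \<otimes>[B] ((x \<oplus>[B] y) [^][B] m
       \<ominus>\<^bsub>ring_of B\<^esub> x [^][B] m \<ominus>[B] y [^][B] m)" by blast
    show ?thesis
    proof (intro bexI[OF _ c(1)] allI impI)
      fix B x y assume B: "is_alg R B" and x: "x \<in> nil[B]" and y: "y \<in> nil[B]"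
      interpret B: big_cring "ring_of B" by (rule alg_big[OF B])
      have xc: "x \<in> carrier[B]" and yc: "y \<in> carrier[B]" using x y by auto
      have pw: "(z [^][B] p) [^][B] m = z [^][B] n" if "z \<in> carrier[B]" for z
        using that m by (simp add: B.nat_pow_pow)
      show "aform n h B x y = str_map B c \<otimes>[B] ((x \<oplus>[B] y) [^][B] n
         \<ominus>\<^bsub>ring_of B\<^esub> x [^][B] n \<ominus>[B] y [^][B] n)"
        using c(2)[OF B B.pow_nil[OF x, of p] B.pow_nil[OF y, of p]] p pw xc yc
        by (simp add: hg[OF B xc yc] frobenius_add[OF p B, symmetric])
    qed
  qed
qed

end

section \<open>The logarithm\<close>

text \<open>Dependent choice of the terms of one sequence. By \<open>cong\<close> the condition
  \<open>Q n\<close> sees only the terms up to \<open>n\<close>, so later choices do not disturb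
  earlier conditions.\<close>

lemma sequence_choice:
  fixes Q :: "nat \<Rightarrow> (nat \<Rightarrow> 'a) \<Rightarrow> bool"
  assumes step: "\<And>n g. (\<And>k. k < n \<Longrightarrow> Q k g) \<Longrightarrow> \<exists>c. Q n (g(n := c))"
    and cong: "\<And>n g g'. (\<And>k. k \<le> n \<Longrightarrow> g k = g' k) \<Longrightarrow> Q n g \<Longrightarrow> Q n g'"
  shows "\<exists>g. \<forall>n. Q n g"
proof -
  define G where "G = rec_nat (\<lambda>_. undefined) (\<lambda>n g. g(n := (SOME c. Q n (g(n := c)))))"
  have GS: "G (Suc n) = (G n)(n := (SOME c. Q n ((G n)(n := c))))" for n by (simp add: G_def)
  have stable: "G m k = G n k" if "k < n" "n \<le> m" for k m n
    using that(2,1) by (induction rule: dec_induct) (auto simp: GS)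
  have "k < n \<Longrightarrow> Q k (G n)" for k n
  proof (induction n arbitrary: k)
    case (Suc n)
    show ?case
    proof (cases "k < n")
      case True
      show ?thesis by (rule cong[OF _ Suc.IH[OF True]]) (use True in \<open>auto simp: GS\<close>)
    next
      case False
      hence "k = n" using Suc.prems by simp
      moreover have "Q n ((G n)(n := (SOME c. Q n ((G n)(n := c)))))"
        by (rule someI_ex[OF step]) (rule Suc.IH)
      ultimately show ?thesis by (simp only: GS)
    qed
  qed simp
  hence "Q n (\<lambda>k. G (Suc k) k)" for n
    by (rule cong[rotated, OF _ , of n "G (Suc n)"]) (use stable[of _ "Suc _" "Suc n"] in auto)
  thus ?thesis by blast
qed

context cring
begin

lemma series_scale:
  assumes x: "x \<in> nil R" and t: "t \<in> carrier R" and a: "\<And>k. a k \<in> carrier R"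
  shows "series R a (t \<otimes> x) = series R (\<lambda>k. a k \<otimes> t [^] k) x"
proof -
  obtain N where N: "x \<in> carrier R" "x [^] (N::nat) = \<zero>" using x by (elim nilE)
  have tN: "(t \<otimes> x) [^] N = \<zero>" using N t by (simp add: nat_pow_distrib)
  have "series R a (t \<otimes> x) = (\<Oplus>k\<in>{..<N}. a k \<otimes> (t \<otimes> x) [^] k)"
    using N t a by (intro series_eq[OF _ tN]) auto
  also have "\<dots> = (\<Oplus>k\<in>{..<N}. (a k \<otimes> t [^] k) \<otimes> x [^] k)"
    using N t a by (intro finsum_cong') (auto simp: nat_pow_distrib m_assoc)
  also have "\<dots> = series R (\<lambda>k. a k \<otimes> t [^] k) x"
    using N t a by (intro series_eq[symmetric]) auto
  finally show ?thesis .
qed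

text \<open>\<open>t^n\<close> annihilates every multiple of \<open>t\<close>, so after
  multiplication by \<open>t^n\<close> only \<open>x\<close> modulo \<open>t\<close> counts.\<close>

lemma pow_perturb:
  assumes t: "t \<in> carrier R" "t [^] Suc n = \<zero>" and x: "x \<in> carrier R" and u: "u \<in> carrier R"
  shows "t [^] n \<otimes> (x \<oplus> t \<otimes> u) [^] (s::nat) = t [^] n \<otimes> x [^] s"
proof (induction s)
  case (Suc s)
  define T where "T = t [^] n"
  define X where "X = (x \<oplus> t \<otimes> u) [^] s"
  define Y where "Y = x [^] s"
  have c: "T \<in> carrier R" "X \<in> carrier R" "Y \<in> carrier R" "T \<otimes> t = \<zero>" using t x u by (simp_all add: T_def X_def Y_def)
  have TX: "T \<otimes> X = T \<otimes> Y" using Suc by (simp add: T_def X_def Y_def)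
  have "T \<otimes> (X \<otimes> (x \<oplus> t \<otimes> u)) = (T \<otimes> X) \<otimes> x \<oplus> (T \<otimes> t) \<otimes> (X \<otimes> u)"
    using c(1,2) t(1) x u by algebra
  also have "\<dots> = T \<otimes> (Y \<otimes> x)" unfolding TX c(4) using c(1-3) x u by (simp add: m_assoc)
  finally show ?case by (simp add: T_def X_def Y_def)
qed simp

lemma form_perturb:
  assumes t: "t \<in> carrier R" "t [^] Suc n = \<zero>" and x: "x \<in> carrier R" and u: "u \<in> carrier R"
    and y: "y \<in> carrier R" and v: "v \<in> carrier R" and a: "\<And>s. a s \<in> carrier R"
  shows "t [^] n \<otimes> form R m a (x \<oplus> t \<otimes> u) (y \<oplus> t \<otimes> v) = t [^] n \<otimes> form R m a x y"
proof -
  have "t [^] n \<otimes> ((a s \<otimes> (y \<oplus> t \<otimes> v) [^] (m - s)) \<otimes> (x \<oplus> t \<otimes> u) [^] s) =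
     t [^] n \<otimes> ((a s \<otimes> y [^] (m - s)) \<otimes> x [^] s)" for s
  proof -
    define T where "T = t [^] n"
    define X where "X = (x \<oplus> t \<otimes> u) [^] s"
    define X' where "X' = x [^] s"
    define Y where "Y = (y \<oplus> t \<otimes> v) [^] (m - s)"
    define Y' where "Y' = y [^] (m - s)"
    have c: "T \<in> carrier R" "X \<in> carrier R" "Y \<in> carrier R" "X' \<in> carrier R" "Y' \<in> carrier R" "a s \<in> carrier R"
      using t x u y v a by (simp_all add: T_def X_def Y_def X'_def Y'_def)
    have e: "T \<otimes> X = T \<otimes> X'" "T \<otimes> Y = T \<otimes> Y'"
      unfolding T_def X_def Y_def X'_def Y'_def by (rule pow_perturb[OF t x u] pow_perturb[OF t y v])+
    have "T \<otimes> ((a s \<otimes> Y) \<otimes> X) = a s \<otimes> Y \<otimes> (T \<otimes> X)" using c by (simp add: m_ac)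
    also have "\<dots> = a s \<otimes> X' \<otimes> (T \<otimes> Y)" unfolding e(1) using c by (simp add: m_ac)
    also have "\<dots> = T \<otimes> ((a s \<otimes> Y') \<otimes> X')" unfolding e(2) using c by (simp add: m_ac)
    finally show ?thesis by (simp add: T_def X_def Y_def X'_def Y'_def)
  qed
  thus ?thesis unfolding form_def using t(1) x u y v a
    by (subst (1 2) finsum_rdistr) (auto intro!: finsum_cong')
qed

lemma form_swap:
  assumes x: "x \<in> carrier R" and y: "y \<in> carrier R" and a: "\<And>s. a s \<in> carrier R"
  shows "form R n a y x = form R n (\<lambda>s. a (n - s)) x y"
proof -
  have b: "(\<lambda>s. n - s) ` {..n} = {..n}"
  proof (intro equalityI subsetI)
    fix s assume "s \<in> {..n}"
    thus "s \<in> (\<lambda>s. n - s) ` {..n}" by (intro image_eqI[of _ _ "n - s"]) auto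
  qed auto
  have "form R n a y x = (\<Oplus>s\<in>(\<lambda>s. n - s) ` {..n}. (a s \<otimes> x [^] (n - s)) \<otimes> y [^] s)"
    unfolding b form_def ..
  also have "\<dots> = (\<Oplus>s\<in>{..n}. (a (n - s) \<otimes> x [^] (n - (n - s))) \<otimes> y [^] (n - s))"
    using x y a by (intro add.finprod_reindex) (auto simp: inj_on_def)
  also have "\<dots> = form R n (\<lambda>s. a (n - s)) x y"
    unfolding form_def using x y a by (intro finsum_cong') (auto simp: m_ac)
  finally show ?thesis .
qed

lemma scaled_nil: "t \<in> carrier R \<Longrightarrow> x \<in> nil R \<Longrightarrow> t \<otimes> x \<in> nil R"
  by (rule mult_nil)

end

section \<open>Separating total degrees by a scaling parameter\<close>

context big_cring
begin

text \<open>Scaling both variables by \<open>t\<close> attaches \<open>t^(s+k)\<close> to the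
  coefficient \<open>d s k\<close>, which here belongs to \<open>x^s y^k\<close>: the total degree
  becomes visible as a power of \<open>t\<close>.\<close>

lemma kser2_scaled:
  assumes B: "is_alg R B" and t: "t \<in> carrier[B]" and x: "x \<in> nil[B]" and y: "y \<in> nil[B]"
    and d: "\<And>s k. d s k \<in> carrier R"
  shows "kser2 d B (t \<otimes>[B] y) (t \<otimes>[B] x) = series (ring_of B)
    (\<lambda>s. series (ring_of B) (\<lambda>k. str_map B (d s k) \<otimes>[B] t [^][B] (s + k)) y) x"
proof -
  interpret B: big_cring "ring_of B" by (rule alg_big[OF B])
  have sc: "str_map B (d s k) \<in> carrier[B]" for s k by (rule str_closed[OF B d])
  have kc: "kser (d s) B (t \<otimes>[B] y) \<in> carrier[B]" for s
    by (rule kser_closed[OF B d B.scaled_nil[OF t y]])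
  have "kser (d s) B (t \<otimes>[B] y) \<otimes>[B] t [^][B] s =
     series (ring_of B) (\<lambda>k. str_map B (d s k) \<otimes>[B] t [^][B] (s + k)) y" for s
  proof -
    have "kser (d s) B (t \<otimes>[B] y) \<otimes>[B] t [^][B] s =
      t [^][B] s \<otimes>[B] series (ring_of B) (\<lambda>k. str_map B (d s k) \<otimes>[B] t [^][B] k) y"
      unfolding kser_def B.series_scale[OF y t sc] using t y sc
      by (intro B.m_comm B.series_closed) auto
    also have "\<dots> = series (ring_of B) (\<lambda>k. t [^][B] s \<otimes>[B] (str_map B (d s k) \<otimes>[B] t [^][B] k)) y"
      using t y sc by (intro B.series_smult[symmetric]) auto
    also have "\<dots> = series (ring_of B) (\<lambda>k. str_map B (d s k) \<otimes>[B] t [^][B] (s + k)) y"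
      using t sc by (intro B.series_cong) (simp add: B.nat_pow_mult[OF t, symmetric] B.m_ac)
    finally show ?thesis .
  qed
  thus ?thesis unfolding kser2_def B.series_scale[OF x t kc] by simp
qed

text \<open>Vanishing for all \<open>t\<close> with \<open>t^N = 0\<close> means vanishing modulo
  total degree \<open>N\<close>. The three variables are made generic one after the other: first
  \<open>x\<close>, then \<open>y\<close>, finally \<open>t\<close>.\<close>

lemma kser2_scaled_zero:
  assumes d: "\<And>s k. d s k \<in> carrier R"
    and z: "\<And>B t x y. is_alg R B \<Longrightarrow> t \<in> carrier[B] \<Longrightarrow> t [^][B] (N::nat) = \<zero>[B] \<Longrightarrow>
       x \<in> nil[B] \<Longrightarrow> y \<in> nil[B] \<Longrightarrow> kser2 d B (t \<otimes>[B] y) (t \<otimes>[B] x) = \<zero>[B]"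
    and sk: "s + k < N"
  shows "d s k = \<zero>"
proof -
  have z1: "series (ring_of B) (\<lambda>k. str_map B (d s k) \<otimes>[B] t [^][B] (s + k)) y = \<zero>[B]"
    if B: "is_alg R B" and t: "t \<in> carrier[B]" "t [^][B] N = \<zero>[B]" and y: "y \<in> nil[B]" for B t y s
  proof -
    interpret B: big_cring "ring_of B" by (rule alg_big[OF B])
    let ?c = "\<lambda>s. series (ring_of B) (\<lambda>k. str_map B (d s k) \<otimes>[B] t [^][B] (s + k)) y"
    have mc: "str_map B (d s k) \<otimes>[B] t [^][B] (s + k) \<in> carrier[B]" for s k
      using str_closed[OF B d] t by simp
    have cc: "?c s \<in> carrier[B]" for s by (rule B.series_closed[OF y mc])
    show ?thesis
    proof (rule series_unique_all[OF B, where c = ?c])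
      fix C f x assume f: "alg_hom R B C f" and x: "x \<in> nil[C]"
      note fD = alg_homD[OF f]
      have fm: "f (str_map B (d s k) \<otimes>[B] t [^][B] j) = str_map C (d s k) \<otimes>[C] f t [^][C] j" for s k and j :: nat
        using ring_hom_mult[OF fD(3) str_closed[OF B d]] t fD(6)[OF d] hom_pow_eq[OF fD(4,5,3) t(1)] by simp
      have "series (ring_of C) (\<lambda>s. f (?c s)) x = kser2 d C (f t \<otimes>[C] f y) (f t \<otimes>[C] x)"
        unfolding kser2_scaled[OF fD(2) fD(7)[OF t(1)] x fD(8)[OF y] d]
        by (simp add: hom_series[OF fD(4,5,3) y mc] fm)
      also have "\<dots> = \<zero>[C]"
        using t hom_pow_eq[OF fD(4,5,3) t(1), of N] fD(7,9) by (intro z[OF fD(2) _ _ x fD(8)[OF y]]) auto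
      finally show "series (ring_of C) (\<lambda>s. f (?c s)) x = \<zero>[C]" .
    qed (rule cc)
  qed
  have z2: "str_map B (d s k) \<otimes>[B] t [^][B] (s + k) = \<zero>[B]"
    if B: "is_alg R B" and t: "t \<in> carrier[B]" "t [^][B] N = \<zero>[B]" for B t s k
  proof -
    interpret B: big_cring "ring_of B" by (rule alg_big[OF B])
    let ?c = "\<lambda>k. str_map B (d s k) \<otimes>[B] t [^][B] (s + k)"
    show ?thesis
    proof (rule series_unique_all[OF B, where c = ?c])
      fix k show "?c k \<in> carrier[B]" using str_closed[OF B d] t by simp
    next
      fix C f y assume f: "alg_hom R B C f" and y: "y \<in> nil[C]"
      note fD = alg_homD[OF f]
      have fm: "f (?c k) = str_map C (d s k) \<otimes>[C] f t [^][C] (s + k)" for k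
        using ring_hom_mult[OF fD(3) str_closed[OF B d]] t fD(6)[OF d] hom_pow_eq[OF fD(4,5,3) t(1)] by simp
      show "series (ring_of C) (\<lambda>k. f (?c k)) y = \<zero>[C]"
        unfolding fm using t hom_pow_eq[OF fD(4,5,3) t(1), of N] fD(7,9) by (intro z1[OF fD(2) _ _ y]) auto
    qed
  qed
  have "(if s + k = s + k then d s k else \<zero>) = \<zero>"
  proof (rule kser_unique_le[where c = "\<lambda>m. if m = s + k then d s k else \<zero>", OF _ _ sk])
    fix B t assume B: "is_alg R B" and t: "t \<in> carrier[B]" "t [^][B] N = \<zero>[B]"
    interpret B: big_cring "ring_of B" by (rule alg_big[OF B])
    have s0: "str_map B \<zero> = \<zero>[B]" using alg_homD(9)[OF str_alg_hom[OF is_cring B]] by simp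
    have "kser (\<lambda>m. if m = s + k then d s k else \<zero>) B t = series (ring_of B) (\<lambda>m. if m = s + k then str_map B (d s k) else \<zero>[B]) t"
      unfolding kser_def by (intro B.series_cong) (simp add: s0)
    also have "\<dots> = \<zero>[B]"
      using B.series_monom[OF nilI[OF t] str_closed[OF B d]] z2[OF B t] by simp
    finally show "kser (\<lambda>m. if m = s + k then d s k else \<zero>) B t = \<zero>[B]" .
  qed (use d in simp)
  thus ?thesis by simp
qed

text \<open>With \<open>t^(n+1) = 0\<close> the degrees above \<open>n\<close> are invisible and
  those below vanish by hypothesis; only the homogeneous part of degree \<open>n\<close> is
  left.\<close>

lemma kser2_scaled_leading:
  assumes d: "\<And>s k. d s k \<in> carrier R" and d0: "\<And>s k. s + k < n \<Longrightarrow> d s k = \<zero>"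
    and B: "is_alg R B" and t: "t \<in> carrier[B]" "t [^][B] Suc n = \<zero>[B]"
    and x: "x \<in> nil[B]" and y: "y \<in> nil[B]"
  shows "kser2 d B (t \<otimes>[B] y) (t \<otimes>[B] x) =
    t [^][B] n \<otimes>[B] aform n (\<lambda>s. d s (n - s)) B x y"
proof -
  interpret B: big_cring "ring_of B" by (rule alg_big[OF B])
  have s0: "str_map B \<zero> = \<zero>[B]" using alg_homD(9)[OF str_alg_hom[OF is_cring B]] by simp
  let ?a = "\<lambda>s. t [^][B] n \<otimes>[B] str_map B (d s (n - s))"
  have ac: "?a s \<in> carrier[B]" for s using t str_closed[OF B d] by simp
  have "str_map B (d s k) \<otimes>[B] t [^][B] (s + k) = (if s + k = n then ?a s else \<zero>[B])" for s k
  proof -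
    consider "s + k < n" | "s + k = n" | "Suc n \<le> s + k" by linarith
    thus ?thesis
    proof cases
      case 1 thus ?thesis using d0[OF 1] s0 t by simp
    next
      case 2
      hence "n - s = k" by simp
      thus ?thesis using 2 t str_closed[OF B d] by (simp add: B.m_comm)
    next
      case 3
      thus ?thesis using B.pow_zero_mono[OF t 3] str_closed[OF B d] by simp
    qed
  qed
  hence "kser2 d B (t \<otimes>[B] y) (t \<otimes>[B] x) =
      series (ring_of B) (\<lambda>s. series (ring_of B) (\<lambda>k. if s + k = n then ?a s else \<zero>[B]) y) x"
    unfolding kser2_scaled[OF B t(1) x y d] by (simp only:)
  also have "\<dots> = form (ring_of B) n ?a x y" by (rule B.form_series[OF x y ac])
  also have "\<dots> = t [^][B] n \<otimes>[B] aform n (\<lambda>s. d s (n - s)) B x y"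
    unfolding aform_def using t x y str_closed[OF B d] by (intro B.form_smult) auto
  finally show ?thesis .
qed

lemma kser_minus_monom:
  assumes B: "is_alg R B" and c: "\<And>k. c k \<in> carrier R" and b: "b \<in> carrier R" and z: "z \<in> nil[B]"
  shows "kser (\<lambda>k. c k \<ominus> (if k = n then b else \<zero>)) B z = kser c B z \<ominus>[B] str_map B b \<otimes>[B] z [^][B] n"
proof -
  interpret B: big_cring "ring_of B" by (rule alg_big[OF B])
  interpret s: ring_hom_cring R "ring_of B" "str_map B"
    using is_alg_str[OF B] is_cring B.is_cring by (simp add: ring_hom_cring_def ring_hom_cring_axioms_def)
  have "kser (\<lambda>k. c k \<ominus> (if k = n then b else \<zero>)) B z =
     series (ring_of B) (\<lambda>k. str_map B (c k) \<ominus>[B] (if k = n then str_map B b else \<zero>[B])) z"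
    unfolding kser_def using c b by (intro B.series_cong) (simp add: a_minus_def)
  also have "\<dots> = kser c B z \<ominus>[B] str_map B b \<otimes>[B] z [^][B] n"
    unfolding kser_def using c b z by (subst B.series_minus) (auto simp: B.series_monom)
  finally show ?thesis .
qed

lemma kser_truncate:
  assumes B: "is_alg R B" and c: "\<And>k. c k \<in> carrier R" and z: "z \<in> carrier[B]" "z [^][B] Suc n = \<zero>[B]"
  shows "kser (\<lambda>k. if k \<le> n then c k else \<zero>) B z = kser c B z"
proof -
  interpret B: big_cring "ring_of B" by (rule alg_big[OF B])
  have sc: "str_map B a \<in> carrier[B]" if "a \<in> carrier R" for a by (rule str_closed[OF B that])
  show ?thesis unfolding kser_def using z c sc
    by (subst (1 2) B.series_eq[OF z]) (auto intro!: B.finsum_cong' simp: less_Suc_eq_le)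
qed

end

context nil_group
begin

text \<open>To first order in \<open>t\<close> the group law is addition. This is how an identity
  for \<open>F\<close> yields, in the leading degree, an identity for the additive group.\<close>

lemma F_scaled:
  assumes B: "is_alg R B" and t: "t \<in> carrier[B]" and x: "x \<in> nil[B]" and y: "y \<in> nil[B]"
  shows "\<exists>u\<in>carrier[B]. F B (t \<otimes>[B] x) (t \<otimes>[B] y) =
    t \<otimes>[B] ((x \<oplus>[B] y) \<oplus>[B] t \<otimes>[B] u)"
proof -
  interpret B: big_cring "ring_of B" by (rule alg_big[OF B])
  obtain w where w: "w \<in> carrier[B]" and F: "F B (t \<otimes>[B] x) (t \<otimes>[B] y) =
     t \<otimes>[B] x \<oplus>[B] t \<otimes>[B] y \<oplus>[B] t \<otimes>[B] x \<otimes>[B] (t \<otimes>[B] y) \<otimes>[B] w"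
    using F_form[OF B B.scaled_nil[OF t x] B.scaled_nil[OF t y]] by blast
  have xc: "x \<in> carrier[B]" and yc: "y \<in> carrier[B]" using x y by auto
  have "F B (t \<otimes>[B] x) (t \<otimes>[B] y) =
    t \<otimes>[B] ((x \<oplus>[B] y) \<oplus>[B] t \<otimes>[B] (x \<otimes>[B] y \<otimes>[B] w))"
    unfolding F using t xc yc w by algebra
  moreover have "x \<otimes>[B] y \<otimes>[B] w \<in> carrier[B]" using xc yc w by simp
  ultimately show ?thesis by (rule bexI)
qed

lemma multiple_closed: "is_alg R B \<Longrightarrow> x \<in> nil[B] \<Longrightarrow> multiple (line_group F) i B x \<in> nil[B]"
  by (induction i) (auto simp: F_closed cring.zero_nil[OF is_alg_cring])

lemma multiple_nat: "alg_hom R B C f \<Longrightarrow> x \<in> nil[B] \<Longrightarrow>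
   f (multiple (line_group F) i B x) = multiple (line_group F) i C (f x)"
  by (induction i) (auto simp: alg_homD(9) nat multiple_closed[OF alg_homD(1)])

lemma multiple_scaled:
  assumes B: "is_alg R B" and t: "t \<in> nil[B]" and x: "x \<in> nil[B]"
  shows "\<exists>u\<in>carrier[B]. multiple (line_group F) i B (t \<otimes>[B] x) =
    t \<otimes>[B] (nat_in (ring_of B) i \<otimes>[B] x \<oplus>[B] t \<otimes>[B] u)"
proof (induction i)
  case 0
  interpret B: big_cring "ring_of B" by (rule alg_big[OF B])
  show ?case using t x by (intro bexI[of _ "\<zero>[B]"]) auto
next
  case (Suc i)
  interpret B: big_cring "ring_of B" by (rule alg_big[OF B])
  have tc: "t \<in> carrier[B]" and xc: "x \<in> carrier[B]" using t x by auto
  obtain u where u: "u \<in> carrier[B]" "multiple (line_group F) i B (t \<otimes>[B] x) =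
    t \<otimes>[B] (nat_in (ring_of B) i \<otimes>[B] x \<oplus>[B] t \<otimes>[B] u)" using Suc by blast
  define X where "X = nat_in (ring_of B) i \<otimes>[B] x"
  have X: "X \<in> nil[B]" unfolding X_def using x by (intro B.scaled_nil) auto
  have Xt: "X \<oplus>[B] t \<otimes>[B] u \<in> nil[B]" using X t u by (intro B.add_nil B.mult_nil)
  obtain v where v: "v \<in> carrier[B]" "F B (t \<otimes>[B] (X \<oplus>[B] t \<otimes>[B] u)) (t \<otimes>[B] x) =
    t \<otimes>[B] (((X \<oplus>[B] t \<otimes>[B] u) \<oplus>[B] x) \<oplus>[B] t \<otimes>[B] v)"
    using F_scaled[OF B tc Xt x] by blast
  have "((X \<oplus>[B] t \<otimes>[B] u) \<oplus>[B] x) \<oplus>[B] t \<otimes>[B] v =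
    (X \<oplus>[B] x) \<oplus>[B] t \<otimes>[B] (u \<oplus>[B] v)"
    using nil_carrier[OF X] tc xc u(1) v(1) by (simp add: B.r_distr B.a_ac)
  moreover have "X \<oplus>[B] x = nat_in (ring_of B) (Suc i) \<otimes>[B] x"
    using xc by (simp add: X_def B.l_distr)
  ultimately have "multiple (line_group F) (Suc i) B (t \<otimes>[B] x) =
    t \<otimes>[B] (nat_in (ring_of B) (Suc i) \<otimes>[B] x \<oplus>[B] t \<otimes>[B] (u \<oplus>[B] v))"
    using u(2) v(2) by (simp add: X_def[symmetric])
  thus ?case using u(1) v(1) by blast
qed

end

section \<open>The failure of a power series to be additive for the group law\<close>

locale formal_group_field = nil_group R F + line_field R p for R :: "'u ring" (structure) and F and p
begin

definition defect :: "(nat \<Rightarrow> 'u) \<Rightarrow> 'u alg \<Rightarrow> 'u \<Rightarrow> 'u \<Rightarrow> 'u" where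
  "defect c B x y = kser c B (F B x y) \<ominus>[B] (kser c B x \<oplus>[B] kser c B y)"

lemma defect_natop:
  assumes c: "\<And>k. c k \<in> carrier R" shows "natop R 2 (\<lambda>B xs. defect c B (xs ! 0) (xs ! 1))"
proof (rule natopI)
  fix B xs assume B: "is_alg R B" and "xs \<in> nilpts B 2"
  then obtain x y where xs: "xs = [x, y]" and n: "x \<in> nil[B]" "y \<in> nil[B]"
    by (auto simp: nilpts_def length_Suc_conv numeral_2_eq_2)
  interpret B: big_cring "ring_of B" by (rule alg_big[OF B])
  show "defect c B (xs ! 0) (xs ! 1) \<in> carrier[B]"
    using n xs kser_closed[OF B c] F_closed[OF B] by (simp add: defect_def)
next
  fix B C f xs assume f: "alg_hom R B C f" and "xs \<in> nilpts B 2"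
  then obtain x y where xs: "xs = [x, y]" and n: "x \<in> nil[B]" "y \<in> nil[B]"
    by (auto simp: nilpts_def length_Suc_conv numeral_2_eq_2)
  note fD = alg_homD[OF f]
  interpret f: ring_hom_cring "ring_of B" "ring_of C" f
    using fD by (simp add: ring_hom_cring_def ring_hom_cring_axioms_def)
  show "defect c C (map f xs ! 0) (map f xs ! 1) = f (defect c B (xs ! 0) (xs ! 1))"
    using n xs kser_closed[OF fD(1) c] F_closed[OF fD(1)] kser_nat[OF f c]
    by (simp add: defect_def a_minus_def nat[OF f])
qed

lemma defect_kser2:
  assumes c: "\<And>k. c k \<in> carrier R"
  shows "\<exists>d. (\<forall>s k. d s k \<in> carrier R) \<and> (\<forall>B x y. is_alg R B \<longrightarrow> x \<in> nil[B] \<longrightarrow> y \<in> nil[B] \<longrightarrow>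
    defect c B x y = kser2 d B y x)"
proof (rule natop2_kser2[OF defect_natop[OF c]])
  fix d assume d: "\<And>s k. d s k \<in> carrier R" "\<And>B x y. is_alg R B \<Longrightarrow> x \<in> nil[B] \<Longrightarrow> y \<in> nil[B] \<Longrightarrow>
      defect c B ([y, x] ! 0) ([y, x] ! 1) = kser2 d B x y"
  have "defect c B x y = kser2 d B y x" if "is_alg R B" "x \<in> nil[B]" "y \<in> nil[B]" for B x y
    using d(2)[of B y x] that by simp
  thus ?thesis using d(1) by blast
qed

text \<open>Both sides equal the value at the triple sum minus the three single values, by
  associativity of \<open>F\<close>.\<close>

lemma defect_cocycle:
  assumes B: "is_alg R B" and c: "\<And>k. c k \<in> carrier R"
    and x: "x \<in> nil[B]" and y: "y \<in> nil[B]" and z: "z \<in> nil[B]"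
  shows "defect c B x y \<oplus>[B] defect c B (F B x y) z = defect c B x (F B y z) \<oplus>[B] defect c B y z"
proof -
  interpret B: big_cring "ring_of B" by (rule alg_big[OF B])
  note Fc = F_closed[OF B]
  have kc: "kser c B w \<in> carrier[B]" if "w \<in> nil[B]" for w by (rule kser_closed[OF B c that])
  define T where "T = kser c B (F B x (F B y z))"
  have T: "kser c B (F B (F B x y) z) = T" using F_assoc[OF B x y z] by (simp add: T_def)
  have cl: "T \<in> carrier[B]" using x y z Fc kc by (simp add: T_def)
  have aux: "(a \<ominus>[B] (u \<oplus>[B] v)) \<oplus>[B] (T \<ominus>[B] (a \<oplus>[B] w)) = T \<ominus>[B] (u \<oplus>[B] v \<oplus>[B] w)"
    if "a \<in> carrier[B]" "u \<in> carrier[B]" "v \<in> carrier[B]" "w \<in> carrier[B]" for a u v w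
  proof -
    have "(a \<ominus>[B] (u \<oplus>[B] v)) \<oplus>[B] (T \<ominus>[B] (a \<oplus>[B] w)) =
      (a \<ominus>[B] a) \<oplus>[B] (T \<ominus>[B] (u \<oplus>[B] v \<oplus>[B] w))"
      using that cl by (simp add: a_minus_def B.minus_add B.a_ac)
    thus ?thesis using that cl by (simp add: a_minus_def[of _ a a] B.r_neg)
  qed
  have "defect c B x y \<oplus>[B] defect c B (F B x y) z = T \<ominus>[B] (kser c B x \<oplus>[B] kser c B y \<oplus>[B] kser c B z)"
    unfolding defect_def T by (rule aux) (use x y z Fc kc in auto)
  moreover have "defect c B x (F B y z) \<oplus>[B] defect c B y z = T \<ominus>[B] (kser c B y \<oplus>[B] kser c B z \<oplus>[B] kser c B x)"
  proof -
    have "defect c B x (F B y z) \<oplus>[B] defect c B y z =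
      (kser c B (F B y z) \<ominus>[B] (kser c B y \<oplus>[B] kser c B z)) \<oplus>[B] (T \<ominus>[B] (kser c B (F B y z) \<oplus>[B] kser c B x))"
      unfolding defect_def T_def[symmetric] using x y z Fc kc cl by (simp add: B.a_comm)
    also have "\<dots> = T \<ominus>[B] (kser c B y \<oplus>[B] kser c B z \<oplus>[B] kser c B x)"
      by (rule aux) (use x y z Fc kc in auto)
    finally show ?thesis .
  qed
  ultimately show ?thesis using x y z kc by (simp add: B.a_ac)
qed

text \<open>Telescoping: passing from the \<open>i\<close>-th to the next multiple of
  \<open>x\<close> changes \<open>kser c\<close> by \<open>kser c B x\<close> plus a defect.\<close>

lemma defect_sum:
  assumes B: "is_alg R B" and c: "\<And>k. c k \<in> carrier R" and c0: "c 0 = \<zero>" and x: "x \<in> nil[B]"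
  shows "(\<Oplus>\<^bsub>ring_of B\<^esub>i\<in>{..<m}. defect c B (multiple (line_group F) i B x) x) \<oplus>[B] nat_in (ring_of B) m \<otimes>[B] kser c B x
    = kser c B (multiple (line_group F) m B x)"
proof -
  interpret B: big_cring "ring_of B" by (rule alg_big[OF B])
  have kc: "kser c B w \<in> carrier[B]" if "w \<in> nil[B]" for w by (rule kser_closed[OF B c that])
  have mc: "multiple (line_group F) i B x \<in> nil[B]" for i by (rule multiple_closed[OF B x])
  have dc: "defect c B (multiple (line_group F) i B x) x \<in> carrier[B]" for i
    using kc mc x F_closed[OF B] by (simp add: defect_def)
  show ?thesis
  proof (induction m)
    case 0
    have "kser c B \<zero>[B] = \<zero>[B]"
      unfolding kser_def using B.series_at_zero[of "\<lambda>k. str_map B (c k)", OF str_closed[OF B c]] c0 alg_str_zero[OF B] by simp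
    thus ?case using kc[OF x] by simp
  next
    case (Suc m)
    define S where "S = (\<Oplus>\<^bsub>ring_of B\<^esub>i\<in>{..<m}. defect c B (multiple (line_group F) i B x) x)"
    define N where "N = nat_in (ring_of B) m"
    define k where "k = kser c B x"
    define M where "M = kser c B (multiple (line_group F) m B x)"
    define M' where "M' = kser c B (multiple (line_group F) (Suc m) B x)"
    have cl: "S \<in> carrier[B]" "N \<in> carrier[B]" "k \<in> carrier[B]" "M \<in> carrier[B]" "M' \<in> carrier[B]"
      using dc kc x mc mc[of "Suc m"] by (auto simp: S_def N_def k_def M_def M'_def simp del: multiple.simps intro!: B.finsum_closed)
    have IH: "S \<oplus>[B] N \<otimes>[B] k = M" using Suc by (simp add: S_def N_def k_def M_def)
    have "(\<Oplus>\<^bsub>ring_of B\<^esub>i\<in>{..<Suc m}. defect c B (multiple (line_group F) i B x) x) = (M' \<ominus>[B] (M \<oplus>[B] k)) \<oplus>[B] S"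
      using dc by (subst B.finsum_lessThan_Suc) (auto simp: defect_def[of c B "multiple (line_group F) m B x"] S_def M_def M'_def k_def)
    hence "(\<Oplus>\<^bsub>ring_of B\<^esub>i\<in>{..<Suc m}. defect c B (multiple (line_group F) i B x) x) \<oplus>[B] nat_in (ring_of B) (Suc m) \<otimes>[B] k
       = ((M' \<ominus>[B] (M \<oplus>[B] k)) \<oplus>[B] S) \<oplus>[B] (N \<otimes>[B] k \<oplus>[B] k)"
      using cl by (simp add: N_def B.l_distr)
    also have "\<dots> = (M' \<ominus>[B] (M \<oplus>[B] k)) \<oplus>[B] ((S \<oplus>[B] N \<otimes>[B] k) \<oplus>[B] k)"
      using cl by (simp add: B.a_assoc)
    also have "\<dots> = M'" unfolding IH using cl by (simp add: a_minus_def B.a_assoc B.l_neg)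
    finally show ?case by (simp only: k_def M'_def)
  qed
qed

end

context formal_group_field
begin

text \<open>The degree \<open>n\<close> part of the failure of a truncated logarithm to be additive is a cocycle.
  Being a coboundary, it can be killed by changing the coefficient of \<open>T\<^sup>n\<close>.\<close>

definition log_stage :: "nat \<Rightarrow> (nat \<Rightarrow> 'u) \<Rightarrow> bool" where
  "log_stage n g \<longleftrightarrow> g n \<in> carrier R \<and> (n = 0 \<longrightarrow> g 0 = \<zero>) \<and> (n = 1 \<longrightarrow> g 1 = \<one>) \<and>
     (\<forall>B t x y. is_alg R B \<longrightarrow> t \<in> carrier[B] \<longrightarrow> t [^][B] Suc n = \<zero>[B] \<longrightarrow>
        x \<in> nil[B] \<longrightarrow> y \<in> nil[B] \<longrightarrow>
        defect (\<lambda>k. if k \<le> n then g k else \<zero>) B (t \<otimes>[B] x) (t \<otimes>[B] y) = \<zero>[B])"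

lemma log_step:
  assumes n: "2 \<le> n" and c: "\<And>k. c k \<in> carrier R" and c0: "c 0 = \<zero>" and cn: "c n = \<zero>"
    and tors: "p \<noteq> 0 \<Longrightarrow> (\<And>B x. is_alg R B \<Longrightarrow> x \<in> nil[B] \<Longrightarrow> multiple (line_group F) p B x = \<zero>[B])"
    and prev: "\<And>B t x y. is_alg R B \<Longrightarrow> t \<in> carrier[B] \<Longrightarrow> t [^][B] n = \<zero>[B] \<Longrightarrow>
        x \<in> nil[B] \<Longrightarrow> y \<in> nil[B] \<Longrightarrow> defect c B (t \<otimes>[B] x) (t \<otimes>[B] y) = \<zero>[B]"
  shows "\<exists>b\<in>carrier R. \<forall>B t x y. is_alg R B \<longrightarrow> t \<in> carrier[B] \<longrightarrow> t [^][B] Suc n = \<zero>[B] \<longrightarrow>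
        x \<in> nil[B] \<longrightarrow> y \<in> nil[B] \<longrightarrow>
        defect (\<lambda>k. c k \<ominus> (if k = n then b else \<zero>)) B (t \<otimes>[B] x) (t \<otimes>[B] y) = \<zero>[B]"
proof -
  obtain d where d: "\<And>s k. d s k \<in> carrier R"
    and dd: "\<And>B x y. is_alg R B \<Longrightarrow> x \<in> nil[B] \<Longrightarrow> y \<in> nil[B] \<Longrightarrow> defect c B x y = kser2 d B y x"
    using defect_kser2[where c = c, OF c] by blast
  \<comment> \<open>The previous stage says that the defect vanishes modulo total degree
    \<open>n\<close>.\<close>
  have d0: "d s k = \<zero>" if "s + k < n" for s k
  proof (rule kser2_scaled_zero[OF d _ that])
    fix B t x y assume B: "is_alg R B" and t: "t \<in> carrier[B]" "t [^][B] n = \<zero>[B]"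
      and xy: "x \<in> nil[B]" "y \<in> nil[B]"
    show "kser2 d B (t \<otimes>[B] y) (t \<otimes>[B] x) = \<zero>[B]"
      using dd[OF B cring.scaled_nil[OF is_alg_cring[OF B] t(1) xy(1)] cring.scaled_nil[OF is_alg_cring[OF B] t(1) xy(2)]]
        prev[OF B t xy] by simp
  qed
  define h where "h s = d s (n - s)" for s
  have h: "h s \<in> carrier R" for s using d by (simp add: h_def)
  have lead: "defect c B (t \<otimes>[B] x) (t \<otimes>[B] y) = t [^][B] n \<otimes>[B] aform n h B x y"
    if B: "is_alg R B" and t: "t \<in> carrier[B]" "t [^][B] Suc n = \<zero>[B]"
      and x: "x \<in> nil[B]" and y: "y \<in> nil[B]" for B t x y
    unfolding dd[OF B cring.scaled_nil[OF is_alg_cring[OF B] t(1) x] cring.scaled_nil[OF is_alg_cring[OF B] t(1) y]] h_def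
    by (rule kser2_scaled_leading[OF d d0 B t x y])
  have ac: "aform n h B x y \<in> carrier[B]" if "is_alg R B" "x \<in> carrier[B]" "y \<in> carrier[B]" for B x y
    by (rule aform_closed[OF that(1) h that(2,3)])
  \<comment> \<open>The coefficient of the pure power of \<open>y\<close>, killed by the unit law
    and \<open>c 0 = 0\<close>.\<close>
  have h00: "h 0 = \<zero>"
  proof -
    have "d 0 k = \<zero>" for k
    proof (rule kser_unique[OF d])
      fix B y assume B: "is_alg R B" and y: "y \<in> nil[B]"
      interpret B: big_cring "ring_of B" by (rule alg_big[OF B])
      have kc: "kser (d s) B y \<in> carrier[B]" for s by (rule kser_closed[OF B d y])
      have k0: "kser c B \<zero>[B] = \<zero>[B]"
        unfolding kser_def using B.series_at_zero[of "\<lambda>k. str_map B (c k)", OF str_closed[OF B c]] c0 alg_str_zero[OF B] by simp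
      have "kser (d 0) B y = kser2 d B y \<zero>[B]"
        unfolding kser2_def using B.series_at_zero[of "\<lambda>s. kser (d s) B y", OF kc] by simp
      also have "\<dots> = defect c B \<zero>[B] y" using dd[OF B B.zero_nil y] by simp
      also have "\<dots> = \<zero>[B]"
        unfolding defect_def F_zero(2)[OF B y] k0 using kser_closed[OF B c y] by simp
      finally show "kser (d 0) B y = \<zero>[B]" .
    qed
    thus ?thesis by (simp add: h_def)
  qed
  \<comment> \<open>Commutativity of \<open>F\<close>, seen in the leading degree.\<close>
  have sym: "h s = h (n - s)" if s: "s \<le> n" for s
  proof -
    have "h s \<ominus> h (n - s) = \<zero>"
    proof (rule aform_zero[where h = "\<lambda>s. h s \<ominus> h (n - s)", OF _ _ s])
      fix B x y assume B: "is_alg R B" and x: "x \<in> nil[B]" and y: "y \<in> nil[B]"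
      interpret B: big_cring "ring_of B" by (rule alg_big[OF B])
      interpret s: ring_hom_cring R "ring_of B" "str_map B"
        using is_alg_str[OF B] is_cring B.is_cring by (simp add: ring_hom_cring_def ring_hom_cring_axioms_def)
      have xc: "x \<in> carrier[B]" and yc: "y \<in> carrier[B]" using x y by auto
      have eq: "aform n (\<lambda>s. h s \<ominus> h (n - s)) B x y = aform n h B x y \<ominus>[B] aform n h B y x"
      proof -
        have "aform n (\<lambda>s. h s \<ominus> h (n - s)) B x y = form (ring_of B) n (\<lambda>s. str_map B (h s) \<ominus>[B] str_map B (h (n - s))) x y"
          unfolding aform_def using h by (simp add: a_minus_def)
        also have "\<dots> = aform n h B x y \<ominus>[B] form (ring_of B) n (\<lambda>s. str_map B (h (n - s))) x y"
          unfolding aform_def using h xc yc by (intro B.form_minus) auto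
        also have "form (ring_of B) n (\<lambda>s. str_map B (h (n - s))) x y = aform n h B y x"
          unfolding aform_def using h xc yc by (intro B.form_swap[symmetric]) auto
        finally show ?thesis .
      qed
      have "aform n h B x y \<ominus>[B] aform n h B y x = \<zero>[B]"
      proof (rule generic_coefficient[OF B, of _ n])
        fix C f t assume f: "alg_hom R B C f" and t: "t \<in> carrier[C]" "t [^][C] Suc n = \<zero>[C]"
        note fD = alg_homD[OF f]
        interpret C: big_cring "ring_of C" by (rule alg_big[OF fD(2)])
        interpret f: ring_hom_cring "ring_of B" "ring_of C" f
          using fD by (simp add: ring_hom_cring_def ring_hom_cring_axioms_def)
        have X: "f x \<in> nil[C]" "f y \<in> nil[C]" using x y fD(8) by auto
        have "t [^][C] n \<otimes>[C] aform n h C (f x) (f y) = t [^][C] n \<otimes>[C] aform n h C (f y) (f x)"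
          unfolding lead[OF fD(2) t X(1,2), symmetric] lead[OF fD(2) t X(2,1), symmetric] defect_def
          using F_comm[OF fD(2) C.scaled_nil[OF t(1) X(1)] C.scaled_nil[OF t(1) X(2)]]
            kser_closed[OF fD(2) c C.scaled_nil[OF t(1) X(1)]] kser_closed[OF fD(2) c C.scaled_nil[OF t(1) X(2)]]
          by (simp add: C.a_comm)
        thus "f (aform n h B x y \<ominus>[B] aform n h B y x) \<otimes>[C] t [^][C] n = \<zero>[C]"
          using ac[OF B] ac[OF fD(2)] xc yc X t(1)
          by (simp add: a_minus_def aform_nat[OF f h] C.l_distr C.l_minus C.r_distr C.r_minus C.m_comm C.r_neg)
      qed (use ac[OF B] xc yc in simp)
      thus "aform n (\<lambda>s. h s \<ominus> h (n - s)) B x y = \<zero>[B]" unfolding eq .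
    qed (use h in simp)
    thus ?thesis using h by simp
  qed
  \<comment> \<open>In the leading degree the arguments matter only modulo \<open>t\<close>. Hence
    values of \<open>F\<close> and of its multiples may be replaced by ordinary sums and
    multiples.\<close>
  have pert: "defect c B (t \<otimes>[B] (x \<oplus>[B] t \<otimes>[B] u)) (t \<otimes>[B] (y \<oplus>[B] t \<otimes>[B] v)) =
      t [^][B] n \<otimes>[B] aform n h B x y"
    if B: "is_alg R B" and t: "t \<in> carrier[B]" "t [^][B] Suc n = \<zero>[B]"
      and x: "x \<in> nil[B]" and y: "y \<in> nil[B]" and u: "u \<in> carrier[B]" and v: "v \<in> carrier[B]" for B t x y u v
  proof -
    interpret B: big_cring "ring_of B" by (rule alg_big[OF B])
    have tn: "t \<in> nil[B]" by (rule nilI[OF t])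
    have X: "x \<oplus>[B] t \<otimes>[B] u \<in> nil[B]" "y \<oplus>[B] t \<otimes>[B] v \<in> nil[B]"
      by (rule B.add_nil[OF x B.mult_nil(2)[OF tn u]] B.add_nil[OF y B.mult_nil(2)[OF tn v]])+
    show ?thesis unfolding lead[OF B t X] aform_def
      by (rule B.form_perturb[OF t nil_carrier[OF x] u nil_carrier[OF y] v str_closed[OF B h]])
  qed
  \<comment> \<open>The leading part of \<open>defect_cocycle\<close>; the inner applications of
    \<open>F\<close> become sums by \<open>pert\<close>.\<close>
  have coc: "cocycle n h"
    unfolding cocycle_def
  proof (intro allI impI)
    fix B x y z assume B: "is_alg R B" and x: "x \<in> nil[B]" and y: "y \<in> nil[B]" and z: "z \<in> nil[B]"
    interpret B: big_cring "ring_of B" by (rule alg_big[OF B])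
    have xc: "x \<in> carrier[B]" and yc: "y \<in> carrier[B]" and zc: "z \<in> carrier[B]" using x y z by auto
    let ?l = "\<lambda>B x y z. aform n h B x y \<oplus>[B] aform n h B (x \<oplus>[B] y) z"
    let ?r = "\<lambda>B x y z. aform n h B x (y \<oplus>[B] z) \<oplus>[B] aform n h B y z"
    have "?l B x y z \<ominus>[B] ?r B x y z = \<zero>[B]"
    proof (rule generic_coefficient[OF B, of _ n])
      fix C f t assume f: "alg_hom R B C f" and t: "t \<in> carrier[C]" "t [^][C] Suc n = \<zero>[C]"
      note fD = alg_homD[OF f]
      interpret C: big_cring "ring_of C" by (rule alg_big[OF fD(2)])
      interpret f: ring_hom_cring "ring_of B" "ring_of C" f
        using fD by (simp add: ring_hom_cring_def ring_hom_cring_axioms_def)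
      define X where "X = f x"
      define Y where "Y = f y"
      define Z where "Z = f z"
      have n: "X \<in> nil[C]" "Y \<in> nil[C]" "Z \<in> nil[C]"
        using x y z fD(8) by (auto simp: X_def Y_def Z_def)
      have cc: "X \<in> carrier[C]" "Y \<in> carrier[C]" "Z \<in> carrier[C]" using n by auto
      note tn = C.scaled_nil[OF t(1) n(1)] C.scaled_nil[OF t(1) n(2)] C.scaled_nil[OF t(1) n(3)]
      obtain u where u: "u \<in> carrier[C]" "F C (t \<otimes>[C] X) (t \<otimes>[C] Y) = t \<otimes>[C] ((X \<oplus>[C] Y) \<oplus>[C] t \<otimes>[C] u)"
        using F_scaled[OF fD(2) t(1) n(1,2)] by blast
      obtain v where v: "v \<in> carrier[C]" "F C (t \<otimes>[C] Y) (t \<otimes>[C] Z) = t \<otimes>[C] ((Y \<oplus>[C] Z) \<oplus>[C] t \<otimes>[C] v)"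
        using F_scaled[OF fD(2) t(1) n(2,3)] by blast
      let ?t = "t [^][C] n"
      have z0: "w \<oplus>[C] t \<otimes>[C] \<zero>[C] = w" if "w \<in> carrier[C]" for w using that t(1) by simp
      have e1: "defect c C (F C (t \<otimes>[C] X) (t \<otimes>[C] Y)) (t \<otimes>[C] Z) = ?t \<otimes>[C] aform n h C (X \<oplus>[C] Y) Z"
        using pert[OF fD(2) t C.add_nil[OF n(1,2)] n(3) u(1) C.zero_closed] unfolding u(2) z0[OF cc(3)] .
      have e2: "defect c C (t \<otimes>[C] X) (F C (t \<otimes>[C] Y) (t \<otimes>[C] Z)) = ?t \<otimes>[C] aform n h C X (Y \<oplus>[C] Z)"
        using pert[OF fD(2) t n(1) C.add_nil[OF n(2,3)] C.zero_closed v(1)] unfolding v(2) z0[OF cc(1)] .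
      have "?t \<otimes>[C] ?l C X Y Z = ?t \<otimes>[C] ?r C X Y Z"
        using defect_cocycle[where c = c, OF fD(2) c tn] cc t(1) ac[OF fD(2)]
        unfolding e1 e2 lead[OF fD(2) t n(1,2)] lead[OF fD(2) t n(2,3)] by (simp add: C.r_distr)
      hence "?l C X Y Z \<otimes>[C] ?t = ?r C X Y Z \<otimes>[C] ?t"
        using cc t(1) ac[OF fD(2)] by (simp add: C.m_comm)
      moreover have "f (?l B x y z \<ominus>[B] ?r B x y z) = ?l C X Y Z \<ominus>[C] ?r C X Y Z"
        using xc yc zc ac[OF B] by (simp add: a_minus_def aform_nat[OF f h] X_def Y_def Z_def)
      moreover have "?l C X Y Z \<in> carrier[C]" "?r C X Y Z \<in> carrier[C]" "?t \<in> carrier[C]"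
        using cc t(1) ac[OF fD(2)] by auto
      ultimately show "f (?l B x y z \<ominus>[B] ?r B x y z) \<otimes>[C] ?t = \<zero>[C]"
        by (simp add: a_minus_def C.l_distr C.l_minus C.r_neg)
    qed (use ac[OF B] xc yc zc in simp)
    thus "?l B x y z = ?r B x y z" using ac[OF B] xc yc zc by simp
  qed
  \<comment> \<open>The leading part of \<open>defect_sum\<close> for \<open>m = p\<close>: the
    multiple by \<open>p\<close> is zero by hypothesis, and the term with the integer
    \<open>p\<close> vanishes in characteristic \<open>p\<close>.\<close>
  have tor: "torsion n h" if p: "p \<noteq> 0"
    unfolding torsion_def
  proof (intro allI impI)
    fix B x assume B: "is_alg R B" and x: "x \<in> nil[B]"
    interpret B: big_cring "ring_of B" by (rule alg_big[OF B])
    have xc: "x \<in> carrier[B]" using x by simp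
    let ?S = "\<lambda>B x. \<Oplus>\<^bsub>ring_of B\<^esub>i\<in>{..<p}. aform n h B (nat_in (ring_of B) i \<otimes>[B] x) x"
    show "?S B x = \<zero>[B]"
    proof (rule generic_coefficient[OF B, of _ n])
      show "?S B x \<in> carrier[B]" using xc ac[OF B] by (intro B.finsum_closed) auto
      fix C f t assume f: "alg_hom R B C f" and t: "t \<in> carrier[C]" "t [^][C] Suc n = \<zero>[C]"
      note fD = alg_homD[OF f]
      interpret C: big_cring "ring_of C" by (rule alg_big[OF fD(2)])
      interpret f: ring_hom_cring "ring_of B" "ring_of C" f
        using fD by (simp add: ring_hom_cring_def ring_hom_cring_axioms_def)
      define X where "X = f x"
      have X: "X \<in> nil[C]" "X \<in> carrier[C]" using fD(8)[OF x] by (auto simp: X_def)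
      have tn: "t \<in> nil[C]" by (rule nilI[OF t])
      let ?t = "t [^][C] n"
      have fS: "f (?S B x) = ?S C X"
        using xc ac[OF B] ac[OF fD(2)] X
        by (subst f.hom_finsum) (auto simp: comp_def X_def aform_nat[OF f h] hom_nat_in[OF fD(4,5,3)] intro!: C.finsum_cong')
      have e: "defect c C (multiple (line_group F) i C (t \<otimes>[C] X)) (t \<otimes>[C] X) =
        ?t \<otimes>[C] aform n h C (nat_in (ring_of C) i \<otimes>[C] X) X" for i
      proof -
        obtain u where u: "u \<in> carrier[C]" "multiple (line_group F) i C (t \<otimes>[C] X) =
           t \<otimes>[C] (nat_in (ring_of C) i \<otimes>[C] X \<oplus>[C] t \<otimes>[C] u)"
          using multiple_scaled[OF fD(2) tn X(1)] by blast
        have z0: "X \<oplus>[C] t \<otimes>[C] \<zero>[C] = X" using X t(1) by simp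
        show ?thesis
          using pert[OF fD(2) t C.scaled_nil[OF C.nat_in_closed X(1)] X(1) u(1) C.zero_closed] unfolding u(2) z0 .
      qed
      have kc: "kser c C (t \<otimes>[C] X) \<in> carrier[C]" by (rule kser_closed[OF fD(2) c C.scaled_nil[OF t(1) X(1)]])
      have k0: "kser c C \<zero>[C] = \<zero>[C]"
        unfolding kser_def using C.series_at_zero[of "\<lambda>k. str_map C (c k)", OF str_closed[OF fD(2) c]] c0 alg_str_zero[OF fD(2)] by simp
      have np: "nat_in (ring_of C) p = \<zero>[C]" by (rule alg_nat_in_zero[OF fD(2) dvd_refl])
      have sc: "(\<Oplus>\<^bsub>ring_of C\<^esub>i\<in>{..<p}. ?t \<otimes>[C] aform n h C (nat_in (ring_of C) i \<otimes>[C] X) X) \<in> carrier[C]"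
        using X ac[OF fD(2)] t(1) by (intro C.finsum_closed) auto
      have "(\<Oplus>\<^bsub>ring_of C\<^esub>i\<in>{..<p}. ?t \<otimes>[C] aform n h C (nat_in (ring_of C) i \<otimes>[C] X) X) = \<zero>[C]"
        using defect_sum[where c = c, OF fD(2) c c0 C.scaled_nil[OF t(1) X(1)], of p] kc sc
        unfolding e tors[OF p fD(2) C.scaled_nil[OF t(1) X(1)]] k0 np by simp
      hence "?t \<otimes>[C] ?S C X = \<zero>[C]"
        using X ac[OF fD(2)] t(1) by (subst C.finsum_rdistr) auto
      moreover have "?S C X \<in> carrier[C]" using X ac[OF fD(2)] by (intro C.finsum_closed) auto
      ultimately show "f (?S B x) \<otimes>[C] ?t = \<zero>[C]"
        unfolding fS using t(1) by (simp add: C.m_comm)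
    qed
  qed
  have hnn: "h n = \<zero>" using sym[of n] h00 by simp
  obtain b where b: "b \<in> carrier R" and bb: "\<And>B x y. is_alg R B \<Longrightarrow> x \<in> nil[B] \<Longrightarrow> y \<in> nil[B] \<Longrightarrow>
    aform n h B x y = str_map B b \<otimes>[B] ((x \<oplus>[B] y) [^][B] n
       \<ominus>\<^bsub>ring_of B\<^esub> x [^][B] n \<ominus>[B] y [^][B] n)"
    using cocycle_coboundary[of n h, OF n h h00 hnn sym coc tor] by blast
  show ?thesis
  proof (intro bexI[OF _ b] allI impI)
    fix B t x y assume B: "is_alg R B" and t: "t \<in> carrier[B]" "t [^][B] Suc n = \<zero>[B]"
      and x: "x \<in> nil[B]" and y: "y \<in> nil[B]"
    interpret B: big_cring "ring_of B" by (rule alg_big[OF B])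
    have xc: "x \<in> carrier[B]" and yc: "y \<in> carrier[B]" using x y by auto
    have tx: "t \<otimes>[B] x \<in> nil[B]" and ty: "t \<otimes>[B] y \<in> nil[B]"
      by (rule B.scaled_nil[OF t(1) x] B.scaled_nil[OF t(1) y])+
    obtain u where u: "u \<in> carrier[B]" "F B (t \<otimes>[B] x) (t \<otimes>[B] y) = t \<otimes>[B] ((x \<oplus>[B] y) \<oplus>[B] t \<otimes>[B] u)"
      using F_scaled[OF B t(1) x y] by blast
    define T where "T = t [^][B] n"
    define S where "S = (x \<oplus>[B] y) [^][B] n"
    define X where "X = x [^][B] n"
    define Y where "Y = y [^][B] n"
    define \<beta> where "\<beta> = str_map B b"
    define P where "P = kser c B (F B (t \<otimes>[B] x) (t \<otimes>[B] y))"
    define P1 where "P1 = kser c B (t \<otimes>[B] x)"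
    define P2 where "P2 = kser c B (t \<otimes>[B] y)"
    have cl: "T \<in> carrier[B]" "S \<in> carrier[B]" "X \<in> carrier[B]" "Y \<in> carrier[B]" "\<beta> \<in> carrier[B]"
      "P \<in> carrier[B]" "P1 \<in> carrier[B]" "P2 \<in> carrier[B]"
      using t xc yc str_closed[OF B b] kser_closed[OF B c] F_closed[OF B tx ty] tx ty
      by (auto simp: T_def S_def X_def Y_def \<beta>_def P_def P1_def P2_def)
    \<comment> \<open>Subtracting \<open>b T^n\<close> from the series changes the defect in degree
      \<open>n\<close> by \<open>b\<close> times the coboundary of the \<open>n\<close>-th power,
      and \<open>b\<close> was chosen to cancel.\<close>
    have Fn: "F B (t \<otimes>[B] x) (t \<otimes>[B] y) [^][B] n = T \<otimes>[B] S"
      unfolding u(2) T_def S_def using B.pow_perturb[OF t B.a_closed[OF xc yc] u(1), of n] t(1) xc yc u(1)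
      by (simp add: B.nat_pow_distrib)
    have xn: "(t \<otimes>[B] x) [^][B] n = T \<otimes>[B] X" "(t \<otimes>[B] y) [^][B] n = T \<otimes>[B] Y"
      using t(1) xc yc by (simp_all add: T_def X_def Y_def B.nat_pow_distrib)
    have old: "P \<ominus>[B] (P1 \<oplus>[B] P2) = T \<otimes>[B] (\<beta> \<otimes>[B] (S \<ominus>[B] X \<ominus>[B] Y))"
      using lead[OF B t x y] bb[OF B x y] by (simp add: defect_def P_def P1_def P2_def T_def S_def X_def Y_def \<beta>_def)
    have "defect (\<lambda>k. c k \<ominus> (if k = n then b else \<zero>)) B (t \<otimes>[B] x) (t \<otimes>[B] y) =
      (P \<ominus>[B] \<beta> \<otimes>[B] (T \<otimes>[B] S)) \<ominus>[B]
        ((P1 \<ominus>[B] \<beta> \<otimes>[B] (T \<otimes>[B] X)) \<oplus>[B] (P2 \<ominus>[B] \<beta> \<otimes>[B] (T \<otimes>[B] Y)))"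
      unfolding defect_def kser_minus_monom[OF B c b tx] kser_minus_monom[OF B c b ty] kser_minus_monom[OF B c b F_closed[OF B tx ty]]
        Fn xn P_def P1_def P2_def \<beta>_def ..
    also have "\<dots> = (P \<ominus>[B] (P1 \<oplus>[B] P2)) \<ominus>[B] T \<otimes>[B] (\<beta> \<otimes>[B] (S \<ominus>[B] X \<ominus>[B] Y))"
      using cl by algebra
    also have "\<dots> = \<zero>[B]" unfolding old using cl by simp
    finally show "defect (\<lambda>k. c k \<ominus> (if k = n then b else \<zero>)) B (t \<otimes>[B] x) (t \<otimes>[B] y) = \<zero>[B]" .
  qed
qed

text \<open>The hypothesis is void for \<open>p = 0\<close>; for positive \<open>p\<close> it is
  what makes all the cocycles met in the induction coboundaries. Prescribing \<open>g 1 = 1\<close>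
  makes the logarithm a change of coordinate.\<close>

theorem logarithm_exists:
  assumes tors: "p \<noteq> 0 \<Longrightarrow> (\<And>B x. is_alg R B \<Longrightarrow> x \<in> nil[B] \<Longrightarrow> multiple (line_group F) p B x = \<zero>[B])"
  shows "\<exists>g. (\<forall>k. g k \<in> carrier R) \<and> g 0 = \<zero> \<and> g 1 = \<one> \<and>
    (\<forall>B x y. is_alg R B \<longrightarrow> x \<in> nil[B] \<longrightarrow> y \<in> nil[B] \<longrightarrow>
       kser g B (F B x y) = kser g B x \<oplus>[B] kser g B y)"
proof -
  have "\<exists>g. \<forall>n. log_stage n g"
  proof (rule sequence_choice)
    fix n and g g' :: "nat \<Rightarrow> 'u" assume e: "\<And>k. k \<le> n \<Longrightarrow> g k = g' k" and s: "log_stage n g"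
    have te: "(\<lambda>k. if k \<le> n then g k else \<zero>) = (\<lambda>k. if k \<le> n then g' k else \<zero>)" using e by auto
    have "g n = g' n" "n = 1 \<Longrightarrow> g 1 = g' 1" "n = 0 \<Longrightarrow> g 0 = g' 0" using e by auto
    thus "log_stage n g'" using s unfolding log_stage_def te by simp
  next
    fix n g assume IH: "\<And>k. k < n \<Longrightarrow> log_stage k g"
    consider "n = 0" | "n = 1" | "2 \<le> n" by linarith
    thus "\<exists>c. log_stage n (g(n := c))"
    proof cases
      case 1
      have "log_stage 0 (g(0 := \<zero>))"
        unfolding log_stage_def
      proof (intro conjI allI impI)
        fix B t x y assume B: "is_alg R B" and t: "t \<in> carrier[B]" "t [^][B] Suc 0 = \<zero>[B]"
          and x: "x \<in> nil[B]" and y: "y \<in> nil[B]"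
        interpret B: big_cring "ring_of B" by (rule alg_big[OF B])
        have t0: "t = \<zero>[B]" using t by simp
        have "kser (\<lambda>k. \<zero>) B \<zero>[B] = \<zero>[B]"
          unfolding kser_def using B.series_at_zero[of "\<lambda>k. str_map B \<zero>"] alg_str_zero[OF B] by simp
        moreover have "(\<lambda>k. if k \<le> 0 then (g(0 := \<zero>)) k else \<zero>) = (\<lambda>k. \<zero>)" by auto
        ultimately show "defect (\<lambda>k. if k \<le> 0 then (g(0 := \<zero>)) k else \<zero>) B (t \<otimes>[B] x) (t \<otimes>[B] y) = \<zero>[B]"
          using x y F_zero[OF B B.zero_nil] by (simp only: defect_def t0 B.l_null nil_carrier) (simp add: a_minus_def)
      qed auto
      thus ?thesis using 1 by blast
    next
      case 2
      have g0: "g 0 = \<zero>" using IH[of 0] 2 by (simp add: log_stage_def)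
      have "log_stage 1 (g(1 := \<one>))"
        unfolding log_stage_def
      proof (intro conjI allI impI)
        fix B t x y assume B: "is_alg R B" and t: "t \<in> carrier[B]" "t [^][B] Suc 1 = \<zero>[B]"
          and x: "x \<in> nil[B]" and y: "y \<in> nil[B]"
        interpret B: big_cring "ring_of B" by (rule alg_big[OF B])
        have xc: "x \<in> carrier[B]" and yc: "y \<in> carrier[B]" using x y by auto
        have t2: "t \<otimes>[B] t = \<zero>[B]" using t by simp
        have f: "(\<lambda>k. if k \<le> 1 then (g(1 := \<one>)) k else \<zero>) = (\<lambda>k. if k = 1 then \<one> else \<zero>)"
          using g0 by (auto simp: fun_eq_iff le_Suc_eq)
        have k: "kser (\<lambda>k. if k = 1 then \<one> else \<zero>) B z = z" if z: "z \<in> nil[B]" for z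
        proof -
          have "kser (\<lambda>k. if k = 1 then \<one> else \<zero>) B z = series (ring_of B) (\<lambda>k. if k = 1 then \<one>[B] else \<zero>[B]) z"
            unfolding kser_def by (intro B.series_cong) (simp add: alg_str_zero[OF B] alg_str_one[OF B])
          thus ?thesis using z by (simp add: B.series_monom del: One_nat_def)
        qed
        have tx: "t \<otimes>[B] x \<in> nil[B]" and ty: "t \<otimes>[B] y \<in> nil[B]"
          by (rule B.scaled_nil[OF t(1) x] B.scaled_nil[OF t(1) y])+
        obtain u where u: "u \<in> carrier[B]" "F B (t \<otimes>[B] x) (t \<otimes>[B] y) = t \<otimes>[B] ((x \<oplus>[B] y) \<oplus>[B] t \<otimes>[B] u)"
          using F_scaled[OF B t(1) x y] by blast
        have "t \<otimes>[B] ((x \<oplus>[B] y) \<oplus>[B] t \<otimes>[B] u) =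
            (t \<otimes>[B] x \<oplus>[B] t \<otimes>[B] y) \<oplus>[B] (t \<otimes>[B] t) \<otimes>[B] u"
          using t(1) xc yc u(1) by algebra
        thus "defect (\<lambda>k. if k \<le> 1 then (g(1 := \<one>)) k else \<zero>) B (t \<otimes>[B] x) (t \<otimes>[B] y) = \<zero>[B]"
          unfolding f defect_def k[OF tx] k[OF ty] k[OF F_closed[OF B tx ty]] unfolding u(2) t2 using t(1) xc yc u(1) by simp
      qed auto
      thus ?thesis using 2 by blast
    next
      case 3
      \<comment> \<open>The coefficients found so far, with zero in degree \<open>n\<close>; the
        step then puts \<open>-b\<close> there.\<close>
      define c where "c k = (if k < n then g k else \<zero>)" for k
      have c: "c k \<in> carrier R" for k using IH by (simp add: c_def log_stage_def)
      have c0: "c 0 = \<zero>" using IH[of 0] 3 by (simp add: c_def log_stage_def)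
      have cn: "c n = \<zero>" by (simp add: c_def)
      have ce: "(\<lambda>k. if k \<le> n - 1 then g k else \<zero>) = c" using 3 by (auto simp: c_def fun_eq_iff)
      have st: "log_stage (n - 1) g" using IH 3 by simp
      have "\<exists>b\<in>carrier R. \<forall>B t x y. is_alg R B \<longrightarrow> t \<in> carrier[B] \<longrightarrow> t [^][B] Suc n = \<zero>[B] \<longrightarrow>
        x \<in> nil[B] \<longrightarrow> y \<in> nil[B] \<longrightarrow>
        defect (\<lambda>k. c k \<ominus> (if k = n then b else \<zero>)) B (t \<otimes>[B] x) (t \<otimes>[B] y) = \<zero>[B]"
      proof (rule log_step[OF 3 c c0 cn tors])
        fix B t x y assume h: "is_alg R B" "t \<in> carrier[B]" "t [^][B] n = \<zero>[B]"
          "x \<in> nil[B]" "y \<in> nil[B]"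
        have "Suc (n - 1) = n" using 3 by simp
        thus "defect c B (t \<otimes>[B] x) (t \<otimes>[B] y) = \<zero>[B]"
          using st h unfolding log_stage_def ce by metis
      qed
      then obtain b where b: "b \<in> carrier R" "\<forall>B t x y. is_alg R B \<longrightarrow> t \<in> carrier[B] \<longrightarrow> t [^][B] Suc n = \<zero>[B] \<longrightarrow>
        x \<in> nil[B] \<longrightarrow> y \<in> nil[B] \<longrightarrow>
        defect (\<lambda>k. c k \<ominus> (if k = n then b else \<zero>)) B (t \<otimes>[B] x) (t \<otimes>[B] y) = \<zero>[B]" by blast
      have "(\<lambda>k. if k \<le> n then (g(n := \<ominus> b)) k else \<zero>) = (\<lambda>k. c k \<ominus> (if k = n then b else \<zero>))"
      proof
        fix k
        show "(if k \<le> n then (g(n := \<ominus> b)) k else \<zero>) = c k \<ominus> (if k = n then b else \<zero>)"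
          by (cases "k < n"; cases "k = n") (use b(1) c[of k] cn in \<open>auto simp: a_minus_def c_def\<close>)
      qed
      hence "log_stage n (g(n := \<ominus> b))" using b 3 unfolding log_stage_def by simp
      thus ?thesis by blast
    qed
  qed
  then obtain g where g: "\<And>n. log_stage n g" by blast
  have gc: "g k \<in> carrier R" for k using g[of k] by (simp add: log_stage_def)
  have g0: "g 0 = \<zero>" and g1: "g 1 = \<one>" using g[of 0] g[of 1] by (simp_all add: log_stage_def)
  obtain d where d: "\<And>s k. d s k \<in> carrier R"
    and dd: "\<And>B x y. is_alg R B \<Longrightarrow> x \<in> nil[B] \<Longrightarrow> y \<in> nil[B] \<Longrightarrow> defect g B x y = kser2 d B y x"
    using defect_kser2[where c = g, OF gc] by blast
  \<comment> \<open>In total degree \<open>s + k\<close> the complete series cannot be distinguished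
    from its truncation at stage \<open>s + k\<close>.\<close>
  have dz: "d s k = \<zero>" for s k
  proof (rule kser2_scaled_zero[OF d _ lessI])
    fix B t x y assume B: "is_alg R B" and t: "t \<in> carrier[B]" "t [^][B] Suc (s + k) = \<zero>[B]"
      and x: "x \<in> nil[B]" and y: "y \<in> nil[B]"
    interpret B: big_cring "ring_of B" by (rule alg_big[OF B])
    have xc: "x \<in> carrier[B]" and yc: "y \<in> carrier[B]" using x y by auto
    have tx: "t \<otimes>[B] x \<in> nil[B]" and ty: "t \<otimes>[B] y \<in> nil[B]"
      by (rule B.scaled_nil[OF t(1) x] B.scaled_nil[OF t(1) y])+
    have tr: "kser (\<lambda>i. if i \<le> s + k then g i else \<zero>) B (t \<otimes>[B] w) = kser g B (t \<otimes>[B] w)" if w: "w \<in> carrier[B]" for w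
    proof (rule kser_truncate[OF B])
      show "(t \<otimes>[B] w) [^][B] Suc (s + k) = \<zero>[B]"
        unfolding B.nat_pow_distrib[OF t(1) w] t(2) using w by (intro B.l_null B.nat_pow_closed)
    qed (use gc t w in auto)
    obtain u where u: "u \<in> carrier[B]" "F B (t \<otimes>[B] x) (t \<otimes>[B] y) = t \<otimes>[B] ((x \<oplus>[B] y) \<oplus>[B] t \<otimes>[B] u)"
      using F_scaled[OF B t(1) x y] by blast
    have "defect g B (t \<otimes>[B] x) (t \<otimes>[B] y) = defect (\<lambda>i. if i \<le> s + k then g i else \<zero>) B (t \<otimes>[B] x) (t \<otimes>[B] y)"
      unfolding defect_def u(2) using tr[OF xc] tr[OF yc] tr[of "(x \<oplus>[B] y) \<oplus>[B] t \<otimes>[B] u"] xc yc t(1) u(1) by simp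
    also have "\<dots> = \<zero>[B]" using g[of "s + k"] B t x y unfolding log_stage_def by blast
    finally show "kser2 d B (t \<otimes>[B] y) (t \<otimes>[B] x) = \<zero>[B]"
      using dd[OF B tx ty] by simp
  qed
  have "kser g B (F B x y) = kser g B x \<oplus>[B] kser g B y"
    if B: "is_alg R B" and x: "x \<in> nil[B]" and y: "y \<in> nil[B]" for B x y
  proof -
    interpret B: big_cring "ring_of B" by (rule alg_big[OF B])
    have kd: "kser (d s) B y = \<zero>[B]" for s
      unfolding kser_def dz alg_str_zero[OF B] by (rule B.series_zero[OF y])
    have "defect g B x y = \<zero>[B]"
      unfolding dd[OF B x y] kser2_def kd by (rule B.series_zero[OF x])
    thus ?thesis using kser_closed[OF B gc] x y F_closed[OF B x y] by (simp add: defect_def)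
  qed
  thus ?thesis using gc g0 g1 by blast
qed

end

section \<open>Multiplication by \<open>p\<close>\<close>

lemma (in cring) series_add_square_zero:
  assumes y: "y \<in> nil R" and t: "t \<in> carrier R" "t \<otimes> t = \<zero>" and a: "\<And>k. a k \<in> carrier R"
  shows "series R a (t \<oplus> y) = series R a y \<oplus> t \<otimes> series R (\<lambda>s. nat_in R (Suc s) \<otimes> a (Suc s)) y"
proof -
  have yc: "y \<in> carrier R" using y by simp
  have tn: "t \<in> nil R" using t by (intro nilI[of _ _ 2]) (auto simp: numeral_2_eq_2)
  obtain N :: nat where N0: "(t \<oplus> y) [^] N = \<zero>" using add_nil[OF tn y] by (auto simp: nil_def simp del: nil_carrier)
  obtain M :: nat where M0: "y [^] M = \<zero>" using y by (auto simp: nil_def simp del: nil_carrier)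
  define L where "L = N + M"
  have L1: "(t \<oplus> y) [^] Suc L = \<zero>" by (rule pow_zero_mono[OF _ N0]) (use t yc in \<open>auto simp: L_def\<close>)
  have L2: "y [^] L = \<zero>" by (rule pow_zero_mono[OF yc M0]) (simp add: L_def)
  have L3: "y [^] Suc L = \<zero>" by (rule pow_zero_mono[OF yc M0]) (simp add: L_def)
  have "(\<Oplus>k\<in>{..<Suc n}. a k \<otimes> (t \<oplus> y) [^] k) =
    (\<Oplus>k\<in>{..<Suc n}. a k \<otimes> y [^] k) \<oplus> t \<otimes> (\<Oplus>k\<in>{..<n}. nat_in R (Suc k) \<otimes> a (Suc k) \<otimes> y [^] k)" for n
  proof (induction n)
    case 0 thus ?case using t yc a[of 0] by (simp add: lessThan_Suc)
  next
    case (Suc n)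
    let ?A = "\<Oplus>k\<in>{..<Suc n}. a k \<otimes> y [^] k"
    let ?D = "\<Oplus>k\<in>{..<n}. nat_in R (Suc k) \<otimes> a (Suc k) \<otimes> y [^] k"
    have c: "?A \<in> carrier R" "?D \<in> carrier R" "y [^] n \<in> carrier R" "y [^] Suc n \<in> carrier R" "a (Suc n) \<in> carrier R" "nat_in R (Suc n) \<in> carrier R"
      using yc a by (auto intro!: finsum_closed simp del: nat_pow_Suc)
    have s1: "(\<Oplus>k\<in>{..<Suc (Suc n)}. a k \<otimes> (t \<oplus> y) [^] k) = a (Suc n) \<otimes> (t \<oplus> y) [^] Suc n \<oplus> (\<Oplus>k\<in>{..<Suc n}. a k \<otimes> (t \<oplus> y) [^] k)"
      by (rule finsum_lessThan_Suc) (use t yc a in auto)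
    have s2: "(\<Oplus>k\<in>{..<Suc (Suc n)}. a k \<otimes> y [^] k) = a (Suc n) \<otimes> y [^] Suc n \<oplus> ?A"
      by (rule finsum_lessThan_Suc) (use yc a in auto)
    have s3: "(\<Oplus>k\<in>{..<Suc n}. nat_in R (Suc k) \<otimes> a (Suc k) \<otimes> y [^] k) = nat_in R (Suc n) \<otimes> a (Suc n) \<otimes> y [^] n \<oplus> ?D"
      by (rule finsum_lessThan_Suc) (use yc a in auto)
    have e: "b \<otimes> (z \<oplus> t \<otimes> (m \<otimes> w)) \<oplus> (A \<oplus> t \<otimes> D) = (b \<otimes> z \<oplus> A) \<oplus> t \<otimes> (m \<otimes> b \<otimes> w \<oplus> D)"
      if "b \<in> carrier R" "z \<in> carrier R" "m \<in> carrier R" "w \<in> carrier R" "A \<in> carrier R" "D \<in> carrier R" for b z m w A D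
      using that t(1) by algebra
    show ?case unfolding s1 s2 s3 Suc.IH pow_add_square_zero[OF t yc] by (rule e) (rule c)+
  qed
  from this[of L] show ?thesis
    unfolding series_eq[OF _ L1 a, OF a_closed[OF t(1) yc]] series_eq[OF yc L3 a]
    using series_eq[OF yc L2, of "\<lambda>s. nat_in R (Suc s) \<otimes> a (Suc s)"] a by simp
qed

context nil_group
begin

lemma multiple_power:
  assumes "is_alg R B" "x \<in> nil[B]"
  shows "multiple (line_group F) m B x = x [^]\<^bsub>nil_monoid F B\<^esub> m"
  by (induction m) (use comm_group.axioms(1)[OF grp[OF assms(1)]] in \<open>simp_all add: comm_monoid.axioms(1) nat_pow_def\<close>)

lemma multiple_hom:
  assumes B: "is_alg R B" and x: "x \<in> nil[B]" and y: "y \<in> nil[B]"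
  shows "multiple (line_group F) m B (F B x y) = F B (multiple (line_group F) m B x) (multiple (line_group F) m B y)"
  using comm_monoid.nat_pow_distrib[OF comm_group.axioms(1)[OF grp[OF B]], of x y m] x y
  by (simp add: multiple_power[OF B] F_closed[OF B])

lemma multiple_zero: "is_alg R B \<Longrightarrow> multiple (line_group F) m B \<zero>[B] = \<zero>[B]"
  by (induction m) (auto simp: F_zero is_alg_cring cring.zero_nil)

lemma multiple_kser:
  obtains \<gamma> where "\<And>k. \<gamma> k \<in> carrier R" "\<gamma> 0 = \<zero>"
    "\<And>B x. is_alg R B \<Longrightarrow> x \<in> nil[B] \<Longrightarrow> multiple (line_group F) m B x = kser \<gamma> B x"
proof -
  have "natop R 1 (\<lambda>B xs. multiple (line_group F) m B (hd xs))"
  proof (rule natopI)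
    fix B xs assume B: "is_alg R B" and "xs \<in> nilpts B 1"
    then obtain x where x: "xs = [x]" "x \<in> nil[B]" by (auto elim: nilpts_SucE[of _ _ 0])
    show "multiple (line_group F) m B (hd xs) \<in> carrier[B]" using multiple_closed[OF B x(2)] x(1) by simp
  next
    fix B C f xs assume f: "alg_hom R B C f" and "xs \<in> nilpts B 1"
    then obtain x where x: "xs = [x]" "x \<in> nil[B]" by (auto elim: nilpts_SucE[of _ _ 0])
    show "multiple (line_group F) m C (hd (map f xs)) = f (multiple (line_group F) m B (hd xs))"
      using multiple_nat[OF f x(2)] x(1) by simp
  qed
  then obtain \<gamma> where \<gamma>: "\<And>k. \<gamma> k \<in> carrier R"
    and g: "\<And>B x. is_alg R B \<Longrightarrow> x \<in> nil[B] \<Longrightarrow> multiple (line_group F) m B (hd [x]) = kser \<gamma> B x"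
    using natop1_kser[of "\<lambda>B xs. multiple (line_group F) m B (hd xs)"] by metis
  have "\<gamma> 0 = \<zero>"
    using g[OF base_alg[OF is_cring], of \<zero>] multiple_zero[OF base_alg[OF is_cring], of m] series_at_zero[of \<gamma>] \<gamma>
    by (simp add: kser_def)
  thus ?thesis using that[OF \<gamma>] g by simp
qed

lemma multiple_square_zero:
  assumes B: "is_alg R B" and x: "x \<in> carrier[B]" "x \<otimes>[B] x = \<zero>[B]"
  shows "multiple (line_group F) m B x = nat_in (ring_of B) m \<otimes>[B] x"
proof (induction m)
  interpret B: big_cring "ring_of B" by (rule alg_big[OF B])
  {
    case 0 thus ?case using x by (simp add: nat_in_def)
  next
    case (Suc m)
    have xn: "x \<in> nil[B]" using x by (intro nilI[of _ _ 2]) (auto simp: numeral_2_eq_2)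
    obtain w where w: "w \<in> carrier[B]" "F B (nat_in (ring_of B) m \<otimes>[B] x) x = nat_in (ring_of B) m \<otimes>[B] x \<oplus>[B] x
        \<oplus>[B] (nat_in (ring_of B) m \<otimes>[B] x) \<otimes>[B] x \<otimes>[B] w"
      using F_form[OF B B.scaled_nil[OF B.nat_in_closed xn] xn] by blast
    have "(nat_in (ring_of B) m \<otimes>[B] x) \<otimes>[B] x = \<zero>[B]"
      using x by (simp add: B.m_assoc)
    hence "F B (nat_in (ring_of B) m \<otimes>[B] x) x = nat_in (ring_of B) m \<otimes>[B] x \<oplus>[B] x" using w x by simp
    moreover have "nat_in (ring_of B) (Suc m) \<otimes>[B] x = nat_in (ring_of B) m \<otimes>[B] x \<oplus>[B] x"
      using B.nat_in_add[of m 1] B.nat_in_one x by (simp add: B.l_distr)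
    ultimately show ?case using Suc.IH by simp
  }
qed

end

section \<open>Frobenius acting on power series\<close>

context line_field
begin

lemma frobenius_hom:
  assumes p: "p \<noteq> 0" and B: "is_alg R B"
  shows "(\<lambda>x. x [^][B] (p ^ k)) \<in> ring_hom (ring_of B) (ring_of B)"
proof -
  interpret B: big_cring "ring_of B" by (rule alg_big[OF B])
  show ?thesis by (rule ring_hom_memI) (auto simp: frobenius_pow_add[OF p B] B.nat_pow_distrib)
qed

lemma frobenius_series:
  assumes p: "p \<noteq> 0" and B: "is_alg R B" and x: "x \<in> nil[B]" and a: "\<And>k. a k \<in> carrier[B]"
  shows "series (ring_of B) a x [^][B] (p ^ k) = series (ring_of B) (\<lambda>i. a i [^][B] (p ^ k)) (x [^][B] (p ^ k))"
  using hom_series[OF is_alg_cring[OF B] is_alg_cring[OF B] frobenius_hom[OF p B] x a] by simp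

lemma str_pow: "is_alg R B \<Longrightarrow> c \<in> carrier R \<Longrightarrow> str_map B (c [^] (n::nat)) = str_map B c [^][B] n"
  by (rule hom_pow_eq[OF is_cring is_alg_cring is_alg_str])

lemma frobenius_kser:
  assumes p: "p \<noteq> 0" and B: "is_alg R B" and x: "x \<in> nil[B]" and c: "\<And>k. c k \<in> carrier R"
  shows "kser c B x [^][B] (p ^ k) = kser (\<lambda>i. c i [^] (p ^ k)) B (x [^][B] (p ^ k))"
  unfolding kser_def using frobenius_series[OF p B x, of "\<lambda>i. str_map B (c i)"] c str_closed[OF B] str_pow[OF B] by simp

end

context formal_group_field
begin

text \<open>Take the largest power \<open>q\<close> of \<open>p\<close> such that only exponents
  divisible by \<open>q\<close> occur in \<open>[p]\<close>. If \<open>g 1\<close> were zero, the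
  homomorphism property would make the whole derivative of \<open>g\<close> vanish; then
  \<open>g\<close> would be a series in \<open>T^p\<close>, against the choice of \<open>q\<close>.
  The clause identifying \<open>g 1\<close> with a coefficient of \<open>\<gamma>\<close> serves to
  compare \<open>q\<close> with the height.\<close>

lemma multiple_frobenius_form:
  assumes p: "p \<noteq> 0" and \<gamma>: "\<And>k. \<gamma> k \<in> carrier R" "\<gamma> 0 = \<zero>" "\<gamma> m \<noteq> \<zero>"
    and mult: "\<And>B x. is_alg R B \<Longrightarrow> x \<in> nil[B] \<Longrightarrow> multiple (line_group F) p B x = kser \<gamma> B x"
  obtains k g where "0 < k" "\<And>i. g i \<in> carrier R" "g 0 = \<zero>" "g 1 \<noteq> \<zero>" "g 1 = \<gamma> (p ^ k)"
    "\<And>B x. is_alg R B \<Longrightarrow> x \<in> nil[B] \<Longrightarrow> multiple (line_group F) p B x = kser g B (x [^][B] (p ^ k))"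
proof -
  note pr = p_prime[OF p]
  have p1: "1 < p" by (rule prime_gt_1_nat[OF pr])
  define D where "D k \<longleftrightarrow> (\<forall>i. \<gamma> i \<noteq> \<zero> \<longrightarrow> p ^ k dvd i)" for k
  have m: "0 < m" using \<gamma> by (cases m) auto
  have "D 0" by (simp add: D_def)
  \<comment> \<open>The nonzero coefficient at \<open>m\<close> bounds the exponent, so a largest
    one exists.\<close>
  moreover have bd: "\<forall>k. D k \<longrightarrow> k \<le> m"
  proof (intro allI impI)
    fix k assume "D k"
    hence "p ^ k \<le> m" using \<gamma>(3) m by (auto simp: D_def intro: dvd_imp_le)
    moreover have "k < p ^ k" using p1 by (simp add: power_gt_expt)
    ultimately show "k \<le> m" by simp
  qed
  ultimately have G: "D (GREATEST k. D k)" "\<And>l. D l \<Longrightarrow> l \<le> (GREATEST k. D k)"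
    using GreatestI_nat[of D 0 m] Greatest_le_nat[of D _ m] by blast+
  define k where "k = (GREATEST k. D k)"
  define q where "q = p ^ k"
  have q0: "0 < q" using p1 by (simp add: q_def)
  define g where "g i = \<gamma> (q * i)" for i
  have g: "g i \<in> carrier R" for i using \<gamma> by (simp add: g_def)
  have g0: "g 0 = \<zero>" using \<gamma> by (simp add: g_def)
  have Dq: "\<gamma> i \<noteq> \<zero> \<Longrightarrow> q dvd i" for i using G(1) by (simp add: D_def q_def k_def)
  have "\<not> D (Suc k)" using G(2)[of "Suc k"] by (auto simp: k_def)
  then obtain i1 where i1: "\<gamma> i1 \<noteq> \<zero>" "\<not> p ^ Suc k dvd i1" by (auto simp: D_def)
  obtain i0 where i0: "i1 = q * i0" using Dq[OF i1(1)] by blast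
  have i0': "g i0 \<noteq> \<zero>" "\<not> p dvd i0" using i1 i0 by (auto simp: g_def q_def)
  have mg: "multiple (line_group F) p B x = kser g B (x [^][B] q)" if B: "is_alg R B" and x: "x \<in> nil[B]" for B x
  proof -
    interpret B: big_cring "ring_of B" by (rule alg_big[OF B])
    have "(\<lambda>i. if q dvd i then str_map B (g (i div q)) else \<zero>[B]) = (\<lambda>i. str_map B (\<gamma> i))"
    proof
      fix i show "(if q dvd i then str_map B (g (i div q)) else \<zero>[B]) = str_map B (\<gamma> i)"
        using Dq[of i] alg_str_zero[OF B] by (cases "q dvd i"; cases "\<gamma> i = \<zero>") (simp_all add: g_def)
    qed
    thus ?thesis unfolding mult[OF B x] kser_def
      using B.series_pow_arg[OF x, of "\<lambda>i. str_map B (g i)", OF str_closed[OF B g] q0] by simp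
  qed
  have g1: "g 1 \<noteq> \<zero>"
  proof
    assume g1: "g 1 = \<zero>"
    \<comment> \<open>The derivative of \<open>g\<close>, first shown to vanish at all
      \<open>q\<close>-th powers \<open>b^q\<close>.\<close>
    define g' where "g' i = nat_in R (Suc i) \<otimes> g (Suc i)" for i
    have g': "g' i \<in> carrier R" for i using g by (simp add: g'_def)
    have z: "kser g' B (b [^][B] q) = \<zero>[B]" if B: "is_alg R B" and b: "b \<in> nil[B]" for B b
    proof -
      interpret B: big_cring "ring_of B" by (rule alg_big[OF B])
      have bq: "b [^][B] q \<in> nil[B]" by (rule B.pow_nil[OF b q0])
      let ?d = "kser g' B (b [^][B] q)"
      have d: "?d \<in> carrier[B]" by (rule kser_closed[OF B g' bq])
      \<comment> \<open>Tested with a generic \<open>c\<close> such that \<open>c^(2q) = 0\<close>: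
        then \<open>c^q\<close> has square zero, so \<open>[p]\<close> kills \<open>c\<close>
        because \<open>g 0\<close> and \<open>g 1\<close> are zero, while \<open>c^q\<close> still
        detects \<open>?d\<close>.\<close>
      have "(if q = q then ?d else \<zero>[B]) = \<zero>[B]"
      proof (rule series_unique[where c = "\<lambda>i. if i = q then ?d else \<zero>[B]" and k = q, OF B])
        show "q < 2 * q" using q0 by simp
        fix C f c assume f: "alg_hom R B C f" and c: "c \<in> carrier[C]" "c [^][C] (2 * q) = \<zero>[C]"
        note fD = alg_homD[OF f]
        interpret C: big_cring "ring_of C" by (rule alg_big[OF fD(2)])
        have cn: "c \<in> nil[C]" by (rule nilI[OF c])
        have bn: "f b \<in> nil[C]" by (rule fD(8)[OF b])
        have bc: "f b \<in> carrier[C]" using bn by simp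
        have bqn: "f b [^][C] q \<in> nil[C]" by (rule C.pow_nil[OF bn q0])
        have cc: "c [^][C] q \<otimes>[C] c [^][C] q = \<zero>[C]"
          using c by (simp add: C.nat_pow_mult mult_2)
        have cq: "c [^][C] q \<in> carrier[C]" using c by simp
        have sg: "str_map C (g i) \<in> carrier[C]" for i by (rule str_closed[OF fD(2) g])
        have sg': "nat_in (ring_of C) (Suc i) \<otimes>[C] str_map C (g (Suc i)) = str_map C (g' i)" for i
          unfolding g'_def alg_nat_in[OF fD(2), symmetric] by (rule ring_hom_mult[OF is_alg_str[OF fD(2)], symmetric]) (rule nat_in_closed g)+
        have "kser g C (c [^][C] q) = \<zero>[C]"
          unfolding kser_def using C.series_add_square_zero[OF C.zero_nil cq cc, of "\<lambda>i. str_map C (g i)", OF sg]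
            C.series_at_zero[of "\<lambda>i. str_map C (g i)", OF sg]
            C.series_at_zero[of "\<lambda>i. nat_in (ring_of C) (Suc i) \<otimes>[C] str_map C (g (Suc i))"] sg cq g0 g1 alg_str_zero[OF fD(2)]
          by simp
        hence mc: "multiple (line_group F) p C c = \<zero>[C]" using mg[OF fD(2) cn] by simp
        obtain w where w: "w \<in> carrier[C]" "F C (f b) c = f b \<oplus>[C] c \<oplus>[C] f b \<otimes>[C] c \<otimes>[C] w"
          using F_form[OF fD(2) bn cn] by blast
        \<comment> \<open>The sum of \<open>b\<close> and \<open>c\<close> under \<open>F\<close> is
          \<open>b + c v\<close> with \<open>v\<close> a unit, and its \<open>q\<close>-th power is
          \<open>b^q + (c v)^q\<close>. As \<open>[p]\<close> sends it to the same value as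
          \<open>b\<close>, the first order term \<open>(c v)^q\<close> times the derivative at
          \<open>b^q\<close> is zero.\<close>
        define v where "v = \<one>[C] \<oplus>[C] f b \<otimes>[C] w"
        have vU: "v \<in> Units (ring_of C)" unfolding v_def by (rule C.one_plus_nil_unit[OF C.mult_nil(2)[OF bn w(1)]])
        have vc: "v \<in> carrier[C]" using vU by blast
        have Fv: "F C (f b) c = c \<otimes>[C] v \<oplus>[C] f b" unfolding w(2) v_def using bc c(1) w(1) by algebra
        have Fq: "F C (f b) c [^][C] q = (c \<otimes>[C] v) [^][C] q \<oplus>[C] f b [^][C] q"
          unfolding Fv q_def by (rule frobenius_pow_add[OF p fD(2)]) (use c vc bc in auto)
        let ?s = "(c \<otimes>[C] v) [^][C] q"
        have s: "?s = c [^][C] q \<otimes>[C] v [^][C] q" by (rule C.nat_pow_distrib[OF c(1) vc])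
        have vq: "v [^][C] q \<in> carrier[C]" using vc by simp
        have sc: "?s \<in> carrier[C]" using c vc by simp
        have ss: "?s \<otimes>[C] ?s = \<zero>[C]"
        proof -
          have "?s \<otimes>[C] ?s = (c [^][C] q \<otimes>[C] c [^][C] q) \<otimes>[C] (v [^][C] q \<otimes>[C] v [^][C] q)"
            unfolding s using cq vq by algebra
          thus ?thesis unfolding cc using vq by simp
        qed
        have fb: "kser g C (f b [^][C] q) \<in> carrier[C]" "kser g' C (f b [^][C] q) \<in> carrier[C]"
          by (rule kser_closed[OF fD(2) g bqn] kser_closed[OF fD(2) g' bqn])+
        have "kser g C (?s \<oplus>[C] f b [^][C] q) = multiple (line_group F) p C (F C (f b) c)"
          unfolding Fq[symmetric] by (rule mg[OF fD(2) F_closed[OF fD(2) bn cn], symmetric])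
        also have "\<dots> = kser g C (f b [^][C] q)"
          unfolding multiple_hom[OF fD(2) bn cn] mc F_zero(1)[OF fD(2) multiple_closed[OF fD(2) bn]] by (rule mg[OF fD(2) bn])
        finally have e: "kser g C (f b [^][C] q) \<oplus>[C] ?s \<otimes>[C] kser g' C (f b [^][C] q) = kser g C (f b [^][C] q)"
          unfolding kser_def C.series_add_square_zero[OF bqn sc ss, of "\<lambda>i. str_map C (g i)", OF sg] sg' .
        have "?s \<otimes>[C] kser g' C (f b [^][C] q) = \<zero>[C]"
          using e fb sc by (simp add: C.add.l_cancel_one)
        hence "v [^][C] q \<otimes>[C] (kser g' C (f b [^][C] q) \<otimes>[C] c [^][C] q) = \<zero>[C]"
          unfolding s using fb cq vq by (simp add: C.m_ac)
        hence "kser g' C (f b [^][C] q) \<otimes>[C] c [^][C] q = \<zero>[C]"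
          using C.unit_mult_zero[OF C.Units_pow_closed[OF vU]] fb cq by simp
        moreover have "f ?d = kser g' C (f b [^][C] q)"
          using kser_nat[OF f g' bq] hom_pow_eq[OF fD(4,5,3), of b q] b by simp
        moreover have "series (ring_of C) (\<lambda>k. f (if k = q then ?d else \<zero>[B])) c = f ?d \<otimes>[C] c [^][C] q"
          using C.series_monom[OF cn, of "f ?d" q] fD(7)[OF d] fD(9) by (simp add: if_distrib[of f] cong: if_cong)
        ultimately show "series (ring_of C) (\<lambda>k. f (if k = q then ?d else \<zero>[B])) c = \<zero>[C]" by simp
      qed (use d in auto)
      thus ?thesis by simp
    qed
    have "kser g' B x = \<zero>[B]" if B: "is_alg R B" and x: "x \<in> nil[B]" for B x
    proof -
      have "(\<lambda>B xs. kser g' B (hd xs)) B [x] = \<zero>[B]"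
      proof (rule natop_zero_power_test[OF kser_natop[OF g'] q0 _ B])
        fix B xs assume B: "is_alg R B" and "xs \<in> nilpts B 1"
        then obtain x where x: "xs = [x]" "x \<in> nil[B]" by (auto elim: nilpts_SucE[of _ _ 0])
        thus "kser g' B (hd (map (\<lambda>x. x [^][B] q) xs)) = \<zero>[B]" using z[OF B] by simp
      qed (use x in \<open>simp add: nilpts_def\<close>)
      thus ?thesis by simp
    qed
    hence g'z: "g' i = \<zero>" for i using kser_unique[of g' i, OF g'] by blast
    have "i0 \<noteq> 0" using i0'(2) by (cases "i0 = 0") simp_all
    then obtain i where i: "i0 = Suc i" by (cases i0) auto
    have "nat_in R i0 \<noteq> \<zero>" using char_iff i0'(2) by simp
    thus False using g'z[of i] i0'(1) g unfolding g'_def i by (simp add: integral_iff)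
  qed
  \<comment> \<open>On elements of square zero \<open>[p]\<close> is multiplication by the integer
    \<open>p\<close>, that is zero. Hence \<open>q = 1\<close> is impossible.\<close>
  have "\<gamma> 1 = \<zero>"
  proof (rule kser_unique_le[of \<gamma> 2])
    fix B x assume B: "is_alg R B" and x: "x \<in> carrier[B]" "x [^][B] (2::nat) = \<zero>[B]"
    interpret B: big_cring "ring_of B" by (rule alg_big[OF B])
    have "x \<otimes>[B] x = \<zero>[B]" using x by (simp add: numeral_2_eq_2)
    thus "kser \<gamma> B x = \<zero>[B]"
      using mult[OF B nilI[OF x]] multiple_square_zero[OF B x(1)] alg_nat_in_zero[OF B dvd_refl] x by simp
  qed (use \<gamma> in auto)
  hence "0 < k" using g1 by (cases k) (auto simp: g_def q_def)
  thus ?thesis using that[of k g, OF _ g g0 g1] mg by (simp add: q_def g_def)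
qed

end

section \<open>Equations over separably closed fields\<close>

lemma UP_monom: "a \<in> carrier R \<Longrightarrow> monom (UP R) a n = (\<lambda>i. if i = n then a else \<zero>\<^bsub>R\<^esub>)"
  by (simp add: UP_def)

context
  fixes K :: "'u ring" (structure) and q :: nat
  assumes K: "field K" and sep: "separably_closed K" and q: "nat_in K q = \<zero>" "2 \<le> q"
begin

interpretation field K by (rule K)
interpretation U: UP_cring K "UP K"
  by (intro UP_cring.intro is_cring)

lemma eval_id: "UP_pre_univ_prop K K (\<lambda>c. c)"
  by (intro UP_pre_univ_prop.intro UP_cring.intro ring_hom_cring.intro ring_hom_cring_axioms.intro is_cring)
    (simp add: ring_hom_def)

lemma add_pow_nat_in: "x \<in> carrier K \<Longrightarrow> [n] \<cdot> x = nat_in K n \<otimes> x"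
  using add_pow_ldistr[of \<one> x n] unfolding nat_in_add_pow by simp

text \<open>The polynomial \<open>T^q - a T - c\<close> has derivative \<open>-a\<close>, a nonzero
  constant, since \<open>q\<close> is zero in the field; so it is separable.\<close>

lemma artin_schreier_root:
  assumes a: "a \<in> carrier K" "a \<noteq> \<zero>" and c: "c \<in> carrier K"
  shows "\<exists>y\<in>carrier K. y [^] q = a \<otimes> y \<oplus> c"
proof -
  let ?P = "UP K"
  define f where "f = monom ?P \<one> q \<oplus>\<^bsub>?P\<^esub> (monom ?P (\<ominus> a) 1 \<oplus>\<^bsub>?P\<^esub> monom ?P (\<ominus> c) 0)"
  have f: "f \<in> carrier ?P" using a c by (simp add: f_def)
  have cf: "coeff ?P f i = (if q = i then \<one> else \<zero>) \<oplus> ((if 1 = i then \<ominus> a else \<zero>) \<oplus> (if 0 = i then \<ominus> c else \<zero>))" for i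
    using a c by (simp add: f_def)
  have d: "formal_derivative K f = monom ?P (\<ominus> a) 0"
  proof
    fix i show "formal_derivative K f i = monom ?P (\<ominus> a) 0 i"
      using a q add_pow_nat_in[of \<one> q] by (auto simp: formal_derivative_def cf UP_monom)
  qed
  have ia: "inv a \<in> carrier K" "inv a \<otimes> a = \<one>" using a by (auto simp: field_Units)
  have "\<zero>\<^bsub>?P\<^esub> \<otimes>\<^bsub>?P\<^esub> f \<oplus>\<^bsub>?P\<^esub> monom ?P (\<ominus> (inv a)) 0 \<otimes>\<^bsub>?P\<^esub> formal_derivative K f = monom ?P (\<ominus> (inv a) \<otimes> \<ominus> a) (0 + 0)"
    unfolding d using f a ia by (subst U.monom_mult) auto
  also have "\<dots> = \<one>\<^bsub>?P\<^esub>" using a ia by (simp add: l_minus r_minus)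
  finally have "separable_poly K f" unfolding separable_poly_def
    using f ia by (intro conjI bexI[of _ "\<zero>\<^bsub>?P\<^esub>"] bexI[of _ "monom ?P (\<ominus> (inv a)) 0"]) auto
  moreover have "q \<le> deg K f" using f q a by (intro U.deg_belowI) (auto simp: cf)
  hence "0 < deg K f" using q(2) by linarith
  ultimately obtain y where y: "y \<in> carrier K" "eval K K (\<lambda>c. c) y f = \<zero>"
    using sep unfolding separably_closed_def by blast
  note h = UP_pre_univ_prop.eval_ring_hom[OF eval_id y(1)]
  have e1: "eval K K (\<lambda>c. c) y (monom ?P r n) = r \<otimes> y [^] n" if "r \<in> carrier K" for r n
    by (rule UP_pre_univ_prop.eval_monom[OF eval_id that y(1)])
  have e2: "eval K K (\<lambda>c. c) y (A \<oplus>\<^bsub>?P\<^esub> B) = eval K K (\<lambda>c. c) y A \<oplus> eval K K (\<lambda>c. c) y B"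
    if "A \<in> carrier ?P" "B \<in> carrier ?P" for A B
    by (rule ring_hom_add[OF h that])
  have "y [^] q \<oplus> (\<ominus> a \<otimes> y \<oplus> \<ominus> c) = \<zero>"
    using y(1) y(2)[unfolded f_def] a c by (simp add: e1 e2 del: U.monom_a_inv One_nat_def)
  hence "y [^] q \<ominus> (a \<otimes> y \<oplus> c) = \<zero>" using y(1) a c by (simp add: a_minus_def l_minus minus_add)
  thus ?thesis using y(1) a c by (auto intro!: bexI[of _ y])
qed

text \<open>\<open>q - 1\<close> is -1 in the field, so \<open>f = T^(q-1) - a\<close> has
  derivative \<open>-T^(q-2)\<close>. The combination of \<open>f\<close> and \<open>T\<close> times
  its derivative, both multiplied by \<open>-1/a\<close>, is 1.\<close>

lemma kummer_root:
  assumes a: "a \<in> carrier K" "a \<noteq> \<zero>"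
  shows "\<exists>y\<in>carrier K. y [^] (q - 1) = a"
proof -
  let ?P = "UP K"
  define f where "f = monom ?P \<one> (q - 1) \<oplus>\<^bsub>?P\<^esub> monom ?P (\<ominus> a) 0"
  have f: "f \<in> carrier ?P" using a by (simp add: f_def)
  have cf: "coeff ?P f i = (if q - 1 = i then \<one> else \<zero>) \<oplus> (if 0 = i then \<ominus> a else \<zero>)" for i
    using a by (simp add: f_def)
  have nq: "nat_in K (q - 1) = \<ominus> \<one>"
    using nat_in_add[of "q - 1" 1] nat_in_one q by (simp add: minus_equality)
  have d: "formal_derivative K f = monom ?P (\<ominus> \<one>) (q - 2)"
  proof
    fix i show "formal_derivative K f i = monom ?P (\<ominus> \<one>) (q - 2) i"
    proof (cases "Suc i = q - 1")
      case True
      hence "i = q - 2" by simp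
      thus ?thesis using a q add_pow_nat_in[of \<one> "q - 1"] nq unfolding formal_derivative_def True by (simp add: cf UP_monom)
    next
      case False
      hence "i \<noteq> q - 2" using q by simp
      thus ?thesis using False a q by (simp add: formal_derivative_def cf UP_monom)
    qed
  qed
  have ia: "inv a \<in> carrier K" "inv a \<otimes> a = \<one>" using a by (auto simp: field_Units)
  have e: "1 + (q - 2) = q - 1" using q by simp
  have "monom ?P (\<ominus> (inv a)) 0 \<otimes>\<^bsub>?P\<^esub> f = monom ?P (\<ominus> (inv a) \<otimes> \<one>) (0 + (q - 1)) \<oplus>\<^bsub>?P\<^esub> monom ?P (\<ominus> (inv a) \<otimes> \<ominus> a) (0 + 0)"
    unfolding f_def using a ia U.monom_mult[of "\<ominus> (inv a)" "\<one>" 0 "q - 1"] U.monom_mult[of "\<ominus> (inv a)" "\<ominus> a" 0 0]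
    by (simp add: U.P.r_distr del: U.monom_mult)
  moreover have "monom ?P (\<ominus> (inv a)) 1 \<otimes>\<^bsub>?P\<^esub> formal_derivative K f = monom ?P (\<ominus> (inv a) \<otimes> \<ominus> \<one>) (1 + (q - 2))"
    unfolding d using ia by (subst U.monom_mult) auto
  ultimately have "monom ?P (\<ominus> (inv a)) 0 \<otimes>\<^bsub>?P\<^esub> f \<oplus>\<^bsub>?P\<^esub> monom ?P (\<ominus> (inv a)) 1 \<otimes>\<^bsub>?P\<^esub> formal_derivative K f =
     (\<ominus>\<^bsub>?P\<^esub> monom ?P (inv a) (q - 1) \<oplus>\<^bsub>?P\<^esub> \<one>\<^bsub>?P\<^esub>) \<oplus>\<^bsub>?P\<^esub> monom ?P (inv a) (q - 1)"
    unfolding e using a ia by (simp add: l_minus r_minus)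
  also have "\<dots> = \<one>\<^bsub>?P\<^esub>" using ia by (simp add: U.P.add.m_ac U.P.r_neg1 U.P.r_neg2 U.P.r_neg U.P.l_neg)
  finally have "separable_poly K f" unfolding separable_poly_def
    using f ia by (intro conjI bexI[of _ "monom ?P (\<ominus> (inv a)) 0"] bexI[of _ "monom ?P (\<ominus> (inv a)) 1"]) auto
  moreover have "q - 1 \<le> deg K f" using f q a by (intro U.deg_belowI) (auto simp: cf)
  hence "0 < deg K f" using q(2) by linarith
  ultimately obtain y where y: "y \<in> carrier K" "eval K K (\<lambda>c. c) y f = \<zero>"
    using sep unfolding separably_closed_def by blast
  note h = UP_pre_univ_prop.eval_ring_hom[OF eval_id y(1)]
  have e1: "eval K K (\<lambda>c. c) y (monom ?P r n) = r \<otimes> y [^] n" if "r \<in> carrier K" for r n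
    by (rule UP_pre_univ_prop.eval_monom[OF eval_id that y(1)])
  have e2: "eval K K (\<lambda>c. c) y (A \<oplus>\<^bsub>?P\<^esub> B) = eval K K (\<lambda>c. c) y A \<oplus> eval K K (\<lambda>c. c) y B"
    if "A \<in> carrier ?P" "B \<in> carrier ?P" for A B
    by (rule ring_hom_add[OF h that])
  have "y [^] (q - 1) \<ominus> a = \<zero>"
    using y(1) y(2)[unfolded f_def] a by (simp add: e1 e2 a_minus_def del: U.monom_a_inv One_nat_def)
  thus ?thesis using y(1) a by (auto intro!: bexI[of _ y])
qed

text \<open>For \<open>c = 0\<close> the root zero would be useless as linear coefficient of a
  coordinate; a nonzero root is then a root of \<open>y^(q-1) = a\<close>.\<close>

lemma twisted_root:
  assumes a: "a \<in> carrier K" "a \<noteq> \<zero>" and c: "c \<in> carrier K"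
  shows "\<exists>y\<in>carrier K. y [^] q = a \<otimes> y \<oplus> c \<and> (c = \<zero> \<longrightarrow> y \<noteq> \<zero>)"
proof (cases "c = \<zero>")
  case True
  obtain y where y: "y \<in> carrier K" "y [^] (q - 1) = a" using kummer_root[OF a] by blast
  have "y [^] q = a \<otimes> y" using y q(2) nat_pow_Suc[of y "q - 1"] by (simp del: nat_pow_Suc)
  moreover have "y \<noteq> \<zero>" using y a q(2) by (auto simp: nat_pow_zero)
  ultimately show ?thesis using y a True by auto
next
  case False thus ?thesis using artin_schreier_root[OF a c] by blast
qed

end

text \<open>In a field with \<open>N\<close> elements \<open>N\<close> is zero and
  \<open>y^N = y\<close> for every \<open>y\<close>, whereas \<open>artin_schreier_root\<close>
  would solve \<open>y^N = y + 1\<close>.\<close>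

lemma separably_closed_infinite:
  fixes K :: "'u ring"
  assumes K: "field K" and sep: "separably_closed K"
  shows "infinite (carrier K)"
proof
  assume fin: "finite (carrier K)"
  interpret field K by (rule K)
  define N where "N = card (carrier K)"
  have "card {\<zero>\<^bsub>K\<^esub>, \<one>\<^bsub>K\<^esub>} \<le> N" unfolding N_def by (rule card_mono[OF fin]) auto
  hence N2: "2 \<le> N" by simp
  have "nat_in K N = \<zero>\<^bsub>K\<^esub>"
    using add.pow_order_eq_1[of "\<one>\<^bsub>K\<^esub>"] by (simp add: nat_in_add_pow N_def order_def)
  have pN: "y [^]\<^bsub>K\<^esub> N = y" if y: "y \<in> carrier K" for y
  proof (cases "y = \<zero>\<^bsub>K\<^esub>")
    case True thus ?thesis using N2 by (simp add: nat_pow_zero)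
  next
    case False
    interpret G: group "units_of K" by (rule units_group)
    have "card (carrier (units_of K)) = N - 1"
      unfolding N_def using fin by (simp add: units_of_carrier field_Units card_Diff_singleton)
    hence "y [^]\<^bsub>K\<^esub> (N - 1) = \<one>\<^bsub>K\<^esub>"
      using G.pow_order_eq_1[of y] False y
      by (simp add: units_of_carrier field_Units order_def units_of_pow units_of_one)
    thus ?thesis using nat_pow_Suc[of y "N - 1"] y N2 by (simp del: nat_pow_Suc)
  qed
  obtain y where y: "y \<in> carrier K" "y [^]\<^bsub>K\<^esub> N = \<one>\<^bsub>K\<^esub> \<otimes>\<^bsub>K\<^esub> y \<oplus>\<^bsub>K\<^esub> \<one>\<^bsub>K\<^esub>"
    using artin_schreier_root[OF K sep \<open>nat_in K N = \<zero>\<^bsub>K\<^esub>\<close> N2, of "\<one>\<^bsub>K\<^esub>" "\<one>\<^bsub>K\<^esub>"] by auto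
  have "y \<oplus>\<^bsub>K\<^esub> \<one>\<^bsub>K\<^esub> = y" using y pN[OF y(1)] by simp
  thus False using y(1) by (simp add: add.r_cancel_one)
qed

context formal_group_field
begin

text \<open>\<open>\<phi>\<close> is to conjugate \<open>x \<mapsto> g (x\<^sup>q)\<close> into \<open>x \<mapsto> x\<^sup>q\<close>. Its coefficients are found one at a time:
  the one of \<open>T\<^sup>n\<close> has to solve an equation \<open>b\<^sup>q = a b + e\<close> with \<open>a \<noteq> 0\<close>.\<close>

lemma linearize_frobenius:
  assumes p: "p \<noteq> 0" and sep: "separably_closed R" and k: "0 < k"
    and g: "\<And>i. g i \<in> carrier R" "g 0 = \<zero>" "g 1 \<noteq> \<zero>"
  obtains \<phi> where "\<And>i. \<phi> i \<in> carrier R" "\<phi> 0 = \<zero>" "\<phi> 1 \<noteq> \<zero>"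
    "\<And>B y. is_alg R B \<Longrightarrow> y \<in> nil[B] \<Longrightarrow> kser \<phi> B (kser g B y) = kser (\<lambda>i. \<phi> i [^] (p ^ k)) B y"
proof -
  define q where "q = p ^ k"
  have p1: "1 < p" by (rule prime_gt_1_nat[OF p_prime[OF p]])
  have q2: "2 \<le> q" unfolding q_def using p1 k power_increasing[of 1 k p] by simp
  have q0: "0 < q" using q2 by simp
  have nq: "nat_in R q = \<zero>" using char_iff k by (simp add: q_def)
  have gB: "str_map B (g i) \<in> carrier[B]" if "is_alg R B" for B i by (rule str_closed[OF that g(1)])
  have gn: "kser g B y \<in> nil[B]" if B: "is_alg R B" and y: "y \<in> nil[B]" for B y
    by (rule kser_nil[where c = g, OF B g(1) y g(2)])
  have gf: "\<exists>u\<in>carrier[B]. kser g B y = y \<otimes>[B] (str_map B (g 1) \<oplus>[B] y \<otimes>[B] u)" if B: "is_alg R B" and y: "y \<in> nil[B]" for B y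
  proof -
    interpret B: big_cring "ring_of B" by (rule alg_big[OF B])
    let ?u = "series (ring_of B) (\<lambda>i. str_map B (g (Suc (Suc i)))) y"
    have u: "?u \<in> carrier[B]" by (rule B.series_closed[OF y gB[OF B]])
    have "kser g B y = y \<otimes>[B] (str_map B (g 1) \<oplus>[B] y \<otimes>[B] ?u)"
      unfolding kser_def
      using B.series_shift[OF y, of "\<lambda>i. str_map B (g i)", OF gB[OF B]] B.series_shift[OF y, of "\<lambda>i. str_map B (g (Suc i))", OF gB[OF B]]
        g(2) alg_str_zero[OF B] u y gB[OF B] by simp
    thus ?thesis using u by blast
  qed
  define T where "T n \<phi> = (\<lambda>i. if i \<le> n then \<phi> i else \<zero>)" for n :: nat and \<phi> :: "nat \<Rightarrow> 'u"
  \<comment> \<open>The required identity modulo \<open>y^(n+1)\<close>. On its right side the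
    coefficients are raised to the power \<open>q\<close>; with \<open>y = x^q\<close> that side
    becomes the \<open>q\<close>-th power of the new coordinate of \<open>x\<close>.\<close>
  define Q where "Q n \<phi> \<longleftrightarrow> \<phi> n \<in> carrier R \<and> (n = 0 \<longrightarrow> \<phi> 0 = \<zero>) \<and> (n = 1 \<longrightarrow> \<phi> 1 \<noteq> \<zero>) \<and>
    (\<forall>B y. is_alg R B \<longrightarrow> y \<in> carrier[B] \<longrightarrow> y [^][B] Suc n = \<zero>[B] \<longrightarrow>
       kser (T n \<phi>) B (kser g B y) = kser (\<lambda>i. T n \<phi> i [^] q) B y)" for n \<phi>
  have "\<exists>\<phi>. \<forall>n. Q n \<phi>"
  proof (rule sequence_choice)
    fix n and \<phi> \<phi>' :: "nat \<Rightarrow> 'u" assume e: "\<And>k. k \<le> n \<Longrightarrow> \<phi> k = \<phi>' k" and Q: "Q n \<phi>"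
    have "T n \<phi> = T n \<phi>'" using e by (auto simp: T_def)
    thus "Q n \<phi>'" using Q e[of n] e[of 0] e[of 1] by (auto simp: Q_def)
  next
    fix n and \<phi> :: "nat \<Rightarrow> 'u" assume prev: "\<And>k. k < n \<Longrightarrow> Q k \<phi>"
    show "\<exists>b. Q n (\<phi>(n := b))"
    proof (cases "n = 0")
      case True
      have "Q 0 (\<phi>(0 := \<zero>))" unfolding Q_def
      proof (intro conjI allI impI)
        fix B y assume B: "is_alg R B" and y: "y \<in> carrier[B]" "y [^][B] Suc 0 = \<zero>[B]"
        interpret B: big_cring "ring_of B" by (rule alg_big[OF B])
        have yn: "y \<in> nil[B]" using y by (rule nilI)
        have c: "T 0 (\<phi>(0 := \<zero>)) = (\<lambda>i. \<zero>)" "\<zero> [^] q = \<zero>" using q0 by (auto simp: T_def nat_pow_zero)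
        show "kser (T 0 (\<phi>(0 := \<zero>))) B (kser g B y) = kser (\<lambda>i. T 0 (\<phi>(0 := \<zero>)) i [^] q) B y"
          unfolding kser_def c alg_str_zero[OF B] B.series_zero[OF yn] by (rule B.series_zero[OF gn[OF B yn, unfolded kser_def]])
      qed auto
      thus ?thesis using True by blast
    next
      case False
      define c where "c i = (if i < n then \<phi> i else \<zero>)" for i
      have c: "c i \<in> carrier R" for i using prev by (auto simp: c_def Q_def)
      have cq: "c i [^] q \<in> carrier R" for i using c by simp
      have "i \<le> n - 1 \<longleftrightarrow> i < n" for i using False by auto
      hence Tc: "T (n - 1) \<phi> = c" by (simp add: T_def c_def[abs_def])
      have nS: "n - 1 < n" "Suc (n - 1) = n" using False by simp_all
      \<comment> \<open>The discrepancy left by the coefficients below \<open>n\<close> is itself a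
        power series \<open>e\<close>, and by the previous stage it starts in degree
        \<open>n\<close>.\<close>
      have "natop R 1 (\<lambda>B xs. kser c B (kser g B (hd xs)) \<ominus>[B] kser (\<lambda>i. c i [^] q) B (hd xs))"
      proof (rule natop_minus[OF _ kser_natop[OF cq]])
        show "natop R 1 (\<lambda>B xs. kser c B (kser g B (hd xs)))"
        proof (rule natopI)
          fix B xs assume B: "is_alg R B" and "xs \<in> nilpts B 1"
          then obtain y where y: "xs = [y]" "y \<in> nil[B]" by (auto elim: nilpts_SucE[of _ _ 0])
          show "kser c B (kser g B (hd xs)) \<in> carrier[B]" unfolding y(1) list.sel by (rule kser_closed[OF B c gn[OF B y(2)]])
        next
          fix B C f xs assume f: "alg_hom R B C f" and "xs \<in> nilpts B 1"
          then obtain y where y: "xs = [y]" "y \<in> nil[B]" by (auto elim: nilpts_SucE[of _ _ 0])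
          show "kser c C (kser g C (hd (map f xs))) = f (kser c B (kser g B (hd xs)))"
            unfolding y(1) list.map list.sel kser_nat[where c = c, OF f c gn[OF alg_homD(1)[OF f] y(2)]] kser_nat[where c = g, OF f g(1) y(2)] ..
        qed
      qed
      from natop1_kser[OF this] obtain e where e: "\<And>i. e i \<in> carrier R"
        and ee: "\<And>B y. is_alg R B \<Longrightarrow> y \<in> nil[B] \<Longrightarrow> kser c B (kser g B y) \<ominus>[B] kser (\<lambda>i. c i [^] q) B y = kser e B y"
        unfolding list.sel by blast
      have ez: "e i = \<zero>" if "i < n" for i
      proof (rule kser_unique_le[OF e _ that])
        fix B y assume B: "is_alg R B" and y: "y \<in> carrier[B]" "y [^][B] n = \<zero>[B]"
        interpret B: big_cring "ring_of B" by (rule alg_big[OF B])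
        have yn: "y \<in> nil[B]" using y by (rule nilI)
        have "kser c B (kser g B y) = kser (\<lambda>i. c i [^] q) B y"
          using prev[OF nS(1)] B y unfolding Q_def Tc nS(2) by blast
        thus "kser e B y = \<zero>[B]" unfolding ee[OF B yn, symmetric]
          using B.r_right_minus_eq[OF kser_closed[where c = "\<lambda>i. c i [^] q", OF B cq yn] kser_closed[where c = "\<lambda>i. c i [^] q", OF B cq yn]] by simp
      qed
      \<comment> \<open>This puts the first step into the case in which \<open>twisted_root\<close>
        guarantees a nonzero root.\<close>
      have e1: "e n = \<zero>" if n: "n = 1"
      proof (rule kser_unique[OF e])
        fix B y assume B: "is_alg R B" and yn: "y \<in> nil[B]"
        interpret B: big_cring "ring_of B" by (rule alg_big[OF B])
        have "c = (\<lambda>i. \<zero>)" "\<zero> [^] q = \<zero>" using prev[of 0] n q0 by (auto simp: c_def Q_def nat_pow_zero)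
        hence "kser c B (kser g B y) = \<zero>[B]" "kser (\<lambda>i. c i [^] q) B y = \<zero>[B]"
          using B.series_zero[OF yn] B.series_zero[OF gn[OF B yn, unfolded kser_def]] alg_str_zero[OF B] by (simp_all add: kser_def)
        thus "kser e B y = \<zero>[B]" using ee[OF B yn] B.r_right_minus_eq[OF B.zero_closed B.zero_closed] by simp
      qed
      have a: "g 1 [^] n \<in> carrier R" "g 1 [^] n \<noteq> \<zero>" using g field_Units Units_pow_closed[of "g 1" n] by auto
      \<comment> \<open>A new coefficient \<open>b\<close> adds \<open>b\<close> times
        \<open>(g 1)^n\<close> to the coefficient of \<open>y^n\<close> on the left and
        \<open>b^q\<close> on the right.\<close>
      obtain b where b: "b \<in> carrier R" "b [^] q = g 1 [^] n \<otimes> b \<oplus> e n" "e n = \<zero> \<longrightarrow> b \<noteq> \<zero>"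
        using twisted_root[OF field_axioms sep nq q2 a e] by blast
      have Tn: "T n (\<phi>(n := b)) = (\<lambda>i. c i \<ominus> (if i = n then \<ominus> b else \<zero>))"
      proof
        fix i show "T n (\<phi>(n := b)) i = c i \<ominus> (if i = n then \<ominus> b else \<zero>)"
          using c[of i] b(1) by (cases "i < n"; cases "i = n") (auto simp: T_def c_def a_minus_def)
      qed
      have Tq: "(\<lambda>i. T n (\<phi>(n := b)) i [^] q) = (\<lambda>i. c i [^] q \<ominus> (if i = n then \<ominus> (b [^] q) else \<zero>))"
      proof
        fix i show "T n (\<phi>(n := b)) i [^] q = c i [^] q \<ominus> (if i = n then \<ominus> (b [^] q) else \<zero>)"
          using c[of i] b(1) q0 by (cases "i < n"; cases "i = n") (auto simp: T_def c_def a_minus_def nat_pow_zero)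
      qed
      have "Q n (\<phi>(n := b))" unfolding Q_def
      proof (intro conjI allI impI)
        fix B y assume B: "is_alg R B" and y: "y \<in> carrier[B]" "y [^][B] Suc n = \<zero>[B]"
        interpret B: big_cring "ring_of B" by (rule alg_big[OF B])
        have yn: "y \<in> nil[B]" using y by (rule nilI)
        have s: "str_map B x \<in> carrier[B]" if "x \<in> carrier R" for x by (rule str_closed[OF B that])
        note hh = is_alg_str[OF B]
        have sm: "str_map B (\<ominus> x) = \<ominus>\<^bsub>ring_of B\<^esub> str_map B x" if "x \<in> carrier R" for x
          by (rule ring_hom_cring.hom_a_inv[OF _ that]) (intro ring_hom_cring.intro ring_hom_cring_axioms.intro is_cring B.is_cring hh)
        obtain u where u: "u \<in> carrier[B]" "kser g B y = y \<otimes>[B] (str_map B (g 1) \<oplus>[B] y \<otimes>[B] u)" using gf[OF B yn] by blast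
        have "kser g B y [^][B] n = y [^][B] n \<otimes>[B] (str_map B (g 1) \<oplus>[B] y \<otimes>[B] u) [^][B] n"
          unfolding u(2) using y u s[OF g(1)] by (intro B.nat_pow_distrib) auto
        also have "\<dots> = y [^][B] n \<otimes>[B] str_map B (g 1 [^] n)"
          using B.pow_perturb[OF y s[OF g(1)] u(1)] str_pow[OF B g(1)] by simp
        finally have gp: "kser g B y [^][B] n = y [^][B] n \<otimes>[B] str_map B (g 1 [^] n)" .
        have en: "kser e B y = str_map B (e n) \<otimes>[B] y [^][B] n"
        proof -
          have "kser e B y = kser (\<lambda>i. if i \<le> n then e i else \<zero>) B y" by (rule kser_truncate[OF B e y, symmetric])
          also have "\<dots> = series (ring_of B) (\<lambda>i. if i = n then str_map B (e n) else \<zero>[B]) y"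
            unfolding kser_def using ez alg_str_zero[OF B] by (intro arg_cong2[where f = "series (ring_of B)"]) (auto simp: fun_eq_iff)
          also have "\<dots> = str_map B (e n) \<otimes>[B] y [^][B] n" by (rule B.series_monom[OF yn s[OF e]])
          finally show ?thesis .
        qed
        have bq: "str_map B (b [^] q) = str_map B (g 1 [^] n) \<otimes>[B] str_map B b \<oplus>[B] str_map B (e n)"
          unfolding b(2) using a b(1) e ring_hom_add[OF hh] ring_hom_mult[OF hh] by simp
        have l: "kser (T n (\<phi>(n := b))) B (kser g B y) = kser c B (kser g B y) \<ominus>[B] str_map B (\<ominus> b) \<otimes>[B] kser g B y [^][B] n"
          unfolding Tn by (rule kser_minus_monom[OF B c _ gn[OF B yn]]) (use b(1) in simp)
        have r: "kser (\<lambda>i. T n (\<phi>(n := b)) i [^] q) B y = kser (\<lambda>i. c i [^] q) B y \<ominus>[B] str_map B (\<ominus> (b [^] q)) \<otimes>[B] y [^][B] n"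
          unfolding Tq by (rule kser_minus_monom[where c = "\<lambda>i. c i [^] q", OF B cq _ yn]) (use b(1) in simp)
        have cc: "kser c B (kser g B y) \<in> carrier[B]" "kser (\<lambda>i. c i [^] q) B y \<in> carrier[B]" "y [^][B] n \<in> carrier[B]"
          "str_map B (g 1 [^] n) \<in> carrier[B]" "str_map B b \<in> carrier[B]" "str_map B (e n) \<in> carrier[B]"
          using kser_closed[OF B c gn[OF B yn]] kser_closed[where c = "\<lambda>i. c i [^] q", OF B cq yn] y(1) s a b e by auto
        have ce: "kser c B (kser g B y) = kser (\<lambda>i. c i [^] q) B y \<oplus>[B] str_map B (e n) \<otimes>[B] y [^][B] n"
          using ee[OF B yn] cc unfolding en by (simp add: a_minus_def B.minus_equality[symmetric]) (metis B.a_ac(1,2) B.r_neg1 B.r_neg B.r_zero B.a_inv_closed cc(1,2))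
        have alg: "(d \<oplus>[B] en \<otimes>[B] z) \<ominus>[B] (\<ominus>\<^bsub>ring_of B\<^esub> bb) \<otimes>[B] (z \<otimes>[B] gg) = d \<ominus>[B] (\<ominus>\<^bsub>ring_of B\<^esub> (gg \<otimes>[B] bb \<oplus>[B] en)) \<otimes>[B] z"
          if "d \<in> carrier[B]" "en \<in> carrier[B]" "z \<in> carrier[B]" "bb \<in> carrier[B]" "gg \<in> carrier[B]" for d en z bb gg
          using that by algebra
        show "kser (T n (\<phi>(n := b))) B (kser g B y) = kser (\<lambda>i. T n (\<phi>(n := b)) i [^] q) B y"
          unfolding l r gp ce sm[OF b(1)] sm[OF nat_pow_closed[OF b(1)]] bq by (rule alg) (rule cc)+
      qed (use b e1 False in auto)
      thus ?thesis by blast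
    qed
  qed
  then obtain \<phi> where \<phi>: "\<And>n. Q n \<phi>" by blast
  have c: "\<phi> i \<in> carrier R" for i using \<phi>[of i] by (simp add: Q_def)
  show ?thesis
  proof (rule that[of \<phi>, OF c])
    show "\<phi> 0 = \<zero>" "\<phi> 1 \<noteq> \<zero>" using \<phi>[of 0] \<phi>[of 1] by (auto simp: Q_def)
    fix B y assume B: "is_alg R B" and y: "y \<in> nil[B]"
    interpret B: big_cring "ring_of B" by (rule alg_big[OF B])
    have yc: "y \<in> carrier[B]" using y by simp
    obtain n :: nat where n: "y [^][B] n = \<zero>[B]" using y by (rule nilE)
    have n': "y [^][B] Suc n = \<zero>[B]" by (rule B.pow_zero_mono[OF yc n]) simp
    obtain u where u: "u \<in> carrier[B]" "kser g B y = y \<otimes>[B] (str_map B (g 1) \<oplus>[B] y \<otimes>[B] u)" using gf[OF B y] by blast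
    have gz: "kser g B y [^][B] Suc n = \<zero>[B]"
      unfolding u(2) using u(1) yc gB[OF B] n' by (subst B.nat_pow_distrib) (auto simp del: B.nat_pow_Suc)
    have T: "(\<lambda>i. T n \<phi> i [^] q) = (\<lambda>i. if i \<le> n then \<phi> i [^] q else \<zero>)" using q0 by (auto simp: T_def nat_pow_zero)
    have "kser \<phi> B (kser g B y) = kser (T n \<phi>) B (kser g B y)"
      unfolding T_def by (rule kser_truncate[OF B c _ gz, symmetric]) (use gn[OF B y] in simp)
    also have "\<dots> = kser (\<lambda>i. T n \<phi> i [^] q) B y" using \<phi>[of n] B yc n' unfolding Q_def by blast
    also have "\<dots> = kser (\<lambda>i. \<phi> i [^] q) B y"
      unfolding T by (rule kser_truncate[OF B _ yc n']) (use c in simp)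
    finally show "kser \<phi> B (kser g B y) = kser (\<lambda>i. \<phi> i [^] (p ^ k)) B y" unfolding q_def .
  qed
qed

end

section \<open>Changing the coordinate of a group law\<close>

context formal_group_field
begin

context
  fixes \<phi> :: "nat \<Rightarrow> 'u" and F' :: "'u alg \<Rightarrow> 'u \<Rightarrow> 'u \<Rightarrow> 'u"
  assumes \<phi>: "\<And>i. \<phi> i \<in> carrier R" "\<phi> 0 = \<zero>" "\<phi> 1 \<noteq> \<zero>"
begin

lemma coordinate_bij:
  assumes B: "is_alg R B" shows "bij_betw (kser \<phi> B) nil[B] nil[B]"
proof -
  interpret B: big_cring "ring_of B" by (rule alg_big[OF B])
  have "str_map B (\<phi> 1) \<otimes>[B] str_map B (inv \<phi> 1) = \<one>[B]"
    using ring_hom_mult[OF is_alg_str[OF B], of "\<phi> 1" "inv \<phi> 1"] \<phi> field_Units alg_str_one[OF B] by simp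
  moreover have "str_map B (\<phi> 1) \<in> carrier[B]" "str_map B (inv \<phi> 1) \<in> carrier[B]"
    using str_closed[OF B] \<phi> field_Units by auto
  ultimately have "str_map B (\<phi> 1) \<in> Units (ring_of B)"
    unfolding Units_def using B.m_comm by (intro CollectI conjI bexI[of _ "str_map B (inv \<phi> 1)"]) auto
  thus ?thesis unfolding kser_def[abs_def] using str_closed[OF B \<phi>(1)] \<phi>(2) alg_str_zero[OF B] by (intro B.series_bij) auto
qed

lemma coordinate_nil: "is_alg R B \<Longrightarrow> x \<in> nil[B] \<Longrightarrow> kser \<phi> B x \<in> nil[B]"
  using coordinate_bij by (rule bij_betw_apply)

lemma coordinate_zero: "is_alg R B \<Longrightarrow> kser \<phi> B \<zero>[B] = \<zero>[B]"
  unfolding kser_def using cring.series_at_zero[OF is_alg_cring, of R B "\<lambda>k. str_map B (\<phi> k)"] str_closed \<phi> alg_str_zero by simp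

context
  assumes hom: "\<And>B x y. is_alg R B \<Longrightarrow> x \<in> nil[B] \<Longrightarrow> y \<in> nil[B] \<Longrightarrow>
    kser \<phi> B (F B x y) = F' B (kser \<phi> B x) (kser \<phi> B y)"
begin

lemma coordinate_change_group: "nil_group R F'"
proof (intro nil_group.intro nil_group_axioms.intro big_cring_axioms)
  fix B assume B: "is_alg R B"
  have "comm_group \<lparr>carrier = nil[B], monoid.mult = F' B, one = kser \<phi> B \<one>\<^bsub>nil_monoid F B\<^esub>\<rparr>"
    by (rule comm_group_transport[OF grp[OF B]]) (use coordinate_bij[OF B] hom[OF B] in simp_all)
  thus "comm_group (nil_monoid F' B)" by (simp add: coordinate_zero[OF B] nil_monoid_def)
next
  fix B C f x y assume f: "alg_hom R B C f" and x: "x \<in> nil[B]" and y: "y \<in> nil[B]"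
  note fD = alg_homD[OF f]
  obtain a where a: "a \<in> nil[B]" "x = kser \<phi> B a" using coordinate_bij[OF fD(1)] x by (auto simp: bij_betw_def)
  obtain b where b: "b \<in> nil[B]" "y = kser \<phi> B b" using coordinate_bij[OF fD(1)] y by (auto simp: bij_betw_def)
  note k = kser_nat[where c = \<phi>, OF f \<phi>(1)]
  show "f (F' B x y) = F' C (f x) (f y)"
    unfolding a b hom[OF fD(1) a(1) b(1), symmetric] k[OF F_closed[OF fD(1) a(1) b(1)]] nat[OF f a(1) b(1)]
      hom[OF fD(2) fD(8)[OF a(1)] fD(8)[OF b(1)]] k[OF a(1)] k[OF b(1)] ..
qed

lemma coordinate_change_multiple:
  assumes B: "is_alg R B" and x: "x \<in> nil[B]"
  shows "multiple (line_group F') m B (kser \<phi> B x) = kser \<phi> B (multiple (line_group F) m B x)"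
  by (induction m) (auto simp: coordinate_zero[OF B] hom[OF B multiple_closed[OF B x] x])

end
end

lemma kser2_additive:
  assumes B: "is_alg R B" and x: "x \<in> nil[B]" and y: "y \<in> nil[B]"
  shows "kser2 (\<lambda>i k. if i + k = 1 then \<one> else \<zero>) B x y = x \<oplus>[B] y"
proof -
  interpret B: big_cring "ring_of B" by (rule alg_big[OF B])
  note s = alg_str_zero[OF B] alg_str_one[OF B]
  have xc: "x \<in> carrier[B]" "y \<in> carrier[B]" using x y by auto
  have "kser (\<lambda>k. if i + k = 1 then \<one> else \<zero>) B x = (if i = 0 then x else \<zero>[B]) \<oplus>[B] (if i = 1 then \<one>[B] else \<zero>[B])" for i
  proof -
    have "kser (\<lambda>k. if i + k = 1 then \<one> else \<zero>) B x =
      series (ring_of B) (\<lambda>k. (if k = 1 then (if i = 0 then \<one>[B] else \<zero>[B]) else \<zero>[B]) \<oplus>[B] (if k = 0 then (if i = 1 then \<one>[B] else \<zero>[B]) else \<zero>[B])) x"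
      unfolding kser_def by (rule B.series_cong) (auto simp: s)
    also have "\<dots> = (if i = 0 then x else \<zero>[B]) \<oplus>[B] (if i = 1 then \<one>[B] else \<zero>[B])"
      using xc by (subst B.series_add[OF x]) (auto simp: B.series_monom[OF x])
    finally show ?thesis .
  qed
  hence "kser2 (\<lambda>i k. if i + k = 1 then \<one> else \<zero>) B x y =
    series (ring_of B) (\<lambda>i. (if i = 0 then x else \<zero>[B]) \<oplus>[B] (if i = 1 then \<one>[B] else \<zero>[B])) y"
    by (simp add: kser2_def)
  also have "\<dots> = x \<oplus>[B] y" using xc by (subst B.series_add[OF y]) (auto simp: B.series_monom[OF y])
  finally show ?thesis .
qed

text \<open>The coefficients \<open>\<alpha>\<close> all satisfy \<open>a\<^sup>r = a\<close> for some \<open>r \<ge> 2\<close>; this is what makes the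
  formal group law integral over every valuation ring of the field.\<close>

theorem integral_coordinate:
  assumes sep: "p \<noteq> 0 \<Longrightarrow> separably_closed R"
    and height: "\<And>B x. p \<noteq> 0 \<Longrightarrow> is_alg R B \<Longrightarrow> x \<in> carrier[B] \<Longrightarrow> x [^][B] n = \<zero>[B] \<Longrightarrow>
      multiple (line_group F) p B x = \<zero>[B]"
  obtains \<phi> \<alpha> r e q where "\<And>i. \<phi> i \<in> carrier R" "\<phi> 0 = \<zero>" "\<phi> 1 \<noteq> \<zero>"
    "\<And>i k. \<alpha> i k \<in> carrier R" "2 \<le> (r::nat)" "\<And>i k. \<alpha> i k [^] r = \<alpha> i k"
    "\<And>B x y. is_alg R B \<Longrightarrow> x \<in> nil[B] \<Longrightarrow> y \<in> nil[B] \<Longrightarrow>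
      kser \<phi> B (F B x y) = kser2 \<alpha> B (kser \<phi> B x) (kser \<phi> B y)"
    "e \<in> {\<zero>, \<one>}" "n \<le> q"
    "\<And>B x. p \<noteq> 0 \<Longrightarrow> is_alg R B \<Longrightarrow> x \<in> nil[B] \<Longrightarrow>
      multiple (line_group (kser2 \<alpha>)) p B x = str_map B e \<otimes>[B] x [^][B] q"
proof (cases "\<exists>B x. p \<noteq> 0 \<and> is_alg R B \<and> x \<in> nil[B] \<and> multiple (line_group F) p B x \<noteq> \<zero>[B]")
  \<comment> \<open>Either \<open>p = 0\<close> or \<open>[p]\<close> is zero: the logarithm makes
    the law additive.\<close>
  case False
  hence z: "p \<noteq> 0 \<Longrightarrow> (\<And>B x. is_alg R B \<Longrightarrow> x \<in> nil[B] \<Longrightarrow> multiple (line_group F) p B x = \<zero>[B])" by blast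
  obtain g where g: "\<And>k. g k \<in> carrier R" "g 0 = \<zero>" "g 1 = \<one>"
    and gh: "\<And>B x y. is_alg R B \<Longrightarrow> x \<in> nil[B] \<Longrightarrow> y \<in> nil[B] \<Longrightarrow> kser g B (F B x y) = kser g B x \<oplus>[B] kser g B y"
  proof -
    have "\<exists>g. (\<forall>k. g k \<in> carrier R) \<and> g 0 = \<zero> \<and> g 1 = \<one> \<and>
      (\<forall>B x y. is_alg R B \<longrightarrow> x \<in> nil[B] \<longrightarrow> y \<in> nil[B] \<longrightarrow> kser g B (F B x y) = kser g B x \<oplus>[B] kser g B y)"
      by (rule logarithm_exists) (rule z)
    thus ?thesis using that by blast
  qed
  have g1: "g 1 \<noteq> \<zero>" using g by simp
  define \<alpha> where "\<alpha> i k = (if i + k = 1 then \<one> else \<zero>)" for i k :: nat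
  have h: "kser g B (F B x y) = kser2 \<alpha> B (kser g B x) (kser g B y)"
    if "is_alg R B" "x \<in> nil[B]" "y \<in> nil[B]" for B x y
    unfolding gh[OF that] \<alpha>_def kser2_additive[OF that(1) coordinate_nil[where \<phi> = g, OF g(1,2) g1 that(1,2)] coordinate_nil[where \<phi> = g, OF g(1,2) g1 that(1,3)]] ..
  \<comment> \<open>The coefficients 0 and 1 are fixed by squaring, hence \<open>r = 2\<close>. The
    values \<open>\<zero>\<close> for \<open>e\<close> and \<open>n\<close> for \<open>q\<close>
    write \<open>[p] = 0\<close> in the common shape.\<close>
  show ?thesis
  proof (rule that[of g \<alpha> 2 \<zero> n])
    fix B x assume p: "p \<noteq> 0" and B: "is_alg R B" and x: "x \<in> nil[B]"
    interpret B: big_cring "ring_of B" by (rule alg_big[OF B])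
    obtain a where a: "a \<in> nil[B]" "x = kser g B a" using coordinate_bij[where \<phi> = g, OF g(1,2) g1 B] x by (auto simp: bij_betw_def)
    have cm: "multiple (line_group (kser2 \<alpha>)) p B (kser g B a) = kser g B (multiple (line_group F) p B a)"
      by (rule coordinate_change_multiple[where \<phi> = g, OF g(1,2) g1 _ B a(1)]) (rule h)
    show "multiple (line_group (kser2 \<alpha>)) p B x = str_map B \<zero> \<otimes>[B] x [^][B] n"
      using cm x
      unfolding a(2)[symmetric] z[OF p B a(1)] coordinate_zero[where \<phi> = g, OF g(1,2) g1 B] alg_str_zero[OF B] by simp
  qed (use g g1 h in \<open>auto simp: \<alpha>_def nat_pow_zero\<close>)
next
  case True
  then obtain B0 x0 where p: "p \<noteq> 0" and B0: "is_alg R B0" "x0 \<in> nil[B0]" "multiple (line_group F) p B0 x0 \<noteq> \<zero>[B0]" by blast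
  obtain \<gamma> where \<gamma>: "\<And>k. \<gamma> k \<in> carrier R" "\<gamma> 0 = \<zero>"
    and \<gamma>m: "\<And>B x. is_alg R B \<Longrightarrow> x \<in> nil[B] \<Longrightarrow> multiple (line_group F) p B x = kser \<gamma> B x"
    using multiple_kser[of p] by blast
  have "\<exists>m. \<gamma> m \<noteq> \<zero>"
  proof (rule ccontr)
    assume "\<not> ?thesis"
    hence "kser \<gamma> B0 x0 = \<zero>[B0]"
      unfolding kser_def using cring.series_zero[OF is_alg_cring[OF B0(1)] B0(2)] alg_str_zero[OF B0(1)] by simp
    thus False using B0 \<gamma>m by simp
  qed
  then obtain m where m: "\<gamma> m \<noteq> \<zero>" by blast
  obtain k g where k: "0 < k" and g: "\<And>i. g i \<in> carrier R" "g 0 = \<zero>" "g 1 \<noteq> \<zero>" and g1: "g 1 = \<gamma> (p ^ k)"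
    and gm: "\<And>B x. is_alg R B \<Longrightarrow> x \<in> nil[B] \<Longrightarrow> multiple (line_group F) p B x = kser g B (x [^][B] (p ^ k))"
    using multiple_frobenius_form[where \<gamma> = \<gamma>, OF p \<gamma> m \<gamma>m] by metis
  define q where "q = p ^ k"
  have p1: "1 < p" by (rule prime_gt_1_nat[OF p_prime[OF p]])
  have q2: "2 \<le> q" unfolding q_def using p1 k power_increasing[of 1 k p] by simp
  have q0: "0 < q" using q2 by simp
  \<comment> \<open>By hypothesis \<open>[p]\<close> has no coefficients below degree
    \<open>n\<close>, but the one in degree \<open>q\<close> is \<open>g 1\<close>.\<close>
  have nq: "n \<le> q"
  proof (rule ccontr)
    assume "\<not> n \<le> q"
    hence "q < n" by simp
    hence "\<gamma> q = \<zero>"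
      by (rule kser_unique_le[where c = \<gamma>, OF \<gamma>(1), rotated]) (metis \<gamma>m height p nilI)
    thus False using g1 g(3) by (simp add: q_def)
  qed
  obtain \<phi> where \<phi>: "\<And>i. \<phi> i \<in> carrier R" "\<phi> 0 = \<zero>" "\<phi> 1 \<noteq> \<zero>"
    and \<phi>g: "\<And>B y. is_alg R B \<Longrightarrow> y \<in> nil[B] \<Longrightarrow> kser \<phi> B (kser g B y) = kser (\<lambda>i. \<phi> i [^] q) B y"
    using linearize_frobenius[where g = g, OF p sep[OF p] k g] unfolding q_def by metis
  define inv\<phi> where "inv\<phi> B = inv_into nil[B] (kser \<phi> B)" for B
  define F' where "F' B x y = kser \<phi> B (F B (inv\<phi> B x) (inv\<phi> B y))" for B x y
  note bij = coordinate_bij[where \<phi> = \<phi>, OF \<phi>]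
  have iv: "inv\<phi> B (kser \<phi> B x) = x" if "is_alg R B" "x \<in> nil[B]" for B x
    unfolding inv\<phi>_def using bij_betw_inv_into_left[OF bij[OF that(1)] that(2)] .
  have h': "kser \<phi> B (F B x y) = F' B (kser \<phi> B x) (kser \<phi> B y)" if "is_alg R B" "x \<in> nil[B]" "y \<in> nil[B]" for B x y
    unfolding F'_def iv[OF that(1,2)] iv[OF that(1,3)] ..
  interpret F': nil_group R F' by (rule coordinate_change_group[where \<phi> = \<phi>, OF \<phi> h'])
  obtain \<alpha> where \<alpha>: "\<And>i k. \<alpha> i k \<in> carrier R"
    and \<alpha>F: "\<And>B x y. is_alg R B \<Longrightarrow> x \<in> nil[B] \<Longrightarrow> y \<in> nil[B] \<Longrightarrow> F' B ([y, x] ! 1) ([y, x] ! 0) = kser2 \<alpha> B x y"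
    using natop2_kser2[OF F'.F_natop] by metis
  have \<alpha>F': "F' B x y = kser2 \<alpha> B x y" if "is_alg R B" "x \<in> nil[B]" "y \<in> nil[B]" for B x y
    using \<alpha>F[OF that] by simp
  \<comment> \<open>The new coordinate of \<open>[p] x\<close> is \<open>\<phi>\<close> at
    \<open>g (x^q)\<close>, which is the series with \<open>q\<close>-th powers of the coefficients
    at \<open>x^q\<close>, that is, the \<open>q\<close>-th power of the coordinate of
    \<open>x\<close>.\<close>
  have mult: "multiple (line_group F') p B z = z [^][B] q" if B: "is_alg R B" and z: "z \<in> nil[B]" for B z
  proof -
    interpret B: big_cring "ring_of B" by (rule alg_big[OF B])
    obtain x where x: "x \<in> nil[B]" "z = kser \<phi> B x" using bij[OF B] z by (auto simp: bij_betw_def)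
    have cm: "multiple (line_group F') p B (kser \<phi> B x) = kser \<phi> B (multiple (line_group F) p B x)"
      by (rule coordinate_change_multiple[where \<phi> = \<phi>, OF \<phi> _ B x(1)]) (rule h')
    show ?thesis
      unfolding x(2) cm gm[OF B x(1)]
      unfolding q_def[symmetric] \<phi>g[OF B B.pow_nil[OF x(1) q0]]
      unfolding q_def by (rule frobenius_kser[where c = \<phi>, OF p B x(1) \<phi>(1), symmetric])
  qed
  \<comment> \<open>The \<open>q\<close>-th power map is now an endomorphism of the group. So the
    law at \<open>x^q\<close>, \<open>y^q\<close> equals the \<open>q\<close>-th power of its value
    at \<open>x\<close>, \<open>y\<close>, which by Frobenius is the law with coefficients raised to
    \<open>q\<close>, again at \<open>x^q\<close>, \<open>y^q\<close>.\<close>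
  have \<alpha>q: "\<alpha> i l [^] q = \<alpha> i l" for i l
  proof -
    let ?\<beta> = "\<lambda>i k. \<alpha> i k [^] q"
    have \<beta>: "?\<beta> i k \<in> carrier R" for i k using \<alpha> by simp
    have k2: "kser2 \<alpha> B (x [^][B] q) (y [^][B] q) = kser2 ?\<beta> B (x [^][B] q) (y [^][B] q)"
      if B: "is_alg R B" and x: "x \<in> nil[B]" and y: "y \<in> nil[B]" for B x y
    proof -
      interpret B: big_cring "ring_of B" by (rule alg_big[OF B])
      have n: "x [^][B] q \<in> nil[B]" "y [^][B] q \<in> nil[B]" by (rule B.pow_nil[OF x q0] B.pow_nil[OF y q0])+
      have kc: "kser (\<alpha> i) B x \<in> carrier[B]" for i by (rule kser_closed[OF B \<alpha> x])
      have "kser2 \<alpha> B (x [^][B] q) (y [^][B] q) = F' B (multiple (line_group F') p B x) (multiple (line_group F') p B y)"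
        unfolding mult[OF B x] mult[OF B y] by (rule \<alpha>F'[OF B n, symmetric])
      also have "\<dots> = F' B x y [^][B] q"
        unfolding F'.multiple_hom[OF B x y, symmetric] by (rule mult[OF B F'.F_closed[OF B x y]])
      also have "\<dots> = kser2 \<alpha> B x y [^][B] q" by (simp only: \<alpha>F'[OF B x y])
      also have "\<dots> = series (ring_of B) (\<lambda>i. kser (\<alpha> i) B x [^][B] q) (y [^][B] q)"
        unfolding kser2_def q_def by (rule frobenius_series[OF p B y kc])
      also have "\<dots> = kser2 ?\<beta> B (x [^][B] q) (y [^][B] q)"
        unfolding kser2_def q_def by (rule B.series_cong) (rule frobenius_kser[OF p B x \<alpha>])
      finally show ?thesis .
    qed
    define \<delta> where "\<delta> i k = \<alpha> i k \<ominus> ?\<beta> i k" for i k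
    have \<delta>: "\<delta> i k \<in> carrier R" for i k using \<alpha> by (simp add: \<delta>_def)
    have d: "kser2 \<delta> B x y = kser2 \<alpha> B x y \<ominus>[B] kser2 ?\<beta> B x y" if B: "is_alg R B" and x: "x \<in> nil[B]" and y: "y \<in> nil[B]" for B x y
    proof -
      interpret B: big_cring "ring_of B" by (rule alg_big[OF B])
      have hB: "ring_hom_cring R (ring_of B) (str_map B)"
        by (intro ring_hom_cring.intro ring_hom_cring_axioms.intro is_cring B.is_cring is_alg_str[OF B])
      have sm: "str_map B (a \<ominus> b) = str_map B a \<ominus>[B] str_map B b" if "a \<in> carrier R" "b \<in> carrier R" for a b
        using that ring_hom_add[OF is_alg_str[OF B]] ring_hom_cring.hom_a_inv[OF hB] by (simp add: a_minus_def)
      have "kser (\<delta> i) B x = kser (\<alpha> i) B x \<ominus>[B] kser (?\<beta> i) B x" for i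
        unfolding kser_def \<delta>_def sm[OF \<alpha> \<beta>] by (rule B.series_minus[OF x str_closed[OF B \<alpha>] str_closed[OF B \<beta>]])
      thus ?thesis unfolding kser2_def
        using B.series_minus[OF y, of "\<lambda>i. kser (\<alpha> i) B x" "\<lambda>i. kser (?\<beta> i) B x"]
          kser_closed[OF B \<alpha> x] kser_closed[where c = "?\<beta> _", OF B \<beta> x] by simp
    qed
    have "kser2 \<delta> B x y = \<zero>[B]" if B: "is_alg R B" and x: "x \<in> nil[B]" and y: "y \<in> nil[B]" for B x y
    proof -
      have "(\<lambda>B xs. kser2 \<delta> B (xs ! 1) (xs ! 0)) B [y, x] = \<zero>[B]"
      proof (rule natop_zero_power_test[OF kser2_natop[OF \<delta>] q0 _ B])
        fix B xs assume B: "is_alg R B" and "xs \<in> nilpts B 2"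
        then obtain x y where xy: "xs = [y, x]" "x \<in> nil[B]" "y \<in> nil[B]"
          unfolding numeral_2_eq_2 by (auto elim!: nilpts_SucE)
        interpret B: big_cring "ring_of B" by (rule alg_big[OF B])
        have n: "x [^][B] q \<in> nil[B]" "y [^][B] q \<in> nil[B]" by (rule B.pow_nil[OF xy(2) q0] B.pow_nil[OF xy(3) q0])+
        have "kser2 ?\<beta> B (x [^][B] q) (y [^][B] q) \<in> carrier[B]"
          unfolding kser2_def by (rule B.series_closed[OF n(2) kser_closed[where c = "?\<beta> _", OF B \<beta> n(1)]])
        thus "kser2 \<delta> B (map (\<lambda>x. x [^][B] q) xs ! 1) (map (\<lambda>x. x [^][B] q) xs ! 0) = \<zero>[B]"
          using d[OF B n] k2[OF B xy(2,3)] B.r_right_minus_eq by (simp add: xy(1))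
      qed (use x y in \<open>simp add: nilpts_def\<close>)
      thus ?thesis by simp
    qed
    hence "\<delta> i l = \<zero>" using kser2_unique[where c = \<delta>, OF \<delta>] by blast
    thus ?thesis using \<alpha>[of i l] \<beta>[of i l] r_right_minus_eq unfolding \<delta>_def by metis
  qed
  \<comment> \<open>Here \<open>r = q\<close>, and \<open>[p]\<close> is \<open>x^q\<close> with
    coefficient \<open>e = 1\<close>.\<close>
  show ?thesis
  proof (rule that[of \<phi> \<alpha> q \<one> q])
    fix B x y assume B: "is_alg R B" and x: "x \<in> nil[B]" and y: "y \<in> nil[B]"
    note cn = coordinate_nil[where \<phi> = \<phi>, OF \<phi> B]
    show "kser \<phi> B (F B x y) = kser2 \<alpha> B (kser \<phi> B x) (kser \<phi> B y)"
      unfolding h'[OF B x y] by (rule \<alpha>F'[OF B cn[OF x] cn[OF y]])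
  next
    fix B x assume B: "is_alg R B" and x: "x \<in> nil[B]"
    interpret B: big_cring "ring_of B" by (rule alg_big[OF B])
    have "multiple (line_group (kser2 \<alpha>)) i B x = multiple (line_group F') i B x" for i
      by (induction i) (auto simp: \<alpha>F'[OF B F'.multiple_closed[OF B x] x])
    thus "multiple (line_group (kser2 \<alpha>)) p B x = str_map B \<one> \<otimes>[B] x [^][B] q"
      using mult[OF B x] x by (simp add: alg_str_one[OF B])
  qed (use \<phi> \<alpha> \<alpha>q q2 nq in auto)
qed

end

section \<open>Descent to the valuation ring\<close>

lemma kser_via: "kser c (alg_via j B) = kser (\<lambda>k. j (c k)) B"
  by (simp add: kser_def fun_eq_iff)

lemma kser2_via: "kser2 c (alg_via j B) = kser2 (\<lambda>i k. j (c i k)) B"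
  by (simp add: kser2_def kser_via fun_eq_iff)

lemma natop_transfer:
  assumes V: "big_cring V" and K: "big_cring K" and j: "j \<in> ring_hom V K" "inj_on j (carrier V)"
    and P: "natop V n P" and Q: "natop V n Q"
    and e: "\<And>B xs. is_alg K B \<Longrightarrow> xs \<in> nilpts B n \<Longrightarrow> P (alg_via j B) xs = Q (alg_via j B) xs"
    and B: "is_alg V B" and xs: "xs \<in> nilpts B n"
  shows "P B xs = Q B xs"
proof -
  have *: "P B xs \<ominus>[B] Q B xs = \<zero>[B]"
  proof (rule natop_zero_transfer[OF V K j natop_minus[OF P Q] _ B xs])
    fix C xs assume C: "is_alg K C" and xs: "xs \<in> nilpts C n"
    interpret C: cring "ring_of C" by (rule is_alg_cring[OF C])
    have "P (alg_via j C) xs \<in> carrier[C]" using natop_closed[OF P alg_via_is_alg[OF j(1) C]] xs by simp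
    thus "P (alg_via j C) xs \<ominus>[alg_via j C] Q (alg_via j C) xs = \<zero>[C]"
      unfolding e[OF C xs, symmetric] using C.r_right_minus_eq by simp
  qed
  interpret B: cring "ring_of B" by (rule is_alg_cring[OF B])
  show ?thesis using * B.r_right_minus_eq natop_closed[OF P B xs] natop_closed[OF Q B xs] by blast
qed

lemma (in big_cring) natop_kser2:
  assumes c: "\<And>i k. c i k \<in> carrier R" and a: "natop R n a" and b: "natop R n b"
    and an: "\<And>B xs. is_alg R B \<Longrightarrow> xs \<in> nilpts B n \<Longrightarrow> a B xs \<in> nil[B]"
    and bn: "\<And>B xs. is_alg R B \<Longrightarrow> xs \<in> nilpts B n \<Longrightarrow> b B xs \<in> nil[B]"
  shows "natop R n (\<lambda>B xs. kser2 c B (a B xs) (b B xs))"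
proof -
  have "natop R n (\<lambda>B xs. (\<lambda>B xs. kser2 c B (xs ! 1) (xs ! 0)) B (map (\<lambda>i. (if i = 0 then b else a) B xs) [0..<2]))"
    by (rule natop_comp[OF kser2_natop[where c = c, OF c]]) (use a b an bn in \<open>auto split: if_splits\<close>)
  thus ?thesis by (simp add: upt_rec)
qed

context
  fixes V K :: "'u ring" and j and \<beta> :: "nat \<Rightarrow> nat \<Rightarrow> 'u"
  assumes V: "big_cring V" and K: "big_cring K" and j: "j \<in> ring_hom V K" "inj_on j (carrier V)"
    and \<beta>: "\<And>i k. \<beta> i k \<in> carrier V" and G: "nil_group K (kser2 (\<lambda>i k. j (\<beta> i k)))"
begin

interpretation V: big_cring V by (rule V)
interpretation K: big_cring K by (rule K)
interpretation G: nil_group K "kser2 (\<lambda>i k. j (\<beta> i k))" by (rule G)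

text \<open>Unit, commutative and associative laws are identities between operations and pass from
  \<open>K\<close> to \<open>V\<close> by \<open>natop_transfer\<close>. Inverses are obtained by
  solving the equation for the second argument as a power series.\<close>

lemma nil_group_descent: "nil_group V (kser2 \<beta>)"
proof -
  note tr = natop_transfer[OF V K j]
  have jc: "j c \<in> carrier K" if "c \<in> carrier V" for c using ring_hom_closed[OF j(1) that] .
  have j0: "j \<zero>\<^bsub>V\<^esub> = \<zero>\<^bsub>K\<^esub>" by (rule ring_hom_zero[OF j(1) V.ring_axioms K.ring_axioms])
  \<comment> \<open>Without constant term the series preserves nilpotent elements.\<close>
  have "\<beta> 0 0 = \<zero>\<^bsub>V\<^esub>"
  proof (rule inj_onD[OF j(2)])
    have "kser2 (\<lambda>i k. j (\<beta> i k)) (K, \<lambda>a. a) \<zero>\<^bsub>K\<^esub> \<zero>\<^bsub>K\<^esub> = \<zero>\<^bsub>K\<^esub>"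
      using G.F_zero(1)[OF base_alg[OF K.is_cring], of "\<zero>\<^bsub>K\<^esub>"] by simp
    thus "j (\<beta> 0 0) = j \<zero>\<^bsub>V\<^esub>"
      unfolding j0 kser2_def kser_def using jc[OF \<beta>] by (simp add: K.series_at_zero)
  qed (use \<beta> in simp_all)
  have s0: "str_map B \<zero>\<^bsub>V\<^esub> = \<zero>[B]" if "is_alg V B" for B
    using ring_hom_zero[OF is_alg_str[OF that] V.ring_axioms] is_alg_cring[OF that] by (simp add: cring_def)
  have s1: "str_map B \<one>\<^bsub>V\<^esub> = \<one>[B]" if "is_alg V B" for B by (rule ring_hom_one[OF is_alg_str[OF that]])
  have cl: "kser2 \<beta> B x y \<in> nil[B]" if B: "is_alg V B" and x: "x \<in> nil[B]" and y: "y \<in> nil[B]" for B x y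
  proof -
    interpret B: big_cring "ring_of B" by (rule V.alg_big[OF B])
    show ?thesis unfolding kser2_def
      by (rule B.series_nil[where a = "\<lambda>i. kser (\<beta> i) B x", OF y V.kser_closed[where c = "\<beta> _", OF B \<beta> x] V.kser_nil[where c = "\<beta> _", OF B \<beta> x \<open>\<beta> 0 0 = \<zero>\<^bsub>V\<^esub>\<close>]])
  qed
  note nn = natop_nth
  have nth: "xs ! i \<in> nil[B]" if "xs \<in> nilpts B n" "i < n" for xs i n and B :: "'u alg"
    using that by (auto simp: nilpts_def)
  have zr: "kser2 \<beta> B x \<zero>[B] = x" "kser2 \<beta> B \<zero>[B] x = x" if B: "is_alg V B" and x: "x \<in> nil[B]" for B x
  proof -
    have zn: "str_map B \<zero>\<^bsub>V\<^esub> \<in> nil[B]" if "is_alg V B" for B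
      using s0[OF that] cring.zero_nil[OF is_alg_cring[OF that]] by simp
    have "(\<lambda>B xs. kser2 \<beta> B (xs ! 0) (str_map B \<zero>\<^bsub>V\<^esub>)) B [x] = (\<lambda>B xs. xs ! 0) B [x]"
    proof (rule tr[where n = 1, OF V.natop_kser2[OF \<beta> natop_nth natop_const] natop_nth _ B])
      fix B xs assume B: "is_alg K B" and xs: "xs \<in> nilpts B 1"
      show "kser2 \<beta> (alg_via j B) (xs ! 0) (str_map (alg_via j B) \<zero>\<^bsub>V\<^esub>) = xs ! 0"
        unfolding kser2_via using G.F_zero(1)[OF B nth[OF xs]] s0[OF alg_via_is_alg[OF j(1) B]] by simp
    qed (use x nth zn in \<open>auto simp: nilpts_def\<close>)
    moreover have "(\<lambda>B xs. kser2 \<beta> B (str_map B \<zero>\<^bsub>V\<^esub>) (xs ! 0)) B [x] = (\<lambda>B xs. xs ! 0) B [x]"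
    proof (rule tr[where n = 1, OF V.natop_kser2[OF \<beta> natop_const natop_nth] natop_nth _ B])
      fix B xs assume B: "is_alg K B" and xs: "xs \<in> nilpts B 1"
      show "kser2 \<beta> (alg_via j B) (str_map (alg_via j B) \<zero>\<^bsub>V\<^esub>) (xs ! 0) = xs ! 0"
        unfolding kser2_via using G.F_zero(2)[OF B nth[OF xs]] s0[OF alg_via_is_alg[OF j(1) B]] by simp
    qed (use x nth zn in \<open>auto simp: nilpts_def\<close>)
    ultimately show "kser2 \<beta> B x \<zero>[B] = x" "kser2 \<beta> B \<zero>[B] x = x" using s0[OF B] by simp_all
  qed
  have comm: "kser2 \<beta> B x y = kser2 \<beta> B y x" if B: "is_alg V B" and x: "x \<in> nil[B]" and y: "y \<in> nil[B]" for B x y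
  proof -
    have "(\<lambda>B xs. kser2 \<beta> B (xs ! 0) (xs ! 1)) B [x, y] = (\<lambda>B xs. kser2 \<beta> B (xs ! 1) (xs ! 0)) B [x, y]"
    proof (rule tr[where n = 2, OF V.natop_kser2[OF \<beta> natop_nth natop_nth] V.natop_kser2[OF \<beta> natop_nth natop_nth] _ B])
      fix B xs assume B: "is_alg K B" and xs: "xs \<in> nilpts B 2"
      show "kser2 \<beta> (alg_via j B) (xs ! 0) (xs ! 1) = kser2 \<beta> (alg_via j B) (xs ! 1) (xs ! 0)"
        unfolding kser2_via by (rule G.F_comm[OF B nth[OF xs] nth[OF xs]]) simp_all
    qed (use x y nth in \<open>auto simp: nilpts_def\<close>)
    thus ?thesis by simp
  qed
  have assoc: "kser2 \<beta> B (kser2 \<beta> B x y) z = kser2 \<beta> B x (kser2 \<beta> B y z)"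
    if B: "is_alg V B" and x: "x \<in> nil[B]" and y: "y \<in> nil[B]" and z: "z \<in> nil[B]" for B x y z
  proof -
    have "(\<lambda>B xs. kser2 \<beta> B (kser2 \<beta> B (xs ! 0) (xs ! 1)) (xs ! 2)) B [x, y, z] =
      (\<lambda>B xs. kser2 \<beta> B (xs ! 0) (kser2 \<beta> B (xs ! 1) (xs ! 2))) B [x, y, z]"
    proof (rule tr[where n = 3, OF V.natop_kser2[OF \<beta> V.natop_kser2[OF \<beta> natop_nth natop_nth] natop_nth]
         V.natop_kser2[OF \<beta> natop_nth V.natop_kser2[OF \<beta> natop_nth natop_nth]] _ B])
      fix B xs assume B: "is_alg K B" and xs: "xs \<in> nilpts B 3"
      show "kser2 \<beta> (alg_via j B) (kser2 \<beta> (alg_via j B) (xs ! 0) (xs ! 1)) (xs ! 2) =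
        kser2 \<beta> (alg_via j B) (xs ! 0) (kser2 \<beta> (alg_via j B) (xs ! 1) (xs ! 2))"
        unfolding kser2_via by (rule G.F_assoc[OF B nth[OF xs] nth[OF xs] nth[OF xs]]) simp_all
    qed (use x y z nth cl in \<open>auto simp: nilpts_def\<close>)
    thus ?thesis by simp
  qed
  \<comment> \<open>The coefficient of \<open>y\<close> is 1, from the unit law with zero as first
    argument. The conditional matches the shape of \<open>kser_minus_monom\<close> at the index
    1.\<close>
  have "\<beta> 1 0 \<ominus>\<^bsub>V\<^esub> (if (1::nat) = 1 then \<one>\<^bsub>V\<^esub> else \<zero>\<^bsub>V\<^esub>) = \<zero>\<^bsub>V\<^esub>"
  proof (rule V.kser_unique[where c = "\<lambda>i. \<beta> i 0 \<ominus>\<^bsub>V\<^esub> (if i = 1 then \<one>\<^bsub>V\<^esub> else \<zero>\<^bsub>V\<^esub>)" and k = 1])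
    fix B y assume B: "is_alg V B" and y: "y \<in> nil[B]"
    interpret B: big_cring "ring_of B" by (rule V.alg_big[OF B])
    have "kser (\<lambda>i. \<beta> i 0) B y = kser2 \<beta> B \<zero>[B] y"
      unfolding kser2_def kser_def using V.str_closed[OF B \<beta>] by (simp add: B.series_at_zero)
    hence e: "kser (\<lambda>i. \<beta> i 0) B y = y" using zr(2)[OF B y] by simp
    show "kser (\<lambda>i. \<beta> i 0 \<ominus>\<^bsub>V\<^esub> (if i = 1 then \<one>\<^bsub>V\<^esub> else \<zero>\<^bsub>V\<^esub>)) B y = \<zero>[B]"
      unfolding V.kser_minus_monom[where c = "\<lambda>i. \<beta> i 0", OF B \<beta> V.one_closed y] e s1[OF B] using y B.r_right_minus_eq by simp
  qed (use \<beta> in auto)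
  hence \<beta>1: "\<beta> 1 0 = \<one>\<^bsub>V\<^esub>" using \<beta> V.r_right_minus_eq by simp
  have inv: "\<exists>y\<in>nil[B]. kser2 \<beta> B y x = \<zero>[B]" if B: "is_alg V B" and x: "x \<in> nil[B]" for B x
  proof -
    interpret B: big_cring "ring_of B" by (rule V.alg_big[OF B])
    have xc: "x \<in> carrier[B]" using x by simp
    define a where "a i = kser (\<beta> i) B x" for i
    have a: "a i \<in> carrier[B]" for i unfolding a_def by (rule V.kser_closed[where c = "\<beta> _", OF B \<beta> x])
    \<comment> \<open>The law as a series in \<open>y\<close> without its constant term, which is
      \<open>x\<close>. An inverse of \<open>x\<close> is a solution of \<open>c (y) = -x\<close>;
      it exists because the linear coefficient is 1 plus a multiple of \<open>x\<close>, a
      unit.\<close>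
    define c where "c i = (if i = 0 then \<zero>[B] else a i)" for i
    have c: "c i \<in> carrier[B]" for i using a by (simp add: c_def)
    have a0: "a 0 = x" using zr(1)[OF B x] a B.series_at_zero[of a] by (simp add: kser2_def a_def[abs_def])
    let ?s = "series (ring_of B) (\<lambda>k. str_map B (\<beta> 1 (Suc k))) x"
    have s: "?s \<in> carrier[B]" by (rule B.series_closed[OF x V.str_closed[OF B \<beta>]])
    have "a 1 = \<one>[B] \<oplus>[B] x \<otimes>[B] ?s"
      unfolding a_def kser_def B.series_shift[OF x, of "\<lambda>k. str_map B (\<beta> 1 k)", OF V.str_closed[OF B \<beta>]] \<beta>1 s1[OF B] ..
    hence "c 1 \<in> Units (ring_of B)" using B.one_plus_nil_unit[OF B.mult_nil(2)[OF x s]] by (simp add: c_def)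
    hence "bij_betw (series (ring_of B) c) nil[B] nil[B]" using c by (intro B.series_bij) (simp_all add: c_def)
    moreover have "\<ominus>\<^bsub>ring_of B\<^esub> x \<in> nil[B]" by (rule B.uminus_nil[OF x])
    ultimately obtain y where y: "y \<in> nil[B]" "series (ring_of B) c y = \<ominus>\<^bsub>ring_of B\<^esub> x"
      unfolding bij_betw_def by (metis imageE)
    have "a = (\<lambda>i. (if i = 0 then x else \<zero>[B]) \<oplus>[B] c i)" using a a0 xc by (auto simp: c_def fun_eq_iff)
    hence "kser2 \<beta> B x y = series (ring_of B) (\<lambda>i. (if i = 0 then x else \<zero>[B]) \<oplus>[B] c i) y"
      by (simp add: kser2_def a_def[abs_def])
    also have "\<dots> = x \<oplus>[B] \<ominus>\<^bsub>ring_of B\<^esub> x"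
      using xc c y by (subst B.series_add) (auto simp: B.series_monom)
    finally show ?thesis using y comm[OF B x y(1)] xc by (auto simp: B.r_neg)
  qed
  show ?thesis
  proof (intro nil_group.intro nil_group_axioms.intro V)
    fix B assume B: "is_alg V B"
    show "comm_group (nil_monoid (kser2 \<beta>) B)"
      by (rule comm_groupI)
        (use cl[OF B] zr[OF B] inv[OF B] assoc[OF B] comm[OF B] cring.zero_nil[OF is_alg_cring[OF B]] in \<open>auto\<close>)
  next
    fix B C f x y assume f: "alg_hom V B C f" and x: "x \<in> nil[B]" and y: "y \<in> nil[B]"
    show "f (kser2 \<beta> B x y) = kser2 \<beta> C (f x) (f y)"
      using natop_natural[OF V.kser2_natop[where c = \<beta>, OF \<beta>] f, of "[y, x]"] x y by (simp add: nilpts_def)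
  qed
qed

end

text \<open>If \<open>a\<close> is not zero, then \<open>a^(r-1) = 1\<close>. Should
  \<open>a\<close> not be integral, its inverse is, and \<open>a\<close> is the power with exponent
  \<open>r - 2\<close> of that inverse.\<close>

lemma (in line_field) power_fixed_integral:
  assumes j: "valuation_ring V R j" and a: "a \<in> carrier R" "a [^] (r::nat) = a" "2 \<le> r"
  shows "a \<in> j ` carrier V"
proof -
  have V: "domain V" and h: "j \<in> ring_hom V R" using j by (auto simp: valuation_ring_def field_of_fractions_def)
  interpret V: "domain" V by (rule V)
  show ?thesis
  proof (cases "a = \<zero>")
    case True
    thus ?thesis using ring_hom_zero[OF h V.ring_axioms ring_axioms] by (metis V.zero_closed imageI)
  next
    case False
    have U: "a \<in> Units R" using a(1) False field_Units by blast
    hence ic: "inv a \<in> carrier R" by simp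
    show ?thesis
    proof (cases "a \<in> j ` carrier V")
      case n: False
      obtain b where b: "b \<in> carrier V" "j b = inv a" using j a(1) False n by (auto simp: valuation_ring_def)
      have r: "Suc (Suc (r - 2)) = r" using a(3) by simp
      have "a \<otimes> (a [^] (r - 2) \<otimes> a) = a \<otimes> \<one>" using a(1,2) r nat_pow_Suc[of a] by (metis m_comm nat_pow_closed m_closed r_one)
      hence e: "a [^] (r - 2) \<otimes> a = \<one>"
        using a(1) False m_lcancel[of a "a [^] (r - 2) \<otimes> a" \<one>] by simp
      have "inv a [^] (r - 2) = a"
      proof -
        have "a [^] (r - 2) \<otimes> inv a [^] (r - 2) = \<one>"
          using nat_pow_distrib[OF a(1) ic, of "r - 2"] U by (simp add: Units_r_inv)
        hence "inv a [^] (r - 2) = (a [^] (r - 2) \<otimes> a) \<otimes> inv a [^] (r - 2)" using e ic by simp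
        also have "\<dots> = (a [^] (r - 2) \<otimes> inv a [^] (r - 2)) \<otimes> a" using a(1) ic by (simp add: m_ac)
        finally show ?thesis using \<open>a [^] (r - 2) \<otimes> inv a [^] (r - 2) = \<one>\<close> a(1) by simp
      qed
      hence "a = j (b [^]\<^bsub>V\<^esub> (r - 2))" using hom_pow_eq[OF V.is_cring is_cring h b(1)] b(2) by simp
      thus ?thesis using b(1) by blast
    qed
  qed
qed

text \<open>This puts the presections of a neighbourhood among its sections: a condition that holds
  globally holds locally for the identity covering.\<close>

lemma fppf_cover_trivial:
  fixes A :: "'u ring" and B :: "'u alg"
  assumes B: "is_alg A B" shows "fppf_cover A B {(B, \<lambda>b. b)}"
proof -
  let ?R = "ring_of B"
  interpret B: cring ?R by (rule is_alg_cring[OF B])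
  let ?S = "restrict_scalars ?R (\<lambda>b. b)"
  have "flat_hom ?R ?R (\<lambda>b. b)" unfolding flat_hom_def
  proof (intro allI impI ballI)
    fix M N :: "('u, 'u) module" and t k m s
    assume h: "module ?R M \<and> module ?R N \<and> injective_linear ?R M N t"
      and m: "m \<in> {..<k} \<rightarrow> carrier M" and s: "s \<in> {..<k} \<rightarrow> carrier ?R"
      and z: "tensor_zero ?R N ?S k (t \<circ> m) s"
    interpret M: module ?R M using h by simp
    interpret N: module ?R N using h by simp
    have t: "t \<in> carrier M \<rightarrow> carrier N" "inj_on t (carrier M)"
      "\<And>x y. x \<in> carrier M \<Longrightarrow> y \<in> carrier M \<Longrightarrow> t (x \<oplus>\<^bsub>M\<^esub> y) = t x \<oplus>\<^bsub>N\<^esub> t y"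
      "\<And>r x. r \<in> carrier ?R \<Longrightarrow> x \<in> carrier M \<Longrightarrow> t (r \<odot>\<^bsub>M\<^esub> x) = r \<odot>\<^bsub>N\<^esub> t x"
      using h by (auto simp: injective_linear_def)
    have t0: "t \<zero>\<^bsub>M\<^esub> = \<zero>\<^bsub>N\<^esub>" using t(4)[of "\<zero>[B]" "\<zero>\<^bsub>M\<^esub>"] t(1) by (simp add: Pi_iff)
    \<comment> \<open>Scalar multiplication is the bilinear map that identifies the tensor product
      with the base ring; it turns the hypothesis into one equation in \<open>N\<close>, which
      injectivity brings back to \<open>M\<close>.\<close>
    have "bilinear_map ?R N ?S N (\<lambda>x r. r \<odot>\<^bsub>N\<^esub> x)"
    proof -
      have c: "s \<odot>\<^bsub>N\<^esub> (r \<odot>\<^bsub>N\<^esub> x) = r \<odot>\<^bsub>N\<^esub> (s \<odot>\<^bsub>N\<^esub> x)" if "x \<in> carrier N" "r \<in> carrier ?R" "s \<in> carrier ?R" for x r s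
        using N.smult_assoc1[of s r x] N.smult_assoc1[of r s x] B.m_comm[of r s] that by simp
      show ?thesis
        unfolding bilinear_map_def restrict_scalars_def
        using N.smult_r_distr N.smult_l_distr N.smult_assoc1 c by simp
    qed
    hence z1: "(\<Oplus>\<^bsub>N\<^esub>i\<in>{..<k}. s i \<odot>\<^bsub>N\<^esub> t (m i)) = \<zero>\<^bsub>N\<^esub>" using z h by (auto simp: tensor_zero_def)
    show "tensor_zero ?R M ?S k m s" unfolding tensor_zero_def
    proof (intro allI impI)
      fix L :: "('u, 'u) module" and b assume "module ?R L \<and> bilinear_map ?R M ?S L b"
      hence L: "module ?R L" and bl: "bilinear_map ?R M ?S L b" by auto
      interpret L: module ?R L by (rule L)
      have b: "b x r \<in> carrier L" "b (x \<oplus>\<^bsub>M\<^esub> x') r = b x r \<oplus>\<^bsub>L\<^esub> b x' r" "b (r' \<odot>\<^bsub>M\<^esub> x) r = r' \<odot>\<^bsub>L\<^esub> b x r"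
        "b x (r' \<otimes>[B] r) = r' \<odot>\<^bsub>L\<^esub> b x r"
        if "x \<in> carrier M" "x' \<in> carrier M" "r \<in> carrier ?R" "r' \<in> carrier ?R" for x x' r r'
        using bl that by (auto simp: bilinear_map_def restrict_scalars_def)
      have b0: "b \<zero>\<^bsub>M\<^esub> \<one>[B] = \<zero>\<^bsub>L\<^esub>"
        using b(3)[of "\<zero>\<^bsub>M\<^esub>" "\<zero>\<^bsub>M\<^esub>" "\<one>[B]" "\<zero>[B]"] b(1)[of "\<zero>\<^bsub>M\<^esub>" "\<zero>\<^bsub>M\<^esub>" "\<one>[B]" "\<zero>[B]"] by simp
      \<comment> \<open>Over the base ring itself a sum of tensors collapses to a single tensor with
        second factor 1.\<close>
      have "l \<le> k \<Longrightarrow> (\<Oplus>\<^bsub>M\<^esub>i\<in>{..<l}. s i \<odot>\<^bsub>M\<^esub> m i) \<in> carrier M \<and>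
          t (\<Oplus>\<^bsub>M\<^esub>i\<in>{..<l}. s i \<odot>\<^bsub>M\<^esub> m i) = (\<Oplus>\<^bsub>N\<^esub>i\<in>{..<l}. s i \<odot>\<^bsub>N\<^esub> t (m i)) \<and>
          (\<Oplus>\<^bsub>L\<^esub>i\<in>{..<l}. b (m i) (s i)) = b (\<Oplus>\<^bsub>M\<^esub>i\<in>{..<l}. s i \<odot>\<^bsub>M\<^esub> m i) \<one>[B]" for l
      proof (induction l)
        case 0 thus ?case using t0 b0 by simp
      next
        case (Suc l)
        have c: "m i \<in> carrier M" "s i \<in> carrier ?R" if "i < Suc l" for i using m s Suc.prems that by (auto simp: Pi_iff)
        have c': "t (m i) \<in> carrier N" "b (m i) (s i) \<in> carrier L" if "i < Suc l" for i
          using t(1) c[OF that] b(1)[of "m i" "m i" "s i" "s i"] by (auto simp: Pi_iff)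
        have "b (m l) (s l) = b (s l \<odot>\<^bsub>M\<^esub> m l) \<one>[B]"
          using b(3)[of "m l" "m l" "\<one>[B]" "s l"] b(4)[of "m l" "m l" "\<one>[B]" "s l"] c[of l] by simp
        moreover have "(\<Oplus>\<^bsub>M\<^esub>i\<in>{..<Suc l}. s i \<odot>\<^bsub>M\<^esub> m i) = s l \<odot>\<^bsub>M\<^esub> m l \<oplus>\<^bsub>M\<^esub> (\<Oplus>\<^bsub>M\<^esub>i\<in>{..<l}. s i \<odot>\<^bsub>M\<^esub> m i)"
          by (rule M.finsum_lessThan_Suc) (use c in auto)
        moreover have "(\<Oplus>\<^bsub>N\<^esub>i\<in>{..<Suc l}. s i \<odot>\<^bsub>N\<^esub> t (m i)) = s l \<odot>\<^bsub>N\<^esub> t (m l) \<oplus>\<^bsub>N\<^esub> (\<Oplus>\<^bsub>N\<^esub>i\<in>{..<l}. s i \<odot>\<^bsub>N\<^esub> t (m i))"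
          by (rule N.finsum_lessThan_Suc) (use c c' in auto)
        moreover have "(\<Oplus>\<^bsub>L\<^esub>i\<in>{..<Suc l}. b (m i) (s i)) = b (m l) (s l) \<oplus>\<^bsub>L\<^esub> (\<Oplus>\<^bsub>L\<^esub>i\<in>{..<l}. b (m i) (s i))"
          by (rule L.finsum_lessThan_Suc) (use c' in auto)
        ultimately show ?case using Suc c[of l] t(3,4) b(2)[of _ _ "\<one>[B]" "\<one>[B]"] by simp
      qed
      from this[of k] have e: "(\<Oplus>\<^bsub>M\<^esub>i\<in>{..<k}. s i \<odot>\<^bsub>M\<^esub> m i) \<in> carrier M"
        "t (\<Oplus>\<^bsub>M\<^esub>i\<in>{..<k}. s i \<odot>\<^bsub>M\<^esub> m i) = \<zero>\<^bsub>N\<^esub>"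
        "(\<Oplus>\<^bsub>L\<^esub>i\<in>{..<k}. b (m i) (s i)) = b (\<Oplus>\<^bsub>M\<^esub>i\<in>{..<k}. s i \<odot>\<^bsub>M\<^esub> m i) \<one>[B]" using z1 by auto
      have "(\<Oplus>\<^bsub>M\<^esub>i\<in>{..<k}. s i \<odot>\<^bsub>M\<^esub> m i) = \<zero>\<^bsub>M\<^esub>"
        using inj_onD[OF t(2), of _ "\<zero>\<^bsub>M\<^esub>"] e(1,2) t0 by simp
      thus "(\<Oplus>\<^bsub>L\<^esub>i\<in>{..<k}. b (m i) (s i)) = \<zero>\<^bsub>L\<^esub>" using e(3) b0 by simp
    qed
  qed
  moreover have "finite_presentation ?R ?R (\<lambda>b. b)" unfolding finite_presentation_def
  proof (intro exI conjI)
    let ?P = "(?R, \<lambda>b. b)"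
    have P: "is_alg ?R ?P" by (rule base_alg[OF B.is_cring])
    \<comment> \<open>The ring is its own polynomial algebra in no variables, with no
      relations.\<close>
    show "polynomial_alg ?R 0 ?P (\<lambda>_. \<zero>[B])" unfolding polynomial_alg_def
    proof (intro conjI allI impI ballI P)
      fix C assume C: "is_alg ?R C"
      show "\<exists>g. alg_hom ?R ?P C g \<and> (\<forall>i<(0::nat). g \<zero>[B] = c i)" for c
        by (rule exI[of _ "str_map C"]) (use str_alg_hom[OF B.is_cring C] in simp)
    next
      fix C c g g' y
      assume "alg_hom ?R ?P C g \<and> (\<forall>i<(0::nat). g \<zero>[B] = c i) \<and> alg_hom ?R ?P C g' \<and> (\<forall>i<(0::nat). g' \<zero>[B] = c i)"
        and y: "y \<in> carrier (ring_of ?P)"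
      hence "\<forall>a\<in>carrier ?R. g a = str_map C a" "\<forall>a\<in>carrier ?R. g' a = str_map C a" by (simp_all add: alg_hom_def)
      thus "g y = g' y" using y by simp
    qed simp
    show "alg_hom ?R ?P ?P (\<lambda>b. b)" by (rule alg_hom_id[OF P])
    have "a_kernel ?R ?R (\<lambda>b. b) = {\<zero>[B]}" by (auto simp: a_kernel_def')
    moreover have "Idl\<^bsub>?R\<^esub> {} = {\<zero>[B]}"
      using B.genideal_minimal[OF B.zeroideal, of "{}"] additive_subgroup.zero_closed[OF ideal.axioms(1)[OF B.genideal_ideal[of "{}"]]] by auto
    ultimately show "a_kernel (ring_of ?P) ?R (\<lambda>b. b) = Idl\<^bsub>ring_of ?P\<^esub> {}" by simp
  qed simp_all
  moreover have "P = {b \<in> carrier ?R. b \<in> P}" if "primeideal P ?R" for P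
    using additive_subgroup.a_subset[OF ideal.axioms(1)[OF primeideal.axioms(1)[OF that]]] by auto
  ultimately show ?thesis unfolding fppf_cover_def using alg_hom_id[OF B] by auto
qed

section \<open>Infinitesimal neighbourhoods and height\<close>

text \<open>The quotient by a principal ideal, carried by representatives of the cosets.\<close>

lemma quotient_alg:
  fixes A :: "'u ring" and B :: "'u alg"
  assumes B: "is_alg A B" and b: "b \<in> carrier[B]"
  obtains D q where "alg_hom A B D q" "q ` carrier[B] = carrier[D]" "q b = \<zero>[D]"
    "\<And>x. x \<in> a_kernel (ring_of B) (ring_of D) q \<Longrightarrow> \<exists>r\<in>carrier[B]. x = b \<otimes>[B] r"
proof -
  interpret B: cring "ring_of B" by (rule is_alg_cring[OF B])
  define I where "I = PIdl\<^bsub>ring_of B\<^esub> b"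
  define f where "f a = (SOME c. c \<in> I +>\<^bsub>ring_of B\<^esub> a)" for a
  have I: "ideal I (ring_of B)" unfolding I_def by (rule B.cgenideal_ideal[OF b])
  interpret I: ideal I "ring_of B" by (rule I)
  have fI: "f a \<in> I +>\<^bsub>ring_of B\<^esub> a" if "a \<in> carrier[B]" for a
    unfolding f_def using I.a_rcos_self[OF that] by (rule someI)
  have w: "weak_ring_morphism f I (ring_of B)"
  proof (rule weak_ring_morphismI[OF I])
    fix a a' assume a: "a \<in> carrier[B]" "a' \<in> carrier[B]"
    have "f a = f a' \<longleftrightarrow> I +>\<^bsub>ring_of B\<^esub> a = I +>\<^bsub>ring_of B\<^esub> a'"
    proof
      assume "f a = f a'"
      thus "I +>\<^bsub>ring_of B\<^esub> a = I +>\<^bsub>ring_of B\<^esub> a'"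
        using B.a_repr_independence[OF fI[OF a(1)] a(1) I.a_subgroup] B.a_repr_independence[OF fI[OF a(2)] a(2) I.a_subgroup] by simp
    qed (simp add: f_def)
    thus "f a = f a' \<longleftrightarrow> a \<ominus>\<^bsub>ring_of B\<^esub> a' \<in> I" using B.quotient_eq_iff_same_a_r_cos[OF I a] by simp
  qed
  let ?D = "(image_ring f (ring_of B), f \<circ> str_map B)"
  have h: "f \<in> ring_hom (ring_of B) (image_ring f (ring_of B))" by (rule B.weak_ring_morphism_is_hom[OF w])
  have D: "is_alg A ?D"
    unfolding is_alg_def using B.image_ring_is_cring[OF w] ring_hom_trans[OF is_alg_str[OF B] h] by simp
  have k: "a_kernel (ring_of B) (image_ring f (ring_of B)) f = I" by (rule B.weak_ring_morphism_ker[OF w])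
  have "b \<in> I" unfolding I_def by (rule B.cgenideal_self[OF b])
  hence "b \<in> a_kernel (ring_of B) (image_ring f (ring_of B)) f" unfolding k .
  hence fb: "f b = \<zero>[?D]" by (simp add: a_kernel_def')
  show ?thesis
  proof (rule that[of ?D f])
    show "alg_hom A B ?D f" using B D h by (simp add: alg_hom_def)
    show "f ` carrier[B] = carrier[?D]" by (simp add: image_ring_carrier)
    show "f b = \<zero>[?D]" by (rule fb)
    fix x assume "x \<in> a_kernel (ring_of B) (ring_of ?D) f"
    hence "x \<in> I" using k by simp
    thus "\<exists>r\<in>carrier[B]. x = b \<otimes>[B] r" unfolding I_def cgenideal_def using b by (auto simp: B.m_comm)
  qed
qed

context cring
begin

lemma ideal_power_pow: "x \<in> I \<Longrightarrow> x \<in> carrier R \<Longrightarrow> x [^] k \<in> ideal_power R I k"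
proof (induction k)
  case (Suc k)
  hence "x \<otimes> x [^] k \<in> I \<cdot> ideal_power R I k" by (intro ideal_prod.prod) auto
  thus ?case using Suc.prems(2) by (simp add: m_comm)
qed simp

lemma ideal_power_principal:
  assumes t: "t \<in> carrier R" and J: "\<And>x. x \<in> J \<Longrightarrow> \<exists>r\<in>carrier R. x = t \<otimes> r"
  shows "x \<in> ideal_power R J k \<Longrightarrow> \<exists>r\<in>carrier R. x = t [^] k \<otimes> r"
proof (induction k arbitrary: x)
  case (Suc k)
  from Suc.prems have "x \<in> J \<cdot> ideal_power R J k" by simp
  thus ?case
  proof (induction x)
    case (prod a b)
    obtain r s where "r \<in> carrier R" "s \<in> carrier R" "a = t \<otimes> r" "b = t [^] k \<otimes> s"
      using J[OF prod(1)] Suc.IH[OF prod(2)] by blast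
    hence "a \<otimes> b = t [^] Suc k \<otimes> (r \<otimes> s)" using t by (simp add: m_ac)
    thus ?case using \<open>r \<in> carrier R\<close> \<open>s \<in> carrier R\<close> by blast
  next
    case (sum a b)
    then obtain r s where "r \<in> carrier R" "s \<in> carrier R" "a = t [^] Suc k \<otimes> r" "b = t [^] Suc k \<otimes> s" by blast
    hence "a \<oplus> b = t [^] Suc k \<otimes> (r \<oplus> s)" using t by (simp add: r_distr del: nat_pow_Suc)
    thus ?case using \<open>r \<in> carrier R\<close> \<open>s \<in> carrier R\<close> by blast
  qed
qed simp

end

lemma inf_nbhd_simps [simp]: "res (inf_nbhd A X n) = res X" "pt (inf_nbhd A X n) = pt X" "gadd (inf_nbhd A X n) = gadd X"
  by (simp_all add: inf_nbhd_def)

lemma multiple_inf_nbhd [simp]: "multiple (inf_nbhd A X n) m B x = multiple X m B x"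
  by (induction m) simp_all

text \<open>What is common to a formal Lie group over \<open>K\<close> with a global coordinate and
  to the lifted group over \<open>V\<close>, whose coordinate is the identity.\<close>

locale formal_line = big_cring R for R :: "'u ring" (structure) +
  fixes Y :: "'u group_psh" and \<tau> :: "'u alg \<Rightarrow> 'u \<Rightarrow> 'u"
  assumes bij: "is_alg R B \<Longrightarrow> bij_betw (\<tau> B) (sec Y B) nil[B]"
    and zero: "is_alg R B \<Longrightarrow> pt Y B \<in> sec Y B" "is_alg R B \<Longrightarrow> \<tau> B (pt Y B) = \<zero>[B]"
    and natural: "alg_hom R B C f \<Longrightarrow> x \<in> sec Y B \<Longrightarrow> res Y B C f x \<in> sec Y C"
      "alg_hom R B C f \<Longrightarrow> x \<in> sec Y B \<Longrightarrow> \<tau> C (res Y B C f x) = f (\<tau> B x)"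
    and ident: "is_alg R B \<Longrightarrow> x \<in> sec Y B \<Longrightarrow> res Y B B (\<lambda>b. b) x = x"
begin

lemma coord_nil: "is_alg R B \<Longrightarrow> y \<in> sec Y B \<Longrightarrow> \<tau> B y \<in> nil[B]"
  using bij by (rule bij_betw_apply)

lemma coord_inj: "is_alg R B \<Longrightarrow> x \<in> sec Y B \<Longrightarrow> y \<in> sec Y B \<Longrightarrow> \<tau> B x = \<tau> B y \<Longrightarrow> x = y"
  by (rule inj_onD[OF bij_betw_imp_inj_on[OF bij]])

lemma coord_surj: assumes "is_alg R B" "b \<in> nil[B]" obtains y where "y \<in> sec Y B" "\<tau> B y = b"
  using bij[OF assms(1)] assms(2) that unfolding bij_betw_def by (metis imageE)

text \<open>If a section is the base point modulo an ideal, its coordinate lies in that ideal, so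
  its power with exponent \<open>n + 1\<close> vanishes locally, hence globally by
  \<open>cover_injective\<close>. Conversely the ideal generated by the coordinate works, with the
  trivial covering.\<close>

lemma inf_nbhd_sec:
  assumes B: "is_alg R B"
  shows "y \<in> sec (inf_nbhd R Y n) B \<longleftrightarrow> y \<in> sec Y B \<and> \<tau> B y [^][B] Suc n = \<zero>[B]"
proof -
  interpret B: cring "ring_of B" by (rule is_alg_cring[OF B])
  show ?thesis
  proof
    assume "y \<in> sec (inf_nbhd R Y n) B"
    then obtain U where y: "y \<in> sec Y B" and U: "fppf_cover R B U"
      and l: "\<And>C f. (C, f) \<in> U \<Longrightarrow> res Y B C f y \<in> nbhd_presections R Y n C" by (auto simp: inf_nbhd_def)
    have b: "\<tau> B y \<in> carrier[B]" using coord_nil[OF B y] by simp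
    have "\<tau> B y [^][B] Suc n = \<zero>[B]"
    proof (rule cover_injective[OF U B])
      fix C f assume C: "(C, f) \<in> U"
      have f: "alg_hom R B C f" using U C by (auto simp: fppf_cover_def)
      note fD = alg_homD[OF f]
      interpret C: cring "ring_of C" by (rule fD(5))
      obtain D q where q: "alg_hom R C D q"
        and ip: "ideal_power (ring_of C) (a_kernel (ring_of C) (ring_of D) q) (n + 1) = {\<zero>[C]}"
        and rq: "res Y C D q (res Y B C f y) = pt Y D"
        using l[OF C] by (auto simp: nbhd_presections_def)
      have fb: "f (\<tau> B y) \<in> carrier[C]" by (rule fD(7)[OF b])
      have "q (f (\<tau> B y)) = \<zero>[D]"
        using natural(2)[OF q natural(1)[OF f y]] natural(2)[OF f y] zero(2)[OF alg_homD(2)[OF q]] rq by simp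
      hence "f (\<tau> B y) \<in> a_kernel (ring_of C) (ring_of D) q" using fb by (simp add: a_kernel_def')
      from C.ideal_power_pow[OF this fb, of "n + 1"] have "f (\<tau> B y) [^][C] Suc n = \<zero>[C]" using ip by simp
      thus "f (\<tau> B y [^][B] Suc n) = f \<zero>[B]" using hom_pow_eq[OF fD(4,5,3) b, of "Suc n"] fD(9) by simp
    qed (use b in auto)
    thus "y \<in> sec Y B \<and> \<tau> B y [^][B] Suc n = \<zero>[B]" using y by simp
  next
    assume "y \<in> sec Y B \<and> \<tau> B y [^][B] Suc n = \<zero>[B]"
    hence y: "y \<in> sec Y B" and z: "\<tau> B y [^][B] Suc n = \<zero>[B]" by auto
    have b: "\<tau> B y \<in> carrier[B]" using coord_nil[OF B y] by simp
    obtain D q where q: "alg_hom R B D q" "q ` carrier[B] = carrier[D]" "q (\<tau> B y) = \<zero>[D]"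
      and k: "\<And>x. x \<in> a_kernel (ring_of B) (ring_of D) q \<Longrightarrow> \<exists>r\<in>carrier[B]. x = \<tau> B y \<otimes>[B] r"
      using quotient_alg[OF B b] by metis
    let ?J = "a_kernel (ring_of B) (ring_of D) q"
    have "\<tau> B y \<in> ?J" using b q(3) by (simp add: a_kernel_def')
    from B.ideal_power_pow[OF this b, of "n + 1"] have "\<zero>[B] \<in> ideal_power (ring_of B) ?J (n + 1)" using z by simp
    moreover have "x = \<zero>[B]" if x: "x \<in> ideal_power (ring_of B) ?J (n + 1)" for x
    proof -
      obtain r where "r \<in> carrier[B]" "x = \<tau> B y [^][B] (n + 1) \<otimes>[B] r"
        using B.ideal_power_principal[where J = ?J and k = "n + 1", OF b k x] by blast
      thus ?thesis using z by simp
    qed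
    ultimately have ip: "ideal_power (ring_of B) ?J (n + 1) = {\<zero>[B]}" by blast
    have "res Y B D q y = pt Y D"
      using coord_inj[OF alg_homD(2)[OF q(1)] natural(1)[OF q(1) y] zero(1)[OF alg_homD(2)[OF q(1)]]]
        natural(2)[OF q(1) y] zero(2)[OF alg_homD(2)[OF q(1)]] q(3) by simp
    hence "y \<in> nbhd_presections R Y n B" unfolding nbhd_presections_def using y q(1,2) ip by blast
    hence "\<forall>(C, f)\<in>{(B, \<lambda>b. b)}. res Y B C f y \<in> nbhd_presections R Y n C" using ident[OF B y] by simp
    thus "y \<in> sec (inf_nbhd R Y n) B" using y fppf_cover_trivial[OF B] unfolding inf_nbhd_def by auto
  qed
qed

lemma inf_nbhd_res:
  assumes f: "alg_hom R B C f" and y: "y \<in> sec (inf_nbhd R Y n) B"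
  shows "res Y B C f y \<in> sec (inf_nbhd R Y n) C"
proof -
  note fD = alg_homD[OF f]
  have y': "y \<in> sec Y B" "\<tau> B y [^][B] Suc n = \<zero>[B]" using y inf_nbhd_sec[OF fD(1)] by auto
  have "f (\<tau> B y) [^][C] Suc n = \<zero>[C]"
    using hom_pow_eq[OF fD(4,5,3) nil_carrier[OF coord_nil[OF fD(1) y'(1)]], of "Suc n"] y'(2) fD(9) by simp
  thus ?thesis using inf_nbhd_sec[OF fD(2)] natural[OF f y'(1)] by simp
qed

lemma function_ringI:
  assumes "\<And>B y. is_alg R B \<Longrightarrow> y \<in> sec (inf_nbhd R Y n) B \<Longrightarrow> P B y \<in> carrier[B]"
    and "\<And>B C f y. alg_hom R B C f \<Longrightarrow> y \<in> sec (inf_nbhd R Y n) B \<Longrightarrow> P C (res Y B C f y) = f (P B y)"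
  shows "on_domain R (inf_nbhd R Y n) P \<in> carrier (function_ring R (inf_nbhd R Y n))"
  unfolding function_ring_def partial_object.select_convs mem_Collect_eq
proof (intro conjI allI impI ballI)
  fix B C f y assume f: "alg_hom R B C f" and y: "y \<in> sec (inf_nbhd R Y n) B"
  show "on_domain R (inf_nbhd R Y n) P C (res (inf_nbhd R Y n) B C f y) = f (on_domain R (inf_nbhd R Y n) P B y)"
    using assms(2)[OF f y] inf_nbhd_res[OF f y] y alg_homD(1,2)[OF f] by (simp add: on_domain_def)
qed (use assms(1) in \<open>auto simp: on_domain_def fun_eq_iff\<close>)

lemma coord_augmentation: "on_domain R (inf_nbhd R Y n) \<tau> \<in> augmentation_ideal R (inf_nbhd R Y n)"
proof -
  have "on_domain R (inf_nbhd R Y n) \<tau> B (pt Y B) = \<zero>[B]" if B: "is_alg R B" for B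
  proof -
    interpret B: cring "ring_of B" by (rule is_alg_cring[OF B])
    have "pt Y B \<in> sec (inf_nbhd R Y n) B" unfolding inf_nbhd_sec[OF B] using zero[OF B] by simp
    thus ?thesis using B zero(2)[OF B] by (simp add: on_domain_def)
  qed
  thus ?thesis unfolding augmentation_ideal_def
    using function_ringI[where P = \<tau>] coord_nil natural(2) by (auto simp: inf_nbhd_sec alg_homD(1))
qed

text \<open>The point with coordinate \<open>T\<close> over \<open>R[T]/(T^(n+1))\<close> is the
  universal section of the neighbourhood. A function is determined by its value there, which is a
  truncated polynomial.\<close>

lemma function_expand:
  assumes \<chi>: "\<chi> \<in> carrier (function_ring R (inf_nbhd R Y n))"
  obtains c where "\<And>k. c k \<in> carrier R"
    "\<And>B y. is_alg R B \<Longrightarrow> y \<in> sec (inf_nbhd R Y n) B \<Longrightarrow> \<chi> B y = kser c B (\<tau> B y)"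
    "\<chi> \<in> augmentation_ideal R (inf_nbhd R Y n) \<Longrightarrow> c 0 = \<zero>"
proof -
  let ?K = "(R, \<lambda>a. a)" and ?N = "Suc n"
  let ?P = "trunc_alg ?K ?N" and ?T = "trunc_ring R ?N" and ?t = "tvar R ?N"
  have K: "is_alg R ?K" by (rule base_alg[OF is_cring])
  have P: "is_alg R ?P" by (rule trunc_is_alg[OF K])
  interpret T: cring ?T by (rule trunc_cring)
  have tn: "?t \<in> nil[?P]" using tvar_nil[OF K, of ?N] by simp
  obtain y0 where y0: "y0 \<in> sec Y ?P" "\<tau> ?P y0 = ?t" using coord_surj[OF P tn] by blast
  have y0s: "y0 \<in> sec (inf_nbhd R Y n) ?P" unfolding inf_nbhd_sec[OF P] using y0 tvar_pow_N[of ?N] by simp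
  define u where "u = \<chi> ?P y0"
  have cl: "\<And>B y. is_alg R B \<Longrightarrow> y \<in> sec (inf_nbhd R Y n) B \<Longrightarrow> \<chi> B y \<in> carrier[B]"
    and nt: "\<And>B C f y. alg_hom R B C f \<Longrightarrow> y \<in> sec (inf_nbhd R Y n) B \<Longrightarrow> \<chi> C (res Y B C f y) = f (\<chi> B y)"
    using \<chi> unfolding function_ring_def partial_object.select_convs mem_Collect_eq inf_nbhd_simps by blast+
  have u: "u \<in> carrier ?T" using cl[OF P y0s] by (simp add: u_def)
  define c where "c = tcoef R ?N u"
  have c: "c k \<in> carrier R" for k unfolding c_def by (rule tcoef_closed[OF u])
  have tc: "tconst R ?N a \<in> carrier ?T" if "a \<in> carrier R" for a by (rule ring_hom_closed[OF tconst_hom that])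
  have ue: "u = series ?T (\<lambda>k. tconst R ?N (c k)) ?t"
    using trunc_expand[OF u] c tc unfolding c_def[symmetric]
    by (subst T.series_eq[OF tvar_closed tvar_pow_N]) auto
  have e: "\<chi> B y = kser c B (\<tau> B y)" if B: "is_alg R B" and y: "y \<in> sec (inf_nbhd R Y n) B" for B y
  proof -
    have y': "y \<in> sec Y B" "\<tau> B y [^][B] ?N = \<zero>[B]" using y inf_nbhd_sec[OF B] by auto
    have b: "\<tau> B y \<in> carrier[B]" using coord_nil[OF B y'(1)] by simp
    obtain g where g: "alg_hom R ?P B g" "\<And>r. r \<in> carrier R \<Longrightarrow> g (tconst R ?N r) = str_map B r" "g ?t = \<tau> B y"
      using trunc_alg_universal[OF str_alg_hom[OF is_cring B] b y'(2)] by (metis fst_conv)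
    have "res Y ?P B g y0 = y"
      using coord_inj[OF B natural(1)[OF g(1) y0(1)] y'(1)] natural(2)[OF g(1) y0(1)] y0(2) g(3) by simp
    hence "\<chi> B y = g u" using nt[OF g(1) y0s] by (simp add: u_def)
    also have "\<dots> = series (ring_of B) (\<lambda>k. g (tconst R ?N (c k))) (g ?t)"
      by (subst ue, rule hom_series) (use alg_homD(3,4,5)[OF g(1)] tn tc[OF c] in auto)
    finally show ?thesis using g(2)[OF c] g(3) by (simp add: kser_def)
  qed
  have "c 0 = \<zero>" if "\<chi> \<in> augmentation_ideal R (inf_nbhd R Y n)"
  proof -
    have "\<chi> ?K (pt Y ?K) = \<zero>" using that K by (force simp: augmentation_ideal_def)
    moreover have "pt Y ?K \<in> sec (inf_nbhd R Y n) ?K" unfolding inf_nbhd_sec[OF K] using zero[OF K] by simp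
    ultimately have "kser c ?K \<zero> = \<zero>" using e[OF K] zero(2)[OF K] by simp
    thus ?thesis using series_at_zero[of c] c by (simp add: kser_def)
  qed
  thus ?thesis using that c e by blast
qed

text \<open>On the neighbourhood with exponent \<open>p^h\<close> only the linear term of a function
  survives composition with \<open>e x^q\<close>, and \<open>x^q\<close> is a multiple of
  \<open>x^(p^h)\<close>.\<close>

lemma height_geI:
  assumes n: "0 < p ^ h" "p ^ h \<le> q" and e: "e \<in> carrier R"
    and m: "\<And>B y. is_alg R B \<Longrightarrow> y \<in> sec Y B \<Longrightarrow> multiple Y p B y \<in> sec Y B"
      "\<And>B y. is_alg R B \<Longrightarrow> y \<in> sec Y B \<Longrightarrow> \<tau> B (multiple Y p B y) = str_map B e \<otimes>[B] \<tau> B y [^][B] q"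
  shows "height_ge p R Y h"
proof -
  define n' where "n' = p ^ h"
  define X where "X = inf_nbhd R Y n'"
  let ?FR = "function_ring R X" and ?I = "augmentation_ideal R X"
  have nq: "0 < n'" "n' \<le> q" using n by (simp_all add: n'_def)
  have "on_domain R X (\<lambda>B x. \<phi> B (multiple X p B x)) \<in> ideal_power ?FR ?I n'" if \<phi>: "\<phi> \<in> ?I" for \<phi>
  proof -
    have "\<phi> \<in> carrier ?FR" using \<phi> by (simp add: augmentation_ideal_def)
    then obtain c where c: "\<And>k. c k \<in> carrier R" and c0: "c 0 = \<zero>"
      and ce: "\<And>B y. is_alg R B \<Longrightarrow> y \<in> sec X B \<Longrightarrow> \<phi> B y = kser c B (\<tau> B y)"
      using function_expand[of \<phi> n'] \<phi> unfolding X_def by metis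
    \<comment> \<open>The cofactor of the power \<open>n'\<close> of the coordinate in the composite
      of \<open>\<phi>\<close> with \<open>[p]\<close>.\<close>
    define P where "P B y = str_map B (c 1 \<otimes> e) \<otimes>[B] \<tau> B y [^][B] (q - n')" for B y
    have tb: "\<tau> B y \<in> carrier[B]" "y \<in> sec Y B" "\<tau> B y [^][B] Suc n' = \<zero>[B]" if "is_alg R B" "y \<in> sec X B" for B y
      using that coord_nil[OF that(1)] by (auto simp: X_def inf_nbhd_sec)
    have ce1: "c 1 \<otimes> e \<in> carrier R" using c e by simp
    have P: "on_domain R X P \<in> carrier ?FR" unfolding X_def
    proof (rule function_ringI)
      fix B y assume B: "is_alg R B" and y: "y \<in> sec (inf_nbhd R Y n') B"
      interpret B: cring "ring_of B" by (rule is_alg_cring[OF B])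
      show "P B y \<in> carrier[B]" using tb[OF B y[folded X_def]] str_closed[OF B ce1] by (simp add: P_def)
    next
      fix B C f y assume f: "alg_hom R B C f" and y: "y \<in> sec (inf_nbhd R Y n') B"
      note fD = alg_homD[OF f]
      interpret B: cring "ring_of B" by (rule fD(4))
      note t = tb[OF fD(1) y[folded X_def]]
      show "P C (res Y B C f y) = f (P B y)"
        unfolding P_def natural(2)[OF f t(2)] fD(6)[OF ce1, symmetric] using t str_closed[OF fD(1) ce1]
        by (simp add: ring_hom_mult[OF fD(3)] hom_pow_eq[OF fD(4,5,3)])
    qed
    have "on_domain R X (\<lambda>B y. \<tau> B y [^][B] k \<otimes>[B] P B y) \<in> ideal_power ?FR ?I k" for k
    proof (induction k)
      case 0
      have "on_domain R X (\<lambda>B y. \<tau> B y [^][B] (0::nat) \<otimes>[B] P B y) = on_domain R X P"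
      proof (intro ext)
        fix B y
        show "on_domain R X (\<lambda>B y. \<tau> B y [^][B] (0::nat) \<otimes>[B] P B y) B y = on_domain R X P B y"
        proof (cases "is_alg R B \<and> y \<in> sec X B")
          case True
          interpret B: cring "ring_of B" by (rule is_alg_cring) (use True in blast)
          show ?thesis using True tb str_closed[OF _ ce1] by (simp add: on_domain_def P_def)
        next
          case False thus ?thesis by (simp only: on_domain_def if_False)
        qed
      qed
      thus ?case using P by simp
    next
      case (Suc k)
      have "on_domain R X \<tau> \<otimes>\<^bsub>?FR\<^esub> on_domain R X (\<lambda>B y. \<tau> B y [^][B] k \<otimes>[B] P B y) =
        on_domain R X (\<lambda>B y. \<tau> B y [^][B] Suc k \<otimes>[B] P B y)"
      proof (intro ext)
        fix B y
        show "(on_domain R X \<tau> \<otimes>\<^bsub>?FR\<^esub> on_domain R X (\<lambda>B y. \<tau> B y [^][B] k \<otimes>[B] P B y)) B y =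
          on_domain R X (\<lambda>B y. \<tau> B y [^][B] Suc k \<otimes>[B] P B y) B y"
        proof (cases "is_alg R B \<and> y \<in> sec X B")
          case True
          interpret B: cring "ring_of B" by (rule is_alg_cring) (use True in blast)
          show ?thesis using True tb str_closed[OF _ ce1] by (simp add: on_domain_def function_ring_def P_def B.m_ac)
        qed (auto simp: on_domain_def function_ring_def)
      qed
      moreover have "on_domain R X \<tau> \<otimes>\<^bsub>?FR\<^esub> on_domain R X (\<lambda>B y. \<tau> B y [^][B] k \<otimes>[B] P B y) \<in> ideal_power ?FR ?I (Suc k)"
        using ideal_prod.prod[OF coord_augmentation[of n', folded X_def] Suc.IH] by simp
      ultimately show ?case by (simp only:)
    qed
    moreover have "on_domain R X (\<lambda>B x. \<phi> B (multiple X p B x)) = on_domain R X (\<lambda>B y. \<tau> B y [^][B] n' \<otimes>[B] P B y)"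
    proof (intro ext)
      fix B y
      show "on_domain R X (\<lambda>B x. \<phi> B (multiple X p B x)) B y = on_domain R X (\<lambda>B y. \<tau> B y [^][B] n' \<otimes>[B] P B y) B y"
      proof (cases "is_alg R B \<and> y \<in> sec X B")
        case True
        hence B: "is_alg R B" and y: "y \<in> sec X B" by auto
        interpret B: big_cring "ring_of B" by (rule alg_big[OF B])
        note t = tb[OF B y]
        let ?b = "\<tau> B y" and ?z = "str_map B e \<otimes>[B] \<tau> B y [^][B] q"
        have se: "str_map B e \<in> carrier[B]" by (rule str_closed[OF B e])
        have sc: "str_map B (c k) \<in> carrier[B]" for k by (rule str_closed[OF B c])
        have z: "?z \<in> carrier[B]" using se t(1) by simp
        \<comment> \<open>Since \<open>q\<close> is at least \<open>n'\<close> and \<open>n'\<close>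
          is positive, \<open>2 q\<close> reaches the exponent \<open>n' + 1\<close> that kills the
          coordinate; so \<open>?z\<close> has square zero.\<close>
        have "?b [^][B] (q + q) = \<zero>[B]" by (rule B.pow_zero_mono[OF t(1,3)]) (use nq in simp)
        hence "?b [^][B] q \<otimes>[B] ?b [^][B] q = \<zero>[B]" using t(1) by (simp add: B.nat_pow_mult)
        moreover have "?z \<otimes>[B] ?z = (str_map B e \<otimes>[B] str_map B e) \<otimes>[B] (?b [^][B] q \<otimes>[B] ?b [^][B] q)"
          using se t(1) by (simp add: B.m_ac)
        ultimately have zz: "?z \<otimes>[B] ?z = \<zero>[B]" using se by simp
        have "?z [^][B] Suc n' = \<zero>[B]"
          by (rule B.pow_zero_mono[of _ 2]) (use z zz nq in \<open>auto simp: numeral_2_eq_2\<close>)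
        hence ms: "multiple Y p B y \<in> sec X B" using m[OF B t(2)] by (simp add: X_def inf_nbhd_sec[OF B])
        have "\<phi> B (multiple Y p B y) = kser c B ?z" using ce[OF B ms] m(2)[OF B t(2)] by simp
        also have "\<dots> = str_map B (c 1) \<otimes>[B] ?z"
          using B.series_add_square_zero[OF B.zero_nil z zz, of "\<lambda>k. str_map B (c k)", OF sc]
            B.series_at_zero[of "\<lambda>k. str_map B (c k)", OF sc]
            B.series_at_zero[of "\<lambda>i. nat_in (ring_of B) (Suc i) \<otimes>[B] str_map B (c (Suc i))"] sc z c0
            ring_hom_zero[OF is_alg_str[OF B] ring_axioms B.ring_axioms]
          by (simp add: kser_def B.m_comm)
        also have "?b [^][B] q = ?b [^][B] n' \<otimes>[B] ?b [^][B] (q - n')" using t(1) nq by (simp add: B.nat_pow_mult)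
        also have "str_map B (c 1) \<otimes>[B] (str_map B e \<otimes>[B] (?b [^][B] n' \<otimes>[B] ?b [^][B] (q - n'))) = ?b [^][B] n' \<otimes>[B] P B y"
          unfolding P_def ring_hom_mult[OF is_alg_str[OF B] c e] using sc[of 1] se t(1) by (simp add: B.m_ac)
        finally show ?thesis using True unfolding on_domain_def X_def multiple_inf_nbhd by simp
      qed (auto simp: on_domain_def)
    qed
    ultimately show ?thesis by simp
  qed
  thus ?thesis unfolding height_ge_def bud_height_ge_def X_def n'_def by blast
qed

text \<open>The height condition is used for one function only, the coordinate itself. Its composite
  with \<open>[p]\<close> lies in the power \<open>p^h\<close> of the augmentation ideal, and a
  member of that power takes at \<open>y\<close> a multiple of the same power of the
  coordinate.\<close>

lemma height_geD:
  assumes ht: "height_ge p R Y h" and B: "is_alg R B" and y: "y \<in> sec Y B" "\<tau> B y [^][B] (p ^ h) = \<zero>[B]"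
    and m: "\<And>B y. is_alg R B \<Longrightarrow> y \<in> sec Y B \<Longrightarrow> multiple Y p B y \<in> sec Y B"
      "\<And>B C f y. alg_hom R B C f \<Longrightarrow> y \<in> sec Y B \<Longrightarrow> res Y B C f (multiple Y p B y) = multiple Y p C (res Y B C f y)"
    and z: "\<And>B C f y. is_alg R B \<Longrightarrow> y \<in> sec Y B \<Longrightarrow> \<tau> B y [^][B] Suc (p ^ h) = \<zero>[B] \<Longrightarrow>
        \<tau> B (multiple Y p B y) [^][B] Suc (p ^ h) = \<zero>[B]"
  shows "\<tau> B (multiple Y p B y) = \<zero>[B]"
proof -
  define n where "n = p ^ h"
  define X where "X = inf_nbhd R Y n"
  let ?FR = "function_ring R X" and ?I = "augmentation_ideal R X"
  interpret B: big_cring "ring_of B" by (rule alg_big[OF B])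
  have b: "\<tau> B y \<in> carrier[B]" "\<tau> B y \<in> nil[B]" using coord_nil[OF B y(1)] by auto
  have z1: "\<tau> B y [^][B] Suc n = \<zero>[B]" by (rule B.pow_zero_mono[OF b(1) y(2)]) (simp add: n_def)
  have ys: "y \<in> sec X B" using y(1) z1 by (simp add: X_def inf_nbhd_sec[OF B])
  have ms: "multiple Y p B y \<in> sec X B" using z[OF B y(1)] z1 m(1)[OF B y(1)] by (simp add: X_def n_def inf_nbhd_sec[OF B])
  have ev: "\<exists>r\<in>carrier[B]. \<chi> B y = \<tau> B y \<otimes>[B] r" if \<chi>: "\<chi> \<in> ?I" for \<chi>
  proof -
    have "\<chi> \<in> carrier ?FR" using \<chi> by (simp add: augmentation_ideal_def)
    then obtain c where c: "\<And>k. c k \<in> carrier R" and c0: "c 0 = \<zero>"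
      and ce: "\<And>B y. is_alg R B \<Longrightarrow> y \<in> sec X B \<Longrightarrow> \<chi> B y = kser c B (\<tau> B y)"
      using function_expand[of \<chi> n] \<chi> unfolding X_def by metis
    have sc: "str_map B (c k) \<in> carrier[B]" for k by (rule str_closed[OF B c])
    let ?s = "series (ring_of B) (\<lambda>k. str_map B (c (Suc k))) (\<tau> B y)"
    have s: "?s \<in> carrier[B]" by (rule B.series_closed[OF b(2) sc])
    have "\<chi> B y = \<tau> B y \<otimes>[B] ?s"
      unfolding ce[OF B ys] kser_def using B.series_shift[OF b(2), of "\<lambda>k. str_map B (c k)", OF sc] s b c0
        ring_hom_zero[OF is_alg_str[OF B] ring_axioms B.ring_axioms] by simp
    thus ?thesis using s by blast
  qed
  have pw: "\<chi> \<in> ideal_power ?FR ?I k \<Longrightarrow> \<exists>r\<in>carrier[B]. \<chi> B y = \<tau> B y [^][B] k \<otimes>[B] r" for k \<chi>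
  proof (induction k arbitrary: \<chi>)
    case 0
    hence "\<chi> B y \<in> carrier[B]" using B ys unfolding ideal_power.simps function_ring_def partial_object.select_convs mem_Collect_eq by blast
    thus ?case by (intro bexI[of _ "\<chi> B y"]) simp_all
  next
    case (Suc k)
    from Suc.prems have "\<chi> \<in> ideal_prod ?FR ?I (ideal_power ?FR ?I k)" by simp
    thus ?case
    proof (induction \<chi>)
      case (prod f g)
      obtain r s where rs: "r \<in> carrier[B]" "s \<in> carrier[B]" "f B y = \<tau> B y \<otimes>[B] r" "g B y = \<tau> B y [^][B] k \<otimes>[B] s"
        using ev[OF prod(1)] Suc.IH[OF prod(2)] by blast
      have "(f \<otimes>\<^bsub>?FR\<^esub> g) B y = f B y \<otimes>[B] g B y" using B ys by (simp add: function_ring_def on_domain_def)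
      also have "\<dots> = \<tau> B y [^][B] Suc k \<otimes>[B] (r \<otimes>[B] s)" using rs b(1) by (simp add: B.m_ac)
      finally show ?case using rs by blast
    next
      case (sum f g)
      then obtain r s where rs: "r \<in> carrier[B]" "s \<in> carrier[B]" "f B y = \<tau> B y [^][B] Suc k \<otimes>[B] r"
        "g B y = \<tau> B y [^][B] Suc k \<otimes>[B] s" by blast
      have "(f \<oplus>\<^bsub>?FR\<^esub> g) B y = f B y \<oplus>[B] g B y" using B ys by (simp add: function_ring_def on_domain_def)
      also have "\<dots> = \<tau> B y [^][B] Suc k \<otimes>[B] (r \<oplus>[B] s)" using rs b(1) by (simp add: B.r_distr del: B.nat_pow_Suc)
      finally show ?case using rs by blast
    qed
  qed
  have "on_domain R X (\<lambda>B y. on_domain R X \<tau> B (multiple X p B y)) \<in> ideal_power ?FR ?I n"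
    using ht coord_augmentation[of n] unfolding height_ge_def bud_height_ge_def X_def n_def by blast
  from pw[OF this] obtain r where r: "r \<in> carrier[B]"
    "on_domain R X (\<lambda>B y. on_domain R X \<tau> B (multiple X p B y)) B y = \<tau> B y [^][B] n \<otimes>[B] r" by blast
  have "on_domain R X (\<lambda>B y. on_domain R X \<tau> B (multiple X p B y)) B y = \<tau> B (multiple Y p B y)"
    using B ys ms unfolding on_domain_def by (simp add: X_def)
  thus ?thesis using r y(2) by (simp add: n_def)
qed

end

section \<open>The lift to the valuation ring\<close>

lemma formal_line_line_group:
  assumes "big_cring R" shows "formal_line R (line_group F) (\<lambda>B x. x)"
proof (intro formal_line.intro formal_line_axioms.intro assms)
  fix B assume B: "is_alg R B"
  show "pt (line_group F) B \<in> sec (line_group F) B"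
    unfolding line_group_simps by (rule cring.zero_nil[OF is_alg_cring[OF B]])
next
  fix B C f x assume f: "alg_hom R B C f" and x: "x \<in> sec (line_group F) B"
  show "res (line_group F) B C f x \<in> sec (line_group F) C"
    unfolding line_group_simps by (rule alg_homD(8)[OF f x[unfolded line_group_simps]])
qed (simp_all add: bij_betw_def)

text \<open>Both halves of the theorem in one statement: \<open>p\<close> is the characteristic of
  \<open>K\<close>, and for \<open>p = 0\<close> the conditions on height and separable closure are
  void.\<close>

theorem formal_Lie_group_lift:
  fixes V K :: "'u ring" and Y :: "'u group_psh"
  assumes val: "valuation_ring V K j" and inf: "infinite (UNIV :: 'u set)"
    and lf: "line_field K p" and sep: "p \<noteq> 0 \<Longrightarrow> separably_closed K"
    and Y: "formal_Lie_group K Y" and ht: "p \<noteq> 0 \<Longrightarrow> height_ge p K Y h"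
  shows "\<exists>X. formal_Lie_group V X \<and> (p \<noteq> 0 \<longrightarrow> height_ge p V X h) \<and> formal_Lie_group_iso K (base_change j X) Y"
proof -
  have dV: "domain V" and j: "j \<in> ring_hom V K" "inj_on j (carrier V)"
    using val by (auto simp: valuation_ring_def field_of_fractions_def)
  interpret dV: "domain" V by (rule dV)
  have V: "big_cring V" using inf dV.is_cring by (simp add: big_cring_def big_cring_axioms_def)
  interpret V: big_cring V by (rule V)
  interpret K: line_field K p by (rule lf)
  obtain \<tau> F where F: "nil_group K F" and \<tau>: "\<And>B. is_alg K B \<Longrightarrow> bij_betw (\<tau> B) (sec Y B) nil[B]"
      "\<And>B. is_alg K B \<Longrightarrow> \<tau> B (pt Y B) = \<zero>[B]"
      "\<And>B x y. is_alg K B \<Longrightarrow> x \<in> sec Y B \<Longrightarrow> y \<in> sec Y B \<Longrightarrow> \<tau> B (gadd Y B x y) = F B (\<tau> B x) (\<tau> B y)"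
      "\<And>B C f x. alg_hom K B C f \<Longrightarrow> x \<in> sec Y B \<Longrightarrow> res Y B C f x \<in> sec Y C \<and> f (\<tau> B x) = \<tau> C (res Y B C f x)"
    apply (rule formal_Lie_group_over_field[OF K.field_axioms K.big_cring_axioms Y])
    subgoal premises prems by (rule prems(1)[OF prems(2-)])
    done
  interpret F: nil_group K F by (rule F)
  interpret G: formal_group_field K F p by (intro formal_group_field.intro F lf)
  have grp: "comm_group (group_at Y B)" if "is_alg K B" for B using Y that unfolding formal_Lie_group_def by blast
  have ps: "presheaf K Y" using Y by (simp add: formal_Lie_group_def formal_Lie_variety_def fppf_sheaf_def)
  have ptY: "pt Y B \<in> sec Y B" if "is_alg K B" for B
    using Y that unfolding formal_Lie_group_def formal_Lie_variety_def is_section_def by blast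
  have idY: "res Y B B (\<lambda>b. b) x = x" if "is_alg K B" "x \<in> sec Y B" for B x
    using ps that unfolding presheaf_def by blast
  have addY: "gadd Y B x y \<in> sec Y B" if "is_alg K B" "x \<in> sec Y B" "y \<in> sec Y B" for B x y
    using monoid.m_closed[OF comm_monoid.axioms(1)[OF comm_group.axioms(1)[OF grp[OF that(1)]]], of x y] that by (simp add: group_at_def)
  interpret L: formal_line K Y \<tau>
    by (intro formal_line.intro formal_line_axioms.intro K.big_cring_axioms) (use \<tau> ptY idY in auto)
  have mulY: "multiple Y m B y \<in> sec Y B \<and> \<tau> B (multiple Y m B y) = multiple (line_group F) m B (\<tau> B y)"
    if B: "is_alg K B" and y: "y \<in> sec Y B" for B y m
    by (induction m) (auto simp: ptY[OF B] \<tau>(2)[OF B] addY[OF B] \<tau>(3)[OF B] y)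
  have mulres: "res Y B C f (multiple Y p B y) = multiple Y p C (res Y B C f y)"
    if f: "alg_hom K B C f" and y: "y \<in> sec Y B" for B C f y
  proof (rule L.coord_inj[OF alg_homD(2)[OF f]])
    note m = mulY[OF alg_homD(1)[OF f] y, of p]
    note m' = mulY[OF alg_homD(2)[OF f] L.natural(1)[OF f y], of p]
    show "res Y B C f (multiple Y p B y) \<in> sec Y C" using L.natural(1)[OF f] m by blast
    show "multiple Y p C (res Y B C f y) \<in> sec Y C" using m' by blast
    show "\<tau> C (res Y B C f (multiple Y p B y)) = \<tau> C (multiple Y p C (res Y B C f y))"
      using L.natural(2)[OF f, of "multiple Y p B y"] m m' L.natural(2)[OF f y]
        F.multiple_nat[OF f L.coord_nil[OF alg_homD(1)[OF f] y], of p] by simp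
  qed
  \<comment> \<open>\<open>[p]\<close> has no constant term, so \<open>[p] x\<close> is a multiple
    of \<open>x\<close> and stays in every infinitesimal neighbourhood of the base point.\<close>
  have zero_pow: "multiple (line_group F) p B x [^][B] n = \<zero>[B]"
    if B: "is_alg K B" and x: "x \<in> carrier[B]" "x [^][B] n = \<zero>[B]" for B x n
  proof -
    interpret B: big_cring "ring_of B" by (rule K.alg_big[OF B])
    have xn: "x \<in> nil[B]" by (rule nilI[OF x])
    obtain \<gamma> where \<gamma>: "\<And>k. \<gamma> k \<in> carrier K" "\<gamma> 0 = \<zero>\<^bsub>K\<^esub>"
      and m: "\<And>B x. is_alg K B \<Longrightarrow> x \<in> nil[B] \<Longrightarrow> multiple (line_group F) p B x = kser \<gamma> B x"
      using F.multiple_kser[of p] by blast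
    have sc: "str_map B (\<gamma> k) \<in> carrier[B]" for k by (rule K.str_closed[OF B \<gamma>(1)])
    let ?s = "series (ring_of B) (\<lambda>k. str_map B (\<gamma> (Suc k))) x"
    have s: "?s \<in> carrier[B]" by (rule B.series_closed[OF xn sc])
    have "multiple (line_group F) p B x = x \<otimes>[B] ?s"
      unfolding m[OF B xn] kser_def using B.series_shift[OF xn, of "\<lambda>k. str_map B (\<gamma> k)", OF sc] \<gamma>(2) K.alg_str_zero[OF B] s x by simp
    thus ?thesis using B.nat_pow_distrib[OF x(1) s, of n] x(2) s by simp
  qed
  \<comment> \<open>The height of \<open>Y\<close> in terms of the coordinate: \<open>[p]\<close>
    vanishes where the power \<open>p^h\<close> does.\<close>
  have height: "multiple (line_group F) p B x = \<zero>[B]"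
    if p: "p \<noteq> 0" and B: "is_alg K B" and x: "x \<in> carrier[B]" "x [^][B] (p ^ h) = \<zero>[B]" for B x
  proof -
    obtain y where y: "y \<in> sec Y B" "\<tau> B y = x" using L.coord_surj[OF B nilI[OF x]] by blast
    have "\<tau> B (multiple Y p B y) = \<zero>[B]"
    proof (rule L.height_geD[OF ht[OF p] B y(1)])
      fix C z assume C: "is_alg K C" and z: "z \<in> sec Y C" "\<tau> C z [^][C] Suc (p ^ h) = \<zero>[C]"
      show "\<tau> C (multiple Y p C z) [^][C] Suc (p ^ h) = \<zero>[C]"
        using zero_pow[OF C nil_carrier[OF L.coord_nil[OF C z(1)]] z(2)] mulY[OF C z(1), of p] by simp
    qed (use x y mulY mulres in auto)
    thus ?thesis using mulY[OF B y(1), of p] y(2) by simp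
  qed
  obtain \<phi> \<alpha> r e q where \<phi>: "\<And>i. \<phi> i \<in> carrier K" "\<phi> 0 = \<zero>\<^bsub>K\<^esub>" "\<phi> 1 \<noteq> \<zero>\<^bsub>K\<^esub>"
    and \<alpha>: "\<And>i k. \<alpha> i k \<in> carrier K" "2 \<le> (r::nat)" "\<And>i k. \<alpha> i k [^]\<^bsub>K\<^esub> r = \<alpha> i k"
    and hom: "\<And>B x y. is_alg K B \<Longrightarrow> x \<in> nil[B] \<Longrightarrow> y \<in> nil[B] \<Longrightarrow>
      kser \<phi> B (F B x y) = kser2 \<alpha> B (kser \<phi> B x) (kser \<phi> B y)"
    and e: "e \<in> {\<zero>\<^bsub>K\<^esub>, \<one>\<^bsub>K\<^esub>}" "p ^ h \<le> q"
    and mult: "\<And>B x. p \<noteq> 0 \<Longrightarrow> is_alg K B \<Longrightarrow> x \<in> nil[B] \<Longrightarrow>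
      multiple (line_group (kser2 \<alpha>)) p B x = str_map B e \<otimes>[B] x [^][B] q"
    apply (rule G.integral_coordinate[of "p ^ h"])
    subgoal by (rule sep)
    subgoal by (rule height)
    subgoal premises prems by (rule prems(1)[OF prems(2-)])
    done
  \<comment> \<open>All coefficients of the law in the new coordinate are integral, being fixed by
    the power \<open>r\<close>; they define the lift.\<close>
  have "\<exists>b\<in>carrier V. j b = \<alpha> i k" for i k
    using K.power_fixed_integral[OF val \<alpha>(1) \<alpha>(3) \<alpha>(2), of i k] by (metis imageE)
  then obtain \<beta> where \<beta>: "\<And>i k. \<beta> i k \<in> carrier V" "\<And>i k. j (\<beta> i k) = \<alpha> i k" by metis
  have "e \<in> j ` carrier V"
    using e(1) ring_hom_one[OF j(1)] ring_hom_zero[OF j(1) dV.ring_axioms K.ring_axioms] dV.one_closed dV.zero_closed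
    by (metis imageI insertE singletonD)
  then obtain e' where e': "e' \<in> carrier V" "j e' = e" by blast
  have GK: "nil_group K (kser2 \<alpha>)"
    by (rule G.coordinate_change_group[where \<phi> = \<phi>, OF \<phi>]) (rule hom)
  have "nil_group K (kser2 (\<lambda>i k. j (\<beta> i k)))" using GK by (simp add: \<beta>(2))
  hence GV: "nil_group V (kser2 \<beta>)"
    by (intro nil_group_descent[where \<beta> = \<beta>, OF V K.big_cring_axioms j \<beta>(1)])
  interpret GV: nil_group V "kser2 \<beta>" by (rule GV)
  have via: "kser2 \<beta> (alg_via j B) = kser2 \<alpha> B" for B by (simp add: kser2_via \<beta>(2))
  define X where "X = line_group (kser2 \<beta>)"
  have "formal_Lie_group V X" unfolding X_def by (rule GV.line_group_formal_Lie_group)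
  moreover have "height_ge p V X h" if p: "p \<noteq> 0"
  proof -
    interpret LV: formal_line V X "\<lambda>B x. x" unfolding X_def by (rule formal_line_line_group[OF V])
    \<comment> \<open>The shape of \<open>[p]\<close> known over \<open>K\<close> is an identity
      between operations over \<open>V\<close>, so it transfers.\<close>
    have mV: "multiple X p B x = str_map B e' \<otimes>[B] x [^][B] q" if B: "is_alg V B" and x: "x \<in> nil[B]" for B x
    proof -
      have "natop V 1 (\<lambda>B xs. multiple X p B (xs ! 0))" unfolding X_def
        by (rule natopI) (auto simp: nilpts_def nth_mem subset_iff alg_homD(1) intro!: nil_carrier GV.multiple_closed GV.multiple_nat[symmetric])
      hence "(\<lambda>B xs. multiple X p B (xs ! 0)) B [x] = (\<lambda>B xs. str_map B e' \<otimes>[B] (xs ! 0) [^][B] q) B [x]"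
      proof (rule natop_transfer[OF V K.big_cring_axioms j _ natop_mult[OF natop_const[OF e'(1)] natop_pow[OF natop_nth]] _ B])
        fix C xs assume C: "is_alg K C" and xs: "xs \<in> nilpts C 1"
        then obtain z where z: "xs = [z]" "z \<in> nil[C]" by (auto elim: nilpts_SucE[of _ _ 0])
        have "multiple X i (alg_via j C) z = multiple (line_group (kser2 \<alpha>)) i C z" for i
          by (induction i) (simp_all add: X_def via)
        thus "multiple X p (alg_via j C) (xs ! 0) = str_map (alg_via j C) e' \<otimes>[alg_via j C] (xs ! 0) [^][alg_via j C] q"
          using mult[OF p C z(2)] e'(2) z(1) by simp
      qed (use x in \<open>auto simp: nilpts_def\<close>)
      thus ?thesis by simp
    qed
    show ?thesis
    proof (rule LV.height_geI[OF _ e(2) e'(1)])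
      show "0 < p ^ h" using p by simp
      fix B y assume B: "is_alg V B" and "y \<in> sec X B"
      hence y: "y \<in> nil[B]" by (simp add: X_def)
      show "multiple X p B y \<in> sec X B" using GV.multiple_closed[OF B y] by (simp add: X_def)
      show "multiple X p B y = str_map B e' \<otimes>[B] y [^][B] q" by (rule mV[OF B y])
    qed
  qed
  moreover have "formal_Lie_group_iso K (base_change j X) Y"
  proof -
    \<comment> \<open>The original coordinate of \<open>Y\<close> followed by the change to the
      integral one. It maps \<open>Y\<close> to the base change, so its inverse is the isomorphism
      asked for.\<close>
    define \<theta> where "\<theta> B y = kser \<phi> B (\<tau> B y)" for B y
    note cb = G.coordinate_bij[where \<phi> = \<phi>, OF \<phi>]
    have \<theta>: "bij_betw (\<theta> B) (sec Y B) nil[B]" if B: "is_alg K B" for B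
      using bij_betw_trans[OF \<tau>(1)[OF B] cb[OF B]] by (simp add: \<theta>_def[abs_def] comp_def)
    have gX: "group_at (base_change j X) B = nil_monoid (kser2 \<alpha>) B" for B
      by (simp add: group_at_def base_change_def X_def via nil_monoid_def)
    have iso: "\<theta> B \<in> iso (group_at Y B) (nil_monoid (kser2 \<alpha>) B)" if B: "is_alg K B" for B
    proof -
      have "kser \<phi> B b \<in> nil[B]" if "b \<in> nil[B]" for b by (rule bij_betw_apply[OF cb[OF B] that])
      thus ?thesis
        unfolding iso_def hom_def using \<theta>[OF B] L.coord_nil[OF B] \<tau>(3)[OF B] hom[OF B]
        by (auto simp: group_at_def \<theta>_def)
    qed
    show ?thesis unfolding formal_Lie_group_iso_def
    proof (intro exI[of _ "\<lambda>B. inv_into (sec Y B) (\<theta> B)"] conjI allI impI ballI)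
      fix B assume B: "is_alg K B"
      show "inv_into (sec Y B) (\<theta> B) \<in> iso (group_at (base_change j X) B) (group_at Y B)"
        using group.iso_set_sym[OF comm_group.axioms(2)[OF grp[OF B]] iso[OF B]] unfolding gX by (simp add: group_at_def)
    next
      fix B C f x assume f: "alg_hom K B C f" and "x \<in> sec (base_change j X) B"
      hence x: "x \<in> nil[B]" by (simp add: base_change_def X_def)
      note fD = alg_homD[OF f]
      define y where "y = inv_into (sec Y B) (\<theta> B) x"
      have y: "y \<in> sec Y B" "\<theta> B y = x" unfolding y_def
        using \<theta>[OF fD(1)] x by (auto simp: bij_betw_def intro: inv_into_into f_inv_into_f)
      have "\<theta> C (res Y B C f y) = f x"
        unfolding y(2)[symmetric] \<theta>_def L.natural(2)[OF f y(1)]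
        by (rule K.kser_nat[where c = \<phi>, OF f \<phi>(1) L.coord_nil[OF fD(1) y(1)], symmetric])
      hence "inv_into (sec Y C) (\<theta> C) (f x) = res Y B C f y"
        using \<theta>[OF fD(2)] L.natural(1)[OF f y(1)] by (intro inv_into_f_eq) (auto simp: bij_betw_def)
      thus "inv_into (sec Y C) (\<theta> C) (res (base_change j X) B C f x) = res Y B C f (inv_into (sec Y B) (\<theta> B) x)"
        by (simp add: base_change_def X_def y_def)
    qed
  qed
  ultimately show ?thesis by blast
qed

theorem theorem5p4:
  fixes p :: nat
    and V K :: "'u ring"
    and j :: "'u \<Rightarrow> 'u"
  assumes "Factorial_Ring.prime p"
    and "valuation_ring V K j"
  shows "(has_characteristic K 0 \<longrightarrow>
            (\<forall>Y. formal_Lie_group K Y \<longrightarrow>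
               (\<exists>X. formal_Lie_group V X \<and> formal_Lie_group_iso K (base_change j X) Y)))
       \<and> (has_characteristic K p \<and> separably_closed K \<longrightarrow>
            (\<forall>h. \<forall>Y. formal_Lie_group K Y \<and> height_ge p K Y h \<longrightarrow>
               (\<exists>X. formal_Lie_group V X \<and> height_ge p V X h \<and>
                    formal_Lie_group_iso K (base_change j X) Y)))"
proof -
  have K: "field K" using assms(2) by (simp add: valuation_ring_def field_of_fractions_def)
  interpret field K by (rule K)
  have lf: "line_field K c" if "has_characteristic K c" "c = 0 \<or> c = p" "infinite (UNIV :: 'u set)" for c
  proof (intro line_field.intro line_field_axioms.intro K)
    show "big_cring K" using that(3) is_cring by (simp add: big_cring_def big_cring_axioms_def)
    show "nat_in K i = \<zero>\<^bsub>K\<^esub> \<longleftrightarrow> c dvd i" for i using that(1) by (simp add: has_characteristic_def nat_in_add_pow)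
    show "c \<noteq> 0 \<Longrightarrow> Factorial_Ring.prime c" using that(2) assms(1) by auto
  qed
  \<comment> \<open>The codings need an infinite universe. In characteristic 0 the natural numbers
    embed into \<open>K\<close>; a separably closed field is infinite as well.\<close>
  have i0: "infinite (UNIV :: 'u set)" if h: "has_characteristic K 0"
  proof -
    have z: "nat_in K i = \<zero>\<^bsub>K\<^esub> \<Longrightarrow> i = 0" for i using h by (simp add: has_characteristic_def nat_in_add_pow)
    have "i = k" if "nat_in K i = nat_in K k" "i \<le> k" for i k
      using z[of "k - i"] nat_in_add[of i "k - i"] that by (simp add: add.l_cancel_one)
    hence "inj (nat_in K)" by (metis injI nat_le_linear)
    thus ?thesis by (meson finite_subset infinite_UNIV_nat finite_imageD subset_UNIV)
  qed
  have ip: "infinite (UNIV :: 'u set)" if "separably_closed K"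
    using separably_closed_infinite[OF K that] by (meson finite_subset subset_UNIV)
  have p0: "p \<noteq> 0" using assms(1) by auto
  show ?thesis
  proof (intro conjI impI allI)
    \<comment> \<open>The lifting theorem is applied with characteristic 0 in place of
      \<open>p\<close>, so its height clause is void and \<open>h\<close> is set to 0.\<close>
    fix Y assume "has_characteristic K 0" "formal_Lie_group K Y"
    thus "\<exists>X. formal_Lie_group V X \<and> formal_Lie_group_iso K (base_change j X) Y"
      using formal_Lie_group_lift[OF assms(2) i0 lf[of 0], of Y 0] i0 by blast
  next
    fix h Y assume a: "has_characteristic K p \<and> separably_closed K" "formal_Lie_group K Y \<and> height_ge p K Y h"
    have s: "separably_closed K" and c: "has_characteristic K p" using a by auto
    show "\<exists>X. formal_Lie_group V X \<and> height_ge p V X h \<and> formal_Lie_group_iso K (base_change j X) Y"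
      using formal_Lie_group_lift[OF assms(2) ip[OF s] lf[OF c _ ip[OF s]] s, of Y h] a(2) p0 by blast
  qed
qed

end
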